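(* For each $n\ge 1$ let $\mathbb{P}_n$ be the law, on the space $\mathcal{M}_{+,1}(\partial\mathbb{D})$ of Borel probability measures on the unit circle, of the spectral measure of the pair $(U,e_1)$, where $U$ is a Haar-distributed random $n\times n$ unitary matrix and $e_1$ is the first standard basis vector of $\mathbb{C}^n$. Then $\{\mathbb{P}_n\}_{n\ge1}$ obeys a large deviation principle on $\mathcal{M}_{+,1}(\partial\mathbb{D})$ with speed $n$ and good rate function $$I(\mu) = -\int_0^{2\pi} \log w(\theta)\,\frac{d\theta}{2\pi},$$ where $d\mu(\theta)=w(\theta)\frac{d\theta}{2\pi}+d\mu_s$ with $d\mu_s$ singular with respect to $d\theta$.
   Context: $\mathbb{D}$ is the open unit disc in $\mathbb{C}$ and $\partial\mathbb{D}$ the unit circle, whose points are written $e^{i\theta}$. $\mathcal{M}_{+,1}(\partial\mathbb{D})$ carries the weak topology (convergence of integrals of continuous functions), in which it is a compact metrizable (hence Polish) space. The spectral measure of $(U,e_1)$ is the probability measure $\mu$ on $\partial\mathbb{D}$ with $\int z^k\,d\mu(z)=\langle e_1,U^k e_1\rangle$ for all $k\in\mathbb{Z}$; almost surely it equals $\sum_{j=1}^n w_j\delta_{\lambda_j}$, where $\lambda_1,\dots,\lambda_n$ are the (distinct) eigenvalues of $U$, and $w_j=|\langle\varphi_j,e_1\rangle|^2$ for orthonormal eigenvectors $\varphi_j$. Convention: $\log 0=-\infty$; thus $I(\mu)\in[0,\infty]$ equals $-S(\frac{d\theta}{2\pi}\,|\,\mu)$, where $S(\nu\,|\,\mu)=-\int\log\left(\frac{d\nu}{d\mu}\right)d\nu$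 if $\nu$ is absolutely continuous with respect to $\mu$ and $S(\nu\,|\,\mu)=-\infty$ otherwise. In particular $I(\mu)=\infty$ if $w=0$ on a set of positive Lebesgue measure. Large deviation principle (LDP): a sequence $\{\mathbb{P}_n\}$ of probability measures on a Polish space $X$ obeys an LDP with rate function $I:X\to[0,\infty]$ and speed $a_n$ (positive numbers with $a_n\to\infty$) if (1) $I$ is non-negative and lower semicontinuous; (2) for every open $O\subset X$, $\liminf_{n\to\infty}\frac1{a_n}\log\mathbb{P}_n(O)\ge-\inf_{x\in O}I(x)$; (3) for every closed $K\subset X$, $\limsup_{n\to\infty}\frac1{a_n}\log\mathbb{P}_n(K)\le-\inf_{x\in K}I(x)$. The rate function is good if $\{x: I(x)\le\alpha\}$ is compact for every $\alpha>0$. *)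

theory Defs
  imports "HOL-Probability.Probability" "Jordan_Normal_Form.Schur_Decomposition"
begin

section \<open>Large deviation principles\<close>

definition borel_of :: "'a topology \<Rightarrow> 'a measure" where
  "borel_of X = sigma (topspace X) {S. openin X S}"

definition polish_topology :: "'a topology \<Rightarrow> bool" where
  "polish_topology X \<longleftrightarrow> completely_metrizable_space X \<and> separable_space X"

text \<open>The logarithm on nonnegative reals with the convention \<open>log 0 = -\<infinity>\<close>
  (the library has \<open>ln 0 = 0\<close>).\<close>

definition elog :: "real \<Rightarrow> ereal" where
  "elog x = (if x = 0 then - \<infinity> else ereal (ln x))"

definition lower_semicontinuous_on_topology :: "'a topology \<Rightarrow> ('a \<Rightarrow> ereal) \<Rightarrow> bool" where
  "lower_semicontinuous_on_topology X I \<longleftrightarrow> (\<forall>c. closedin X {x \<in> topspace X. I x \<le> c})"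

text \<open>Sequences of measures and speeds are indexed by \<open>n \<ge> 1\<close>; the terms with index 0 are
  irrelevant.\<close>

definition LDP :: "'a topology \<Rightarrow> (nat \<Rightarrow> 'a measure) \<Rightarrow> (nat \<Rightarrow> real) \<Rightarrow> ('a \<Rightarrow> ereal) \<Rightarrow> bool" where
  "LDP X P a I \<longleftrightarrow>
     polish_topology X \<and>
     (\<forall>n\<ge>1. prob_space (P n) \<and> sets (P n) = sets (borel_of X)) \<and>
     (\<forall>n\<ge>1. a n > 0) \<and> filterlim a at_top sequentially \<and>
     (\<forall>x\<in>topspace X. I x \<ge> 0) \<and> lower_semicontinuous_on_topology X I \<and>
     (\<forall>G. openin X G \<longrightarrow>
        liminf (\<lambda>n. elog (measure (P n) G) / ereal (a n)) \<ge> - (INF x\<in>G. I x)) \<and>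
     (\<forall>K. closedin X K \<longrightarrow>
        limsup (\<lambda>n. elog (measure (P n) K) / ereal (a n)) \<le> - (INF x\<in>K. I x))"

definition good_rate_function :: "'a topology \<Rightarrow> ('a \<Rightarrow> ereal) \<Rightarrow> bool" where
  "good_rate_function X I \<longleftrightarrow>
     (\<forall>\<alpha>::real. \<alpha> > 0 \<longrightarrow> compactin X {x \<in> topspace X. I x \<le> ereal \<alpha>})"


section \<open>Probability measures on the unit circle\<close>

definition circle_borel :: "complex measure" where
  "circle_borel = restrict_space borel (sphere 0 1)"

definition circle_probs :: "complex measure set" where
  "circle_probs = {\<mu>. sets \<mu> = sets circle_borel \<and> prob_space \<mu>}"

text \<open>The coarsest topology on \<^const>\<open>circle_probs\<close> for which integration of each continuous
  function is continuous; real-valued test functions suffice.\<close>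

definition weak_topology :: "complex measure topology" where
  "weak_topology = topology_generated_by
     {{\<mu> \<in> circle_probs. (\<integral>z. f z \<partial>\<mu>) \<in> V} | (f :: complex \<Rightarrow> real) V.
        continuous_on (sphere 0 1) f \<and> open V}"


section \<open>The rate function\<close>

text \<open>The measure \<open>d\<theta>/2\<pi>\<close>, transported to the circle by \<open>\<theta> \<mapsto> e\<^sup>i\<^sup>\<theta>\<close>.\<close>

definition arc_measure :: "complex measure" where
  "arc_measure = distr (uniform_measure lborel {0..<2 * pi}) circle_borel cis"

definition mutually_singular :: "'a measure \<Rightarrow> 'a measure \<Rightarrow> bool" where
  "mutually_singular \<mu> \<nu> \<longleftrightarrow> sets \<mu> = sets \<nu> \<and>
     (\<exists>N\<in>sets \<mu>. emeasure \<mu> N = 0 \<and> emeasure \<nu> (space \<nu> - N) = 0)"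

definition lebesgue_decomposition ::
  "complex measure \<Rightarrow> (complex \<Rightarrow> real) \<Rightarrow> complex measure \<Rightarrow> bool" where
  "lebesgue_decomposition \<mu> w \<mu>s \<longleftrightarrow>
     w \<in> borel_measurable arc_measure \<and> (\<forall>z. w z \<ge> 0) \<and>
     mutually_singular arc_measure \<mu>s \<and>
     (\<forall>A\<in>sets arc_measure.
        emeasure \<mu> A = (\<integral>\<^sup>+z\<in>A. ennreal (w z) \<partial>arc_measure) + emeasure \<mu>s A)"

text \<open>The density \<open>w\<close> is determined almost everywhere; the choice does not affect
  the rate function.\<close>

definition ac_density :: "complex measure \<Rightarrow> complex \<Rightarrow> real" where
  "ac_density \<mu> = (SOME w. \<exists>\<mu>s. lebesgue_decomposition \<mu> w \<mu>s)"

text \<open>The integral of an extended real function as the difference of the integrals of its positive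
  and negative parts (\<^const>\<open>e2ennreal\<close> maps negative numbers to 0). Only used
  where the integral of the positive part is finite.\<close>

definition extended_integral :: "'a measure \<Rightarrow> ('a \<Rightarrow> ereal) \<Rightarrow> ereal" where
  "extended_integral M f =
     enn2ereal (\<integral>\<^sup>+x. e2ennreal (f x) \<partial>M) - enn2ereal (\<integral>\<^sup>+x. e2ennreal (- f x) \<partial>M)"

definition szego_rate :: "complex measure \<Rightarrow> ereal" where
  "szego_rate \<mu> = - extended_integral arc_measure (\<lambda>z. elog (ac_density \<mu> z))"


section \<open>Haar measure on the unitary group and spectral measures\<close>

definition unitary_group :: "nat \<Rightarrow> complex mat set" where
  "unitary_group n = {U \<in> carrier_mat n n. mat_adjoint U * U = 1\<^sub>m n}"

text \<open>The Borel \<open>\<sigma>\<close>-algebra of the unitary group as a subspace of \<open>n \<times> n\<close> complex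
  matrices, i.e. the one generated by the matrix entries.\<close>

definition unitary_borel :: "nat \<Rightarrow> complex mat measure" where
  "unitary_borel n = vimage_algebra (unitary_group n)
     (\<lambda>A. \<lambda>(i, j)\<in>{..<n} \<times> {..<n}. A $$ (i, j))
     (Pi\<^sub>M ({..<n} \<times> {..<n}) (\<lambda>_. borel))"

definition haar_prob :: "nat \<Rightarrow> complex mat measure \<Rightarrow> bool" where
  "haar_prob n H \<longleftrightarrow> prob_space H \<and> sets H = sets (unitary_borel n) \<and>
     (\<forall>V\<in>unitary_group n. \<forall>A\<in>sets H. emeasure H ((\<lambda>U. V * U) ` A) = emeasure H A)"

text \<open>Integer powers of a unitary matrix, whose inverse is its adjoint.\<close>

definition unitary_powi :: "complex mat \<Rightarrow> int \<Rightarrow> complex mat" where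
  "unitary_powi U k = (if k \<ge> 0 then U ^\<^sub>m nat k else mat_adjoint U ^\<^sub>m nat (- k))"

text \<open>The operation \<open>x \<bullet>c y\<close> is conjugate-linear in its second argument, so
  \<open>\<langle>v, A v\<rangle>\<close> (linear in the second argument) is \<open>(A v) \<bullet>c v\<close>.\<close>

definition spectral_measure :: "complex mat \<Rightarrow> complex Matrix.vec \<Rightarrow> complex measure" where
  "spectral_measure U v = (THE \<mu>. \<mu> \<in> circle_probs \<and>
     (\<forall>k::int. (\<integral>z. z powi k \<partial>\<mu>) = (unitary_powi U k *\<^sub>v v) \<bullet>c v))"

text \<open>The law of the spectral measure of \<open>(U, e\<^sub>1)\<close> when \<open>U\<close> has law \<open>H\<close>; coordinates are
  numbered from 0, so \<open>e\<^sub>1\<close> is \<open>unit_vec n 0\<close>.\<close>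

definition spectral_law :: "nat \<Rightarrow> complex mat measure \<Rightarrow> complex measure measure" where
  "spectral_law n H =
     distr H (borel_of weak_topology) (\<lambda>U. spectral_measure U (unit_vec n 0))"

end

theory Submission
  imports Defs
begin

unbundle no vec_syntax
unbundle no inner_syntax

text \<open>A probability measure on the circle is determined by its moments, and the moments of the spectral
  measure are \<open>c\<^sub>i = (U\<^sup>i)\<^sub>0\<^sub>0\<close>. For Haar distributed \<open>U\<close>, peeling off the entry \<open>\<alpha> = U\<^sub>0\<^sub>0\<close> by a plane
  rotation expresses the moments through \<open>\<alpha>\<close> and the moments of an independent Haar unitary of size
  \<open>n - 1\<close> (one step of the Schur algorithm), and \<open>P(1 - \<bar>\<alpha>\<bar>\<^sup>2 < t)\<close> is of order \<open>t\<^sup>n\<close>. So \<open>k\<close> steps give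
  independent Verblunsky coefficients, and the product of the first \<open>k\<close> numbers \<open>1 - \<bar>\<alpha>\<^sub>j\<bar>\<^sup>2\<close> is the minimum
  of \<open>\<integral>\<bar>P\<bar>\<^sup>2 d\<mu>\<close> over polynomials \<open>P\<close> of degree at most \<open>k\<close> with \<open>P(0) = 1\<close>. The law of this minimum
  decays like \<open>t\<^sup>n\<close>, and by Szego's theorem its limit as \<open>k\<close> tends to infinity is \<open>exp (- I(\<mu>))\<close>.
  Compactness of the space of measures turns these estimates into the two bounds.\<close>

text \<open>For the upper bound one polynomial per measure serves: \<integral>|P|^2 d\<mu> < t is an
  open condition, and for P of degree k with P(0) = 1 it forces the product of the first k numbers 1
  - |\<alpha>_j|^2 below t, an event about independent coefficients. For the lower bound a measure
  of finite rate is first replaced by one with finitely many atoms, the spectral measure of an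
  explicit unitary matrix, whose coefficients matrix algebra supplies. Independence comes from
  invariance: U may be multiplied by 1 \<oplus> V with V Haar, and for fixed U the moments then
  depend on V through a two-sided translate, which the law of V ignores. Invariance also fixes all
  moments of |U_00|^2 and so its density (n - 1)(1 - x)^(n - 2). Each step lowers the size by one,
  but k stays fixed while n grows, so the loss from n to n - k and all powers of n disappear at
  speed n. Since (1 - x)^(-m) is at the border of integrability against this density when m = n - 1,
  a shift by \<eta> is inserted and removed in the limit.\<close>

abbreviation circle :: "complex set" where
  "circle \<equiv> sphere 0 1"

section \<open>Continuous functions on the circle\<close>

lemma space_circle_borel: "space circle_borel = circle"
  by (simp add: circle_borel_def space_restrict_space)

lemma circle_probsD:
  assumes "\<mu> \<in> circle_probs"
  shows "prob_space \<mu>" "sets \<mu> = sets circle_borel" "space \<mu> = circle"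
  using assms sets_eq_imp_space_eq[of \<mu> circle_borel]
  by (auto simp: circle_probs_def space_circle_borel)

lemma continuous_on_circle_measurable:
  fixes f :: "complex \<Rightarrow> 'b::{banach,second_countable_topology}"
  assumes "continuous_on circle f" "sets \<mu> = sets circle_borel"
  shows "f \<in> borel_measurable \<mu>"
  using borel_measurable_continuous_on_restrict[OF assms(1)] assms(2)
  by (simp add: circle_borel_def cong: measurable_cong_sets)

lemma continuous_on_circle_bounded:
  fixes f :: "complex \<Rightarrow> 'b::real_normed_vector"
  assumes "continuous_on circle f"
  obtains B where "B \<ge> 0" "\<And>z. z \<in> circle \<Longrightarrow> norm (f z) \<le> B"
proof -
  have "bounded (f ` circle)"
    by (intro compact_imp_bounded compact_continuous_image assms compact_sphere)
  then obtain B where "\<And>z. z \<in> circle \<Longrightarrow> norm (f z) \<le> B"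
    unfolding bounded_iff by blast
  then have "\<And>z. z \<in> circle \<Longrightarrow> norm (f z) \<le> max B 0" by (simp add: le_max_iff_disj)
  then show ?thesis using that[of "max B 0"] by auto
qed

lemma continuous_on_circle_integrable:
  fixes f :: "complex \<Rightarrow> 'b::{banach,second_countable_topology}"
  assumes f: "continuous_on circle f" and \<mu>: "\<mu> \<in> circle_probs"
  shows "integrable \<mu> f"
proof -
  interpret prob_space \<mu> by (rule circle_probsD[OF \<mu>])
  obtain B where "\<And>z. z \<in> circle \<Longrightarrow> norm (f z) \<le> B" using continuous_on_circle_bounded[OF f] by metis
  then show ?thesis
    using circle_probsD[OF \<mu>]
    by (intro integrable_const_bound[of _ B] continuous_on_circle_measurable[OF f]) auto
qed

subsection \<open>Trigonometric polynomials\<close>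

lemma circle_cnj_power:
  assumes "z \<in> circle"
  shows "z ^ i * cnj (z ^ j) = (if j \<le> i then z ^ (i - j) else cnj (z ^ (j - i)))"
proof -
  have 1: "z * cnj z = 1" using assms complex_norm_square[of z] by simp
  have 2: "z ^ k * cnj (z ^ k) = 1" for k
    using 1 by (simp flip: power_mult_distrib)
  show ?thesis
  proof (cases "j \<le> i")
    case True
    then have "z ^ i = z ^ (i - j) * z ^ j" by (simp flip: power_add)
    then show ?thesis using True 2[of j] by (simp add: mult.assoc)
  next
    case False
    then have "z ^ j = z ^ (j - i) * z ^ i" by (simp flip: power_add)
    then show ?thesis using False 2[of i] by (simp add: mult_ac)
  qed
qed

text \<open>The real trigonometric polynomials: negative frequencies fold onto positive ones because
  \<open>Re\<close> is invariant under conjugation. The one-sided form pays off later, where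
  \<open>Re (poly p 0)\<close> is the mean of f for \<open>arc_measure\<close> and exp p is an
  analytic function of modulus exp f.\<close>

definition trig_poly :: "(complex \<Rightarrow> real) \<Rightarrow> bool" where
  "trig_poly f \<longleftrightarrow> (\<exists>p. \<forall>z\<in>circle. f z = Re (poly p z))"

lemma trig_poly_add: "trig_poly f \<Longrightarrow> trig_poly g \<Longrightarrow> trig_poly (\<lambda>z. f z + g z)"
  unfolding trig_poly_def by (metis plus_complex.simps(1) poly_add)

lemma trig_poly_Re_poly: "trig_poly (\<lambda>z. Re (poly p z))"
  unfolding trig_poly_def by blast

lemma trig_poly_sum: "(\<And>i. i \<in> I \<Longrightarrow> trig_poly (f i)) \<Longrightarrow> trig_poly (\<lambda>z. \<Sum>i\<in>I. f i z)"
proof (induction I rule: infinite_finite_induct)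
  case (insert x F)
  then show ?case by (simp add: trig_poly_add)
qed (use trig_poly_Re_poly[of 0] in auto)

lemma trig_poly_cong: "(\<And>z. z \<in> circle \<Longrightarrow> f z = g z) \<Longrightarrow> trig_poly f \<Longrightarrow> trig_poly g"
  unfolding trig_poly_def by metis

lemma trig_poly_monom_cnj: "trig_poly (\<lambda>z. Re (c * (z ^ i * cnj (z ^ j))))"
proof (cases "j \<le> i")
  case True
  show ?thesis
    by (rule trig_poly_cong[OF _ trig_poly_Re_poly[of "monom c (i - j)"]])
       (simp only: circle_cnj_power, simp add: True poly_monom)
next
  case False
  have "Re (c * cnj w) = Re (cnj c * w)" for w by simp
  then show ?thesis
    by (intro trig_poly_cong[OF _ trig_poly_Re_poly[of "monom (cnj c) (j - i)"]])
       (simp only: circle_cnj_power False if_False poly_monom)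
qed

text \<open>Since Re a Re b = Re (a b) / 2 + Re (a cnj b) / 2, the only new terms are z^i cnj (z^j),
  and on the circle these collapse to a single power or its conjugate. Closure under products is
  what Stone-Weierstrass asks for.\<close>

lemma trig_poly_mult:
  assumes "trig_poly f" "trig_poly g"
  shows "trig_poly (\<lambda>z. f z * g z)"
proof -
  obtain p q where p: "\<And>z. z \<in> circle \<Longrightarrow> f z = Re (poly p z)"
    and q: "\<And>z. z \<in> circle \<Longrightarrow> g z = Re (poly q z)"
    using assms unfolding trig_poly_def by metis
  have split: "Re a * Re b = Re (a * b / 2) + Re (a * cnj b / 2)" for a b by (simp add: field_simps)
  have "trig_poly (\<lambda>z. Re (poly p z * cnj (poly q z) / 2))"
  proof (rule trig_poly_cong)
    show "trig_poly (\<lambda>z. \<Sum>i\<le>degree p. \<Sum>j\<le>degree q.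
        Re (coeff p i * cnj (coeff q j) / 2 * (z ^ i * cnj (z ^ j))))"
      by (intro trig_poly_sum trig_poly_monom_cnj)
    show "(\<Sum>i\<le>degree p. \<Sum>j\<le>degree q. Re (coeff p i * cnj (coeff q j) / 2 * (z ^ i * cnj (z ^ j)))) =
        Re (poly p z * cnj (poly q z) / 2)" for z
      unfolding poly_altdef cnj_sum sum_product sum_divide_distrib Re_sum
      by (intro sum.cong refl arg_cong[of _ _ Re]) (simp add: mult_ac)
  qed
  moreover have "trig_poly (\<lambda>z. Re (poly p z * poly q z / 2))"
    by (rule trig_poly_cong[OF _ trig_poly_Re_poly[of "[:1/2:] * (p * q)"]]) (simp add: field_simps)
  ultimately have "trig_poly (\<lambda>z. Re (poly p z * poly q z / 2) + Re (poly p z * cnj (poly q z) / 2))"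
    by (intro trig_poly_add)
  then show ?thesis by (rule trig_poly_cong[rotated]) (simp only: p q split)
qed

lemma trig_poly_dense:
  assumes "continuous_on circle f" "e > 0"
  shows "\<exists>p. \<forall>z\<in>circle. \<bar>f z - Re (poly p z)\<bar> < e"
proof -
  have "\<exists>g. (trig_poly g \<and> continuous_on circle g) \<and> (\<forall>x \<in> circle. \<bar>f x - g x\<bar> < e)"
  proof (rule Stone_Weierstrass_HOL[where P="\<lambda>g. trig_poly g \<and> continuous_on circle g"])
    fix x y :: complex
    assume xy: "x \<in> circle \<and> y \<in> circle \<and> x \<noteq> y"
    consider "Re x \<noteq> Re y" | "Im x \<noteq> Im y" using xy complex_eqI by blast
    then show "\<exists>f. (trig_poly f \<and> continuous_on circle f) \<and> f x \<noteq> f y"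
    proof cases
      case 1
      then show ?thesis
        by (intro exI[of _ Re]) (use trig_poly_Re_poly[of "[:0,1:]"] in \<open>auto intro!: continuous_intros\<close>)
    next
      case 2
      then show ?thesis
        by (intro exI[of _ Im]) (use trig_poly_Re_poly[of "[:0,-\<i>:]"] in \<open>auto intro!: continuous_intros\<close>)
    qed
  next
    fix c :: real
    show "trig_poly (\<lambda>x. c) \<and> continuous_on circle (\<lambda>x. c)"
      using trig_poly_Re_poly[of "[:of_real c:]"] by simp
  qed (use assms in \<open>auto intro: trig_poly_add trig_poly_mult continuous_on_add continuous_on_mult\<close>)
  then obtain g where "trig_poly g" "\<forall>x \<in> circle. \<bar>f x - g x\<bar> < e" by blast
  then show ?thesis unfolding trig_poly_def by metis
qed

subsection \<open>Moments\<close>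

text \<open>Powers k \<ge> 0 suffice as coordinates: the measures are positive, so the moments of
  negative index are the complex conjugates of these.\<close>

definition moments :: "complex measure \<Rightarrow> nat \<Rightarrow> complex" where
  "moments \<mu> k = (\<integral>z. z ^ k \<partial>\<mu>)"

lemma integral_poly:
  assumes "\<mu> \<in> circle_probs"
  shows "(\<integral>z. poly p z \<partial>\<mu>) = (\<Sum>i\<le>degree p. coeff p i * moments \<mu> i)"
  unfolding poly_altdef moments_def
  by (subst Bochner_Integration.integral_sum)
     (auto intro!: continuous_on_circle_integrable assms continuous_intros)

lemma integral_Re_poly:
  assumes "\<mu> \<in> circle_probs"
  shows "(\<integral>z. Re (poly p z) \<partial>\<mu>) = Re (\<Sum>i\<le>degree p. coeff p i * moments \<mu> i)"
  by (subst integral_Re) (auto intro!: continuous_on_circle_integrable assms continuous_intros simp: integral_poly[OF assms])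

lemma integral_circle_dist_le:
  assumes "\<mu> \<in> circle_probs" "continuous_on circle f" "continuous_on circle g"
    "\<And>z. z \<in> circle \<Longrightarrow> \<bar>f z - g z\<bar> \<le> e"
  shows "\<bar>(\<integral>z. f z \<partial>\<mu>) - (\<integral>z. g z \<partial>\<mu>)\<bar> \<le> (e::real)"
proof -
  interpret prob_space \<mu> by (rule circle_probsD[OF assms(1)])
  have i: "integrable \<mu> f" "integrable \<mu> g"
    using assms by (auto intro: continuous_on_circle_integrable)
  have "\<bar>\<integral>z. f z - g z \<partial>\<mu>\<bar> \<le> (\<integral>z. \<bar>f z - g z\<bar> \<partial>\<mu>)" by (rule integral_abs_bound)
  also have "\<dots> \<le> (\<integral>z. e \<partial>\<mu>)"
    using i assms(4) circle_probsD[OF assms(1)] by (intro integral_mono) auto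
  finally show ?thesis using i by (simp add: prob_space)
qed

lemma integral_eq_if_moments_eq:
  assumes \<mu>: "\<mu> \<in> circle_probs" and \<nu>: "\<nu> \<in> circle_probs" and eq: "moments \<mu> = moments \<nu>"
    and f: "continuous_on circle (f :: complex \<Rightarrow> real)"
  shows "(\<integral>z. f z \<partial>\<mu>) = (\<integral>z. f z \<partial>\<nu>)"
proof -
  have "\<bar>(\<integral>z. f z \<partial>\<mu>) - (\<integral>z. f z \<partial>\<nu>)\<bar> \<le> 0 + e" if "e > 0" for e
  proof -
    obtain p where p: "\<And>z. z \<in> circle \<Longrightarrow> \<bar>f z - Re (poly p z)\<bar> < e/2"
      using trig_poly_dense[OF f half_gt_zero[OF \<open>e > 0\<close>]] by blast
    have c: "continuous_on circle (\<lambda>z. Re (poly p z))" by (intro continuous_intros)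
    have "(\<integral>z. Re (poly p z) \<partial>\<mu>) = (\<integral>z. Re (poly p z) \<partial>\<nu>)"
      using \<mu> \<nu> eq by (simp add: integral_Re_poly)
    moreover have "\<bar>(\<integral>z. f z \<partial>\<mu>) - (\<integral>z. Re (poly p z) \<partial>\<mu>)\<bar> \<le> e/2"
      by (rule integral_circle_dist_le[OF \<mu> f c]) (use p in \<open>auto intro: less_imp_le\<close>)
    moreover have "\<bar>(\<integral>z. f z \<partial>\<nu>) - (\<integral>z. Re (poly p z) \<partial>\<nu>)\<bar> \<le> e/2"
      by (rule integral_circle_dist_le[OF \<nu> f c]) (use p in \<open>auto intro: less_imp_le\<close>)
    ultimately show ?thesis by linarith
  qed
  then have "\<bar>(\<integral>z. f z \<partial>\<mu>) - (\<integral>z. f z \<partial>\<nu>)\<bar> \<le> 0" by (rule field_le_epsilon)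
  then show ?thesis by simp
qed

text \<open>The tent functions of height 1 on C and slope n decrease to the indicator of C, which
  turns equality of integrals of continuous functions into equality on closed sets. The empty set is
  set apart because \<open>infdist z {}\<close> is 0.\<close>

lemma measure_closed_eq_lim:
  assumes \<mu>: "\<mu> \<in> circle_probs" and C: "closed C" "C \<noteq> {}"
  shows "(\<lambda>n. \<integral>z. max 0 (1 - real n * infdist z C) \<partial>\<mu>) \<longlonglongrightarrow> measure \<mu> (C \<inter> circle)"
proof -
  interpret prob_space \<mu> by (rule circle_probsD[OF \<mu>])
  note sp = circle_probsD[OF \<mu>]
  have C': "C \<inter> circle \<in> sets \<mu>"
    using C sp by (auto simp: circle_borel_def sets_restrict_space)
  have "(\<lambda>n. \<integral>z. max 0 (1 - real n * infdist z C) \<partial>\<mu>) \<longlonglongrightarrow> (\<integral>z. indicator (C \<inter> circle) z \<partial>\<mu>)"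
  proof (rule integral_dominated_convergence[where w="\<lambda>_. 1"])
    show "AE z in \<mu>. (\<lambda>n. max 0 (1 - real n * infdist z C)) \<longlonglongrightarrow> indicator (C \<inter> circle) z"
    proof (rule AE_I2)
      fix z assume z: "z \<in> space \<mu>"
      show "(\<lambda>n. max 0 (1 - real n * infdist z C)) \<longlonglongrightarrow> indicator (C \<inter> circle) z"
      proof (cases "z \<in> C")
        case True
        then show ?thesis using z sp C by simp
      next
        case False
        then have pos: "infdist z C > 0"
          using C in_closed_iff_infdist_zero[of C z] infdist_nonneg[of z C] by fastforce
        obtain N where N: "real N * infdist z C > 1" using reals_Archimedean3[OF pos] by blast
        have "eventually (\<lambda>n. max 0 (1 - real n * infdist z C) = 0) sequentially"
        proof (rule eventually_sequentiallyI[of N])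
          fix n assume "N \<le> n"
          then have "real N * infdist z C \<le> real n * infdist z C" using pos by simp
          then show "max 0 (1 - real n * infdist z C) = 0" using N by simp
        qed
        then show ?thesis using False by (simp add: tendsto_eventually)
      qed
    qed
    show "(\<lambda>z. max 0 (1 - real n * infdist z C)) \<in> borel_measurable \<mu>" for n
      by (intro continuous_on_circle_measurable sp continuous_intros)
    show "AE z in \<mu>. norm (max 0 (1 - real n * infdist z C)) \<le> 1" for n
      by (intro AE_I2) (auto simp: infdist_nonneg)
    show "integrable \<mu> (\<lambda>_. 1::real)" by simp
    show "indicat_real (C \<inter> circle) \<in> borel_measurable \<mu>" using C' by simp
  qed
  moreover have "(\<integral>z. indicator (C \<inter> circle) z \<partial>\<mu>) = measure \<mu> (C \<inter> circle)"
    using C' by simp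
  ultimately show ?thesis by simp
qed

lemma circle_probs_eqI:
  assumes \<mu>: "\<mu> \<in> circle_probs" and \<nu>: "\<nu> \<in> circle_probs" and eq: "moments \<mu> = moments \<nu>"
  shows "\<mu> = \<nu>"
proof -
  interpret \<mu>: prob_space \<mu> by (rule circle_probsD[OF \<mu>])
  interpret \<nu>: prob_space \<nu> by (rule circle_probsD[OF \<nu>])
  note sp = circle_probsD[OF \<mu>] circle_probsD[OF \<nu>]
  have eq': "measure \<mu> (C \<inter> circle) = measure \<nu> (C \<inter> circle)" if "closed C" for C
  proof (cases "C = {}")
    case False
    have "(\<lambda>n. \<integral>z. max 0 (1 - real n * infdist z C) \<partial>\<mu>) = (\<lambda>n. \<integral>z. max 0 (1 - real n * infdist z C) \<partial>\<nu>)"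
      by (intro ext integral_eq_if_moments_eq \<mu> \<nu> eq continuous_intros)
    then show ?thesis
      using measure_closed_eq_lim[OF \<mu> that False] measure_closed_eq_lim[OF \<nu> that False]
        LIMSEQ_unique by metis
  qed simp
  \<comment> \<open>Both measures are viewed on the whole plane, where the closed sets form an
    intersection-stable generator of the Borel sets.\<close>
  let ?M = "distr \<mu> borel (\<lambda>z. z)" and ?N = "distr \<nu> borel (\<lambda>z. z)"
  have meas: "(\<lambda>z. z) \<in> measurable \<mu> borel" "(\<lambda>z. z) \<in> measurable \<nu> borel"
    using sp by (auto intro!: continuous_on_circle_measurable)
  have "?M = ?N"
  proof (rule measure_eqI_generator_eq[where E="Collect closed" and \<Omega>=UNIV and A="\<lambda>_. UNIV"])
    fix C :: "complex set"
    assume "C \<in> Collect closed"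
    then have C: "closed C" by simp
    then show "emeasure ?M C = emeasure ?N C"
      using eq'[OF C] sp
      by (simp add: emeasure_distr meas \<mu>.emeasure_eq_measure \<nu>.emeasure_eq_measure)
  next
    show "sets ?M = sigma_sets UNIV (Collect closed)" "sets ?N = sigma_sets UNIV (Collect closed)"
      by (simp_all add: borel_eq_closed)
    show "emeasure ?M UNIV \<noteq> \<infinity>"
      using sp by (simp add: emeasure_distr[OF meas(1)] \<mu>.emeasure_eq_measure)
  qed (auto simp: Int_stable_def)
  show ?thesis
  proof (rule measure_eqI)
    fix A assume A: "A \<in> sets \<mu>"
    then have "A \<subseteq> circle" "A \<in> sets borel"
      using sp by (auto simp: circle_borel_def sets_restrict_space)
    then have "emeasure \<mu> A = emeasure ?M A" "emeasure \<nu> A = emeasure ?N A"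
      using sp by (simp_all add: emeasure_distr meas Int_absorb2)
    then show "emeasure \<mu> A = emeasure \<nu> A" using \<open>?M = ?N\<close> by simp
  qed (use sp in simp)
qed

subsection \<open>The weak topology\<close>

lemma topspace_weak_topology [simp]: "topspace weak_topology = circle_probs"
proof -
  have "circle_probs \<in> {{\<mu> \<in> circle_probs. (\<integral>z. f z \<partial>\<mu>) \<in> V} | (f :: complex \<Rightarrow> real) V.
        continuous_on (sphere 0 1) f \<and> open V}"
    by (auto intro!: exI[of _ "\<lambda>_. 0"] exI[of _ UNIV])
  then show ?thesis
    unfolding weak_topology_def topology_generated_by_topspace by blast
qed

lemma continuous_map_weak_integral:
  assumes "continuous_on circle f"
  shows "continuous_map weak_topology euclideanreal (\<lambda>\<mu>. \<integral>z. f z \<partial>\<mu>)"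
  unfolding continuous_map_def
proof (intro conjI allI impI)
  fix U :: "real set" assume "openin euclideanreal U"
  then have "openin weak_topology {\<mu> \<in> circle_probs. (\<integral>z. f z \<partial>\<mu>) \<in> U}"
    unfolding weak_topology_def using assms
    by (intro topology_generated_by_Basis) auto
  then show "openin weak_topology {x \<in> topspace weak_topology. (\<integral>z. f z \<partial>x) \<in> U}"
    by simp
qed simp

lemma continuous_map_moments: "continuous_map weak_topology euclidean moments"
proof -
  have "continuous_map weak_topology euclidean (\<lambda>\<mu>. moments \<mu> k)" for k
  proof -
    have "continuous_map weak_topology euclidean
        (\<lambda>\<mu>. complex_of_real (\<integral>z. Re (z ^ k) \<partial>\<mu>) + \<i> * complex_of_real (\<integral>z. Im (z ^ k) \<partial>\<mu>))"
    proof (rule continuous_map_add)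
      show "continuous_map weak_topology euclidean (\<lambda>\<mu>. complex_of_real (\<integral>z. Re (z ^ k) \<partial>\<mu>))"
        by (rule continuous_map_compose[OF continuous_map_weak_integral, unfolded o_def, of "\<lambda>z. Re (z ^ k)" _ of_real])
           (auto intro!: continuous_intros)
      show "continuous_map weak_topology euclidean (\<lambda>\<mu>. \<i> * complex_of_real (\<integral>z. Im (z ^ k) \<partial>\<mu>))"
        by (rule continuous_map_compose[OF continuous_map_weak_integral, unfolded o_def, of "\<lambda>z. Im (z ^ k)" _ "\<lambda>x. \<i> * of_real x"])
           (auto intro!: continuous_intros)
    qed
    then show ?thesis
    proof (rule continuous_map_eq)
      fix \<mu> assume "\<mu> \<in> topspace weak_topology"
      then have "integrable \<mu> (\<lambda>z. z ^ k)"
        by (auto intro!: continuous_on_circle_integrable continuous_intros)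
      then show "complex_of_real (\<integral>z. Re (z ^ k) \<partial>\<mu>) + \<i> * complex_of_real (\<integral>z. Im (z ^ k) \<partial>\<mu>) = moments \<mu> k"
        unfolding moments_def by (simp add: complex_eq_iff)
    qed
  qed
  then show ?thesis
    unfolding euclidean_product_topology[symmetric] continuous_map_componentwise_UNIV by simp
qed

lemma inj_on_moments: "inj_on moments circle_probs"
  by (intro inj_onI circle_probs_eqI)

definition of_moments :: "(nat \<Rightarrow> complex) \<Rightarrow> complex measure" where
  "of_moments = the_inv_into circle_probs moments"

lemma of_moments: "\<mu> \<in> circle_probs \<Longrightarrow> of_moments (moments \<mu>) = \<mu>"
  unfolding of_moments_def by (rule the_inv_into_f_f[OF inj_on_moments])

text \<open>The moments are coordinates for the weak topology, so compactness, metrizability and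
  measurability can be read off in the space of sequences. The point is the continuity of the
  inverse: as a function of the moments, \<integral>f d\<mu> is a uniform limit of functions of
  finitely many moments.\<close>

lemma homeomorphic_maps_moments:
  "homeomorphic_maps weak_topology (top_of_set (moments ` circle_probs)) moments of_moments"
  unfolding homeomorphic_maps_def
proof (intro conjI)
  let ?M = "moments ` circle_probs"
  show "continuous_map weak_topology (top_of_set ?M) moments"
    by (auto intro: continuous_map_into_subtopology continuous_map_moments)
  show "continuous_map (top_of_set ?M) weak_topology of_moments"
    unfolding weak_topology_def
  proof (rule continuous_on_generated_topo)
    fix U
    assume "U \<in> {{\<mu> \<in> circle_probs. (\<integral>z. f z \<partial>\<mu>) \<in> V} | (f :: complex \<Rightarrow> real) V.
        continuous_on (sphere 0 1) f \<and> open V}"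
    then obtain f :: "complex \<Rightarrow> real" and V where f: "continuous_on circle f" and V: "open V"
      and U: "U = {\<mu> \<in> circle_probs. (\<integral>z. f z \<partial>\<mu>) \<in> V}" by auto
    have "\<exists>p. \<forall>z\<in>circle. \<bar>f z - Re (poly p z)\<bar> < inverse (Suc n)" for n
      by (intro trig_poly_dense f) simp
    then obtain p where p: "\<And>n z. z \<in> circle \<Longrightarrow> \<bar>f z - Re (poly (p n) z)\<bar> < inverse (Suc n)" by metis
    \<comment> \<open>Each \<open>?g n\<close> reads finitely many coordinates of c and is therefore
      continuous; the error of the approximation is uniform in \<mu> because every total mass is
      1.\<close>
    let ?g = "\<lambda>n c. Re (\<Sum>i\<le>degree (p n). coeff (p n) i * c i)"
    have "uniform_limit ?M ?g (\<lambda>c. \<integral>z. f z \<partial>(of_moments c)) sequentially"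
    proof (rule uniform_limitI)
      fix e :: real assume "e > 0"
      then obtain N where N: "inverse (Suc N) < e" using reals_Archimedean by blast
      show "\<forall>\<^sub>F n in sequentially. \<forall>c\<in>?M. dist (?g n c) (\<integral>z. f z \<partial>(of_moments c)) < e"
      proof (rule eventually_sequentiallyI[of N], safe)
        fix n \<mu> assume n: "N \<le> n" and \<mu>: "\<mu> \<in> circle_probs"
        have "\<bar>(\<integral>z. f z \<partial>\<mu>) - (\<integral>z. Re (poly (p n) z) \<partial>\<mu>)\<bar> \<le> inverse (Suc n)"
          using p[of _ n] by (intro integral_circle_dist_le[OF \<mu> f]) (auto intro!: continuous_intros less_imp_le)
        also have "\<dots> \<le> inverse (Suc N)" using n by simp
        finally show "dist (?g n (moments \<mu>)) (\<integral>z. f z \<partial>(of_moments (moments \<mu>))) < e"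
          using N by (simp add: of_moments[OF \<mu>] integral_Re_poly[OF \<mu>] dist_norm abs_minus_commute)
      qed
    qed
    moreover have "continuous_on ?M (?g n)" for n
      by (intro continuous_intros continuous_on_subset[OF continuous_on_product_coordinates subset_UNIV])
    ultimately have "continuous_on ?M (\<lambda>c. \<integral>z. f z \<partial>(of_moments c))"
      by (intro uniform_limit_theorem) auto
    then have "openin (top_of_set ?M) (?M \<inter> (\<lambda>c. \<integral>z. f z \<partial>(of_moments c)) -` V)"
      using V by (intro continuous_openin_preimage_gen)
    moreover have "of_moments -` U \<inter> topspace (top_of_set ?M) = ?M \<inter> (\<lambda>c. \<integral>z. f z \<partial>(of_moments c)) -` V"
      unfolding U by (auto simp: of_moments)
    ultimately show "openin (top_of_set ?M) (of_moments -` U \<inter> topspace (top_of_set ?M))" by simp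
  next
    show "of_moments ` topspace (top_of_set ?M) \<subseteq> \<Union> {{\<mu> \<in> circle_probs. (\<integral>z. f z \<partial>\<mu>) \<in> V} | (f :: complex \<Rightarrow> real) V.
        continuous_on (sphere 0 1) f \<and> open V}"
      using topspace_weak_topology unfolding weak_topology_def topology_generated_by_topspace
      by (simp add: image_subset_iff of_moments)
  qed
qed (auto simp: of_moments)

text \<open>A basic open set of the product restricts finitely many coordinates; K bounds their
  indices and the smallest of the radii serves for all. Weak neighbourhoods thus become conditions
  on the first K moments, which K Schur steps control.\<close>

lemma open_seq_contains_cylinder:
  fixes S :: "(nat \<Rightarrow> 'a::metric_space) set"
  assumes "open S" "x \<in> S"
  obtains K e where "e > 0" "\<And>y. (\<And>i. i \<le> K \<Longrightarrow> dist (y i) (x i) < e) \<Longrightarrow> y \<in> S"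
proof -
  have "openin (product_topology (\<lambda>i. euclidean) UNIV) S"
    using assms by (simp add: open_fun_def)
  from product_topology_open_contains_basis[OF this assms(2)]
  obtain X where X: "x \<in> (\<Pi>\<^sub>E i\<in>UNIV. X i)" "\<And>i. open (X i)" "finite {i. X i \<noteq> UNIV}" "(\<Pi>\<^sub>E i\<in>UNIV. X i) \<subseteq> S"
    by auto
  have "\<exists>e>0. ball (x i) e \<subseteq> X i" for i
    using X(1,2) by (auto simp: open_contains_ball PiE_iff)
  then obtain e where e: "\<And>i. e i > 0" "\<And>i. ball (x i) (e i) \<subseteq> X i" by metis
  obtain K where K: "{i. X i \<noteq> UNIV} \<subseteq> {..K}" 
    using X(3) unfolding finite_nat_set_iff_bounded_le by auto
  define d where "d = Min (e ` {..K})"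
  have "d > 0" using e by (simp add: d_def)
  moreover have "y \<in> S" if y: "\<And>i. i \<le> K \<Longrightarrow> dist (y i) (x i) < d" for y
  proof -
    have "y i \<in> X i" for i
    proof (cases "i \<le> K")
      case True
      then have "d \<le> e i" by (simp add: d_def)
      then show ?thesis using y[OF True] e(2)[of i] by (auto simp: dist_commute)
    qed (use K in auto)
    then show ?thesis using X(4) by auto
  qed
  ultimately show ?thesis using that by blast
qed

lemma openin_weak_topology_iff:
  "openin weak_topology G \<longleftrightarrow> (\<exists>S. open S \<and> G = {\<mu> \<in> circle_probs. moments \<mu> \<in> S})"
proof
  assume G: "openin weak_topology G"
  then have "openin (top_of_set (moments ` circle_probs)) (moments ` G)"
    using homeomorphic_map_openness[OF homeomorphic_maps_imp_map[OF homeomorphic_maps_moments] openin_subset[OF G]] by simp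
  then obtain S where S: "open S" "moments ` G = moments ` circle_probs \<inter> S"
    by (metis openin_open)
  have "G \<subseteq> circle_probs" using openin_subset[OF G] by simp
  have "\<mu> \<in> G \<longleftrightarrow> moments \<mu> \<in> S" if \<mu>: "\<mu> \<in> circle_probs" for \<mu>
  proof -
    have "moments \<mu> \<in> S \<longleftrightarrow> moments \<mu> \<in> moments ` G" using S(2) \<mu> by blast
    also have "\<dots> \<longleftrightarrow> \<mu> \<in> G"
      using inj_on_moments \<mu> \<open>G \<subseteq> circle_probs\<close> by (rule inj_on_image_mem_iff)
    finally show ?thesis by simp
  qed
  then have "G = {\<mu> \<in> circle_probs. moments \<mu> \<in> S}" using \<open>G \<subseteq> circle_probs\<close> by blast
  then show "\<exists>S. open S \<and> G = {\<mu> \<in> circle_probs. moments \<mu> \<in> S}" using S by blast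
next
  assume "\<exists>S. open S \<and> G = {\<mu> \<in> circle_probs. moments \<mu> \<in> S}"
  then show "openin weak_topology G"
    using continuous_map_moments unfolding continuous_map_def by auto
qed

section \<open>Compactness and the Borel structure of the weak topology\<close>

definition arg_acos :: "complex \<Rightarrow> real" where
  "arg_acos z = (if Im z \<ge> 0 then arccos (max (-1) (min 1 (Re z))) else - arccos (max (-1) (min 1 (Re z))))"

text \<open>Clamping \<open>Re z\<close> to [-1, 1] makes the \<open>arccos\<close> term continuous
  on the whole plane, so \<open>arg_acos\<close> is Borel everywhere; on the circle it is a right
  inverse of \<open>cis\<close>.\<close>

lemma borel_measurable_arg_acos [measurable]: "arg_acos \<in> borel_measurable borel"
proof -
  have "continuous_on UNIV (\<lambda>z::complex. arccos (max (-1) (min 1 (Re z))))"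
    by (intro continuous_on_arccos continuous_intros) auto
  from borel_measurable_continuous_onI[OF this] show ?thesis
    unfolding arg_acos_def[abs_def] by measurable
qed

lemma cis_arg_acos:
  assumes "z \<in> circle"
  shows "cis (arg_acos z) = z"
proof -
  have n: "(Re z)\<^sup>2 + (Im z)\<^sup>2 = 1" using assms by (simp add: cmod_def)
  then have b: "\<bar>Re z\<bar> \<le> 1" using abs_Re_le_cmod[of z] assms by simp
  then have "max (-1) (min 1 (Re z)) = Re z" by auto
  moreover have "1 - (Re z)\<^sup>2 = (Im z)\<^sup>2" using n by simp
  then have "sin (arccos (Re z)) = \<bar>Im z\<bar>"
    using b by (simp add: sin_arccos_abs)
  ultimately show ?thesis using b by (simp add: arg_acos_def complex_eq_iff)
qed

lemma arg_acos_bounds: "- 4 < arg_acos z" "arg_acos z \<le> 4"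
proof -
  have "0 \<le> arccos (max (-1) (min 1 (Re z)))" "arccos (max (-1) (min 1 (Re z))) \<le> pi"
    by (auto intro!: arccos_lbound arccos_ubound)
  then show "- 4 < arg_acos z" "arg_acos z \<le> 4"
    using pi_less_4 by (auto simp: arg_acos_def)
qed

text \<open>Helly's theorem on the line: the laws of the angles are tight, a weakly convergent
  subsequence exists, and its limit is wrapped back onto the circle by \<open>cis\<close>. As
  \<open>cis\<close> is continuous, the jump of the angle at -1 does no harm.\<close>

lemma moments_convergent_subsequence:
  fixes \<mu> :: "nat \<Rightarrow> complex measure"
  assumes \<mu>: "\<And>n. \<mu> n \<in> circle_probs"
  shows "\<exists>r \<nu>. strict_mono (r :: nat \<Rightarrow> nat) \<and> \<nu> \<in> circle_probs \<and>
    (\<forall>k. (\<lambda>n. moments (\<mu> (r n)) k) \<longlonglongrightarrow> moments \<nu> k)"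
proof -
  have meas: "arg_acos \<in> measurable (\<mu> n) borel" for n
  proof -
    have "arg_acos \<in> measurable circle_borel borel" 
      unfolding circle_borel_def by (intro measurable_restrict_space1) simp
    then show ?thesis using circle_probsD(2)[OF \<mu>] by (simp cong: measurable_cong_sets)
  qed
  define D where "D n = distr (\<mu> n) borel arg_acos" for n
  have rd: "real_distribution (D n)" for n
    unfolding D_def by (intro prob_space.real_distribution_distr circle_probsD(1)[OF \<mu>] meas)
  have "tight D"
    unfolding tight_def
  proof (intro conjI allI impI)
    fix e :: real assume "e > 0"
    \<comment> \<open>One bounded interval carries every \<open>D n\<close>; 4 is merely a round
      number above \<pi>.\<close>
    have "measure (D n) {-4<..4} = 1" for n
    proof -
      interpret prob_space "\<mu> n" by (rule circle_probsD[OF \<mu>])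
      have "arg_acos -` {-4<..4} \<inter> space (\<mu> n) = space (\<mu> n)"
        using arg_acos_bounds by auto
      then show ?thesis by (simp add: D_def measure_distr[OF meas] prob_space)
    qed
    then show "\<exists>a b. a < b \<and> (\<forall>n. 1 - e < measure (D n) {a<..b})"
      using \<open>e > 0\<close> by (intro exI[of _ "-4"] exI[of _ 4]) auto
  qed (rule rd)
  from tight_imp_convergent_subsubsequence[OF this strict_mono_id]
  obtain r N where r: "strict_mono (r :: nat \<Rightarrow> nat)" and N: "real_distribution N" and conv: "weak_conv_m (D \<circ> id \<circ> r) N"
    by auto
  interpret N: real_distribution N by (rule N)
  have cis_meas: "cis \<in> measurable borel circle_borel"
    unfolding circle_borel_def
    by (intro measurable_restrict_space2 borel_measurable_continuous_onI continuous_intros) auto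
  then have cis_meas_N: "cis \<in> measurable N circle_borel" by simp
  define \<nu> where "\<nu> = distr N circle_borel cis"
  have \<nu>: "\<nu> \<in> circle_probs"
    unfolding \<nu>_def circle_probs_def using N.prob_space_distr[OF cis_meas_N] by simp
  have "(\<lambda>n. moments (\<mu> (r n)) k) \<longlonglongrightarrow> moments \<nu> k" for k
  proof -
    have "(\<lambda>n. integral\<^sup>L ((D \<circ> id \<circ> r) n) (\<lambda>x. cis x ^ k)) \<longlonglongrightarrow> integral\<^sup>L N (\<lambda>x. cis x ^ k)"
      by (rule weak_conv_imp_integral_bdd_continuous_conv[where B=1, OF _ N conv])
         (auto simp: rd norm_power intro!: continuous_intros continuous_on_interior[of UNIV cis])
    moreover have "integral\<^sup>L ((D \<circ> id \<circ> r) n) (\<lambda>x. cis x ^ k) = moments (\<mu> (r n)) k" for n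
    proof -
      have "integral\<^sup>L (D (r n)) (\<lambda>x. cis x ^ k) = (\<integral>z. cis (arg_acos z) ^ k \<partial>\<mu> (r n))"
        unfolding D_def by (intro integral_distr meas borel_measurable_continuous_onI continuous_intros)
      also have "\<dots> = moments (\<mu> (r n)) k"
        unfolding moments_def
        by (intro Bochner_Integration.integral_cong refl) (simp add: cis_arg_acos circle_probsD(3)[OF \<mu>])
      finally show ?thesis by simp
    qed
    moreover have "integral\<^sup>L N (\<lambda>x. cis x ^ k) = moments \<nu> k"
      unfolding moments_def \<nu>_def
      by (intro integral_distr[symmetric] cis_meas_N continuous_on_circle_measurable continuous_intros refl)
    ultimately show ?thesis by simp
  qed
  then show ?thesis using r \<nu> by blast
qed

lemma LIMSEQ_coordinatewise:
  fixes f :: "nat \<Rightarrow> 'b \<Rightarrow> 'a::topological_space"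
  assumes "\<And>k. (\<lambda>n. f n k) \<longlonglongrightarrow> l k"
  shows "f \<longlonglongrightarrow> l"
proof -
  have "limitin (product_topology (\<lambda>i. euclidean) UNIV) f l sequentially"
    using assms by (auto simp: limitin_componentwise)
  then show ?thesis by (simp add: euclidean_product_topology)
qed

lemma compact_moments: "compact (moments ` circle_probs)"
  unfolding compact_eq_seq_compact_metric seq_compact_def
proof (intro allI impI)
  fix f :: "nat \<Rightarrow> nat \<Rightarrow> complex"
  assume "\<forall>n. f n \<in> moments ` circle_probs"
  then have "\<forall>n. \<exists>\<nu>. \<nu> \<in> circle_probs \<and> f n = moments \<nu>" by auto
  from choice[OF this] obtain \<mu> where \<mu>: "\<And>n. \<mu> n \<in> circle_probs" "\<And>n. f n = moments (\<mu> n)"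
    by auto
  obtain r \<nu> where r: "strict_mono (r :: nat \<Rightarrow> nat)" "\<nu> \<in> circle_probs"
    "\<forall>k. (\<lambda>n. moments (\<mu> (r n)) k) \<longlonglongrightarrow> moments \<nu> k"
    using moments_convergent_subsequence[of \<mu>] \<mu>(1) by auto
  have "(f \<circ> r) \<longlonglongrightarrow> moments \<nu>"
    using r(3) by (intro LIMSEQ_coordinatewise) (simp add: \<mu>)
  then show "\<exists>l\<in>moments ` circle_probs. \<exists>r. strict_mono r \<and> (f \<circ> r) \<longlonglongrightarrow> l"
    using r by blast
qed

lemma compact_space_weak_topology: "compact_space weak_topology"
proof -
  have "compact_space (top_of_set (moments ` circle_probs))"
    using compact_moments by (simp add: compact_space_subtopology)
  then show ?thesis
    using homeomorphic_maps_imp_homeomorphic_space[OF homeomorphic_maps_moments] homeomorphic_compact_space by blast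
qed

lemma polish_weak_topology: "polish_topology weak_topology"
proof -
  let ?M = "moments ` circle_probs"
  have hom: "weak_topology homeomorphic_space (top_of_set ?M)"
    by (rule homeomorphic_maps_imp_homeomorphic_space[OF homeomorphic_maps_moments])
  have "completely_metrizable_space (top_of_set ?M)"
    using compact_moments
    by (intro completely_metrizable_space_closedin completely_metrizable_space_euclidean) (auto intro: compact_imp_closed)
  moreover have "separable_space (top_of_set ?M)"
  proof -
    obtain T where T: "countable T" "T \<subseteq> ?M" "?M \<subseteq> closure T" using separable[of ?M] by metis
    then have "top_of_set ?M closure_of T = ?M"
      by (auto simp: closure_of_subtopology Int_absorb1)
    then show ?thesis unfolding separable_space_def using T by auto
  qed
  ultimately show ?thesis
    unfolding polish_topology_def
    using homeomorphic_completely_metrizable_space[OF hom] homeomorphic_separable_space[OF hom] by simp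
qed

text \<open>Open sets are preimages of open sets of sequences under \<open>moments\<close>, and in a
  countable product of second countable spaces the coordinates generate the Borel sets; hence
  measurability can be tested moment by moment.\<close>

lemma measurable_borel_of_weak:
  assumes g: "g \<in> space M \<rightarrow> circle_probs" and m: "\<And>k. (\<lambda>x. moments (g x) k) \<in> borel_measurable M"
  shows "g \<in> measurable M (borel_of weak_topology)"
proof -
  have m': "(\<lambda>x. moments (g x)) \<in> borel_measurable M"
    using m by (rule measurable_coordinatewise_then_product)
  show ?thesis
    unfolding borel_of_def
  proof (rule measurable_sigma_sets)
    fix G assume "G \<in> {S. openin weak_topology S}"
    then obtain S where S: "open S" and G: "G = {\<mu> \<in> circle_probs. moments \<mu> \<in> S}"
      by (auto simp: openin_weak_topology_iff)
    have "g -` G \<inter> space M = (\<lambda>x. moments (g x)) -` S \<inter> space M"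
      using g G by auto
    also have "\<dots> \<in> sets M" using m' S by (intro measurable_sets[OF m']) auto
    finally show "g -` G \<inter> space M \<in> sets M" .
  next
    show sub: "{S. openin weak_topology S} \<subseteq> Pow (topspace weak_topology)"
      using openin_subset by blast
    show "sets (sigma (topspace weak_topology) {S. openin weak_topology S}) =
        sigma_sets (topspace weak_topology) {S. openin weak_topology S}"
      using sub by (rule sets_measure_of)
  qed (use g in simp)
qed

section \<open>Unitary matrices\<close>

lemma mat_adjoint_carrier [simp, intro]: "A \<in> carrier_mat n m \<Longrightarrow> mat_adjoint A \<in> carrier_mat m n"
  unfolding mat_adjoint_def by (auto simp: mat_of_rows_def)

lemma mat_adjoint_index [simp]:
  assumes "A \<in> carrier_mat n m" "i < m" "j < n"
  shows "mat_adjoint A $$ (i, j) = conjugate (A $$ (j, i))"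
  using assms unfolding mat_adjoint_def by (auto simp: mat_of_rows_def)

lemma mat_adjoint_dim [simp]: "dim_row (mat_adjoint A) = dim_col A" "dim_col (mat_adjoint A) = dim_row A"
  unfolding mat_adjoint_def by (simp_all add: mat_of_rows_def)

lemma mat_adjoint_adjoint [simp]:
  fixes A :: "complex mat"
  shows "mat_adjoint (mat_adjoint A) = A"
  by (rule eq_matI) (auto simp: mat_adjoint_index[of _ "dim_col A" "dim_row A"] mat_adjoint_index[of _ "dim_row A" "dim_col A"])

lemma mat_adjoint_mult:
  fixes A B :: "complex mat"
  assumes "A \<in> carrier_mat n m" "B \<in> carrier_mat m k"
  shows "mat_adjoint (A * B) = mat_adjoint B * mat_adjoint A"
proof (rule eq_matI)
  fix i j assume ij: "i < dim_row (mat_adjoint B * mat_adjoint A)" "j < dim_col (mat_adjoint B * mat_adjoint A)"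
  then have ij': "i < k" "j < n" using assms by auto
  have "mat_adjoint (A * B) $$ (i, j) = conjugate ((A * B) $$ (j, i))"
    using ij' assms by (intro mat_adjoint_index[of _ n k]) auto
  also have "\<dots> = (\<Sum>l<m. cnj (A $$ (j, l)) * cnj (B $$ (l, i)))"
    using ij' assms by (auto simp: scalar_prod_def atLeast0LessThan)
  also have "\<dots> = (mat_adjoint B * mat_adjoint A) $$ (i, j)"
    using ij' assms by (auto simp: scalar_prod_def atLeast0LessThan mult.commute
      mat_adjoint_index[of B m k] mat_adjoint_index[of A n m] intro!: sum.cong)
  finally show "mat_adjoint (A * B) $$ (i, j) = (mat_adjoint B * mat_adjoint A) $$ (i, j)" .
qed (use assms in auto)

lemma unitary_group_carrier: "U \<in> unitary_group n \<Longrightarrow> U \<in> carrier_mat n n"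
  by (simp add: unitary_group_def)

lemma unitary_group_dim: "U \<in> unitary_group n \<Longrightarrow> dim_row U = n \<and> dim_col U = n"
  by (auto simp: unitary_group_def)

lemma unitary_group_right:
  assumes "U \<in> unitary_group n"
  shows "U * mat_adjoint U = 1\<^sub>m n"
  using assms mat_mult_left_right_inverse[of "mat_adjoint U" n U]
  by (auto simp: unitary_group_def)

lemma unitary_group_left:
  assumes "U \<in> unitary_group n"
  shows "mat_adjoint U * U = 1\<^sub>m n"
  using assms by (auto simp: unitary_group_def)

lemma unitary_group_adjoint:
  assumes "U \<in> unitary_group n"
  shows "mat_adjoint U \<in> unitary_group n"
  using assms unitary_group_right[OF assms] by (auto simp: unitary_group_def)

lemma unitary_group_mult:
  assumes "U \<in> unitary_group n" "V \<in> unitary_group n"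
  shows "U * V \<in> unitary_group n"
proof -
  have c: "U \<in> carrier_mat n n" "V \<in> carrier_mat n n" using assms by (auto simp: unitary_group_def)
  have "mat_adjoint (U * V) * (U * V) = mat_adjoint V * (mat_adjoint U * U) * V"
    using c mat_adjoint_carrier[OF c(1)] mat_adjoint_carrier[OF c(2)]
    by (simp add: mat_adjoint_mult[of U n n V n] assoc_mult_mat[of _ n n _ n _ n] mult_carrier_mat[of _ n n _ n])
  also have "\<dots> = 1\<^sub>m n"
    using assms c by (simp add: unitary_group_left)
  finally show ?thesis using c by (auto simp: unitary_group_def)
qed

lemma unitary_group_one: "1\<^sub>m n \<in> unitary_group n"
proof -
  have "mat_adjoint (1\<^sub>m n :: complex mat) = 1\<^sub>m n"
    by (rule eq_matI) (auto simp: mat_adjoint_index[of _ n n])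
  then show ?thesis by (auto simp: unitary_group_def)
qed

lemma unitary_groupI:
  assumes "U \<in> carrier_mat n n"
    and "\<And>i j. i < n \<Longrightarrow> j < n \<Longrightarrow> (\<Sum>l<n. cnj (U $$ (l, i)) * U $$ (l, j)) = (if i = j then 1 else 0)"
  shows "U \<in> unitary_group n"
proof -
  have "mat_adjoint U * U = 1\<^sub>m n"
    using assms by (intro eq_matI) (auto simp: scalar_prod_def atLeast0LessThan mat_adjoint_index[of U n n])
  then show ?thesis using assms by (simp add: unitary_group_def)
qed

lemma unitary_group_colD:
  assumes "U \<in> unitary_group n" "i < n" "j < n"
  shows "(\<Sum>l<n. cnj (U $$ (l, i)) * U $$ (l, j)) = (if i = j then 1 else 0)"
proof -
  have "(mat_adjoint U * U) $$ (i, j) = (\<Sum>l<n. cnj (U $$ (l, i)) * U $$ (l, j))"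
    using assms unitary_group_carrier[OF assms(1)] 
    by (auto simp: scalar_prod_def atLeast0LessThan mat_adjoint_index[of U n n])
  then show ?thesis using assms by (simp add: unitary_group_left)
qed

section \<open>Inner products and squared norms\<close>

definition vnorm2 :: "complex Matrix.vec \<Rightarrow> real" where
  "vnorm2 x = (\<Sum>i<dim_vec x. (cmod (x $ i))\<^sup>2)"

lemma vnorm2_nonneg: "vnorm2 x \<ge> 0"
  by (simp add: vnorm2_def sum_nonneg)

lemma cscalar_self: "x \<bullet>c x = complex_of_real (vnorm2 x)"
  by (auto simp: scalar_prod_def vnorm2_def atLeast0LessThan complex_norm_square[symmetric] simp del: of_real_power)

lemma cscalar_adjoint:
  fixes A :: "complex mat"
  assumes "A \<in> carrier_mat n m" "x \<in> carrier_vec m" "y \<in> carrier_vec n"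
  shows "(A *\<^sub>v x) \<bullet>c y = x \<bullet>c (mat_adjoint A *\<^sub>v y)"
proof -
  have "(A *\<^sub>v x) \<bullet>c y = (\<Sum>i<n. \<Sum>j<m. A $$ (i, j) * x $ j * cnj (y $ i))"
    using assms by (auto simp: scalar_prod_def atLeast0LessThan sum_distrib_right)
  also have "\<dots> = (\<Sum>j<m. \<Sum>i<n. A $$ (i, j) * x $ j * cnj (y $ i))" by (rule sum.swap)
  also have "\<dots> = x \<bullet>c (mat_adjoint A *\<^sub>v y)"
    using assms by (auto simp: scalar_prod_def atLeast0LessThan sum_distrib_left mult_ac 
        mat_adjoint_index[of A n m] intro!: sum.cong)
  finally show ?thesis .
qed

lemma unitary_cscalar:
  assumes "U \<in> unitary_group n" "x \<in> carrier_vec n" "y \<in> carrier_vec n"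
  shows "(U *\<^sub>v x) \<bullet>c (U *\<^sub>v y) = x \<bullet>c y"
proof -
  have c: "U \<in> carrier_mat n n" using assms by (simp add: unitary_group_def)
  have "(U *\<^sub>v x) \<bullet>c (U *\<^sub>v y) = x \<bullet>c (mat_adjoint U *\<^sub>v (U *\<^sub>v y))"
    using c assms by (intro cscalar_adjoint) auto
  also have "mat_adjoint U *\<^sub>v (U *\<^sub>v y) = y"
    using c assms by (subst assoc_mult_mat_vec[symmetric, of _ n n _ n]) (auto simp: unitary_group_left)
  finally show ?thesis .
qed

lemma vnorm2_unitary:
  assumes "U \<in> unitary_group n" "x \<in> carrier_vec n"
  shows "vnorm2 (U *\<^sub>v x) = vnorm2 x"
  using unitary_cscalar[OF assms assms(2)] by (simp add: cscalar_self)

subsection \<open>The coupling blocks\<close>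

text \<open>The block sum 1 \<oplus> V. For unitary V these matrices form the stabilizer of the
  first basis vector in the next larger unitary group.\<close>

definition ext_mat :: "complex mat \<Rightarrow> complex mat" where
  "ext_mat V = Matrix.mat (Suc (dim_row V)) (Suc (dim_col V))
     (\<lambda>(i, j). if i = 0 \<and> j = 0 then 1 else if i = 0 \<or> j = 0 then 0 else V $$ (i - 1, j - 1))"

lemma ext_mat_carrier: "V \<in> carrier_mat n m \<Longrightarrow> ext_mat V \<in> carrier_mat (Suc n) (Suc m)"
  by (auto simp: ext_mat_def)

lemma ext_mat_index:
  "ext_mat V $$ (0, 0) = 1"
  "j < dim_col V \<Longrightarrow> ext_mat V $$ (0, Suc j) = 0"
  "i < dim_row V \<Longrightarrow> ext_mat V $$ (Suc i, 0) = 0"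
  "i < dim_row V \<Longrightarrow> j < dim_col V \<Longrightarrow> ext_mat V $$ (Suc i, Suc j) = V $$ (i, j)"
  by (auto simp: ext_mat_def)

lemma ext_mat_mult:
  assumes "V \<in> carrier_mat n m" "W \<in> carrier_mat m k"
  shows "ext_mat (V * W) = ext_mat V * ext_mat W"
proof (rule eq_matI)
  note c = ext_mat_carrier[OF assms(1)] ext_mat_carrier[OF assms(2)]
  fix i j assume "i < dim_row (ext_mat V * ext_mat W)" "j < dim_col (ext_mat V * ext_mat W)"
  then have ij: "i < Suc n" "j < Suc k" using c by auto
  have "(ext_mat V * ext_mat W) $$ (i, j) = (\<Sum>l<Suc m. ext_mat V $$ (i, l) * ext_mat W $$ (l, j))"
    using c ij by (auto simp: scalar_prod_def atLeast0LessThan)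
  also have "\<dots> = ext_mat (V * W) $$ (i, j)"
    unfolding sum.lessThan_Suc_shift using ij assms
    by (cases i; cases j) (auto simp: ext_mat_index scalar_prod_def atLeast0LessThan)
  finally show "ext_mat (V * W) $$ (i, j) = (ext_mat V * ext_mat W) $$ (i, j)" by simp
qed (use assms in \<open>auto simp: ext_mat_def\<close>)

lemma ext_mat_adjoint:
  assumes "V \<in> carrier_mat n m"
  shows "mat_adjoint (ext_mat V) = ext_mat (mat_adjoint V)"
proof (rule eq_matI)
  fix i j assume "i < dim_row (ext_mat (mat_adjoint V))" "j < dim_col (ext_mat (mat_adjoint V))"
  then have ij: "i < Suc m" "j < Suc n" using assms by (auto simp: ext_mat_def)
  then have "mat_adjoint (ext_mat V) $$ (i, j) = conjugate (ext_mat V $$ (j, i))"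
    using ext_mat_carrier[OF assms] by (intro mat_adjoint_index) auto
  also have "\<dots> = ext_mat (mat_adjoint V) $$ (i, j)"
    using ij assms by (cases i; cases j) (auto simp: ext_mat_index mat_adjoint_index[of V n m])
  finally show "mat_adjoint (ext_mat V) $$ (i, j) = ext_mat (mat_adjoint V) $$ (i, j)" .
qed (use assms in \<open>auto simp: ext_mat_def\<close>)

lemma ext_mat_one: "ext_mat (1\<^sub>m n) = 1\<^sub>m (Suc n)"
  by (rule eq_matI) (auto simp: ext_mat_def)

lemma ext_mat_unitary:
  assumes "V \<in> unitary_group n"
  shows "ext_mat V \<in> unitary_group (Suc n)"
proof -
  have c: "V \<in> carrier_mat n n" using assms by (rule unitary_group_carrier)
  have "mat_adjoint (ext_mat V) * ext_mat V = ext_mat (mat_adjoint V * V)"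
    using c by (simp add: ext_mat_adjoint ext_mat_mult[of _ n n _ n])
  then show ?thesis
    using ext_mat_carrier[OF c] assms by (simp add: unitary_group_def ext_mat_one)
qed

lemma ext_mat_mult_vCons:
  assumes "V \<in> carrier_mat n m" "y \<in> carrier_vec m"
  shows "ext_mat V *\<^sub>v vCons a y = vCons a (V *\<^sub>v y)"
proof (rule eq_vecI)
  fix i assume "i < dim_vec (vCons a (V *\<^sub>v y))"
  then have i: "i < Suc n" using assms by auto
  have "(ext_mat V *\<^sub>v vCons a y) $ i = (\<Sum>l<Suc m. ext_mat V $$ (i, l) * vCons a y $ l)"
    using i assms ext_mat_carrier[OF assms(1)] by (auto simp: scalar_prod_def atLeast0LessThan)
  also have "\<dots> = vCons a (V *\<^sub>v y) $ i"
    unfolding sum.lessThan_Suc_shift using i assms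
    by (cases i) (auto simp: ext_mat_index scalar_prod_def atLeast0LessThan)
  finally show "(ext_mat V *\<^sub>v vCons a y) $ i = vCons a (V *\<^sub>v y) $ i" .
qed (use assms in \<open>auto simp: ext_mat_def\<close>)

text \<open>The first column is the first basis vector, and the other columns are orthogonal to it,
  so the rest of the first row vanishes and U splits.\<close>

lemma unitary_fix_unit_vec:
  assumes U: "U \<in> unitary_group (Suc n)" and col: "\<And>i. i < Suc n \<Longrightarrow> U $$ (i, 0) = (if i = 0 then 1 else 0)"
  obtains W where "W \<in> unitary_group n" "U = ext_mat W"
proof -
  have c: "U \<in> carrier_mat (Suc n) (Suc n)" using U by (rule unitary_group_carrier)
  have row: "U $$ (0, Suc j) = 0" if "j < n" for j
  proof -
    have "(\<Sum>l<Suc n. cnj (U $$ (l, 0)) * U $$ (l, Suc j)) = 0"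
      using unitary_group_colD[OF U, of 0 "Suc j"] that by simp
    moreover have "(\<Sum>l<Suc n. cnj (U $$ (l, 0)) * U $$ (l, Suc j)) = U $$ (0, Suc j)"
      unfolding sum.lessThan_Suc_shift by (simp add: col)
    ultimately show ?thesis by simp
  qed
  define W where "W = Matrix.mat n n (\<lambda>(i, j). U $$ (Suc i, Suc j))"
  have "U = ext_mat W"
  proof (rule eq_matI)
    fix i j assume "i < dim_row (ext_mat W)" "j < dim_col (ext_mat W)"
    then have "i < Suc n" "j < Suc n" by (auto simp: W_def ext_mat_def)
    then show "U $$ (i, j) = ext_mat W $$ (i, j)"
      using col row by (cases i; cases j) (auto simp: W_def ext_mat_index)
  qed (use c in \<open>auto simp: W_def ext_mat_def\<close>)
  moreover have "W \<in> unitary_group n"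
  proof (rule unitary_groupI)
    fix i j assume ij: "i < n" "j < n"
    have "(\<Sum>l<Suc n. cnj (U $$ (l, Suc i)) * U $$ (l, Suc j)) = (if i = j then 1 else 0)"
      using unitary_group_colD[OF U, of "Suc i" "Suc j"] ij by simp
    then show "(\<Sum>l<n. cnj (W $$ (l, i)) * W $$ (l, j)) = (if i = j then 1 else 0)"
      unfolding sum.lessThan_Suc_shift using ij row by (simp add: W_def)
  qed (simp add: W_def)
  ultimately show ?thesis using that by blast
qed

definition verblunsky_rho :: "complex \<Rightarrow> complex" where
  "verblunsky_rho \<alpha> = complex_of_real (sqrt (1 - (cmod \<alpha>)\<^sup>2))"

lemma verblunsky_rho_sq:
  assumes "cmod \<alpha> \<le> 1"
  shows "verblunsky_rho \<alpha> * verblunsky_rho \<alpha> = 1 - \<alpha> * cnj \<alpha>"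
    "(cmod (verblunsky_rho \<alpha>))\<^sup>2 = 1 - (cmod \<alpha>)\<^sup>2" "cnj (verblunsky_rho \<alpha>) = verblunsky_rho \<alpha>"
proof -
  have "(cmod \<alpha>)\<^sup>2 \<le> 1" using assms by (simp add: power_le_one)
  then show "verblunsky_rho \<alpha> * verblunsky_rho \<alpha> = 1 - \<alpha> * cnj \<alpha>"
    "(cmod (verblunsky_rho \<alpha>))\<^sup>2 = 1 - (cmod \<alpha>)\<^sup>2" "cnj (verblunsky_rho \<alpha>) = verblunsky_rho \<alpha>"
    by (simp_all add: verblunsky_rho_def complex_norm_square[symmetric] flip: of_real_mult)
qed

text \<open>On the first two coordinates this is the symmetric block with rows (\<alpha>, \<rho>)
  and (\<rho>, -cnj \<alpha>), where \<rho> = sqrt (1 - |\<alpha>|^2). Products of shifted copies of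
  such blocks are the Hessenberg form of a unitary matrix.\<close>

definition givens :: "nat \<Rightarrow> complex \<Rightarrow> complex mat" where
  "givens n \<alpha> = Matrix.mat n n (\<lambda>(i, j).
     if i = 0 \<and> j = 0 then \<alpha>
     else if i = 0 \<and> j = 1 \<or> i = 1 \<and> j = 0 then verblunsky_rho \<alpha>
     else if i = 1 \<and> j = 1 then - cnj \<alpha>
     else if i = j then 1 else 0)"

lemma givens_carrier [simp]: "givens n \<alpha> \<in> carrier_mat n n" "dim_row (givens n \<alpha>) = n" "dim_col (givens n \<alpha>) = n"
  by (auto simp: givens_def)

lemma givens_unitary:
  assumes "cmod \<alpha> \<le> 1"
  shows "givens (Suc (Suc n)) \<alpha> \<in> unitary_group (Suc (Suc n))"
proof (rule unitary_groupI)
  fix i j assume ij: "i < Suc (Suc n)" "j < Suc (Suc n)"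
  show "(\<Sum>l<Suc (Suc n). cnj (givens (Suc (Suc n)) \<alpha> $$ (l, i)) * givens (Suc (Suc n)) \<alpha> $$ (l, j)) =
       (if i = j then 1 else 0)"
    unfolding sum.lessThan_Suc_shift o_def
  proof (cases "i < 2 \<or> j < 2")
    case True
    then have "i = 0 \<or> i = 1 \<or> (i \<ge> 2 \<and> j = 0) \<or> (i \<ge> 2 \<and> j = 1)" by auto
    moreover have "j = 0 \<or> j = 1 \<or> j \<ge> 2" by auto
    moreover have "(\<Sum>l<n. cnj (givens (Suc (Suc n)) \<alpha> $$ (Suc (Suc l), i)) * givens (Suc (Suc n)) \<alpha> $$ (Suc (Suc l), j)) = 0"
      using True ij by (intro sum.neutral) (auto simp: givens_def)
    ultimately show "cnj (givens (Suc (Suc n)) \<alpha> $$ (0, i)) * givens (Suc (Suc n)) \<alpha> $$ (0, j) +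
      (cnj (givens (Suc (Suc n)) \<alpha> $$ (Suc 0, i)) * givens (Suc (Suc n)) \<alpha> $$ (Suc 0, j) +
       (\<Sum>l<n. cnj (givens (Suc (Suc n)) \<alpha> $$ (Suc (Suc l), i)) * givens (Suc (Suc n)) \<alpha> $$ (Suc (Suc l), j))) =
      (if i = j then 1 else 0)"
      using ij by (elim disjE) (auto simp: givens_def verblunsky_rho_sq[OF assms] mult.commute)
  next
    case False
    then obtain i' j' where i: "i = Suc (Suc i')" "j = Suc (Suc j')"
      by (metis Suc_le_D not_less numeral_2_eq_2 Suc_le_mono)
    have "(\<Sum>l<n. cnj (givens (Suc (Suc n)) \<alpha> $$ (Suc (Suc l), i)) * givens (Suc (Suc n)) \<alpha> $$ (Suc (Suc l), j)) =
        (\<Sum>l<n. if l = i' then (if i' = j' then 1 else 0) else 0)"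
      using ij i by (intro sum.cong) (auto simp: givens_def)
    then show "cnj (givens (Suc (Suc n)) \<alpha> $$ (0, i)) * givens (Suc (Suc n)) \<alpha> $$ (0, j) +
      (cnj (givens (Suc (Suc n)) \<alpha> $$ (Suc 0, i)) * givens (Suc (Suc n)) \<alpha> $$ (Suc 0, j) +
       (\<Sum>l<n. cnj (givens (Suc (Suc n)) \<alpha> $$ (Suc (Suc l), i)) * givens (Suc (Suc n)) \<alpha> $$ (Suc (Suc l), j))) =
      (if i = j then 1 else 0)"
      using ij i by (auto simp: givens_def)
  qed
qed simp

text \<open>The tail is written as y plus a multiple of the first basis vector, since only the first
  entry of y changes. This shape makes orbits easy to unroll, and it is the origin of the factor 1 +
  cnj \<alpha> in \<open>schur_a\<close> and \<open>schur_g\<close>.\<close>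

lemma givens_mult_vCons:
  assumes y: "y \<in> carrier_vec (Suc n)"
  shows "givens (Suc (Suc n)) \<alpha> *\<^sub>v vCons a y =
    vCons (\<alpha> * a + verblunsky_rho \<alpha> * y $ 0)
      (y + (verblunsky_rho \<alpha> * a - (1 + cnj \<alpha>) * y $ 0) \<cdot>\<^sub>v unit_vec (Suc n) 0)"
proof (rule eq_vecI)
  fix i assume "i < dim_vec (vCons (\<alpha> * a + verblunsky_rho \<alpha> * y $ 0)
      (y + (verblunsky_rho \<alpha> * a - (1 + cnj \<alpha>) * y $ 0) \<cdot>\<^sub>v unit_vec (Suc n) 0))"
  then have i: "i < Suc (Suc n)" using y by auto
  have "(givens (Suc (Suc n)) \<alpha> *\<^sub>v vCons a y) $ i =
     (\<Sum>l<Suc (Suc n). givens (Suc (Suc n)) \<alpha> $$ (i, l) * vCons a y $ l)"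
    using i y by (auto simp: scalar_prod_def atLeast0LessThan simp del: sum.lessThan_Suc)
  also have "\<dots> = givens (Suc (Suc n)) \<alpha> $$ (i, 0) * a + (givens (Suc (Suc n)) \<alpha> $$ (i, 1) * y $ 0 +
      (\<Sum>l<n. givens (Suc (Suc n)) \<alpha> $$ (i, Suc (Suc l)) * y $ Suc l))"
    unfolding sum.lessThan_Suc_shift o_def by simp
  also have "(\<Sum>l<n. givens (Suc (Suc n)) \<alpha> $$ (i, Suc (Suc l)) * y $ Suc l) =
      (\<Sum>l<n. if i = Suc (Suc l) then y $ Suc l else 0)"
    using i by (intro sum.cong) (auto simp: givens_def)
  also have "\<dots> = (if i \<ge> 2 then y $ (i - 1) else 0)"
  proof (cases "i \<ge> 2")
    case True
    then obtain k where "i = Suc (Suc k)" by (metis Suc_le_D numeral_2_eq_2 Suc_le_mono)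
    then show ?thesis using i by simp
  qed simp
  also have "givens (Suc (Suc n)) \<alpha> $$ (i, 0) * a + (givens (Suc (Suc n)) \<alpha> $$ (i, 1) * y $ 0 +
      (if i \<ge> 2 then y $ (i - 1) else 0)) = vCons (\<alpha> * a + verblunsky_rho \<alpha> * y $ 0)
      (y + (verblunsky_rho \<alpha> * a - (1 + cnj \<alpha>) * y $ 0) \<cdot>\<^sub>v unit_vec (Suc n) 0) $ i"
  proof -
    consider "i = 0" | "i = 1" | k where "i = Suc (Suc k)" by (metis One_nat_def not0_implies_Suc)
    then show ?thesis
      using i y by cases (auto simp: givens_def algebra_simps)
  qed
  finally show "(givens (Suc (Suc n)) \<alpha> *\<^sub>v vCons a y) $ i = \<dots>" .
qed (use y in auto)

subsection \<open>Completing a unit vector to a unitary matrix\<close>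

text \<open>After the phase w has been split off, g is (r, h) with r \<ge> 0 real and |h|^2 = 1 -
  r^2. The rotation in the plane of e_1 and (r, h) that carries the former to the latter has first
  column (r, h), the rest of its first row is minus the adjoint of h, and its remaining block is 1
  minus h times its adjoint over 1 + r. The denominator is nonzero as r \<ge> 0; if
  \<open>g $ 0 = 0\<close> any phase works and w = 1 is taken.\<close>

lemma unitary_completion:
  assumes g: "g \<in> carrier_vec (Suc n)" "vnorm2 g = 1"
  obtains T where "T \<in> unitary_group (Suc n)" "\<And>i. i < Suc n \<Longrightarrow> T $$ (i, 0) = g $ i"
proof -
  define w where "w = (if g $ 0 = 0 then 1 else g $ 0 / of_real (cmod (g $ 0)))"
  define r where "r = complex_of_real (cmod (g $ 0))"
  define h where "h i = cnj w * g $ (Suc i)" for i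
  have w: "cnj w * w = 1" "w * cnj w = 1" "w * r = g $ 0"
    by (auto simp: w_def r_def complex_norm_square power2_eq_square field_simps)
       (simp_all add: complex_norm_square[symmetric] power2_eq_square)
  have r: "1 + r \<noteq> 0" "cnj r = r"
  proof -
    have "Re (1 + r) > 0" by (simp add: r_def add_pos_nonneg)
    then show "1 + r \<noteq> 0" by (metis less_irrefl zero_complex.simps(1))
  qed (simp add: r_def)
  have hh: "(\<Sum>l<n. cnj (h l) * h l) = 1 - r * r"
  proof -
    have "(\<Sum>l<n. cnj (h l) * h l) = (\<Sum>l<n. complex_of_real ((cmod (g $ Suc l))\<^sup>2))"
    proof (intro sum.cong refl)
      fix l
      have "cnj (h l) * h l = (w * cnj w) * (g $ Suc l * cnj (g $ Suc l))"
        by (simp add: h_def mult_ac)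
      then show "cnj (h l) * h l = complex_of_real ((cmod (g $ Suc l))\<^sup>2)"
        by (simp only: w complex_norm_square mult_1)
    qed
    also have "\<dots> = of_real (vnorm2 g) - r * r"
      using g(1) unfolding vnorm2_def
      by (simp add: sum.lessThan_Suc_shift r_def power2_eq_square del: sum.lessThan_Suc)
    finally show ?thesis using g by simp
  qed
  define T where "T = Matrix.mat (Suc n) (Suc n) (\<lambda>(i, j).
    w * (case j of 0 \<Rightarrow> (case i of 0 \<Rightarrow> r | Suc i' \<Rightarrow> h i')
       | Suc j' \<Rightarrow> (case i of 0 \<Rightarrow> - cnj (h j')
           | Suc i' \<Rightarrow> (if i' = j' then 1 else 0) - h i' * cnj (h j') / (1 + r))))"
  have "T \<in> unitary_group (Suc n)"
  proof (rule unitary_groupI)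
    fix i j assume ij: "i < Suc n" "j < Suc n"
    define t where "t i j = (case j of 0 \<Rightarrow> (case i of 0 \<Rightarrow> r | Suc i' \<Rightarrow> h i')
       | Suc j' \<Rightarrow> (case i of 0 \<Rightarrow> - cnj (h j')
           | Suc i' \<Rightarrow> (if i' = j' then 1 else 0) - h i' * cnj (h j') / (1 + r)))" for i j :: nat
    have t: "(\<Sum>l<Suc n. cnj (T $$ (l, i)) * T $$ (l, j)) = (\<Sum>l<Suc n. cnj (t l i) * t l j)"
      using ij by (intro sum.cong refl) (simp add: T_def t_def mult_ac w(1,2))
    \<comment> \<open>All the orthogonality relations below come from 1 - r^2 = (1 - r)(1 + r),
      which cancels the denominator.\<close>
    have eq1: "(\<Sum>l<n. cnj (h l) * ((if l = j' then 1 else 0) - h l * cnj (h j') / (1 + r))) = r * cnj (h j')"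
      if "j' < n" for j'
    proof -
      have "(\<Sum>l<n. cnj (h l) * ((if l = j' then 1 else 0) - h l * cnj (h j') / (1 + r))) =
        (\<Sum>l<n. if l = j' then cnj (h l) else 0) - (\<Sum>l<n. cnj (h l) * h l) * (cnj (h j') / (1 + r))"
        unfolding sum_distrib_right sum_subtractf[symmetric] by (intro sum.cong) (auto simp: algebra_simps)
      also have "\<dots> = cnj (h j') - (1 - r * r) * (cnj (h j') / (1 + r))"
        using that by (simp add: hh)
      also have "\<dots> = r * cnj (h j')" using r by (simp add: field_simps)
      finally show ?thesis .
    qed
    have eq2: "(\<Sum>l<n. ((if l = i' then 1 else 0) - cnj (h l) * h i' / (1 + r)) *
        ((if l = j' then 1 else 0) - h l * cnj (h j') / (1 + r))) =
        (if i' = j' then 1 else 0) - h i' * cnj (h j')" if "i' < n" "j' < n" for i' j'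
    proof -
      have "(\<Sum>l<n. ((if l = i' then 1 else 0) - cnj (h l) * h i' / (1 + r)) *
        ((if l = j' then 1 else 0) - h l * cnj (h j') / (1 + r))) =
        (\<Sum>l<n. if l = i' then ((if l = j' then 1 else 0) - h l * cnj (h j') / (1 + r)) else 0) -
        (\<Sum>l<n. cnj (h l) * ((if l = j' then 1 else 0) - h l * cnj (h j') / (1 + r))) * (h i' / (1 + r))"
        unfolding sum_distrib_right sum_subtractf[symmetric] by (intro sum.cong) (auto simp: algebra_simps)
      also have "\<dots> = (if i' = j' then 1 else 0) - h i' * cnj (h j') / (1 + r) - r * cnj (h j') * (h i' / (1 + r))"
        using that by (simp add: eq1)
      also have "\<dots> = (if i' = j' then 1 else 0) - h i' * cnj (h j')"
        using r by (simp add: divide_simps) (simp add: algebra_simps)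
      finally show ?thesis .
    qed
    have eq1': "(\<Sum>l<n. ((if l = i' then 1 else 0) - cnj (h l) * h i' / (1 + r)) * h l) = r * h i'"
      if "i' < n" for i'
    proof -
      have "(\<Sum>l<n. ((if l = i' then 1 else 0) - cnj (h l) * h i' / (1 + r)) * h l) =
          cnj (\<Sum>l<n. cnj (h l) * ((if l = i' then 1 else 0) - h l * cnj (h i') / (1 + r)))"
        unfolding cnj_sum by (intro sum.cong) (auto simp: r mult.commute)
      then show ?thesis using that by (simp add: eq1 r)
    qed
    show "(\<Sum>l<Suc n. cnj (T $$ (l, i)) * T $$ (l, j)) = (if i = j then 1 else 0)"
      unfolding t unfolding sum.lessThan_Suc_shift o_def
      using ij
      by (cases i; cases j)
         (simp_all add: t_def r hh eq1 eq1' eq2 if_distrib[of cnj] cong: if_cong)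
  qed (simp add: T_def)
  moreover have "T $$ (i, 0) = g $ i" if "i < Suc n" for i
    using that w by (cases i) (auto simp: T_def h_def mult.assoc[symmetric])
  ultimately show ?thesis using that by blast
qed

subsection \<open>Krylov vectors and moments of a matrix\<close>

definition orb :: "complex mat \<Rightarrow> nat \<Rightarrow> complex Matrix.vec" where
  "orb U k = (((*\<^sub>v) U) ^^ k) (unit_vec (dim_row U) 0)"

text \<open>The number \<langle>e_1, U^k e_1\<rangle>. By \<open>spectral_measure_props\<close>
  these are the moments of the spectral measure, so the probabilistic part can work with matrices
  alone.\<close>

definition umom :: "complex mat \<Rightarrow> nat \<Rightarrow> complex" where
  "umom U k = orb U k $ 0"

lemma orb_0 [simp]: "orb U 0 = unit_vec (dim_row U) 0"
  and orb_Suc: "orb U (Suc k) = U *\<^sub>v orb U k"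
  by (simp_all add: orb_def)

lemma orb_carrier: "U \<in> carrier_mat n n \<Longrightarrow> orb U k \<in> carrier_vec n"
  by (induction k) (auto simp: orb_Suc)

lemma carrier_vec_SucE:
  assumes "x \<in> carrier_vec (Suc n)"
  obtains a y where "x = vCons a y" "y \<in> carrier_vec n"
proof -
  have "x = vCons (x $ 0) (Matrix.vec n (\<lambda>i. x $ Suc i))"
  proof (rule eq_vecI)
    fix i assume "i < dim_vec (vCons (x $ 0) (Matrix.vec n (\<lambda>i. x $ Suc i)))"
    then show "x $ i = vCons (x $ 0) (Matrix.vec n (\<lambda>i. x $ Suc i)) $ i" by (cases i) auto
  qed (use assms in auto)
  then show ?thesis using that by auto
qed

lemma pow_mat_orb:
  assumes "U \<in> carrier_mat n n" "v \<in> carrier_vec n"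
  shows "(U ^\<^sub>m k) *\<^sub>v v = (((*\<^sub>v) U) ^^ k) v"
  using assms(2)
proof (induction k arbitrary: v)
  case (Suc k)
  have "(U ^\<^sub>m Suc k) *\<^sub>v v = (U ^\<^sub>m k) *\<^sub>v (U *\<^sub>v v)"
    using assms(1) Suc.prems by (simp add: assoc_mult_mat_vec[of _ n n _ n])
  then show ?case using Suc assms(1) by (simp add: funpow_swap1)
qed (use assms in auto)

lemma mult_mat_vec_index_sum:
  assumes "A \<in> carrier_mat n m" "x \<in> carrier_vec m" "i < n"
  shows "(A *\<^sub>v x) $ i = (\<Sum>j<m. A $$ (i, j) * x $ j)"
  using assms by (auto simp: scalar_prod_def atLeast0LessThan)

text \<open>If \<open>c\<close> are the moments of \<open>V\<close>, then \<open>schur_a \<alpha> c\<close> are those of \<open>U = givens n \<alpha> * ext_mat V\<close>, and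
  \<open>verblunsky_rho \<alpha> * schur_g \<alpha> c k\<close> is the first coordinate of \<open>V x\<close>, where \<open>x\<close> is the tail of \<open>U\<^sup>k e\<^sub>1\<close>.\<close>

function schur_a :: "complex \<Rightarrow> (nat \<Rightarrow> complex) \<Rightarrow> nat \<Rightarrow> complex"
  and schur_g :: "complex \<Rightarrow> (nat \<Rightarrow> complex) \<Rightarrow> nat \<Rightarrow> complex" where
  "schur_a \<alpha> c 0 = 1"
| "schur_a \<alpha> c (Suc k) = \<alpha> * schur_a \<alpha> c k + (1 - \<alpha> * cnj \<alpha>) * schur_g \<alpha> c k"
| "schur_g \<alpha> c k = (\<Sum>i<k. (schur_a \<alpha> c i - (1 + cnj \<alpha>) * schur_g \<alpha> c i) * c (k - i))"
  by pat_completeness auto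
text \<open>Weights 2k for \<open>schur_a\<close> and 2k + 1 for \<open>schur_g\<close>: the call of
  \<open>schur_g\<close> at k from \<open>schur_a\<close> at k + 1 goes from 2k + 2 to 2k + 1, and
  every other call lowers k.\<close>

termination
  by (relation "inv_image less_than (case_sum (\<lambda>(_, _, k). 2 * k) (\<lambda>(_, _, k). 2 * k + 1))") auto

declare schur_a.simps [simp del] schur_g.simps [simp del]

text \<open>Write U^k e_1 = (a_k, y_k). By \<open>givens_mult_vCons\<close> the tail obeys y_(k+1) =
  V y_k + \<rho> d_k e_1 with d_k = a_k - (1 + cnj \<alpha>) g_k, so y_k is a convolution of the d_i
  with the orbit of V. Taking first coordinates of V y_k leaves only moments of V, and this closes
  the recursion.\<close>

lemma orb_givens_ext:
  assumes V: "V \<in> carrier_mat (Suc n) (Suc n)" and \<alpha>: "cmod \<alpha> \<le> 1"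
  defines "U \<equiv> givens (Suc (Suc n)) \<alpha> * ext_mat V"
  shows "orb U k = vCons (schur_a \<alpha> (umom V) k)
    (Matrix.vec (Suc n) (\<lambda>l. \<Sum>i<k. verblunsky_rho \<alpha> *
      (schur_a \<alpha> (umom V) i - (1 + cnj \<alpha>) * schur_g \<alpha> (umom V) i) * orb V (k - Suc i) $ l))"
proof (induction k)
  case 0
  have "unit_vec (dim_row U) 0 = vCons 1 (Matrix.vec (Suc n) (\<lambda>l. 0))"
    by (rule eq_vecI) (auto simp: U_def vec_index_vCons)
  then show ?case by (simp add: schur_a.simps)
next
  case (Suc k)
  let ?a = "schur_a \<alpha> (umom V)" and ?g = "schur_g \<alpha> (umom V)" and ?\<rho> = "verblunsky_rho \<alpha>"
  define d where "d i = ?a i - (1 + cnj \<alpha>) * ?g i" for i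
  define y where "y = Matrix.vec (Suc n) (\<lambda>l. \<Sum>i<k. ?\<rho> * d i * orb V (k - Suc i) $ l)"
  have y: "y \<in> carrier_vec (Suc n)" by (simp add: y_def)
  have c: "ext_mat V \<in> carrier_mat (Suc (Suc n)) (Suc (Suc n))" using ext_mat_carrier[OF V] .
  have Vy: "(V *\<^sub>v y) $ l = (\<Sum>i<k. ?\<rho> * d i * orb V (k - i) $ l)" if "l < Suc n" for l
  proof -
    have "(V *\<^sub>v y) $ l = (\<Sum>j<Suc n. V $$ (l, j) * y $ j)"
      using V y that by (rule mult_mat_vec_index_sum)
    also have "\<dots> = (\<Sum>j<Suc n. \<Sum>i<k. ?\<rho> * d i * (V $$ (l, j) * orb V (k - Suc i) $ j))"
      by (intro sum.cong refl) (simp add: y_def sum_distrib_left mult_ac)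
    also have "\<dots> = (\<Sum>i<k. \<Sum>j<Suc n. ?\<rho> * d i * (V $$ (l, j) * orb V (k - Suc i) $ j))"
      by (rule sum.swap)
    also have "\<dots> = (\<Sum>i<k. ?\<rho> * d i * orb V (k - i) $ l)"
    proof (intro sum.cong refl)
      fix i assume "i \<in> {..<k}"
      then have "k - i = Suc (k - Suc i)" by auto
      then have "orb V (k - i) $ l = (\<Sum>j<Suc n. V $$ (l, j) * orb V (k - Suc i) $ j)"
        using mult_mat_vec_index_sum[OF V orb_carrier[OF V] that] by (simp add: orb_Suc)
      then show "(\<Sum>j<Suc n. ?\<rho> * d i * (V $$ (l, j) * orb V (k - Suc i) $ j)) = ?\<rho> * d i * orb V (k - i) $ l"
        by (simp only: sum_distrib_left)
    qed
    finally show ?thesis .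
  qed
  have Vy0: "(V *\<^sub>v y) $ 0 = ?\<rho> * ?g k"
    unfolding schur_g.simps[of \<alpha> "umom V" k]
    by (simp add: Vy umom_def d_def sum_distrib_left mult.assoc)
  have "orb U (Suc k) = U *\<^sub>v vCons (?a k) y"
    using Suc unfolding orb_Suc y_def d_def by simp
  also have "\<dots> = givens (Suc (Suc n)) \<alpha> *\<^sub>v vCons (?a k) (V *\<^sub>v y)"
    unfolding U_def using V y c by (simp add: assoc_mult_mat_vec[of _ "Suc (Suc n)" "Suc (Suc n)" _ "Suc (Suc n)"] ext_mat_mult_vCons)
  also have "\<dots> = vCons (\<alpha> * ?a k + ?\<rho> * (?\<rho> * ?g k)) 
      ((V *\<^sub>v y) + (?\<rho> * ?a k - (1 + cnj \<alpha>) * (?\<rho> * ?g k)) \<cdot>\<^sub>v unit_vec (Suc n) 0)"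
    using V y by (subst givens_mult_vCons) (auto simp: Vy0)
  also have "\<alpha> * ?a k + ?\<rho> * (?\<rho> * ?g k) = ?a (Suc k)"
    using verblunsky_rho_sq(1)[OF \<alpha>] by (simp add: schur_a.simps mult.assoc[symmetric])
  also have "(V *\<^sub>v y) + (?\<rho> * ?a k - (1 + cnj \<alpha>) * (?\<rho> * ?g k)) \<cdot>\<^sub>v unit_vec (Suc n) 0 =
      Matrix.vec (Suc n) (\<lambda>l. \<Sum>i<Suc k. ?\<rho> * d i * orb V (Suc k - Suc i) $ l)"
    using V y by (intro eq_vecI) (auto simp: Vy d_def algebra_simps simp del: index_mult_mat_vec)
  finally show ?case by (simp add: d_def)
qed

lemma umom_givens_ext:
  assumes "V \<in> carrier_mat (Suc n) (Suc n)" "cmod \<alpha> \<le> 1"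
  shows "umom (givens (Suc (Suc n)) \<alpha> * ext_mat V) = schur_a \<alpha> (umom V)"
  using orb_givens_ext[OF assms] by (auto simp: umom_def)

text \<open>The recursion is triangular: stage k of \<open>schur_a\<close> reads moments below k and
  stage k of \<open>schur_g\<close> reads moments up to k. Hence higher moments may be altered
  freely, as is done in \<open>schur_continuity\<close>.\<close>

lemma schur_cong:
  assumes "\<And>i. i < k \<Longrightarrow> c i = c' i"
  shows "schur_a \<alpha> c k = schur_a \<alpha> c' k"
proof -
  have "((\<forall>i<k. c i = c' i) \<longrightarrow> schur_a \<alpha> c k = schur_a \<alpha> c' k) \<and>
    ((\<forall>i\<le>k. c i = c' i) \<longrightarrow> schur_g \<alpha> c k = schur_g \<alpha> c' k)" for k
  proof (induction k rule: less_induct)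
    case (less k)
    have "schur_a \<alpha> c k = schur_a \<alpha> c' k" if "\<forall>i<k. c i = c' i"
      using less[of "k - 1"] that by (cases k) (auto simp: schur_a.simps)
    moreover have "schur_g \<alpha> c k = schur_g \<alpha> c' k" if "\<forall>i\<le>k. c i = c' i"
      unfolding schur_g.simps[of _ _ k] using less that by (intro sum.cong) auto
    ultimately show ?case by blast
  qed
  then show ?thesis using assms by blast
qed

lemma tendsto_schur:
  assumes \<alpha>: "(f \<longlongrightarrow> \<alpha>) F" and c: "\<And>k. ((\<lambda>x. g x k) \<longlongrightarrow> c k) F"
  shows "((\<lambda>x. schur_a (f x) (g x) k) \<longlongrightarrow> schur_a \<alpha> c k) F"
proof -
  have "((\<lambda>x. schur_a (f x) (g x) k) \<longlongrightarrow> schur_a \<alpha> c k) F \<and>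
        ((\<lambda>x. schur_g (f x) (g x) k) \<longlongrightarrow> schur_g \<alpha> c k) F"
  proof (induction k rule: less_induct)
    case (less k)
    have "((\<lambda>x. schur_a (f x) (g x) k) \<longlongrightarrow> schur_a \<alpha> c k) F"
      using less[of "k - 1"] \<alpha> by (cases k) (auto simp: schur_a.simps intro!: tendsto_intros)
    moreover have "((\<lambda>x. schur_g (f x) (g x) k) \<longlongrightarrow> schur_g \<alpha> c k) F"
      unfolding schur_g.simps[of _ _ k] using less \<alpha> c by (auto intro!: tendsto_intros)
    ultimately show ?case by blast
  qed
  then show ?thesis by blast
qed

subsection \<open>Decomposition of unitary matrices\<close>

lemma unitary_col_norm:
  assumes "U \<in> unitary_group n" "j < n"
  shows "(\<Sum>l<n. (cmod (U $$ (l, j)))\<^sup>2) = 1"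
proof -
  have "complex_of_real (\<Sum>l<n. (cmod (U $$ (l, j)))\<^sup>2) = (\<Sum>l<n. cnj (U $$ (l, j)) * U $$ (l, j))"
    by (simp add: complex_norm_square mult.commute del: of_real_power)
  then show ?thesis using unitary_group_colD[OF assms(1,2,2)] by (simp del: of_real_sum)
qed

lemma unitary_entry_le_1:
  assumes "U \<in> unitary_group n" "i < n" "j < n"
  shows "cmod (U $$ (i, j)) \<le> 1"
proof -
  have "(cmod (U $$ (i, j)))\<^sup>2 \<le> (\<Sum>l<n. (cmod (U $$ (l, j)))\<^sup>2)"
    using assms by (intro member_le_sum) auto
  then show ?thesis using unitary_col_norm[OF assms(1,3)] by (simp add: power_le_one_iff abs_square_le_1)
qed

text \<open>The first column of U is (\<alpha>, \<rho> g) with g a unit vector. If T has first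
  column g, then (1 \<oplus> T) times the Givens matrix has the same first column as U, so the
  quotient of the two fixes e_1 and is some 1 \<oplus> W. When |\<alpha>| = 1 the tail of the column
  is zero and T = 1 is taken.\<close>

lemma unitary_decomposition:
  assumes U: "U \<in> unitary_group (Suc (Suc n))"
  obtains T W where "T \<in> unitary_group (Suc n)" "W \<in> unitary_group (Suc n)"
    "U = ext_mat T * (givens (Suc (Suc n)) (U $$ (0, 0)) * ext_mat W)"
proof -
  define \<alpha> where "\<alpha> = U $$ (0, 0)"
  define u where "u = Matrix.vec (Suc n) (\<lambda>i. U $$ (Suc i, 0))"
  have \<alpha>1: "cmod \<alpha> \<le> 1" unfolding \<alpha>_def by (rule unitary_entry_le_1[OF U]) auto
  have cU: "U \<in> carrier_mat (Suc (Suc n)) (Suc (Suc n))" using U by (rule unitary_group_carrier)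
  have nu: "vnorm2 u = 1 - (cmod \<alpha>)\<^sup>2"
    using unitary_col_norm[OF U, of 0] unfolding sum.lessThan_Suc_shift[of _ "Suc n"]
    by (simp add: vnorm2_def u_def \<alpha>_def)
  have "\<exists>T. T \<in> unitary_group (Suc n) \<and> (\<forall>i<Suc n. u $ i = verblunsky_rho \<alpha> * T $$ (i, 0))"
  proof (cases "cmod \<alpha> = 1")
    case True
    then have "vnorm2 u = 0" using nu by simp
    then have "\<forall>i<Suc n. u $ i = 0"
      unfolding vnorm2_def by (subst (asm) sum_nonneg_eq_0_iff) (auto simp: u_def)
    then show ?thesis using True unitary_group_one[of "Suc n"]
      by (intro exI[of _ "1\<^sub>m (Suc n)"]) (auto simp: verblunsky_rho_def)
  next
    case False
    then have pos: "1 - (cmod \<alpha>)\<^sup>2 > 0" using \<alpha>1 by (simp add: abs_square_less_1)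
    then have \<rho>: "verblunsky_rho \<alpha> \<noteq> 0" by (auto simp: verblunsky_rho_def)
    define g where "g = (1 / verblunsky_rho \<alpha>) \<cdot>\<^sub>v u"
    have "vnorm2 g = vnorm2 u / (cmod (verblunsky_rho \<alpha>))\<^sup>2"
      by (simp add: vnorm2_def g_def u_def norm_mult norm_divide power_divide sum_divide_distrib del: sum.lessThan_Suc)
    also have "\<dots> = 1" using pos by (simp add: nu verblunsky_rho_sq(2)[OF \<alpha>1])
    finally have "vnorm2 g = 1" .
    moreover have "g \<in> carrier_vec (Suc n)" by (simp add: g_def u_def)
    ultimately obtain T where "T \<in> unitary_group (Suc n)" "\<And>i. i < Suc n \<Longrightarrow> T $$ (i, 0) = g $ i"
      by (metis unitary_completion)
    then show ?thesis using \<rho> by (intro exI[of _ T]) (auto simp: g_def u_def)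
  qed
  then obtain T where T: "T \<in> unitary_group (Suc n)" "\<And>i. i < Suc n \<Longrightarrow> u $ i = verblunsky_rho \<alpha> * T $$ (i, 0)"
    by blast
  define G where "G = givens (Suc (Suc n)) \<alpha>"
  define R where "R = ext_mat T * G"
  have G: "G \<in> unitary_group (Suc (Suc n))" unfolding G_def by (rule givens_unitary[OF \<alpha>1])
  have R: "R \<in> unitary_group (Suc (Suc n))"
    unfolding R_def by (intro unitary_group_mult ext_mat_unitary T G)
  have cT: "T \<in> carrier_mat (Suc n) (Suc n)" using T by (simp add: unitary_group_def)
  have cR: "R \<in> carrier_mat (Suc (Suc n)) (Suc (Suc n))" using R by (rule unitary_group_carrier)
  have Rcol: "R $$ (i, 0) = U $$ (i, 0)" if i: "i < Suc (Suc n)" for i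
  proof -
    have "R $$ (i, 0) = (\<Sum>l<Suc (Suc n). ext_mat T $$ (i, l) * G $$ (l, 0))"
      unfolding R_def G_def using i ext_mat_carrier[OF cT]
      by (auto simp: scalar_prod_def atLeast0LessThan simp del: sum.lessThan_Suc)
    also have "\<dots> = ext_mat T $$ (i, 0) * \<alpha> + (ext_mat T $$ (i, 1) * verblunsky_rho \<alpha> + (\<Sum>l<n. 0))"
      unfolding sum.lessThan_Suc_shift o_def by (simp add: G_def givens_def)
    also have "\<dots> = U $$ (i, 0)"
    proof (cases i)
      case 0
      then show ?thesis using cT by (simp add: ext_mat_index \<alpha>_def)
    next
      case (Suc j)
      then have "U $$ (i, 0) = u $ j" using i by (simp add: u_def)
      then show ?thesis using Suc i cT T(2)[of j] by (simp add: ext_mat_index)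
    qed
    finally show ?thesis .
  qed
  define Z where "Z = mat_adjoint R * U"
  have Z: "Z \<in> unitary_group (Suc (Suc n))"
    unfolding Z_def by (intro unitary_group_mult unitary_group_adjoint R U)
  have "Z $$ (i, 0) = (if i = 0 then 1 else 0)" if i: "i < Suc (Suc n)" for i
  proof -
    have "Z $$ (i, 0) = (\<Sum>l<Suc (Suc n). cnj (R $$ (l, i)) * U $$ (l, 0))"
      unfolding Z_def using i cR cU
      by (auto simp: scalar_prod_def atLeast0LessThan mat_adjoint_index[OF cR] simp del: sum.lessThan_Suc)
    also have "\<dots> = (\<Sum>l<Suc (Suc n). cnj (R $$ (l, i)) * R $$ (l, 0))"
      by (intro sum.cong refl) (simp add: Rcol)
    also have "\<dots> = (if i = 0 then 1 else 0)" using unitary_group_colD[OF R i, of 0] by simp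
    finally show ?thesis .
  qed
  from unitary_fix_unit_vec[OF Z this] obtain W where W: "W \<in> unitary_group (Suc n)" "Z = ext_mat W"
    by blast
  have cs: "mat_adjoint R \<in> carrier_mat (Suc (Suc n)) (Suc (Suc n))"
    "ext_mat T \<in> carrier_mat (Suc (Suc n)) (Suc (Suc n))" "ext_mat W \<in> carrier_mat (Suc (Suc n)) (Suc (Suc n))"
    "G \<in> carrier_mat (Suc (Suc n)) (Suc (Suc n))"
    using cR ext_mat_carrier[OF cT] ext_mat_carrier[OF unitary_group_carrier[OF W(1)]] by (auto simp: G_def)
  have "R * Z = U"
    unfolding Z_def using cR cs cU unitary_group_right[OF R]
    by (simp add: assoc_mult_mat[symmetric, of R _ _ _ "Suc (Suc n)" U "Suc (Suc n)"])
  then have "U = ext_mat T * (G * ext_mat W)"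
    unfolding R_def W(2) using cs by (simp add: assoc_mult_mat[of _ "Suc (Suc n)" "Suc (Suc n)" _ "Suc (Suc n)" _ "Suc (Suc n)"])
  then show ?thesis using that T W unfolding G_def \<alpha>_def by blast
qed

text \<open>Because 1 \<oplus> T fixes e_1, conjugation by it just applies 1 \<oplus> T to the
  orbit. First coordinates stay the same, and hence so do the moments.\<close>

lemma orb_conj_ext:
  assumes T: "T \<in> unitary_group n" and A: "A \<in> carrier_mat (Suc n) (Suc n)"
  shows "orb (ext_mat T * (A * ext_mat (mat_adjoint T))) k = ext_mat T *\<^sub>v orb A k"
proof -
  let ?E = "ext_mat T" and ?F = "ext_mat (mat_adjoint T)"
  have c: "T \<in> carrier_mat n n" using T by (rule unitary_group_carrier)
  have cs: "?E \<in> carrier_mat (Suc n) (Suc n)" "?F \<in> carrier_mat (Suc n) (Suc n)"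
    using ext_mat_carrier[OF c] ext_mat_carrier[OF mat_adjoint_carrier[OF c]] by auto
  have FE: "?F * ?E = 1\<^sub>m (Suc n)"
    using c T by (simp add: ext_mat_mult[symmetric, of _ n n _ n] unitary_group_left ext_mat_one)
  have u: "unit_vec (Suc n) 0 = vCons 1 (0\<^sub>v n)"
    by (rule eq_vecI) (auto simp: vec_index_vCons)
  show ?thesis
  proof (induction k)
    case 0
    have "?E *\<^sub>v unit_vec (Suc n) 0 = unit_vec (Suc n) 0"
      unfolding u using c by (subst ext_mat_mult_vCons[of _ n n]) auto
    then show ?case using cs A by auto
  next
    case (Suc k)
    have o: "orb A k \<in> carrier_vec (Suc n)" using A by (rule orb_carrier)
    have "(?E * (A * ?F)) *\<^sub>v (?E *\<^sub>v orb A k) = ?E *\<^sub>v (A *\<^sub>v ((?F * ?E) *\<^sub>v orb A k))"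
      using cs A o by (simp add: assoc_mult_mat_vec[of _ "Suc n" "Suc n" _ "Suc n"])
    then show ?case using Suc o A by (simp add: orb_Suc FE)
  qed
qed

lemma umom_conj_ext:
  assumes T: "T \<in> unitary_group n" and A: "A \<in> carrier_mat (Suc n) (Suc n)"
  shows "umom (ext_mat T * (A * ext_mat (mat_adjoint T))) = umom A"
proof
  fix k
  have c: "T \<in> carrier_mat n n" using T by (rule unitary_group_carrier)
  obtain a y where y: "orb A k = vCons a y" "y \<in> carrier_vec n"
    using orb_carrier[OF A, of k] by (rule carrier_vec_SucE)
  show "umom (ext_mat T * (A * ext_mat (mat_adjoint T))) k = umom A k"
    unfolding umom_def orb_conj_ext[OF assms] y(1) using y c by (simp add: ext_mat_mult_vCons[of _ n n])
qed

text \<open>Decompose U and conjugate the factor 1 \<oplus> T from the left to the right: U (1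
  \<oplus> V) has the moments of the Givens matrix times 1 \<oplus> W V T. The quantifiers matter: T
  and W depend on U but not on V, so they are constants when V is integrated.\<close>

lemma umom_mult_ext:
  assumes U: "U \<in> unitary_group (Suc (Suc n))"
  shows "\<exists>T\<in>unitary_group (Suc n). \<exists>W\<in>unitary_group (Suc n). \<forall>V\<in>unitary_group (Suc n).
    umom (U * ext_mat V) = schur_a (U $$ (0, 0)) (umom (W * V * T))"
proof -
  let ?n = "Suc (Suc n)"
  obtain T W where T: "T \<in> unitary_group (Suc n)" and W: "W \<in> unitary_group (Suc n)"
    and U_eq: "U = ext_mat T * (givens ?n (U $$ (0, 0)) * ext_mat W)"
    using unitary_decomposition[OF U] by metis
  have "umom (U * ext_mat V) = schur_a (U $$ (0, 0)) (umom (W * V * T))" if V: "V \<in> unitary_group (Suc n)" for V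
  proof -
    let ?G = "givens ?n (U $$ (0, 0))"
    have c: "T \<in> carrier_mat (Suc n) (Suc n)" "W \<in> carrier_mat (Suc n) (Suc n)" "V \<in> carrier_mat (Suc n) (Suc n)"
      "mat_adjoint T \<in> carrier_mat (Suc n) (Suc n)"
      using T W V by (auto simp: unitary_group_def)
    have cs: "ext_mat T \<in> carrier_mat ?n ?n" "ext_mat W \<in> carrier_mat ?n ?n" "ext_mat V \<in> carrier_mat ?n ?n"
      "ext_mat (mat_adjoint T) \<in> carrier_mat ?n ?n" "?G \<in> carrier_mat ?n ?n"
      using c by (auto intro: ext_mat_carrier)
    have "W * V * T * mat_adjoint T = W * V"
      using c unitary_group_right[OF T]
      by (subst assoc_mult_mat[of "W * V" "Suc n" "Suc n" T "Suc n" "mat_adjoint T" "Suc n"]) auto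
    then have "ext_mat (W * V * T) * ext_mat (mat_adjoint T) = ext_mat W * ext_mat V"
      using c by (subst ext_mat_mult[symmetric, of _ "Suc n" "Suc n" _ "Suc n"]) (auto simp: ext_mat_mult[of _ "Suc n" "Suc n" _ "Suc n"])
    moreover have "ext_mat (W * V * T) \<in> carrier_mat ?n ?n" using c by (auto intro: ext_mat_carrier)
    moreover have "(?G * ext_mat (W * V * T)) * ext_mat (mat_adjoint T) = ?G * (ext_mat (W * V * T) * ext_mat (mat_adjoint T))"
      by (rule assoc_mult_mat[of _ ?n ?n _ ?n _ ?n]) (use cs calculation in auto)
    moreover have "(?G * ext_mat W) * ext_mat V = ?G * (ext_mat W * ext_mat V)"
      by (rule assoc_mult_mat[of _ ?n ?n _ ?n _ ?n]) (use cs in auto)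
    moreover have "(ext_mat T * (?G * ext_mat W)) * ext_mat V = ext_mat T * ((?G * ext_mat W) * ext_mat V)"
      by (rule assoc_mult_mat[of _ ?n ?n _ ?n _ ?n]) (use cs in auto)
    ultimately have "U * ext_mat V = ext_mat T * ((?G * ext_mat (W * V * T)) * ext_mat (mat_adjoint T))"
      using U_eq by simp
    then have "umom (U * ext_mat V) = umom (?G * ext_mat (W * V * T))"
      using umom_conj_ext[OF T, of "?G * ext_mat (W * V * T)"] cs \<open>ext_mat (W * V * T) \<in> carrier_mat ?n ?n\<close> by simp
    also have "\<dots> = schur_a (U $$ (0, 0)) (umom (W * V * T))"
      using c unitary_entry_le_1[OF U, of 0 0] by (intro umom_givens_ext) auto
    finally show ?thesis .
  qed
  then show ?thesis using T W by blast
qed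

section \<open>Krylov spaces and the minimum of \<integral>|P|^2\<close>

fun kry :: "complex mat \<Rightarrow> nat \<Rightarrow> complex Matrix.vec set" where
  "kry U 0 = {0\<^sub>v (dim_row U)}"
| "kry U (Suc k) = {a \<cdot>\<^sub>v unit_vec (dim_row U) 0 + U *\<^sub>v y | a y. y \<in> kry U k}"

text \<open>The vector P(U) e_1 for the polynomial P with coefficients \<open>c 0\<close>, ...,
  \<open>c (k - 1)\<close>; its squared norm is the integral of |P|^2 against the spectral
  measure.\<close>

definition comb :: "complex mat \<Rightarrow> nat \<Rightarrow> (nat \<Rightarrow> complex) \<Rightarrow> complex Matrix.vec" where
  "comb U k c = Matrix.vec (dim_row U) (\<lambda>l. \<Sum>i<k. c i * orb U i $ l)"

lemma comb_carrier [simp]: "U \<in> carrier_mat n n \<Longrightarrow> comb U k c \<in> carrier_vec n"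
  by (auto simp: comb_def)

lemma comb_Suc:
  assumes U: "U \<in> carrier_mat n n"
  shows "comb U (Suc k) c = c 0 \<cdot>\<^sub>v unit_vec n 0 + U *\<^sub>v comb U k (\<lambda>i. c (Suc i))"
proof (rule eq_vecI)
  fix l assume "l < dim_vec (c 0 \<cdot>\<^sub>v unit_vec n 0 + U *\<^sub>v comb U k (\<lambda>i. c (Suc i)))"
  then have l: "l < n" using U by auto
  have "(U *\<^sub>v comb U k (\<lambda>i. c (Suc i))) $ l = (\<Sum>j<n. \<Sum>i<k. c (Suc i) * (U $$ (l, j) * orb U i $ j))"
    using l U by (subst mult_mat_vec_index_sum[OF U]) 
      (auto simp: comb_def sum_distrib_left mult_ac intro!: sum.cong)
  also have "\<dots> = (\<Sum>i<k. \<Sum>j<n. c (Suc i) * (U $$ (l, j) * orb U i $ j))" by (rule sum.swap)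
  also have "\<dots> = (\<Sum>i<k. c (Suc i) * orb U (Suc i) $ l)"
    by (intro sum.cong refl)
       (simp add: orb_Suc mult_mat_vec_index_sum[OF U orb_carrier[OF U] l] sum_distrib_left del: index_mult_mat_vec)
  finally have "(U *\<^sub>v comb U k (\<lambda>i. c (Suc i))) $ l = (\<Sum>i<k. c (Suc i) * orb U (Suc i) $ l)" .
  then show "comb U (Suc k) c $ l = (c 0 \<cdot>\<^sub>v unit_vec n 0 + U *\<^sub>v comb U k (\<lambda>i. c (Suc i))) $ l"
    using l U unfolding comb_def sum.lessThan_Suc_shift by (simp del: index_mult_mat_vec)
qed (use U in \<open>auto simp: comb_def\<close>)

text \<open>\<open>kry\<close> builds the vectors P(U) e_1 with deg P < k by Horner's scheme, one
  multiplication by U at a time, which suits induction along Schur steps; \<open>comb\<close> shows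
  the coefficients. This lemma and \<open>kry_is_comb\<close> translate between the two.\<close>

lemma comb_in_kry:
  assumes U: "U \<in> carrier_mat n n"
  shows "comb U k c \<in> kry U k"
proof (induction k arbitrary: c)
  case 0
  have "comb U 0 c = 0\<^sub>v (dim_row U)" by (rule eq_vecI) (auto simp: comb_def)
  then show ?case by simp
next
  case (Suc k)
  then show ?case using U by (auto simp: comb_Suc[OF U])
qed

lemma kry_is_comb:
  assumes U: "U \<in> carrier_mat n n" and y: "y \<in> kry U k"
  obtains c where "y = comb U k c"
proof -
  have "\<exists>c. y = comb U k c"
    using y
  proof (induction k arbitrary: y)
    case 0
    then show ?case by (intro exI[of _ undefined] eq_vecI) (auto simp: comb_def)
  next
    case (Suc k)
    then obtain a y' where y': "y' \<in> kry U k" "y = a \<cdot>\<^sub>v unit_vec n 0 + U *\<^sub>v y'" using U by auto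
    then obtain c where "y' = comb U k c" using Suc.IH by blast
    then have "y = comb U (Suc k) (case_nat a c)" using y' by (simp add: comb_Suc[OF U])
    then show ?case by blast
  qed
  then show ?thesis using that by blast
qed

lemma kry_carrier: "U \<in> carrier_mat n n \<Longrightarrow> y \<in> kry U k \<Longrightarrow> y \<in> carrier_vec n"
  using kry_is_comb comb_carrier by metis

lemma kry_smult:
  assumes U: "U \<in> carrier_mat n n" and y: "y \<in> kry U k"
  shows "b \<cdot>\<^sub>v y \<in> kry U k"
proof -
  obtain c where c: "y = comb U k c" using kry_is_comb[OF assms] .
  have "b \<cdot>\<^sub>v y = comb U k (\<lambda>i. b * c i)"
    unfolding c by (rule eq_vecI) (auto simp: comb_def sum_distrib_left mult.assoc)
  then show ?thesis using comb_in_kry[OF U] by simp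
qed

lemma mult_zero_vec:
  fixes A :: "complex mat"
  shows "A \<in> carrier_mat n m \<Longrightarrow> A *\<^sub>v 0\<^sub>v m = 0\<^sub>v n"
  by (intro eq_vecI) auto

text \<open>One Schur step lowers the degree together with the size: multiplication by U applies V
  to the tail and adds a multiple of e_1, which is exactly one Horner step for V.\<close>

lemma kry_givens_ext:
  assumes V: "V \<in> carrier_mat (Suc n) (Suc n)"
    and y: "y \<in> kry (givens (Suc (Suc n)) \<alpha> * ext_mat V) (Suc k)"
  obtains a s where "s \<in> kry V k" "y = vCons a s"
proof -
  let ?U = "givens (Suc (Suc n)) \<alpha> * ext_mat V" and ?\<rho> = "verblunsky_rho \<alpha>"
  have u: "unit_vec (Suc (Suc n)) 0 = vCons 1 (0\<^sub>v (Suc n))"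
    by (rule eq_vecI) (auto simp: vec_index_vCons)
  have cE: "ext_mat V \<in> carrier_mat (Suc (Suc n)) (Suc (Suc n))" using V by (rule ext_mat_carrier)
  have "\<exists>a s. s \<in> kry V k \<and> y = vCons a s"
    using y
  proof (induction k arbitrary: y)
    case 0
    then obtain a where "y = a \<cdot>\<^sub>v unit_vec (Suc (Suc n)) 0 + ?U *\<^sub>v 0\<^sub>v (Suc (Suc n))" by auto
    moreover have "?U *\<^sub>v 0\<^sub>v (Suc (Suc n)) = 0\<^sub>v (Suc (Suc n))"
      using cE by (intro mult_zero_vec mult_carrier_mat) auto
    ultimately have "y = vCons a (0\<^sub>v (dim_row V))"
      using V by (intro eq_vecI) (auto simp: vec_index_vCons)
    then show ?case by auto
  next
    case (Suc k)
    then obtain a y' where y': "y' \<in> kry ?U (Suc k)" "y = a \<cdot>\<^sub>v unit_vec (Suc (Suc n)) 0 + ?U *\<^sub>v y'"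
      by (subst (asm) kry.simps(2)) auto
    then obtain a' s where s: "s \<in> kry V k" "y' = vCons a' s" using Suc.IH by blast
    have cs: "s \<in> carrier_vec (Suc n)" using kry_carrier[OF V s(1)] .
    define b where "b = (V *\<^sub>v s) $ 0"
    have "?U *\<^sub>v y' = givens (Suc (Suc n)) \<alpha> *\<^sub>v vCons a' (V *\<^sub>v s)"
      unfolding s(2) using V cs cE by (simp add: assoc_mult_mat_vec[of _ "Suc (Suc n)" "Suc (Suc n)" _ "Suc (Suc n)"] ext_mat_mult_vCons)
    also have "\<dots> = vCons (\<alpha> * a' + ?\<rho> * b) (V *\<^sub>v s + (?\<rho> * a' - (1 + cnj \<alpha>) * b) \<cdot>\<^sub>v unit_vec (Suc n) 0)"
      unfolding b_def using V cs by (intro givens_mult_vCons) auto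
    finally have "y = vCons (a + (\<alpha> * a' + ?\<rho> * b)) ((?\<rho> * a' - (1 + cnj \<alpha>) * b) \<cdot>\<^sub>v unit_vec (Suc n) 0 + V *\<^sub>v s)"
      unfolding y'(2) u using V cs
      by (intro eq_vecI) (auto simp: vec_index_vCons simp del: index_mult_mat_vec)
    moreover have "(?\<rho> * a' - (1 + cnj \<alpha>) * b) \<cdot>\<^sub>v unit_vec (Suc n) 0 + V *\<^sub>v s \<in> kry V (Suc k)"
      using s V by auto
    ultimately show ?case by blast
  qed
  then show ?thesis using that by blast
qed

text \<open>Conversely every tail occurs, with any first coordinate, as long as \<rho> \<noteq> 0
  couples the first coordinate to the rest.\<close>

lemma vCons_in_kry_givens_ext:
  assumes V: "V \<in> carrier_mat (Suc n) (Suc n)" and s: "s \<in> kry V k" and \<rho>: "verblunsky_rho \<alpha> \<noteq> 0"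
  shows "vCons a s \<in> kry (givens (Suc (Suc n)) \<alpha> * ext_mat V) (Suc k)"
proof -
  let ?U = "givens (Suc (Suc n)) \<alpha> * ext_mat V" and ?\<rho> = "verblunsky_rho \<alpha>"
  have cE: "ext_mat V \<in> carrier_mat (Suc (Suc n)) (Suc (Suc n))" using V by (rule ext_mat_carrier)
  show ?thesis
    using s
  proof (induction k arbitrary: a s)
    case 0
    moreover have "?U *\<^sub>v 0\<^sub>v (Suc (Suc n)) = 0\<^sub>v (Suc (Suc n))"
      using cE by (intro mult_zero_vec mult_carrier_mat) auto
    ultimately have "vCons a s = a \<cdot>\<^sub>v unit_vec (Suc (Suc n)) 0 + ?U *\<^sub>v 0\<^sub>v (Suc (Suc n))"
      using V by (intro eq_vecI) (auto simp: vec_index_vCons)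
    then show ?case by auto
  next
    case (Suc k)
    then obtain c s' where s': "s' \<in> kry V k" "s = c \<cdot>\<^sub>v unit_vec (Suc n) 0 + V *\<^sub>v s'" using V by auto
    have cs: "s' \<in> carrier_vec (Suc n)" using kry_carrier[OF V s'(1)] .
    define b where "b = (V *\<^sub>v s') $ 0"
    \<comment> \<open>Solved from \<rho> a' - (1 + cnj \<alpha>) b = c, so that the multiple of e_1
      produced by the Givens matrix is the prescribed Horner coefficient c.\<close>
    define a' where "a' = (c + (1 + cnj \<alpha>) * b) / ?\<rho>"
    have "?U *\<^sub>v vCons a' s' = givens (Suc (Suc n)) \<alpha> *\<^sub>v vCons a' (V *\<^sub>v s')"
      using V cs cE by (simp add: assoc_mult_mat_vec[of _ "Suc (Suc n)" "Suc (Suc n)" _ "Suc (Suc n)"] ext_mat_mult_vCons)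
    also have "\<dots> = vCons (\<alpha> * a' + ?\<rho> * b) (V *\<^sub>v s' + (?\<rho> * a' - (1 + cnj \<alpha>) * b) \<cdot>\<^sub>v unit_vec (Suc n) 0)"
      unfolding b_def using V cs by (intro givens_mult_vCons) auto
    also have "?\<rho> * a' - (1 + cnj \<alpha>) * b = c" using \<rho> by (simp add: a'_def)
    finally have "vCons a s = (a - (\<alpha> * a' + ?\<rho> * b)) \<cdot>\<^sub>v unit_vec (Suc (Suc n)) 0 + ?U *\<^sub>v vCons a' s'"
      unfolding s'(2) using V cs
      by (intro eq_vecI) (auto simp: vec_index_vCons simp del: index_mult_mat_vec)
    moreover have "vCons a' s' \<in> kry ?U (Suc k)" using Suc.IH s' by blast
    ultimately show ?case by (subst kry.simps(2)) auto
  qed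
qed

lemma vnorm2_vCons: "vnorm2 (vCons a s) = (cmod a)\<^sup>2 + vnorm2 s"
  unfolding vnorm2_def dim_vec_vCons sum.lessThan_Suc_shift by simp

lemma vnorm2_smult: "vnorm2 (b \<cdot>\<^sub>v s) = (cmod b)\<^sup>2 * vnorm2 s"
  by (simp add: vnorm2_def norm_mult power_mult_distrib sum_distrib_left)

text \<open>The Givens matrix G maps (cnj \<alpha>, \<rho> e_1) to e_1, so the vector is G applied
  to (cnj \<alpha> + a, \<rho> e_1 + V s). G preserves norms and the two parts are orthogonal.
  Minimising over a and s separately gives a = -cnj \<alpha> and \<rho>^2 times the minimum for V:
  this is the product formula in one step.\<close>

lemma vnorm2_kry_step:
  assumes V: "V \<in> carrier_mat (Suc n) (Suc n)" and s: "s \<in> carrier_vec (Suc n)" and \<alpha>: "cmod \<alpha> \<le> 1"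
  shows "vnorm2 (unit_vec (Suc (Suc n)) 0 + (givens (Suc (Suc n)) \<alpha> * ext_mat V) *\<^sub>v vCons a s) =
    (cmod (cnj \<alpha> + a))\<^sup>2 + vnorm2 (verblunsky_rho \<alpha> \<cdot>\<^sub>v unit_vec (Suc n) 0 + V *\<^sub>v s)"
proof -
  let ?\<rho> = "verblunsky_rho \<alpha>"
  have cE: "ext_mat V \<in> carrier_mat (Suc (Suc n)) (Suc (Suc n))" using V by (rule ext_mat_carrier)
  define b where "b = (V *\<^sub>v s) $ 0"
  define x where "x = ?\<rho> \<cdot>\<^sub>v unit_vec (Suc n) 0 + V *\<^sub>v s"
  have x: "x \<in> carrier_vec (Suc n)" "x $ 0 = ?\<rho> + b" using V s by (auto simp: x_def b_def)
  have "(givens (Suc (Suc n)) \<alpha> * ext_mat V) *\<^sub>v vCons a s = givens (Suc (Suc n)) \<alpha> *\<^sub>v vCons a (V *\<^sub>v s)"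
    using V s cE by (simp add: assoc_mult_mat_vec[of _ "Suc (Suc n)" "Suc (Suc n)" _ "Suc (Suc n)"] ext_mat_mult_vCons)
  also have "\<dots> = vCons (\<alpha> * a + ?\<rho> * b) (V *\<^sub>v s + (?\<rho> * a - (1 + cnj \<alpha>) * b) \<cdot>\<^sub>v unit_vec (Suc n) 0)"
    unfolding b_def using V s by (intro givens_mult_vCons) auto
  also have "unit_vec (Suc (Suc n)) 0 + \<dots> =
      vCons (1 + \<alpha> * a + ?\<rho> * b) (V *\<^sub>v s + (?\<rho> * a - (1 + cnj \<alpha>) * b) \<cdot>\<^sub>v unit_vec (Suc n) 0)"
    using V s by (intro eq_vecI) (auto simp: vec_index_vCons simp del: index_mult_mat_vec)
  also have "\<dots> = givens (Suc (Suc n)) \<alpha> *\<^sub>v vCons (cnj \<alpha> + a) x"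
  proof -
    have 1: "\<alpha> * (cnj \<alpha> + a) + ?\<rho> * (?\<rho> + b) = 1 + \<alpha> * a + ?\<rho> * b"
      using verblunsky_rho_sq(1)[OF \<alpha>] by (simp add: algebra_simps)
    have 2: "x + (?\<rho> * (cnj \<alpha> + a) - (1 + cnj \<alpha>) * (?\<rho> + b)) \<cdot>\<^sub>v unit_vec (Suc n) 0 =
       V *\<^sub>v s + (?\<rho> * a - (1 + cnj \<alpha>) * b) \<cdot>\<^sub>v unit_vec (Suc n) 0"
      unfolding x_def using V s
      by (intro eq_vecI) (auto simp: algebra_simps simp del: index_mult_mat_vec)
    show ?thesis unfolding givens_mult_vCons[OF x(1)] x(2) 1 2 ..
  qed
  finally show ?thesis
    using x givens_unitary[OF \<alpha>, of n]
    by (simp add: vnorm2_unitary[of _ "Suc (Suc n)"] vnorm2_vCons flip: x_def)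
qed

text \<open>Drop the first square in \<open>vnorm2_kry_step\<close> and pull \<rho> out of the
  second, replacing s by s / \<rho>. If \<rho> = 0 the bound to be shown is 0.\<close>

lemma kry_lower_step:
  assumes V: "V \<in> carrier_mat (Suc n) (Suc n)" and \<alpha>: "cmod \<alpha> \<le> 1" and d: "d \<ge> 0"
    and IH: "\<And>s. s \<in> kry V k \<Longrightarrow> vnorm2 (unit_vec (Suc n) 0 + V *\<^sub>v s) \<ge> d"
    and y: "y \<in> kry (givens (Suc (Suc n)) \<alpha> * ext_mat V) (Suc k)"
  shows "vnorm2 (unit_vec (Suc (Suc n)) 0 + (givens (Suc (Suc n)) \<alpha> * ext_mat V) *\<^sub>v y) \<ge> (1 - (cmod \<alpha>)\<^sup>2) * d"
proof -
  let ?\<rho> = "verblunsky_rho \<alpha>"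
  obtain a s where s: "s \<in> kry V k" "y = vCons a s" using kry_givens_ext[OF V y] .
  have cs: "s \<in> carrier_vec (Suc n)" using kry_carrier[OF V s(1)] .
  have "(1 - (cmod \<alpha>)\<^sup>2) * d \<le> vnorm2 (?\<rho> \<cdot>\<^sub>v unit_vec (Suc n) 0 + V *\<^sub>v s)"
  proof (cases "?\<rho> = 0")
    case True
    then have "(cmod \<alpha>)\<^sup>2 = 1" using verblunsky_rho_sq(2)[OF \<alpha>] by simp
    then show ?thesis by (simp add: vnorm2_nonneg)
  next
    case False
    have "?\<rho> \<cdot>\<^sub>v unit_vec (Suc n) 0 + V *\<^sub>v s = ?\<rho> \<cdot>\<^sub>v (unit_vec (Suc n) 0 + V *\<^sub>v ((1 / ?\<rho>) \<cdot>\<^sub>v s))"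
      using V cs False
      by (intro eq_vecI) (auto simp: mult_mat_vec[OF V cs] algebra_simps simp del: index_mult_mat_vec)
    then have "vnorm2 (?\<rho> \<cdot>\<^sub>v unit_vec (Suc n) 0 + V *\<^sub>v s) =
        (1 - (cmod \<alpha>)\<^sup>2) * vnorm2 (unit_vec (Suc n) 0 + V *\<^sub>v ((1 / ?\<rho>) \<cdot>\<^sub>v s))"
      by (simp add: vnorm2_smult verblunsky_rho_sq(2)[OF \<alpha>])
    moreover have "(cmod \<alpha>)\<^sup>2 \<le> 1" using \<alpha> by (simp add: power_le_one)
    ultimately show ?thesis
      using IH[OF kry_smult[OF V s(1)]] by (simp add: mult_left_mono)
  qed
  then show ?thesis
    unfolding s(2) vnorm2_kry_step[OF V cs \<alpha>] by (simp add: add_increasing)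
qed

text \<open>The unitary matrix with prescribed leading Verblunsky coefficients and continuation V:
  the inverse of repeated peeling, the head of the list being the coefficient that is peeled off
  first.\<close>

fun hess :: "complex list \<Rightarrow> complex mat \<Rightarrow> complex mat" where
  "hess [] V = V"
| "hess (\<alpha> # as) V = givens (Suc (dim_row (hess as V))) \<alpha> * ext_mat (hess as V)"

lemma hess_unitary:
  assumes "V \<in> unitary_group (Suc n)" "\<forall>\<alpha>\<in>set as. cmod \<alpha> \<le> 1"
  shows "hess as V \<in> unitary_group (Suc (length as + n))"
  using assms(2)
proof (induction as)
  case (Cons \<alpha> as)
  then have IH: "hess as V \<in> unitary_group (Suc (length as + n))" by simp
  then have "dim_row (hess as V) = Suc (length as + n)" using unitary_group_dim by blast
  then show ?case
    using Cons.prems ext_mat_unitary[OF IH] givens_unitary[of \<alpha> "length as + n"]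
    by (auto intro!: unitary_group_mult)
qed (use assms in simp)

lemma umom_hess:
  assumes "V \<in> unitary_group (Suc n)" "\<forall>\<alpha>\<in>set as. cmod \<alpha> \<le> 1"
  shows "umom (hess as V) = foldr schur_a as (umom V)"
  using assms(2)
proof (induction as)
  case (Cons \<alpha> as)
  have "hess as V \<in> unitary_group (Suc (length as + n))"
    using hess_unitary[OF assms(1)] Cons.prems by simp
  then have "hess as V \<in> carrier_mat (Suc (length as + n)) (Suc (length as + n))" by (rule unitary_group_carrier)
  then show ?case using Cons umom_givens_ext[of "hess as V" "length as + n" \<alpha>] by auto
qed simp

text \<open>The vectors e_1 + U y with y in the Krylov space are the P(U) e_1 with P(0) = 1 and
  degree at most k, so this is the lower half of the product formula for the minimum.\<close>

lemma hess_kry_lower: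
  assumes V: "V \<in> unitary_group (Suc n)" and as: "\<forall>\<alpha>\<in>set as. cmod \<alpha> \<le> 1"
    and "y \<in> kry (hess as V) (length as)"
  shows "vnorm2 (unit_vec (Suc (length as + n)) 0 + hess as V *\<^sub>v y) \<ge> (\<Prod>\<alpha>\<leftarrow>as. 1 - (cmod \<alpha>)\<^sup>2)"
  using as assms(3)
proof (induction as arbitrary: y)
  case Nil
  have "unit_vec (Suc n) 0 + V *\<^sub>v 0\<^sub>v (dim_row V) = unit_vec (Suc n) 0"
    using unitary_group_dim[OF V] unitary_group_carrier[OF V] by (simp add: mult_zero_vec)
  moreover have "vnorm2 (unit_vec (Suc n) 0) = 1"
    unfolding vnorm2_def index_unit_vec(3) sum.lessThan_Suc_shift by simp
  ultimately show ?case using Nil by simp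
next
  case (Cons \<alpha> as)
  have H: "hess as V \<in> carrier_mat (Suc (length as + n)) (Suc (length as + n))"
    using hess_unitary[OF V, of as] Cons.prems by (auto intro: unitary_group_carrier)
  have "(\<Prod>\<alpha>\<leftarrow>as. 1 - (cmod \<alpha>)\<^sup>2) \<ge> 0"
    using Cons.prems(1) by (induction as) (auto simp: power_le_one)
  then show ?case
    using Cons kry_lower_step[OF H, of \<alpha> "\<Prod>\<alpha>\<leftarrow>as. 1 - (cmod \<alpha>)\<^sup>2" "length as" y] H by auto
qed

text \<open>The Toeplitz form of the moments: for the moments of a measure it is the integral of
  |P|^2 for the polynomial P with coefficients c. The sum is then already real, and
  \<open>Re\<close> only changes the type.\<close>

definition qform :: "nat \<Rightarrow> (nat \<Rightarrow> complex) \<Rightarrow> (nat \<Rightarrow> complex) \<Rightarrow> real" where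
  "qform k c m = Re (\<Sum>i<k. \<Sum>j<k. c i * cnj (c j) * (if j \<le> i then m (i - j) else cnj (m (j - i))))"

text \<open>U preserves inner products, so the Gram matrix of the orbit depends on the difference i
  - j alone, up to conjugation.\<close>

lemma orb_cscalar:
  assumes U: "U \<in> unitary_group (Suc n)"
  shows "orb U i \<bullet>c orb U j = (if j \<le> i then umom U (i - j) else cnj (umom U (j - i)))"
proof -
  have c: "U \<in> carrier_mat (Suc n) (Suc n)" using U by (rule unitary_group_carrier)
  note o = orb_carrier[OF c]
  have 1: "orb U (i + j) \<bullet>c orb U j = umom U i" for i j
  proof (induction j)
    case 0
    have "conjugate (orb U 0) = unit_vec (Suc n) 0" using c by (intro eq_vecI) auto
    then show ?case using o[of i] by (simp add: umom_def)
  next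
    case (Suc j)
    then show ?case using unitary_cscalar[OF U o o, of "i + j" j] by (simp add: orb_Suc)
  qed
  have 2: "orb U i \<bullet>c orb U j = cnj (orb U j \<bullet>c orb U i)" for i j
    using o[of i] o[of j] by (auto simp: scalar_prod_def mult.commute)
  show ?thesis
    using 1[of "i - j" j] 1[of "j - i" i] 2[of i j] by auto
qed

lemma vnorm2_comb:
  assumes U: "U \<in> unitary_group (Suc n)"
  shows "vnorm2 (comb U k c) = qform k c (umom U)"
proof -
  have cU: "U \<in> carrier_mat (Suc n) (Suc n)" using U by (rule unitary_group_carrier)
  have "comb U k c \<bullet>c comb U k c = (\<Sum>l<Suc n. \<Sum>i<k. \<Sum>j<k. c i * cnj (c j) * (orb U i $ l * cnj (orb U j $ l)))"
    using cU by (auto simp: scalar_prod_def comb_def atLeast0LessThan sum_product mult_ac simp del: sum.lessThan_Suc intro!: sum.cong)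
  also have "\<dots> = (\<Sum>i<k. \<Sum>l<Suc n. \<Sum>j<k. c i * cnj (c j) * (orb U i $ l * cnj (orb U j $ l)))"
    by (rule sum.swap)
  also have "\<dots> = (\<Sum>i<k. \<Sum>j<k. \<Sum>l<Suc n. c i * cnj (c j) * (orb U i $ l * cnj (orb U j $ l)))"
    by (intro sum.cong refl sum.swap)
  also have "\<dots> = (\<Sum>i<k. \<Sum>j<k. c i * cnj (c j) * (orb U i \<bullet>c orb U j))"
    using carrier_vecD[OF orb_carrier[OF cU]] by (auto simp: scalar_prod_def atLeast0LessThan sum_distrib_left simp del: sum.lessThan_Suc intro!: sum.cong)
  also have "Re \<dots> = qform k c (umom U)" unfolding qform_def orb_cscalar[OF U] ..
  finally show ?thesis by (simp add: cscalar_self)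
qed

text \<open>The form needed by the upper bound: a value of the quadratic form below t, for any
  single c with \<open>c 0 = 1\<close>, forces the product of the 1 - |\<alpha>|^2 below t.\<close>

lemma qform_foldr_schur_ge:
  assumes V: "V \<in> unitary_group (Suc n)" and as: "\<forall>\<alpha>\<in>set as. cmod \<alpha> \<le> 1" and c: "c 0 = 1"
  shows "qform (Suc (length as)) c (foldr schur_a as (umom V)) \<ge> (\<Prod>\<alpha>\<leftarrow>as. 1 - (cmod \<alpha>)\<^sup>2)"
proof -
  have H: "hess as V \<in> unitary_group (Suc (length as + n))" using hess_unitary[OF V as] .
  then have cH: "hess as V \<in> carrier_mat (Suc (length as + n)) (Suc (length as + n))" by (rule unitary_group_carrier)
  have "unit_vec (Suc (length as + n)) 0 + hess as V *\<^sub>v comb (hess as V) (length as) (\<lambda>i. c (Suc i)) =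
      comb (hess as V) (Suc (length as)) c"
    unfolding comb_Suc[OF cH] by (simp add: c)
  then show ?thesis
    using hess_kry_lower[OF V as comb_in_kry[OF cH]] by (metis vnorm2_comb[OF H] umom_hess[OF V as])
qed

lemma umom_unitary_cases:
  assumes U: "U \<in> unitary_group (Suc (Suc n))"
  obtains V where "V \<in> unitary_group (Suc n)" "umom U = umom (givens (Suc (Suc n)) (U $$ (0, 0)) * ext_mat V)"
proof -
  obtain T W where TW: "T \<in> unitary_group (Suc n)" "W \<in> unitary_group (Suc n)"
    "\<forall>V\<in>unitary_group (Suc n). umom (U * ext_mat V) = schur_a (U $$ (0, 0)) (umom (W * V * T))"
    using umom_mult_ext[OF U] by blast
  have WT: "W * T \<in> unitary_group (Suc n)" using TW by (intro unitary_group_mult)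
  have "U * ext_mat (1\<^sub>m (Suc n)) = U"
    using unitary_group_carrier[OF U] by (simp add: ext_mat_one)
  then have "umom U = schur_a (U $$ (0, 0)) (umom (W * T))"
    using bspec[OF TW(3) unitary_group_one] unitary_group_carrier[OF TW(2)] by simp
  also have "\<dots> = umom (givens (Suc (Suc n)) (U $$ (0, 0)) * ext_mat (W * T))"
    using unitary_group_carrier[OF WT] unitary_entry_le_1[OF U, of 0 0] by (simp add: umom_givens_ext)
  finally show ?thesis using that WT by blast
qed

text \<open>Going down the Schur steps, a minimiser for the smaller matrix yields one for the larger
  by \<open>vnorm2_kry_step\<close>. The value 0 arises when some step meets |\<alpha>| = 1: the
  measure then has so few atoms that a polynomial of degree at most k vanishes on all of
  them.\<close>

lemma qform_attained:
  assumes "U \<in> unitary_group (Suc (k + n))"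
  shows "\<exists>c. c 0 = 1 \<and> (qform (Suc k) c (umom U) = 0 \<or>
    (\<exists>as m. length as = k \<and> (\<forall>\<alpha>\<in>set as. cmod \<alpha> < 1) \<and> m 0 = 1 \<and> umom U = foldr schur_a as m \<and>
       qform (Suc k) c (umom U) = (\<Prod>\<alpha>\<leftarrow>as. 1 - (cmod \<alpha>)\<^sup>2)))"
  using assms
proof (induction k arbitrary: U)
  case 0
  have "umom U 0 = 1" using unitary_group_dim[OF 0] by (simp add: umom_def)
  then show ?case
    by (intro exI[of _ "\<lambda>_. 1"] conjI disjI2 exI[of _ "[]"] exI[of _ "umom U"]) (auto simp: qform_def)
next
  case (Suc k)
  define \<alpha> where "\<alpha> = U $$ (0, 0)"
  let ?G = "givens (Suc (Suc (k + n))) \<alpha>" and ?\<rho> = "verblunsky_rho \<alpha>"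
  have U: "U \<in> unitary_group (Suc (Suc (k + n)))" using Suc.prems by simp
  have \<alpha>1: "cmod \<alpha> \<le> 1" unfolding \<alpha>_def using unitary_entry_le_1[OF U, of 0 0] by simp
  obtain V where V: "V \<in> unitary_group (Suc (k + n))" and eq: "umom U = umom (?G * ext_mat V)"
    using umom_unitary_cases[OF U] unfolding \<alpha>_def by metis
  have cV: "V \<in> carrier_mat (Suc (k + n)) (Suc (k + n))" using V by (rule unitary_group_carrier)
  define A where "A = ?G * ext_mat V"
  have A: "A \<in> unitary_group (Suc (Suc (k + n)))"
    unfolding A_def by (intro unitary_group_mult givens_unitary ext_mat_unitary V \<alpha>1)
  have cA: "A \<in> carrier_mat (Suc (Suc (k + n))) (Suc (Suc (k + n)))" using A by (rule unitary_group_carrier)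
  obtain c where c: "c 0 = 1" and c': "qform (Suc k) c (umom V) = 0 \<or>
    (\<exists>as m. length as = k \<and> (\<forall>\<alpha>\<in>set as. cmod \<alpha> < 1) \<and> m 0 = 1 \<and> umom V = foldr schur_a as m \<and>
       qform (Suc k) c (umom V) = (\<Prod>\<alpha>\<leftarrow>as. 1 - (cmod \<alpha>)\<^sup>2))"
    using Suc.IH[OF V] by blast
  define s where "s = comb V k (\<lambda>i. c (Suc i))"
  have s: "s \<in> kry V k" "s \<in> carrier_vec (Suc (k + n))"
    unfolding s_def using comb_in_kry[OF cV] comb_carrier[OF cV] by auto
  have ns: "vnorm2 (unit_vec (Suc (k + n)) 0 + V *\<^sub>v s) = qform (Suc k) c (umom V)"
    using vnorm2_comb[OF V, of "Suc k" c] unfolding comb_Suc[OF cV] s_def by (simp add: c)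
  have "\<exists>y\<in>kry A (Suc k). vnorm2 (unit_vec (Suc (Suc (k + n))) 0 + A *\<^sub>v y) = (1 - (cmod \<alpha>)\<^sup>2) * qform (Suc k) c (umom V)"
  proof (cases "?\<rho> = 0")
    case False
    \<comment> \<open>The minimiser in \<open>vnorm2_kry_step\<close>: -cnj \<alpha> kills the first
      square, and scaling s by \<rho> makes \<rho> a common factor of the second.\<close>
    have y: "vCons (- cnj \<alpha>) (?\<rho> \<cdot>\<^sub>v s) \<in> kry A (Suc k)"
      unfolding A_def by (rule vCons_in_kry_givens_ext[OF cV kry_smult[OF cV s(1)] False])
    have "?\<rho> \<cdot>\<^sub>v unit_vec (Suc (k + n)) 0 + V *\<^sub>v (?\<rho> \<cdot>\<^sub>v s) = ?\<rho> \<cdot>\<^sub>v (unit_vec (Suc (k + n)) 0 + V *\<^sub>v s)"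
      using cV s(2) by (intro eq_vecI) (auto simp: mult_mat_vec[OF cV s(2)] algebra_simps simp del: index_mult_mat_vec)
    then have "vnorm2 (unit_vec (Suc (Suc (k + n))) 0 + A *\<^sub>v vCons (- cnj \<alpha>) (?\<rho> \<cdot>\<^sub>v s)) =
        (1 - (cmod \<alpha>)\<^sup>2) * qform (Suc k) c (umom V)"
      unfolding A_def using s(2)
      by (subst vnorm2_kry_step[OF cV _ \<alpha>1]) (auto simp: vnorm2_smult ns verblunsky_rho_sq(2)[OF \<alpha>1])
    then show ?thesis using y by blast
  next
    case True
    then have \<alpha>2: "(cmod \<alpha>)\<^sup>2 = 1" using verblunsky_rho_sq(2)[OF \<alpha>1] by simp
    \<comment> \<open>For \<rho> = 0 the vector e_1 is an eigenvector of A, and a polynomial of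
      degree 1 already gives e_1 + A y = 0.\<close>
    define y where "y = vCons (- cnj \<alpha>) (0\<^sub>v (Suc (k + n)))"
    have "comb A k (\<lambda>_. 0) = 0\<^sub>v (Suc (Suc (k + n)))"
      using cA by (intro eq_vecI) (auto simp: comb_def)
    then have "comb A (Suc k) (case_nat (- cnj \<alpha>) (\<lambda>_. 0)) =
        - cnj \<alpha> \<cdot>\<^sub>v unit_vec (Suc (Suc (k + n))) 0 + 0\<^sub>v (Suc (Suc (k + n)))"
      using cA by (simp add: comb_Suc[OF cA] mult_zero_vec)
    also have "\<dots> = y"
      by (rule eq_vecI) (auto simp: y_def vec_index_vCons)
    finally have "y = comb A (Suc k) (case_nat (- cnj \<alpha>) (\<lambda>_. 0))" ..
    then have "y \<in> kry A (Suc k)" using comb_in_kry[OF cA] by metis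
    moreover have "vnorm2 (unit_vec (Suc (Suc (k + n))) 0 + A *\<^sub>v y) = 0"
      unfolding A_def y_def using cV True
      by (subst vnorm2_kry_step[OF cV _ \<alpha>1]) (auto simp: vnorm2_def)
    ultimately show ?thesis using \<alpha>2 by auto
  qed
  then obtain y where y: "y \<in> kry A (Suc k)"
    "vnorm2 (unit_vec (Suc (Suc (k + n))) 0 + A *\<^sub>v y) = (1 - (cmod \<alpha>)\<^sup>2) * qform (Suc k) c (umom V)" by blast
  obtain e where e: "y = comb A (Suc k) e" using kry_is_comb[OF cA y(1)] .
  have q: "qform (Suc (Suc k)) (case_nat 1 e) (umom U) = (1 - (cmod \<alpha>)\<^sup>2) * qform (Suc k) c (umom V)"
    using vnorm2_comb[OF A, of "Suc (Suc k)" "case_nat 1 e"] y(2)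
    unfolding comb_Suc[OF cA, of "Suc k"] e eq A_def[symmetric] by simp
  show ?case
  proof (intro exI[of _ "case_nat 1 e"] conjI)
    show "qform (Suc (Suc k)) (case_nat 1 e) (umom U) = 0 \<or>
    (\<exists>as m. length as = Suc k \<and> (\<forall>\<alpha>\<in>set as. cmod \<alpha> < 1) \<and> m 0 = 1 \<and> umom U = foldr schur_a as m \<and>
       qform (Suc (Suc k)) (case_nat 1 e) (umom U) = (\<Prod>\<alpha>\<leftarrow>as. 1 - (cmod \<alpha>)\<^sup>2))"
    proof (cases "qform (Suc k) c (umom V) = 0 \<or> cmod \<alpha> = 1")
      case True
      then show ?thesis using q by auto
    next
      case False
      then obtain as m where as: "length as = k" "\<forall>\<alpha>\<in>set as. cmod \<alpha> < 1" "umom V = foldr schur_a as m" "m 0 = 1"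
        "qform (Suc k) c (umom V) = (\<Prod>\<alpha>\<leftarrow>as. 1 - (cmod \<alpha>)\<^sup>2)" using c' by blast
      have "umom U = foldr schur_a (\<alpha> # as) m"
        unfolding eq umom_givens_ext[OF cV \<alpha>1] as(3) by simp
      moreover have "cmod \<alpha> < 1" using False \<alpha>1 by simp
      ultimately show ?thesis using as q by (intro disjI2 exI[of _ "\<alpha> # as"] exI[of _ m]) simp
    qed
  qed simp
qed

section \<open>Haar measure\<close>

lemma space_unitary_borel [simp]: "space (unitary_borel n) = unitary_group n"
  by (simp add: unitary_borel_def)

lemma measurable_unitary_entry:
  assumes "i < n" "j < n"
  shows "(\<lambda>U. U $$ (i, j)) \<in> borel_measurable (unitary_borel n)"
proof -
  have 1: "(\<lambda>A. \<lambda>(i, j)\<in>{..<n} \<times> {..<n}. A $$ (i, j)) \<in>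
      measurable (unitary_borel n) (Pi\<^sub>M ({..<n} \<times> {..<n}) (\<lambda>_. borel :: complex measure))"
    unfolding unitary_borel_def by (rule measurable_vimage_algebra1) (simp add: space_PiM)
  have "(i, j) \<in> {..<n} \<times> {..<n}" using assms by simp
  from measurable_compose[OF 1 measurable_component_singleton[OF this]] assms show ?thesis by simp
qed

lemma measurable_unitaryI:
  assumes "\<And>x. x \<in> space M \<Longrightarrow> f x \<in> unitary_group n"
    and "\<And>i j. i < n \<Longrightarrow> j < n \<Longrightarrow> (\<lambda>x. f x $$ (i, j)) \<in> borel_measurable M"
  shows "f \<in> measurable M (unitary_borel n)"
  unfolding unitary_borel_def
proof (rule measurable_vimage_algebra2)
  have "(\<lambda>x. \<lambda>p\<in>{..<n} \<times> {..<n}. f x $$ p) \<in> measurable M (Pi\<^sub>M ({..<n} \<times> {..<n}) (\<lambda>_. borel))"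
    using assms(2) by (intro measurable_restrict) auto
  then show "(\<lambda>x. \<lambda>(i, j)\<in>{..<n} \<times> {..<n}. f x $$ (i, j)) \<in> measurable M (Pi\<^sub>M ({..<n} \<times> {..<n}) (\<lambda>_. borel))"
    by (simp add: case_prod_unfold)
qed (use assms in auto)

lemma measurable_unitary_mult:
  assumes f: "f \<in> measurable M (unitary_borel n)" and g: "g \<in> measurable M (unitary_borel n)"
  shows "(\<lambda>x. f x * g x) \<in> measurable M (unitary_borel n)"
proof (rule measurable_unitaryI)
  have fg: "f x \<in> unitary_group n" "g x \<in> unitary_group n" if "x \<in> space M" for x
    using that measurable_space[OF f] measurable_space[OF g] by auto
  then show "f x * g x \<in> unitary_group n" if "x \<in> space M" for x
    using that by (intro unitary_group_mult) auto
  fix i j assume ij: "i < n" "j < n"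
  have "(\<lambda>x. \<Sum>l<n. f x $$ (i, l) * g x $$ (l, j)) \<in> borel_measurable M"
    using ij by (intro borel_measurable_sum borel_measurable_times
        measurable_compose[OF f measurable_unitary_entry] measurable_compose[OF g measurable_unitary_entry]) auto
  then show "(\<lambda>x. (f x * g x) $$ (i, j)) \<in> borel_measurable M"
  proof (rule measurable_cong[THEN iffD1, rotated])
    fix x assume "x \<in> space M"
    then have "f x \<in> carrier_mat n n" "g x \<in> carrier_mat n n"
      using fg by (auto simp: unitary_group_def)
    then show "(\<Sum>l<n. f x $$ (i, l) * g x $$ (l, j)) = (f x * g x) $$ (i, j)"
      using ij by (auto simp: scalar_prod_def atLeast0LessThan)
  qed
qed

lemma measurable_unitary_adjoint:
  assumes f: "f \<in> measurable M (unitary_borel n)"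
  shows "(\<lambda>x. mat_adjoint (f x)) \<in> measurable M (unitary_borel n)"
proof (rule measurable_unitaryI)
  have fg: "f x \<in> unitary_group n" if "x \<in> space M" for x
    using that measurable_space[OF f] by auto
  then show "mat_adjoint (f x) \<in> unitary_group n" if "x \<in> space M" for x
    using that by (intro unitary_group_adjoint) auto
  fix i j assume ij: "i < n" "j < n"
  have "(\<lambda>x. cnj (f x $$ (j, i))) \<in> borel_measurable M"
    using ij measurable_compose[OF f measurable_unitary_entry[of j n i]]
    by (intro borel_measurable_continuous_on[where f=cnj]) (auto intro!: continuous_intros)
  then show "(\<lambda>x. mat_adjoint (f x) $$ (i, j)) \<in> borel_measurable M"
  proof (rule measurable_cong[THEN iffD1, rotated])
    fix x assume "x \<in> space M"
    then have "f x \<in> carrier_mat n n" using fg by (auto simp: unitary_group_def)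
    then show "cnj (f x $$ (j, i)) = mat_adjoint (f x) $$ (i, j)"
      using ij by (simp add: mat_adjoint_index[of _ n n])
  qed
qed

lemma measurable_unitary_ext:
  assumes f: "f \<in> measurable M (unitary_borel n)"
  shows "(\<lambda>x. ext_mat (f x)) \<in> measurable M (unitary_borel (Suc n))"
proof (rule measurable_unitaryI)
  have fg: "f x \<in> unitary_group n" if "x \<in> space M" for x
    using that measurable_space[OF f] by auto
  then show "ext_mat (f x) \<in> unitary_group (Suc n)" if "x \<in> space M" for x
    using that by (intro ext_mat_unitary) auto
  fix i j assume ij: "i < Suc n" "j < Suc n"
  have "(\<lambda>x. if i = 0 \<and> j = 0 then 1 else if i = 0 \<or> j = 0 then 0 else f x $$ (i - 1, j - 1)) \<in> borel_measurable M"
  proof (cases "i = 0 \<or> j = 0")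
    case False
    then have "(\<lambda>x. f x $$ (i - 1, j - 1)) \<in> borel_measurable M"
      using ij by (intro measurable_compose[OF f measurable_unitary_entry]) auto
    then show ?thesis using False by simp
  qed (cases "i = 0"; cases "j = 0"; simp)
  then show "(\<lambda>x. ext_mat (f x) $$ (i, j)) \<in> borel_measurable M"
  proof (rule measurable_cong[THEN iffD1, rotated])
    fix x assume "x \<in> space M"
    then have "f x \<in> carrier_mat n n" using fg by (auto simp: unitary_group_def)
    then show "(if i = 0 \<and> j = 0 then 1 else if i = 0 \<or> j = 0 then 0 else f x $$ (i - 1, j - 1)) = ext_mat (f x) $$ (i, j)"
      using ij by (simp add: ext_mat_def)
  qed
qed

lemma measurable_unitary_const:
  "V \<in> unitary_group n \<Longrightarrow> (\<lambda>_. V) \<in> measurable M (unitary_borel n)"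
  by (intro measurable_unitaryI) auto

lemma measurable_umom: "umom \<in> measurable (unitary_borel n) borel" if "n > 0"
proof -
  have o: "(\<lambda>U. orb U k $ i) \<in> borel_measurable (unitary_borel n)" if "i < n" for k i
    using that
  proof (induction k arbitrary: i)
    case 0
    have "(\<lambda>U. if i = 0 then 1 else 0 :: complex) \<in> borel_measurable (unitary_borel n)" by simp
    then show ?case
    proof (rule measurable_cong[THEN iffD1, rotated])
      fix U :: "complex mat" assume "U \<in> space (unitary_borel n)"
      then have "dim_row U = n" by (auto dest: unitary_group_dim)
      then show "(if i = 0 then 1 else 0 :: complex) = orb U 0 $ i" using 0 by simp
    qed
  next
    case (Suc k)
    have "(\<lambda>U. \<Sum>j<n. U $$ (i, j) * orb U k $ j) \<in> borel_measurable (unitary_borel n)"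
      using Suc by (intro borel_measurable_sum borel_measurable_times measurable_unitary_entry) auto
    then show ?case
    proof (rule measurable_cong[THEN iffD1, rotated])
      fix U assume "U \<in> space (unitary_borel n)"
      then have "U \<in> carrier_mat n n" by (auto dest: unitary_group_carrier)
      then show "(\<Sum>j<n. U $$ (i, j) * orb U k $ j) = orb U (Suc k) $ i"
        using mult_mat_vec_index_sum[OF _ orb_carrier] Suc.prems by (simp add: orb_Suc del: index_mult_mat_vec)
    qed
  qed
  show ?thesis
    unfolding umom_def[abs_def] using that by (intro measurable_coordinatewise_then_product o)
qed

section \<open>Invariance of Haar measure under both translations and the adjoint\<close>

context
  fixes n :: nat and H :: "complex mat measure"
  assumes haar: "haar_prob n H"
begin

lemma haar_prob_space: "prob_space H"
  using haar by (simp add: haar_prob_def)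

lemma haar_sets: "sets H = sets (unitary_borel n)"
  using haar by (simp add: haar_prob_def)

lemma haar_space: "space H = unitary_group n"
  using sets_eq_imp_space_eq[OF haar_sets] by simp

lemma haar_measurable: "f \<in> measurable (unitary_borel n) N \<Longrightarrow> f \<in> measurable H N"
  using haar_sets by (simp cong: measurable_cong_sets)

lemma haar_measurable_id: "(\<lambda>U. U) \<in> measurable H (unitary_borel n)"
  using haar_sets by (simp add: measurable_ident_sets)

text \<open>\<open>haar_prob\<close> speaks of images of sets, whereas \<open>distr\<close> takes
  preimages; the preimage under left multiplication by V is the image under that by the adjoint of
  V.\<close>

lemma haar_left_distr:
  assumes V: "V \<in> unitary_group n"
  shows "distr H (unitary_borel n) (\<lambda>U. V * U) = H"
proof (rule measure_eqI)
  have m: "(\<lambda>U. V * U) \<in> measurable H (unitary_borel n)"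
    by (intro measurable_unitary_mult measurable_unitary_const V haar_measurable_id)
  fix A assume "A \<in> sets (distr H (unitary_borel n) ((*) V))"
  then have A: "A \<in> sets H" by (simp add: haar_sets)
  have sub: "A \<subseteq> unitary_group n" using sets.sets_into_space[OF A] by (simp add: haar_space)
  have cV: "V \<in> carrier_mat n n" using V by (rule unitary_group_carrier)
  have VV: "V * (mat_adjoint V * U) = U" "mat_adjoint V * (V * U) = U" if "U \<in> unitary_group n" for U
    using that cV mat_adjoint_carrier[OF cV] unitary_group_right[OF V] unitary_group_left[OF V] unitary_group_carrier[OF that]
    by (simp_all add: assoc_mult_mat[symmetric, of _ n n _ n U n])
  have "(\<lambda>U. V * U) -` A \<inter> space H = (\<lambda>U. mat_adjoint V * U) ` A"
  proof (intro equalityI subsetI)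
    fix U assume "U \<in> (\<lambda>U. V * U) -` A \<inter> space H"
    then show "U \<in> (\<lambda>U. mat_adjoint V * U) ` A" using VV(2)[of U] by (intro image_eqI[of _ _ "V * U"]) (auto simp: haar_space)
  next
    fix U assume "U \<in> (\<lambda>U. mat_adjoint V * U) ` A"
    then show "U \<in> (\<lambda>U. V * U) -` A \<inter> space H"
      using VV(1) sub V by (auto simp: haar_space intro!: unitary_group_mult unitary_group_adjoint)
  qed
  moreover have "emeasure H ((\<lambda>U. mat_adjoint V * U) ` A) = emeasure H A"
    using haar A unitary_group_adjoint[OF V] by (simp add: haar_prob_def)
  ultimately show "emeasure (distr H (unitary_borel n) ((*) V)) A = emeasure H A"
    using A m by (simp add: emeasure_distr haar_sets)
qed (simp add: haar_sets)

lemma haar_left_nn_integral: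
  assumes V: "V \<in> unitary_group n" and f: "f \<in> borel_measurable (unitary_borel n)"
  shows "(\<integral>\<^sup>+U. f (V * U) \<partial>H) = (\<integral>\<^sup>+U. f U \<partial>H)"
proof -
  have m: "(\<lambda>U. V * U) \<in> measurable H (unitary_borel n)"
    by (intro measurable_unitary_mult measurable_unitary_const V haar_measurable_id)
  have "(\<integral>\<^sup>+U. f (V * U) \<partial>H) = (\<integral>\<^sup>+U. f U \<partial>distr H (unitary_borel n) (\<lambda>U. V * U))"
    by (simp add: nn_integral_distr[OF m] f)
  then show ?thesis by (simp add: haar_left_distr[OF V])
qed

text \<open>Integrate f of (adjoint of V) times U over two independent copies. Left invariance in U
  gives the integral of f; for fixed U the argument is the adjoint of (adjoint of U) times V, so
  left invariance in V gives the integral of f over adjoints.\<close>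

lemma haar_adjoint_nn_integral:
  assumes f: "f \<in> borel_measurable (unitary_borel n)"
  shows "(\<integral>\<^sup>+U. f (mat_adjoint U) \<partial>H) = (\<integral>\<^sup>+U. f U \<partial>H)"
proof -
  interpret H: prob_space H by (rule haar_prob_space)
  interpret pair_sigma_finite H H ..
  have fst: "fst \<in> measurable (H \<Otimes>\<^sub>M H) (unitary_borel n)" "snd \<in> measurable (H \<Otimes>\<^sub>M H) (unitary_borel n)"
    by (auto intro: measurable_compose[OF measurable_fst haar_measurable_id] measurable_compose[OF measurable_snd haar_measurable_id])
  have m: "(\<lambda>(V, U). f (mat_adjoint V * U)) \<in> borel_measurable (H \<Otimes>\<^sub>M H)"
    unfolding case_prod_unfold
    by (intro measurable_compose[OF _ f] measurable_unitary_mult measurable_unitary_adjoint fst)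
  have fa: "(\<lambda>U. f (mat_adjoint U)) \<in> borel_measurable (unitary_borel n)"
    by (intro measurable_compose[OF _ f] measurable_unitary_adjoint) simp
  have "(\<integral>\<^sup>+U. f U \<partial>H) = (\<integral>\<^sup>+V. \<integral>\<^sup>+U. f (mat_adjoint V * U) \<partial>H \<partial>H)"
  proof -
    have "(\<integral>\<^sup>+V. \<integral>\<^sup>+U. f (mat_adjoint V * U) \<partial>H \<partial>H) = (\<integral>\<^sup>+V. \<integral>\<^sup>+U. f U \<partial>H \<partial>H)"
      by (intro nn_integral_cong haar_left_nn_integral f) (auto simp: haar_space intro: unitary_group_adjoint)
    then show ?thesis by (simp add: H.emeasure_space_1)
  qed
  also have "\<dots> = (\<integral>\<^sup>+U. \<integral>\<^sup>+V. f (mat_adjoint V * U) \<partial>H \<partial>H)"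
    using Fubini'[OF m] by simp
  also have "\<dots> = (\<integral>\<^sup>+U. \<integral>\<^sup>+V. f (mat_adjoint V) \<partial>H \<partial>H)"
  proof (rule nn_integral_cong)
    fix U assume "U \<in> space H"
    then have U: "U \<in> unitary_group n" by (simp add: haar_space)
    have "(\<integral>\<^sup>+V. f (mat_adjoint V * U) \<partial>H) = (\<integral>\<^sup>+V. f (mat_adjoint (mat_adjoint U * V)) \<partial>H)"
    proof (rule nn_integral_cong)
      fix V assume "V \<in> space H"
      then have "V \<in> carrier_mat n n" by (simp add: haar_space unitary_group_carrier)
      then show "f (mat_adjoint V * U) = f (mat_adjoint (mat_adjoint U * V))"
        using mat_adjoint_mult[of "mat_adjoint U" n n V n] unitary_group_carrier[OF U] by simp
    qed
    also have "\<dots> = (\<integral>\<^sup>+V. f (mat_adjoint V) \<partial>H)"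
      by (rule haar_left_nn_integral[OF unitary_group_adjoint[OF U] fa])
    finally show "(\<integral>\<^sup>+V. f (mat_adjoint V * U) \<partial>H) = (\<integral>\<^sup>+V. f (mat_adjoint V) \<partial>H)" .
  qed
  also have "\<dots> = (\<integral>\<^sup>+V. f (mat_adjoint V) \<partial>H)" by (simp add: H.emeasure_space_1)
  finally show ?thesis ..
qed

text \<open>The adjoint turns right translations into left ones.\<close>

lemma haar_right_nn_integral:
  assumes W: "W \<in> unitary_group n" and f: "f \<in> borel_measurable (unitary_borel n)"
  shows "(\<integral>\<^sup>+U. f (U * W) \<partial>H) = (\<integral>\<^sup>+U. f U \<partial>H)"
proof -
  have fa: "(\<lambda>U. f (mat_adjoint U)) \<in> borel_measurable (unitary_borel n)"
    by (intro measurable_compose[OF _ f] measurable_unitary_adjoint) simp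
  have fW: "(\<lambda>U. f (U * W)) \<in> borel_measurable (unitary_borel n)"
    by (intro measurable_compose[OF _ f] measurable_unitary_mult measurable_unitary_const W) simp
  have "(\<integral>\<^sup>+U. f (U * W) \<partial>H) = (\<integral>\<^sup>+U. f (mat_adjoint U * W) \<partial>H)"
    by (rule haar_adjoint_nn_integral[OF fW, symmetric])
  also have "\<dots> = (\<integral>\<^sup>+U. f (mat_adjoint (mat_adjoint W * U)) \<partial>H)"
  proof (rule nn_integral_cong)
    fix V assume "V \<in> space H"
    then have "V \<in> carrier_mat n n" by (simp add: haar_space unitary_group_carrier)
    then show "f (mat_adjoint V * W) = f (mat_adjoint (mat_adjoint W * V))"
      using mat_adjoint_mult[of "mat_adjoint W" n n V n] unitary_group_carrier[OF W] by simp
  qed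
  also have "\<dots> = (\<integral>\<^sup>+U. f (mat_adjoint U) \<partial>H)"
    by (rule haar_left_nn_integral[OF unitary_group_adjoint[OF W] fa])
  also have "\<dots> = (\<integral>\<^sup>+U. f U \<partial>H)" by (rule haar_adjoint_nn_integral[OF f])
  finally show ?thesis .
qed

end

section \<open>One Schur step for Haar measure\<close>

lemma measurable_schur: "(\<lambda>p. schur_a (fst p) (snd p)) \<in> borel_measurable borel"
proof (rule measurable_coordinatewise_then_product)
  fix k
  have "continuous_on UNIV (\<lambda>p. schur_a (fst p) (snd p) k)"
    unfolding continuous_on_def
  proof (intro ballI tendsto_schur)
    fix x :: "complex \<times> (nat \<Rightarrow> complex)" and i
    show "(fst \<longlongrightarrow> fst x) (at x within UNIV)" by (intro tendsto_intros)
    have "continuous_on UNIV (\<lambda>p :: complex \<times> (nat \<Rightarrow> complex). snd p i)"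
      by (intro continuous_on_compose2[OF continuous_on_product_coordinates continuous_on_snd]) (auto intro!: continuous_intros)
    then show "((\<lambda>p. snd p i) \<longlongrightarrow> snd x i) (at x within UNIV)"
      unfolding continuous_on_def by blast
  qed
  then show "(\<lambda>p. schur_a (fst p) (snd p) k) \<in> borel_measurable borel"
    by (rule borel_measurable_continuous_onI)
qed

lemma measurable_schur2:
  assumes "f \<in> borel_measurable M" "g \<in> borel_measurable M"
  shows "(\<lambda>x. schur_a (f x) (g x)) \<in> borel_measurable M"
  using measurable_compose[OF borel_measurable_Pair[OF assms] measurable_schur] by simp

text \<open>The entry \<open>U\<^sub>0\<^sub>0\<close> and the remaining moments decouple because \<open>U\<close> and \<open>U (1 \<oplus> V)\<close> have the same law.\<close>

theorem haar_umom_recursion: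
  assumes H: "haar_prob (Suc (Suc n)) H" and K: "haar_prob (Suc n) K"
    and f: "f \<in> borel_measurable borel"
  shows "(\<integral>\<^sup>+U. f (umom U) \<partial>H) = (\<integral>\<^sup>+U. \<integral>\<^sup>+V. f (schur_a (U $$ (0, 0)) (umom V)) \<partial>K \<partial>H)"
proof -
  interpret H: prob_space H by (rule haar_prob_space[OF H])
  interpret K: prob_space K by (rule haar_prob_space[OF K])
  interpret pair_sigma_finite K H ..
  let ?B = "unitary_borel (Suc (Suc n))" and ?C = "unitary_borel (Suc n)"
  have fu: "(\<lambda>U. f (umom U)) \<in> borel_measurable ?B"
    by (rule measurable_compose[OF measurable_umom f]) simp
  have m: "(\<lambda>(V, U). f (umom (U * ext_mat V))) \<in> borel_measurable (K \<Otimes>\<^sub>M H)"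
    unfolding case_prod_unfold
    by (intro measurable_compose[OF _ fu] measurable_unitary_mult measurable_unitary_ext
        measurable_compose[OF measurable_fst haar_measurable_id[OF K]]
        measurable_compose[OF measurable_snd haar_measurable_id[OF H]])
  have "(\<integral>\<^sup>+U. f (umom U) \<partial>H) = (\<integral>\<^sup>+V. \<integral>\<^sup>+U. f (umom (U * ext_mat V)) \<partial>H \<partial>K)"
  proof -
    have "(\<integral>\<^sup>+V. \<integral>\<^sup>+U. f (umom (U * ext_mat V)) \<partial>H \<partial>K) = (\<integral>\<^sup>+V. \<integral>\<^sup>+U. f (umom U) \<partial>H \<partial>K)"
      by (intro nn_integral_cong haar_right_nn_integral[OF H] fu ext_mat_unitary) (auto simp: haar_space[OF K])
    then show ?thesis by (simp add: K.emeasure_space_1)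
  qed
  also have "\<dots> = (\<integral>\<^sup>+U. \<integral>\<^sup>+V. f (umom (U * ext_mat V)) \<partial>K \<partial>H)"
    using Fubini'[OF m] by simp
  also have "\<dots> = (\<integral>\<^sup>+U. \<integral>\<^sup>+V. f (schur_a (U $$ (0, 0)) (umom V)) \<partial>K \<partial>H)"
  proof (rule nn_integral_cong)
    fix U assume "U \<in> space H"
    then have U: "U \<in> unitary_group (Suc (Suc n))" by (simp add: haar_space[OF H])
    \<comment> \<open>T and W are chosen for each U separately. Both disappear inside the inner
      integral by the two-sided invariance of K, so the resulting integrand depends on U only
      through its corner entry.\<close>
    obtain T W where T: "T \<in> unitary_group (Suc n)" and W: "W \<in> unitary_group (Suc n)"
      and eq: "\<forall>V\<in>unitary_group (Suc n). umom (U * ext_mat V) = schur_a (U $$ (0, 0)) (umom (W * V * T))"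
      using umom_mult_ext[OF U] by blast
    define g where "g V = f (schur_a (U $$ (0, 0)) (umom V))" for V
    have g: "g \<in> borel_measurable ?C"
      unfolding g_def[abs_def]
      by (intro measurable_compose[OF _ f] measurable_schur2 measurable_umom) auto
    have gT: "(\<lambda>V. g (V * T)) \<in> borel_measurable ?C"
      by (intro measurable_compose[OF _ g] measurable_unitary_mult measurable_unitary_const T) simp
    have "(\<integral>\<^sup>+V. f (umom (U * ext_mat V)) \<partial>K) = (\<integral>\<^sup>+V. g (W * V * T) \<partial>K)"
      using eq by (intro nn_integral_cong) (simp add: g_def haar_space[OF K])
    also have "\<dots> = (\<integral>\<^sup>+V. g (V * T) \<partial>K)" by (rule haar_left_nn_integral[OF K W gT])
    also have "\<dots> = (\<integral>\<^sup>+V. g V \<partial>K)" by (rule haar_right_nn_integral[OF K T g])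
    finally show "(\<integral>\<^sup>+V. f (umom (U * ext_mat V)) \<partial>K) = (\<integral>\<^sup>+V. f (schur_a (U $$ (0, 0)) (umom V)) \<partial>K)"
      by (simp add: g_def)
  qed
  finally show ?thesis .
qed

subsection \<open>The law of a corner entry\<close>

lemma polyfun_coeff_eq_0:
  fixes c :: "nat \<Rightarrow> real"
  assumes "\<And>s. s \<ge> 0 \<Longrightarrow> (\<Sum>k\<le>m. c k * s ^ k) = 0" "k \<le> m"
  shows "c k = 0"
proof (rule ccontr)
  assume "c k \<noteq> 0"
  then have "finite {s. (\<Sum>k\<le>m. c k * s ^ k) = 0}"
    using polyfun_finite_roots[of c m] assms(2) by blast
  moreover have "{0::real..} \<subseteq> {s. (\<Sum>k\<le>m. c k * s ^ k) = 0}" using assms(1) by auto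
  ultimately have "finite {0::real..}" by (rule rev_finite_subset)
  then show False using infinite_Ici by blast
qed

lemma real_poly_dense_unit_interval:
  fixes f :: "real \<Rightarrow> real"
  assumes "continuous_on {0..1} f" "e > 0"
  shows "\<exists>p. \<forall>x\<in>{0..1}. \<bar>f x - poly p x\<bar> < e"
proof -
  have "\<exists>g. (\<exists>p. g = poly p) \<and> (\<forall>x\<in>{0..1}. \<bar>f x - g x\<bar> < e)"
  proof (rule Stone_Weierstrass_HOL[where P="\<lambda>g. \<exists>p. g = poly p"])
    show "\<exists>p. (\<lambda>x. c) = poly p" for c :: real by (rule exI[of _ "[:c:]"]) auto
    show "\<exists>p. (\<lambda>x. f x + g x) = poly p" if "(\<exists>p. f = poly p) \<and> (\<exists>p. g = poly p)" for f g :: "real \<Rightarrow> real"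
    proof -
      obtain p q where "f = poly p" "g = poly q" using \<open>(\<exists>p. f = poly p) \<and> (\<exists>p. g = poly p)\<close> by blast
      then have "(\<lambda>x. f x + g x) = poly (p + q)" by (simp add: fun_eq_iff)
      then show ?thesis by blast
    qed
    show "\<exists>p. (\<lambda>x. f x * g x) = poly p" if "(\<exists>p. f = poly p) \<and> (\<exists>p. g = poly p)" for f g :: "real \<Rightarrow> real"
    proof -
      obtain p q where "f = poly p" "g = poly q" using \<open>(\<exists>p. f = poly p) \<and> (\<exists>p. g = poly p)\<close> by blast
      then have "(\<lambda>x. f x * g x) = poly (p * q)" by (simp add: fun_eq_iff)
      then show ?thesis by blast
    qed
    show "\<exists>f. (\<exists>p. f = poly p) \<and> f x \<noteq> f y" if "x \<in> {0..1} \<and> y \<in> {0..1} \<and> x \<noteq> y" for x y :: real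
      using that by (intro exI[of _ "poly [:0, 1:]"]) auto
  qed (use assms in \<open>auto intro: continuous_intros\<close>)
  then show ?thesis by blast
qed

text \<open>The Beta(1, p + 1) density on [0, 1], which is the law of |U_00|^2 for Haar unitaries of
  size p + 2.\<close>

definition beta_density :: "nat \<Rightarrow> real \<Rightarrow> real" where
  "beta_density p x = real (Suc p) * (1 - x) ^ p"

lemma beta_density_nonneg: "x \<le> 1 \<Longrightarrow> beta_density p x \<ge> 0"
  by (simp add: beta_density_def)

lemma continuous_on_beta_density [continuous_intros]: "continuous_on S (beta_density p)"
  unfolding beta_density_def[abs_def] by (intro continuous_intros)

lemma beta_moment_0: "integral {0..1} (\<lambda>x. beta_density p x) = 1"
proof -
  define F :: "real \<Rightarrow> real" where "F x = 0 - (1 - x) ^ Suc p" for x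
  have "(beta_density p has_integral (F 1 - F 0)) {0..1}"
  proof (rule fundamental_theorem_of_calculus)
    fix x :: real
    have d: "((\<lambda>x. 1 - x) has_real_derivative -1) (at x within {0..1})"
      by (auto intro!: derivative_eq_intros)
    have "(F has_real_derivative beta_density p x) (at x within {0..1})"
      unfolding F_def[abs_def]
      by (rule DERIV_cong[OF DERIV_diff[OF DERIV_const DERIV_power_Suc[OF d]]]) (simp add: beta_density_def)
    then show "(F has_vector_derivative beta_density p x) (at x within {0..1})"
      by (simp add: has_real_derivative_iff_has_vector_derivative)
  qed simp
  from integral_unique[OF this] show ?thesis by (simp add: F_def)
qed

text \<open>Integrate the derivative of x^(k+1) (1 - x)^(p+1), a function that vanishes at both ends
  of [0, 1].\<close>

lemma beta_moment_Suc:
  "real (Suc k) * integral {0..1} (\<lambda>x. x ^ k * beta_density p x) =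
   real (k + p + 2) * integral {0..1} (\<lambda>x. x ^ Suc k * beta_density p x)"
proof -
  let ?I = "\<lambda>k. integral {0..1} (\<lambda>x. x ^ k * beta_density p x)"
  have int: "(\<lambda>x. x ^ k * beta_density p x) integrable_on {0..1}" for k
    by (intro integrable_continuous_real continuous_intros)
  have hi: "((\<lambda>x. (real (Suc k) * (x ^ k * beta_density p x) - real (k + p + 2) * (x ^ Suc k * beta_density p x)) / real (Suc p))
      has_integral ((1 ^ Suc k * (1 - 1) ^ Suc p) - (0 ^ Suc k * (1 - 0) ^ Suc p))) {0..1::real}"
  proof (rule fundamental_theorem_of_calculus)
    fix x :: real assume "x \<in> {0..1}"
    have "((\<lambda>x. x ^ Suc k * (1 - x) ^ Suc p) has_real_derivative
       real (Suc k) * x ^ k * (1 - x) ^ Suc p - x ^ Suc k * (real (Suc p) * (1 - x) ^ p)) (at x within {0..1})"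
    proof -
      have d: "((\<lambda>x. 1 - x) has_real_derivative -1) (at x within {0..1})"
        by (auto intro!: derivative_eq_intros)
      show ?thesis
        by (rule DERIV_cong[OF DERIV_mult[OF DERIV_power_Suc[OF DERIV_ident] DERIV_power_Suc[OF d]]])
           (simp add: algebra_simps)
    qed
    also have "real (Suc k) * x ^ k * (1 - x) ^ Suc p - x ^ Suc k * (real (Suc p) * (1 - x) ^ p) =
      (real (Suc k) * (x ^ k * beta_density p x) - real (k + p + 2) * (x ^ Suc k * beta_density p x)) / real (Suc p)"
    proof -
      have "(real (Suc k) * (x ^ k * beta_density p x) - real (k + p + 2) * (x ^ Suc k * beta_density p x)) / real (Suc p)
        = real (Suc k) * (x ^ k * (1 - x) ^ p) - real (k + p + 2) * (x ^ Suc k * (1 - x) ^ p)"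
        by (simp add: beta_density_def field_simps del: of_nat_Suc power_Suc)
      also have "\<dots> = real (Suc k) * x ^ k * (1 - x) ^ Suc p - x ^ Suc k * (real (Suc p) * (1 - x) ^ p)"
        by (simp add: algebra_simps)
      finally show ?thesis ..
    qed
    finally show "((\<lambda>x. x ^ Suc k * (1 - x) ^ Suc p) has_vector_derivative
      (real (Suc k) * (x ^ k * beta_density p x) - real (k + p + 2) * (x ^ Suc k * beta_density p x)) / real (Suc p)) (at x within {0..1})"
      by (simp add: has_real_derivative_iff_has_vector_derivative)
  qed simp
  have "integral {0..1} (\<lambda>x. (real (Suc k) * (x ^ k * beta_density p x) - real (k + p + 2) * (x ^ Suc k * beta_density p x)) / real (Suc p)) = 0"
    using integral_unique[OF hi] by (simp only: diff_self power_one power_0_Suc mult_zero_left mult_zero_right)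
  moreover have "integral {0..1} (\<lambda>x. (real (Suc k) * (x ^ k * beta_density p x) - real (k + p + 2) * (x ^ Suc k * beta_density p x)) / real (Suc p))
     = (real (Suc k) * ?I k - real (k + p + 2) * ?I (Suc k)) / real (Suc p)"
  proof -
    have "integral {0..1} (\<lambda>x. (real (Suc k) * (x ^ k * beta_density p x) - real (k + p + 2) * (x ^ Suc k * beta_density p x)) / real (Suc p))
      = integral {0..1} (\<lambda>x. real (Suc k) * (x ^ k * beta_density p x) - real (k + p + 2) * (x ^ Suc k * beta_density p x)) / real (Suc p)"
      by (rule integral_divide)
    also have "integral {0..1} (\<lambda>x. real (Suc k) * (x ^ k * beta_density p x) - real (k + p + 2) * (x ^ Suc k * beta_density p x)) =
      integral {0..1} (\<lambda>x. real (Suc k) * (x ^ k * beta_density p x)) - integral {0..1} (\<lambda>x. real (k + p + 2) * (x ^ Suc k * beta_density p x))"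
      by (intro Henstock_Kurzweil_Integration.integral_diff integrable_continuous_real continuous_intros)
    finally show ?thesis by (simp only: Henstock_Kurzweil_Integration.integral_mult_right)
  qed
  ultimately show ?thesis by simp
qed

section \<open>Moments of the first column of a Haar unitary\<close>

definition phase_mat :: "nat \<Rightarrow> nat \<Rightarrow> real \<Rightarrow> complex mat" where
  "phase_mat n j t = Matrix.mat n n (\<lambda>(i, k). if i = k then (if i = j then cis t else 1) else 0)"

text \<open>A general monomial in two entries of the first column and their conjugates. These appear
  when a rotated corner entry is expanded, and the phase symmetry kills those with c \<noteq>
  d.\<close>

definition mixed :: "nat \<Rightarrow> nat \<Rightarrow> nat \<Rightarrow> nat \<Rightarrow> nat \<Rightarrow> complex mat \<Rightarrow> complex" where
  "mixed j a b c d U = U $$ (0, 0) ^ a * cnj (U $$ (0, 0)) ^ b * (U $$ (j, 0) ^ c * cnj (U $$ (j, 0)) ^ d)"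

definition entry_sq :: "nat \<Rightarrow> complex mat \<Rightarrow> real" where
  "entry_sq i U = (cmod (U $$ (i, 0)))\<^sup>2"

lemma mixed_diag: "mixed j a a c c U = complex_of_real (entry_sq 0 U ^ a * entry_sq j U ^ c)"
  by (simp only: mixed_def entry_sq_def complex_norm_square[symmetric] power_mult_distrib[symmetric]
      of_real_mult of_real_power)

context
  fixes p :: nat and H :: "complex mat measure"
  assumes haar: "haar_prob (Suc (Suc p)) H"
begin

interpretation H: prob_space H by (rule haar_prob_space[OF haar])

lemma entry_le_1: "U \<in> space H \<Longrightarrow> i < Suc (Suc p) \<Longrightarrow> cmod (U $$ (i, 0)) \<le> 1"
  using unitary_entry_le_1 by (auto simp: haar_space[OF haar])

lemma entry_measurable [measurable]: "i < Suc (Suc p) \<Longrightarrow> (\<lambda>U. U $$ (i, 0)) \<in> borel_measurable H"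
  by (intro haar_measurable[OF haar] measurable_unitary_entry) auto

lemma haar_left_integral:
  fixes F :: "complex mat \<Rightarrow> 'a::{banach,second_countable_topology}"
  assumes V: "V \<in> unitary_group (Suc (Suc p))" and F: "F \<in> borel_measurable H"
  shows "(\<integral>U. F (V * U) \<partial>H) = (\<integral>U. F U \<partial>H)"
proof -
  have m: "(\<lambda>U. V * U) \<in> measurable H (unitary_borel (Suc (Suc p)))"
    by (intro measurable_unitary_mult measurable_unitary_const V haar_measurable_id[OF haar])
  have "F \<in> borel_measurable (unitary_borel (Suc (Suc p)))"
    using F haar_sets[OF haar] by (simp cong: measurable_cong_sets)
  then have "(\<integral>U. F U \<partial>distr H (unitary_borel (Suc (Suc p))) (\<lambda>U. V * U)) = (\<integral>U. F (V * U) \<partial>H)"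
    by (rule integral_distr[OF m])
  then show ?thesis by (simp add: haar_left_distr[OF haar V])
qed

lemma phase_mat_unitary: "phase_mat (Suc (Suc p)) j t \<in> unitary_group (Suc (Suc p))"
proof (rule unitary_groupI)
  fix i k assume ik: "i < Suc (Suc p)" "k < Suc (Suc p)"
  have "(\<Sum>l<Suc (Suc p). cnj (phase_mat (Suc (Suc p)) j t $$ (l, i)) * phase_mat (Suc (Suc p)) j t $$ (l, k)) =
      (\<Sum>l<Suc (Suc p). if l = i then (if i = k then 1 else 0) else 0)"
    using ik by (intro sum.cong refl) (auto simp: phase_mat_def cis_cnj cis_mult)
  then show "(\<Sum>l<Suc (Suc p). cnj (phase_mat (Suc (Suc p)) j t $$ (l, i)) * phase_mat (Suc (Suc p)) j t $$ (l, k)) = (if i = k then 1 else 0)"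
    using ik by simp
qed (simp add: phase_mat_def)

lemma phase_mat_entry:
  assumes "U \<in> space H" "i < Suc (Suc p)"
  shows "(phase_mat (Suc (Suc p)) j t * U) $$ (i, 0) = (if i = j then cis t else 1) * U $$ (i, 0)"
proof -
  have cU: "U \<in> carrier_mat (Suc (Suc p)) (Suc (Suc p))"
    using assms by (simp add: haar_space[OF haar] unitary_group_carrier)
  have "(phase_mat (Suc (Suc p)) j t * U) $$ (i, 0) = (\<Sum>l<Suc (Suc p). phase_mat (Suc (Suc p)) j t $$ (i, l) * U $$ (l, 0))"
    using cU assms by (auto simp: phase_mat_def scalar_prod_def atLeast0LessThan simp del: sum.lessThan_Suc)
  also have "\<dots> = (\<Sum>l<Suc (Suc p). if l = i then (if i = j then cis t else 1) * U $$ (i, 0) else 0)"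
    using assms by (intro sum.cong refl) (auto simp: phase_mat_def)
  also have "\<dots> = (if i = j then cis t else 1) * U $$ (i, 0)" using assms by simp
  finally show ?thesis .
qed

lemma mixed_measurable: "j < Suc (Suc p) \<Longrightarrow> mixed j a b c d \<in> borel_measurable H"
  unfolding mixed_def[abs_def]
  by (intro borel_measurable_times borel_measurable_power entry_measurable
      borel_measurable_continuous_on[where f=cnj] continuous_intros) auto

lemma mixed_integrable: "j < Suc (Suc p) \<Longrightarrow> integrable H (mixed j a b c d)"
proof (rule H.integrable_const_bound[of _ 1])
  assume j: "j < Suc (Suc p)"
  show "AE U in H. norm (mixed j a b c d U) \<le> 1"
  proof (rule AE_I2)
    fix U assume "U \<in> space H"
    then have "cmod (U $$ (0, 0)) \<le> 1" "cmod (U $$ (j, 0)) \<le> 1" using entry_le_1 j by auto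
    then show "norm (mixed j a b c d U) \<le> 1"
      unfolding mixed_def norm_mult norm_power complex_mod_cnj
      by (intro mult_le_one power_le_one mult_nonneg_nonneg zero_le_power norm_ge_zero)
  qed
qed (rule mixed_measurable)

text \<open>Multiplying row j by the phase t, with (c - d) t = \<pi>, changes the sign of the
  integrand and preserves the law, so the integral equals its own negative.\<close>

lemma mixed_zero:
  assumes j: "0 < j" "j < Suc (Suc p)" and cd: "c \<noteq> d"
  shows "(\<integral>U. mixed j a b c d U \<partial>H) = 0"
proof -
  define t where "t = pi / (real c - real d)"
  have t: "cis t ^ c * cnj (cis t) ^ d = -1"
  proof -
    have "cis t ^ c * cnj (cis t) ^ d = cis (real c * t + real d * (- t))"
      by (simp only: cis_cnj Complex.DeMoivre cis_mult)
    also have "real c * t + real d * (- t) = (real c - real d) * t" by (simp add: algebra_simps)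
    also have "(real c - real d) * t = pi" using cd by (simp add: t_def)
    finally show ?thesis by simp
  qed
  have "(\<integral>U. mixed j a b c d U \<partial>H) = (\<integral>U. mixed j a b c d (phase_mat (Suc (Suc p)) j t * U) \<partial>H)"
    by (rule haar_left_integral[OF phase_mat_unitary mixed_measurable[OF j(2)], symmetric])
  also have "\<dots> = (\<integral>U. - mixed j a b c d U \<partial>H)"
  proof (intro Bochner_Integration.integral_cong refl)
    fix U assume U: "U \<in> space H"
    have "mixed j a b c d (phase_mat (Suc (Suc p)) j t * U) = (cis t ^ c * cnj (cis t) ^ d) * mixed j a b c d U"
      using j by (simp add: mixed_def phase_mat_entry[OF U] power_mult_distrib mult_ac)
    then show "mixed j a b c d (phase_mat (Suc (Suc p)) j t * U) = - mixed j a b c d U" unfolding t by simp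
  qed
  also have "\<dots> = - (\<integral>U. mixed j a b c d U \<partial>H)" by simp
  finally show ?thesis by simp
qed

lemma integrable_entry_sq:
  assumes "i < Suc (Suc p)"
  shows "integrable H (\<lambda>U. entry_sq 0 U ^ a * entry_sq i U ^ c)"
proof -
  have "mixed i a a c c = (\<lambda>U. complex_of_real (entry_sq 0 U ^ a * entry_sq i U ^ c))"
    by (rule ext) (rule mixed_diag)
  then show ?thesis using mixed_integrable[OF assms, of a a c c] by (simp only: complex_of_real_integrable_eq)
qed

text \<open>Complete the unit vector with entries a at 0 and b at j to a unitary matrix; the adjoint
  of that matrix has it as first row.\<close>

lemma rotation_exists:
  assumes j: "0 < j" "j < Suc (Suc p)" and ab: "a\<^sup>2 + b\<^sup>2 = (1::real)"
  obtains V where "V \<in> unitary_group (Suc (Suc p))"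
    "\<And>U. U \<in> space H \<Longrightarrow> (V * U) $$ (0, 0) = of_real a * U $$ (0, 0) + of_real b * U $$ (j, 0)"
proof -
  let ?n = "Suc (Suc p)"
  define g where "g = Matrix.vec ?n (\<lambda>i. if i = 0 then complex_of_real a else if i = j then of_real b else 0)"
  have two: "(\<Sum>l<?n. if l = 0 then x else if l = j then y else 0) = x + y" for x y :: "'a::comm_monoid_add"
  proof -
    have "(\<Sum>l<?n. if l = 0 then x else if l = j then y else 0) = (\<Sum>l\<in>{0, j}. if l = 0 then x else if l = j then y else 0)"
      using j by (intro sum.mono_neutral_right) auto
    then show ?thesis using j by simp
  qed
  have "vnorm2 g = (\<Sum>l<?n. if l = 0 then a\<^sup>2 else if l = j then b\<^sup>2 else 0)"
    unfolding vnorm2_def by (rule sum.cong) (auto simp: g_def)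
  then have "vnorm2 g = 1" unfolding two using ab by simp
  then obtain T where T: "T \<in> unitary_group ?n" "\<And>i. i < ?n \<Longrightarrow> T $$ (i, 0) = g $ i"
    using unitary_completion[of g "Suc p"] by (auto simp: g_def)
  have cT: "T \<in> carrier_mat ?n ?n" using T(1) by (rule unitary_group_carrier)
  have "(mat_adjoint T * U) $$ (0, 0) = of_real a * U $$ (0, 0) + of_real b * U $$ (j, 0)" if "U \<in> space H" for U
  proof -
    have cU: "U \<in> carrier_mat ?n ?n" using that by (simp add: haar_space[OF haar] unitary_group_carrier)
    have "(mat_adjoint T * U) $$ (0, 0) = (\<Sum>l<?n. cnj (T $$ (l, 0)) * U $$ (l, 0))"
      using cU cT by (auto simp: scalar_prod_def atLeast0LessThan mat_adjoint_index[OF cT] simp del: sum.lessThan_Suc)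
    also have "\<dots> = (\<Sum>l<?n. if l = 0 then of_real a * U $$ (0, 0) else if l = j then of_real b * U $$ (j, 0) else 0)"
      by (intro sum.cong refl) (auto simp: T(2) g_def)
    finally show ?thesis unfolding two .
  qed
  then show ?thesis using that unitary_group_adjoint[OF T(1)] by blast
qed

text \<open>By invariance |U_00|^2 and |a U_00 + b U_j0|^2 have the same m-th moment. In the
  expansion only the diagonal terms survive \<open>mixed_zero\<close>.\<close>

lemma entry_rotation_identity:
  assumes j: "0 < j" "j < Suc (Suc p)" and ab: "a\<^sup>2 + b\<^sup>2 = (1::real)"
  shows "(\<integral>U. entry_sq 0 U ^ m \<partial>H) =
    (\<Sum>k\<le>m. (real (m choose k))\<^sup>2 * (b\<^sup>2) ^ k * (a\<^sup>2) ^ (m - k) * (\<integral>U. entry_sq 0 U ^ (m - k) * entry_sq j U ^ k \<partial>H))"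
proof -
  obtain V where V: "V \<in> unitary_group (Suc (Suc p))"
    "\<And>U. U \<in> space H \<Longrightarrow> (V * U) $$ (0, 0) = of_real a * U $$ (0, 0) + of_real b * U $$ (j, 0)"
    using rotation_exists[OF assms] by blast
  define C where "C k l = complex_of_real (real (m choose k) * real (m choose l) * (b ^ k * b ^ l) * (a ^ (m - k) * a ^ (m - l)))" for k l
  have "complex_of_real (\<integral>U. entry_sq 0 U ^ m \<partial>H) = (\<integral>U. mixed 0 m m 0 0 U \<partial>H)"
    by (simp add: mixed_diag flip: integral_complex_of_real)
  also have "\<dots> = (\<integral>U. mixed 0 m m 0 0 (V * U) \<partial>H)"
    by (rule haar_left_integral[OF V(1) mixed_measurable, symmetric]) simp
  also have "\<dots> = (\<integral>U. (\<Sum>k\<le>m. \<Sum>l\<le>m. C k l * mixed j (m - k) (m - l) k l U) \<partial>H)"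
  proof (intro Bochner_Integration.integral_cong refl)
    fix U assume U: "U \<in> space H"
    let ?u = "U $$ (0, 0)" and ?v = "U $$ (j, 0)"
    have "mixed 0 m m 0 0 (V * U) = (of_real b * ?v + of_real a * ?u) ^ m * (of_real b * cnj ?v + of_real a * cnj ?u) ^ m"
      by (simp add: mixed_def V(2)[OF U] add.commute)
    also have "\<dots> = (\<Sum>k\<le>m. \<Sum>l\<le>m. C k l * mixed j (m - k) (m - l) k l U)"
      unfolding binomial_ring sum_product
      by (intro sum.cong refl) (simp add: C_def mixed_def power_mult_distrib mult_ac)
    finally show "mixed 0 m m 0 0 (V * U) = (\<Sum>k\<le>m. \<Sum>l\<le>m. C k l * mixed j (m - k) (m - l) k l U)" .
  qed
  also have "\<dots> = (\<Sum>k\<le>m. \<Sum>l\<le>m. C k l * (\<integral>U. mixed j (m - k) (m - l) k l U \<partial>H))"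
    using mixed_integrable[OF j(2)]
    by (subst Bochner_Integration.integral_sum | intro Bochner_Integration.integrable_sum integrable_mult_right sum.cong refl | simp)+
  also have "\<dots> = (\<Sum>k\<le>m. C k k * (\<integral>U. mixed j (m - k) (m - k) k k U \<partial>H))"
  proof (intro sum.cong refl)
    fix k assume k: "k \<in> {..m}"
    have "(\<Sum>l\<le>m. C k l * (\<integral>U. mixed j (m - k) (m - l) k l U \<partial>H)) =
        (\<Sum>l\<le>m. if l = k then C k k * (\<integral>U. mixed j (m - k) (m - k) k k U \<partial>H) else 0)"
      using mixed_zero[OF j] by (intro sum.cong refl) auto
    then show "(\<Sum>l\<le>m. C k l * (\<integral>U. mixed j (m - k) (m - l) k l U \<partial>H)) = C k k * (\<integral>U. mixed j (m - k) (m - k) k k U \<partial>H)"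
      using k by simp
  qed
  also have "\<dots> = complex_of_real (\<Sum>k\<le>m. (real (m choose k))\<^sup>2 * (b\<^sup>2) ^ k * (a\<^sup>2) ^ (m - k) * (\<integral>U. entry_sq 0 U ^ (m - k) * entry_sq j U ^ k \<partial>H))"
    unfolding mixed_diag integral_complex_of_real of_real_sum
    by (intro sum.cong refl) (simp add: C_def power2_eq_square power_mult_distrib mult_ac)
  finally show ?thesis by (simp only: of_real_eq_iff)
qed

text \<open>The previous identity holds for every rotation. With a^2 = 1 / (1 + s) and b^2 = s / (1
  + s), multiplication by (1 + s)^m turns it into a polynomial identity in s \<ge> 0 whose
  coefficients can be compared.\<close>

lemma entry_mixed_moment:
  assumes j: "0 < j" "j < Suc (Suc p)"
  shows "real (Suc k) * (\<integral>U. entry_sq 0 U ^ k * entry_sq j U \<partial>H) = (\<integral>U. entry_sq 0 U ^ Suc k \<partial>H)"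
proof -
  let ?m = "Suc k"
  define M where "M = (\<integral>U. entry_sq 0 U ^ ?m \<partial>H)"
  define e where "e i = (\<integral>U. entry_sq 0 U ^ (?m - i) * entry_sq j U ^ i \<partial>H)" for i
  define c where "c i = (real (?m choose i))\<^sup>2 * e i - real (?m choose i) * M" for i
  have "(\<Sum>i\<le>?m. c i * s ^ i) = 0" if s: "s \<ge> 0" for s
  proof -
    define a b where "a = sqrt (1 / (1 + s))" and "b = sqrt (s / (1 + s))"
    have ab: "a\<^sup>2 = 1 / (1 + s)" "b\<^sup>2 = s / (1 + s)" using s by (auto simp: a_def b_def)
    then have "a\<^sup>2 + b\<^sup>2 = 1" using s by (simp add: add_divide_distrib[symmetric])
    from entry_rotation_identity[OF j this, of ?m]
    have "M = (\<Sum>i\<le>?m. (real (?m choose i))\<^sup>2 * (b\<^sup>2) ^ i * (a\<^sup>2) ^ (?m - i) * e i)"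
      unfolding M_def e_def .
    then have "M * (1 + s) ^ ?m = (\<Sum>i\<le>?m. (real (?m choose i))\<^sup>2 * (b\<^sup>2) ^ i * (a\<^sup>2) ^ (?m - i) * e i) * (1 + s) ^ ?m" by simp
    also have "\<dots> = (\<Sum>i\<le>?m. (real (?m choose i))\<^sup>2 * e i * s ^ i)"
      unfolding sum_distrib_right
    proof (intro sum.cong refl)
      fix i assume "i \<in> {..?m}"
      then have "(1 + s) ^ ?m = (1 + s) ^ i * (1 + s) ^ (?m - i)" by (simp flip: power_add)
      moreover have "1 + s \<noteq> 0" using s by simp
      ultimately show "(real (?m choose i))\<^sup>2 * (b\<^sup>2) ^ i * (a\<^sup>2) ^ (?m - i) * e i * (1 + s) ^ ?m = (real (?m choose i))\<^sup>2 * e i * s ^ i"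
        unfolding ab by (simp add: power_divide field_simps del: power_Suc)
    qed
    finally have "M * (1 + s) ^ ?m = (\<Sum>i\<le>?m. (real (?m choose i))\<^sup>2 * e i * s ^ i)" .
    moreover have "(1 + s) ^ ?m = (\<Sum>i\<le>?m. real (?m choose i) * s ^ i)"
      using binomial_ring[of s 1 ?m] by (simp add: add.commute del: power_Suc sum.atMost_Suc)
    then have "M * (1 + s) ^ ?m = (\<Sum>i\<le>?m. real (?m choose i) * M * s ^ i)"
      by (simp only: sum_distrib_left mult_ac)
    ultimately show ?thesis by (simp add: c_def left_diff_distrib sum_subtractf)
  qed
  \<comment> \<open>The coefficient of s, with m = k + 1, reads m^2 e_1 = m M; here e_1 is the mixed
    moment in question.\<close>
  then have "c 1 = 0" by (rule polyfun_coeff_eq_0[where c=c and k=1 and m="Suc k"]) simp_all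
  then have "real ?m * (real ?m * e 1 - M) = 0" by (simp add: c_def power2_eq_square algebra_simps)
  then show ?thesis by (simp add: e_def M_def del: of_nat_Suc)
qed

text \<open>The column has norm 1, so |U_00|^(2k) is the sum of its products with all |U_i0|^2. The
  term i = 0 is the next moment, and each of the p + 1 others is that moment over k + 1. This is the
  recursion of \<open>beta_moment_Suc\<close>.\<close>

lemma entry_moment_Suc:
  "real (Suc k) * (\<integral>U. entry_sq 0 U ^ k \<partial>H) = real (k + p + 2) * (\<integral>U. entry_sq 0 U ^ Suc k \<partial>H)"
proof -
  let ?M = "\<lambda>k. \<integral>U. entry_sq 0 U ^ k \<partial>H"
  have int: "integrable H (\<lambda>U. entry_sq 0 U ^ k * entry_sq i U)" if "i < Suc (Suc p)" for i
    using integrable_entry_sq[OF that, of k 1] by simp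
  have "?M k = (\<integral>U. (\<Sum>i<Suc (Suc p). entry_sq 0 U ^ k * entry_sq i U) \<partial>H)"
  proof (intro Bochner_Integration.integral_cong refl)
    fix U assume "U \<in> space H"
    then have "(\<Sum>i<Suc (Suc p). entry_sq i U) = 1"
      using unitary_col_norm[of U "Suc (Suc p)" 0] by (simp add: haar_space[OF haar] entry_sq_def del: sum.lessThan_Suc)
    then show "entry_sq 0 U ^ k = (\<Sum>i<Suc (Suc p). entry_sq 0 U ^ k * entry_sq i U)"
      by (simp add: sum_distrib_left[symmetric] del: sum.lessThan_Suc)
  qed
  also have "\<dots> = (\<Sum>i<Suc (Suc p). (\<integral>U. entry_sq 0 U ^ k * entry_sq i U \<partial>H))"
    using int by (intro Bochner_Integration.integral_sum) auto
  also have "\<dots> = ?M (Suc k) + (\<Sum>i<Suc p. (\<integral>U. entry_sq 0 U ^ k * entry_sq (Suc i) U \<partial>H))"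
    unfolding sum.lessThan_Suc_shift[of _ "Suc p"] by (simp add: mult.commute)
  also have "(\<Sum>i<Suc p. (\<integral>U. entry_sq 0 U ^ k * entry_sq (Suc i) U \<partial>H)) = (\<Sum>i<Suc p. ?M (Suc k) / real (Suc k))"
  proof (intro sum.cong refl)
    fix i assume "i \<in> {..<Suc p}"
    then show "(\<integral>U. entry_sq 0 U ^ k * entry_sq (Suc i) U \<partial>H) = ?M (Suc k) / real (Suc k)"
      using entry_mixed_moment[of "Suc i" k] by (simp add: field_simps del: power_Suc of_nat_Suc)
  qed
  finally show ?thesis by (simp add: field_simps del: power_Suc)
qed

lemma entry_moment: "(\<integral>U. entry_sq 0 U ^ k \<partial>H) = integral {0..1} (\<lambda>x. x ^ k * beta_density p x)"
proof (induction k)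
  case 0
  then show ?case by (simp add: beta_moment_0 H.prob_space)
next
  case (Suc k)
  have "real (k + p + 2) * (\<integral>U. entry_sq 0 U ^ Suc k \<partial>H) = real (k + p + 2) * integral {0..1} (\<lambda>x. x ^ Suc k * beta_density p x)"
    unfolding entry_moment_Suc[symmetric] beta_moment_Suc[symmetric] Suc ..
  then show ?case by (simp del: power_Suc)
qed

lemma entry_sq_bounds: "U \<in> space H \<Longrightarrow> entry_sq 0 U \<in> {0..1}"
  using entry_le_1[of U 0] by (auto simp: entry_sq_def power_le_one)

lemma entry_sq_measurable [measurable]: "entry_sq 0 \<in> borel_measurable H"
  unfolding entry_sq_def[abs_def] by measurable

text \<open>Equal moments on [0, 1] give equal integrals of continuous functions by the Weierstrass
  theorem. This weak form of the law is enough for the powers and tent functions used below.\<close>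

lemma entry_sq_law:
  assumes f: "continuous_on {0..1} f"
  shows "(\<integral>U. f (entry_sq 0 U) \<partial>H) = integral {0..1} (\<lambda>x. f x * beta_density p x)"
    and "integrable H (\<lambda>U. f (entry_sq 0 U))"
proof -
  have fm: "(\<lambda>U. f (entry_sq 0 U)) \<in> borel_measurable H" if "continuous_on {0..1} f" for f :: "real \<Rightarrow> real"
  proof -
    have "entry_sq 0 \<in> measurable H (restrict_space borel {0..1})"
      using entry_sq_bounds by (intro measurable_restrict_space2 entry_sq_measurable) auto
    from measurable_compose[OF this borel_measurable_continuous_on_restrict[OF that]] show ?thesis .
  qed
  have fi: "integrable H (\<lambda>U. f (entry_sq 0 U))" if c: "continuous_on {0..1} f" for f :: "real \<Rightarrow> real"
  proof -
    have "bounded (f ` {0..1})" by (intro compact_imp_bounded compact_continuous_image c) auto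
    then obtain B where "\<forall>x\<in>{0..1}. norm (f x) \<le> B" unfolding bounded_iff by auto
    then show ?thesis
      using entry_sq_bounds by (intro H.integrable_const_bound[of _ B] fm c) (auto intro!: AE_I2)
  qed
  show "integrable H (\<lambda>U. f (entry_sq 0 U))" by (rule fi[OF f])
  have poly: "(\<integral>U. poly q (entry_sq 0 U) \<partial>H) = integral {0..1} (\<lambda>x. poly q x * beta_density p x)" for q
  proof -
    have fi': "integrable H (\<lambda>U. entry_sq 0 U ^ i)" for i
      by (rule fi) (intro continuous_intros)
    have "(\<integral>U. poly q (entry_sq 0 U) \<partial>H) = (\<Sum>i\<le>degree q. coeff q i * (\<integral>U. entry_sq 0 U ^ i \<partial>H))"
      unfolding poly_altdef using fi'
      by (subst Bochner_Integration.integral_sum) auto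
    also have "\<dots> = (\<Sum>i\<le>degree q. integral {0..1} (\<lambda>x. coeff q i * (x ^ i * beta_density p x)))"
      by (simp add: entry_moment)
    also have "\<dots> = integral {0..1} (\<lambda>x. \<Sum>i\<le>degree q. coeff q i * (x ^ i * beta_density p x))"
      by (intro integral_sum[symmetric] integrable_continuous_real continuous_intros) auto
    finally show ?thesis by (simp add: poly_altdef sum_distrib_right mult.assoc)
  qed
  have "\<bar>(\<integral>U. f (entry_sq 0 U) \<partial>H) - integral {0..1} (\<lambda>x. f x * beta_density p x)\<bar> \<le> 0 + e" if "e > 0" for e
  proof -
    obtain q where q: "\<And>x. x \<in> {0..1} \<Longrightarrow> \<bar>f x - poly q x\<bar> < e / 2"
      using real_poly_dense_unit_interval[OF f half_gt_zero[OF \<open>e > 0\<close>]] by blast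
    have cq: "continuous_on {0..1} (poly q)" by (intro continuous_intros)
    have "\<bar>(\<integral>U. f (entry_sq 0 U) \<partial>H) - (\<integral>U. poly q (entry_sq 0 U) \<partial>H)\<bar> = \<bar>\<integral>U. f (entry_sq 0 U) - poly q (entry_sq 0 U) \<partial>H\<bar>"
      using fi[OF f] fi[OF cq] by simp
    also have "\<dots> \<le> (\<integral>U. \<bar>f (entry_sq 0 U) - poly q (entry_sq 0 U)\<bar> \<partial>H)" by (rule integral_abs_bound)
    also have "\<dots> \<le> (\<integral>U. e / 2 \<partial>H)"
      using fi[OF f] fi[OF cq] q entry_sq_bounds by (intro integral_mono) (auto intro: less_imp_le)
    finally have 1: "\<bar>(\<integral>U. f (entry_sq 0 U) \<partial>H) - (\<integral>U. poly q (entry_sq 0 U) \<partial>H)\<bar> \<le> e / 2" by (simp add: H.prob_space)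
    have "\<bar>integral {0..1} (\<lambda>x. f x * beta_density p x) - integral {0..1} (\<lambda>x. poly q x * beta_density p x)\<bar>
       = \<bar>integral {0..1} (\<lambda>x. (f x - poly q x) * beta_density p x)\<bar>"
      unfolding left_diff_distrib
      by (subst Henstock_Kurzweil_Integration.integral_diff) (auto intro!: integrable_continuous_real continuous_intros f)
    also have "\<dots> \<le> integral {0..1} (\<lambda>x. e / 2 * beta_density p x)"
    proof (subst real_norm_def[symmetric], rule integral_norm_bound_integral)
      fix x :: real assume x: "x \<in> {0..1}"
      then show "norm ((f x - poly q x) * beta_density p x) \<le> e / 2 * beta_density p x"
        unfolding norm_mult using q[OF x] beta_density_nonneg[of x p] \<open>e > 0\<close>
        by (intro mult_mono) auto
    qed (auto intro!: integrable_continuous_real continuous_intros f)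
    also have "\<dots> = e / 2" by (simp add: beta_moment_0)
    finally show ?thesis using 1 poly[of q] by linarith
  qed
  then show "(\<integral>U. f (entry_sq 0 U) \<partial>H) = integral {0..1} (\<lambda>x. f x * beta_density p x)"
    using field_le_epsilon[of "\<bar>(\<integral>U. f (entry_sq 0 U) \<partial>H) - integral {0..1} (\<lambda>x. f x * beta_density p x)\<bar>" 0] by simp
qed

text \<open>The density is (p + 1)(1 - x)^p, so at m = p + 1 the power (1 - x)^(-m) just fails to be
  integrable. With the shift, (1 - x)^p \<le> (1 - x + \<eta>)^(m - 1) bounds the integrand by (p +
  1) / \<eta>, a cost that is only linear in the size.\<close>

lemma entry_upper:
  assumes \<eta>: "\<eta> > 0" and m: "1 \<le> m" "m \<le> Suc p"
  shows "(\<integral>\<^sup>+U. ennreal (1 / (1 - (cmod (U $$ (0, 0)))\<^sup>2 + \<eta>) ^ m) \<partial>H) \<le> ennreal (real (Suc p) / \<eta>)"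
proof -
  define f where "f x = 1 / (1 - x + \<eta>) ^ m" for x :: real
  have c: "continuous_on {0..1} f" unfolding f_def using \<eta> by (intro continuous_intros) auto
  have "(\<integral>\<^sup>+U. ennreal (f (entry_sq 0 U)) \<partial>H) = ennreal (\<integral>U. f (entry_sq 0 U) \<partial>H)"
    using entry_sq_bounds \<eta> by (intro nn_integral_eq_integral entry_sq_law(2) c) (auto intro!: AE_I2 simp: f_def)
  also have "(\<integral>U. f (entry_sq 0 U) \<partial>H) = integral {0..1} (\<lambda>x. f x * beta_density p x)" by (rule entry_sq_law(1)[OF c])
  also have "\<dots> \<le> integral {0..1} (\<lambda>x::real. real (Suc p) / \<eta>)"
  proof (rule integral_le)
    fix x :: real assume x: "x \<in> {0..1}"
    have "(1 - x) ^ p \<le> (1 - x) ^ (m - 1)" using x m by (intro power_decreasing) auto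
    also have "\<dots> \<le> (1 - x + \<eta>) ^ (m - 1)" using x \<eta> by (intro power_mono) auto
    finally have "f x * (1 - x) ^ p \<le> f x * (1 - x + \<eta>) ^ (m - 1)"
      using x \<eta> by (intro mult_left_mono) (auto simp: f_def)
    also have "\<dots> = 1 / (1 - x + \<eta>)"
      using m x \<eta> power_minus_mult[of m "1 - x + \<eta>"] by (simp add: f_def field_simps)
    also have "\<dots> \<le> 1 / \<eta>" using x \<eta> by (intro divide_left_mono) auto
    finally have "real (Suc p) * (f x * (1 - x) ^ p) \<le> real (Suc p) * (1 / \<eta>)" by (intro mult_left_mono) auto
    then show "f x * beta_density p x \<le> real (Suc p) / \<eta>" by (simp add: beta_density_def mult_ac)
  qed (auto intro!: integrable_continuous_real continuous_intros c)
  finally show ?thesis by (simp add: f_def entry_sq_def ennreal_leI)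
qed

text \<open>A tent function below the indicator is at least 1/2 on the middle half of the interval,
  of length d/2, and the density there is at least (1 - x0 - d)^p; hence the constant d/4.\<close>

lemma entry_modulus_lower:
  assumes x0: "0 \<le> x0" and d: "0 < d" "x0 + d \<le> 1"
  shows "measure H {U \<in> space H. entry_sq 0 U \<in> {x0<..<x0 + d}} \<ge> d / 4 * (1 - x0 - d) ^ p"
proof -
  define f where "f x = max 0 (1 - \<bar>x - (x0 + d / 2)\<bar> * (2 / d))" for x :: real
  have c: "continuous_on S f" for S unfolding f_def by (intro continuous_intros)
  have f_le: "f x \<le> indicator {x0<..<x0 + d} x" for x
    using d by (auto simp: f_def indicator_def field_simps abs_if split: if_splits)
  have f0: "f x \<ge> 0" for x by (simp add: f_def)
  let ?A = "{U \<in> space H. entry_sq 0 U \<in> {x0<..<x0 + d}}"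
  have A: "?A \<in> sets H" by measurable
  let ?I = "{x0 + d / 4..x0 + 3 * d / 4}"
  have "d / 4 * (1 - x0 - d) ^ p = integral ?I (\<lambda>x. 1 / 2 * (1 - x0 - d) ^ p)"
    using d by (simp add: field_simps)
  also have "\<dots> \<le> integral ?I (\<lambda>x. f x * beta_density p x)"
  proof (rule integral_le)
    fix x assume x: "x \<in> ?I"
    have "1 / 2 \<le> f x" using x d by (auto simp: f_def field_simps abs_if)
    moreover have "(1 - x0 - d) ^ p \<le> beta_density p x"
    proof -
      have "(1 - x0 - d) ^ p \<le> (1 - x) ^ p" using x d x0 by (intro power_mono) auto
      also have "\<dots> \<le> real (Suc p) * (1 - x) ^ p"
        using x d x0 mult_right_mono[of 1 "real (Suc p)" "(1 - x) ^ p"] by simp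
      finally show ?thesis by (simp add: beta_density_def)
    qed
    ultimately show "1 / 2 * (1 - x0 - d) ^ p \<le> f x * beta_density p x"
      using d by (intro mult_mono f0) auto
  qed (auto intro!: integrable_continuous_real continuous_intros c)
  also have "\<dots> \<le> integral {0..1} (\<lambda>x. f x * beta_density p x)"
    using d x0 f0 beta_density_nonneg
    by (intro integral_subset_le) (auto intro!: integrable_continuous_real continuous_intros c mult_nonneg_nonneg)
  also have "\<dots> = (\<integral>U. f (entry_sq 0 U) \<partial>H)" by (rule entry_sq_law(1)[OF c, symmetric])
  also have "\<dots> \<le> (\<integral>U. indicator ?A U \<partial>H)"
  proof (intro integral_mono entry_sq_law(2) c)
    show "integrable H (indicat_real ?A)"
      by (rule integrable_real_indicator[OF A]) (simp add: H.emeasure_eq_measure)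
    fix U assume U: "U \<in> space H"
    have "f (entry_sq 0 U) \<le> indicator {x0<..<x0 + d} (entry_sq 0 U)" by (rule f_le)
    also have "\<dots> = indicator ?A U" using U by (simp add: indicator_def)
    finally show "f (entry_sq 0 U) \<le> indicator ?A U" .
  qed
  also have "\<dots> = measure H ?A" using A by simp
  finally show ?thesis .
qed

end

section \<open>From annuli to discs by phase rotations\<close>

lemma norm_cis_diff_le: "cmod (cis a - cis b) \<le> \<bar>a - b\<bar>"
proof -
  have "cis a - cis b = cis b * (cis (a - b) - 1)"
    by (simp add: algebra_simps cis_mult)
  then have "cmod (cis a - cis b) = dist (exp (\<i> * of_real (a - b))) 1"
    by (simp only: norm_mult dist_norm cis_conv_exp[symmetric] norm_cis mult_1)
  also have "\<dots> = 2 * \<bar>sin ((a - b) / 2)\<bar>" unfolding dist_norm by (rule dist_exp_i_1)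
  also have "\<dots> \<le> 2 * \<bar>(a - b) / 2\<bar>" by (intro mult_left_mono abs_sin_x_le_abs_x) simp
  finally show ?thesis by simp
qed

lemma exists_rotation_close:
  assumes M: "M > 0" and w: "cmod w = 1"
  shows "\<exists>j<M. cmod (cis (2 * pi * real j / real M) - w) \<le> 2 * pi / real M"
proof -
  define t where "t = Arg2pi w"
  have t: "0 \<le> t" "t < 2 * pi" "w = cis t"
    using Arg2pi[of w] complex_norm_eq_1_exp[of w] w by (auto simp: t_def cis_conv_exp)
  define j where "j = nat \<lfloor>t * real M / (2 * pi)\<rfloor>"
  have nn: "t * real M / (2 * pi) \<ge> 0" using t by simp
  have j1: "real j \<le> t * real M / (2 * pi)" "t * real M / (2 * pi) < real j + 1"
    using nn by (auto simp: j_def)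
  have "t * real M / (2 * pi) < real M" using t M by (simp add: field_simps)
  then have "j < M" using j1 by linarith
  moreover have "\<bar>2 * pi * real j / real M - t\<bar> \<le> 2 * pi / real M"
  proof -
    have "2 * pi * real j / real M \<le> t" using j1(1) M by (simp add: field_simps)
    moreover have "t \<le> 2 * pi * real j / real M + 2 * pi / real M" using j1(2) M by (simp add: field_simps)
    ultimately show ?thesis by linarith
  qed
  ultimately show ?thesis using norm_cis_diff_le[of "2 * pi * real j / real M" t] t(3) by (intro exI[of _ j]) auto
qed

text \<open>A thin annulus just outside radius |\<alpha>| is covered by M rotated copies of the disc
  of radius e about \<alpha>. By phase invariance all copies are equally likely, so the disc has at
  least 1/M of the mass of the annulus. M and d do not depend on p, which makes \<kappa> uniform in
  the size.\<close>

lemma entry_lower: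
  assumes \<alpha>: "cmod \<alpha> < 1" and e: "e > 0" and \<eta>: "0 < \<eta>" "\<eta> \<le> 1 - (cmod \<alpha>)\<^sup>2"
  shows "\<exists>\<kappa>>0. \<forall>p H. haar_prob (Suc (Suc p)) H \<longrightarrow>
    measure H {U \<in> space H. cmod (U $$ (0, 0) - \<alpha>) < e} \<ge> \<kappa> * (1 - (cmod \<alpha>)\<^sup>2 - \<eta>) ^ p"
proof -
  \<comment> \<open>d \<le> \<eta> protects the base of the power, and d \<le> (e/2)^2 makes the
    radial error less than e/2; M below takes care of the angular error.\<close>
  define d where "d = min \<eta> (e\<^sup>2 / 4)"
  have d: "0 < d" "d \<le> \<eta>" "d \<le> (e / 2)\<^sup>2" using e \<eta> by (auto simp: d_def power_divide)
  obtain M :: nat where M: "2 * pi / (e / 2) < real M" using reals_Archimedean2 by blast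
  have M0: "M > 0" using M e by (metis divide_pos_pos half_gt_zero less_trans of_nat_0_less_iff pi_gt_zero mult_pos_pos zero_less_numeral)
  have M1: "2 * pi / real M < e / 2" using M M0 e by (simp add: field_simps)
  have "measure H {U \<in> space H. cmod (U $$ (0, 0) - \<alpha>) < e} \<ge> d / 4 / real M * (1 - (cmod \<alpha>)\<^sup>2 - \<eta>) ^ p"
    if haar: "haar_prob (Suc (Suc p)) H" for p H
  proof -
    interpret H: prob_space H by (rule haar_prob_space[OF haar])
    note [measurable] = entry_measurable[OF haar, of 0, simplified]
    let ?A = "{U \<in> space H. entry_sq 0 U \<in> {(cmod \<alpha>)\<^sup>2<..<(cmod \<alpha>)\<^sup>2 + d}}"
    define B where "B t = {U \<in> space H. cmod (cis t * U $$ (0, 0) - \<alpha>) < e}" for t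
    have B_meas: "B t \<in> sets H" for t unfolding B_def by measurable
    have B_eq: "measure H (B t) = measure H (B 0)" for t
    proof -
      have "measure H (B 0) = (\<integral>U. indicator (B 0) U \<partial>H)" using B_meas by simp
      also have "\<dots> = (\<integral>U. indicator (B 0) (phase_mat (Suc (Suc p)) 0 t * U) \<partial>H)"
        by (rule haar_left_integral[OF haar phase_mat_unitary[OF haar], symmetric]) (use B_meas in simp)
      also have "\<dots> = (\<integral>U. indicator (B t) U \<partial>H)"
      proof (intro Bochner_Integration.integral_cong refl)
        fix U assume U: "U \<in> space H"
        have "phase_mat (Suc (Suc p)) 0 t * U \<in> space H"
          using U phase_mat_unitary[OF haar] unitary_group_mult by (simp add: haar_space[OF haar])
        then show "indicator (B 0) (phase_mat (Suc (Suc p)) 0 t * U) = (indicator (B t) U :: real)"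
          using phase_mat_entry[OF haar U, of 0 0 t] U by (simp add: B_def indicator_def)
      qed
      also have "\<dots> = measure H (B t)" using B_meas by simp
      finally show ?thesis ..
    qed
    have "?A \<subseteq> (\<Union>j<M. B (2 * pi * real j / real M))"
    proof
      fix U assume U: "U \<in> ?A"
      define r where "r = cmod (U $$ (0, 0))"
      define s where "s = cmod \<alpha>"
      have rs: "s\<^sup>2 < r\<^sup>2" "r\<^sup>2 < s\<^sup>2 + d" using U by (auto simp: entry_sq_def r_def s_def)
      have nn: "0 \<le> r" "0 \<le> s" by (simp_all add: r_def s_def)
      have "s < r" by (rule power_less_imp_less_base[OF rs(1) nn(1)])
      then have nr: "cmod (of_real (r - s)) = r - s" by (simp only: norm_of_real)
      have "(r - s)\<^sup>2 \<le> r\<^sup>2 - s\<^sup>2"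
        using mult_nonneg_nonneg[of s "r - s"] nn \<open>s < r\<close> by (simp add: power2_eq_square algebra_simps)
      then have "(r - s)\<^sup>2 < (e / 2)\<^sup>2" using rs d by linarith
      then have rs': "r - s < e / 2" using e by (intro power_less_imp_less_base[of "r - s" 2 "e / 2"]) auto
      define v where "v = U $$ (0, 0) / of_real r"
      \<comment> \<open>For \<alpha> = 0 every phase is right. No such case arises for v, since r >
        |\<alpha>| \<ge> 0.\<close>
      define v0 where "v0 = (if s = 0 then 1 else \<alpha> / of_real s)"
      have v: "cmod v = 1" "U $$ (0, 0) = of_real r * v"
        using \<open>s < r\<close> nn by (auto simp: v_def norm_divide r_def)
      have v0: "cmod v0 = 1" "\<alpha> = of_real s * v0"
        by (auto simp: v0_def s_def norm_divide)
      have "cmod (v0 / v) = 1" using v v0 by (simp add: norm_divide)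
      then obtain j where j: "j < M" "cmod (cis (2 * pi * real j / real M) - v0 / v) \<le> 2 * pi / real M"
        using exists_rotation_close[OF M0] by blast
      let ?c = "cis (2 * pi * real j / real M)"
      have "?c * U $$ (0, 0) - \<alpha> = v * (of_real (r - s) * ?c + of_real s * (?c - v0 / v))"
        using v by (subst v0(2), subst v(2)) (auto simp: field_simps)
      then have "cmod (?c * U $$ (0, 0) - \<alpha>) = cmod (of_real (r - s) * ?c + of_real s * (?c - v0 / v))"
        using v(1) by (simp only: norm_mult mult_1)
      also have "\<dots> \<le> cmod (of_real (r - s) * ?c) + cmod (of_real s * (?c - v0 / v))"
        by (rule norm_triangle_ineq)
      also have "\<dots> \<le> (r - s) + 1 * (2 * pi / real M)"
        unfolding norm_mult nr using j(2) \<open>s < r\<close> nn \<alpha>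
        by (intro add_mono mult_mono) (auto simp: s_def)
      also have "\<dots> < e" using rs' M1 by simp
      finally show "U \<in> (\<Union>j<M. B (2 * pi * real j / real M))" using j U by (auto simp: B_def)
    qed
    then have "measure H ?A \<le> measure H (\<Union>j<M. B (2 * pi * real j / real M))"
      using B_meas by (intro H.finite_measure_mono sets.finite_UN) auto
    also have "\<dots> \<le> (\<Sum>j<M. measure H (B (2 * pi * real j / real M)))"
      using B_meas by (intro H.finite_measure_subadditive_finite) auto
    also have "\<dots> = real M * measure H (B 0)" by (subst B_eq) simp
    finally have "measure H ?A \<le> real M * measure H (B 0)" .
    moreover have "measure H ?A \<ge> d / 4 * (1 - (cmod \<alpha>)\<^sup>2 - d) ^ p"
      using d \<eta> by (intro entry_modulus_lower[OF haar]) auto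
    moreover have "d / 4 * (1 - (cmod \<alpha>)\<^sup>2 - \<eta>) ^ p \<le> d / 4 * (1 - (cmod \<alpha>)\<^sup>2 - d) ^ p"
      using d \<eta> by (intro mult_left_mono power_mono) auto
    ultimately have "d / 4 * (1 - (cmod \<alpha>)\<^sup>2 - \<eta>) ^ p \<le> real M * measure H (B 0)" by linarith
    then show ?thesis using M0 by (simp add: B_def field_simps)
  qed
  moreover have "d / 4 / real M > 0" using d M0 by simp
  ultimately show ?thesis by blast
qed

section \<open>The normalized arc measure\<close>

lemma arc_circle_probs: "arc_measure \<in> circle_probs"
proof -
  have "prob_space (uniform_measure lborel {0..<2 * pi})"
    by (rule prob_space_uniform_measure) auto
  then interpret prob_space "uniform_measure lborel {0..<2 * pi}" .
  have "continuous_on UNIV cis" by (intro continuous_on_cis continuous_intros)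
  then have "cis \<in> borel_measurable borel" by (rule borel_measurable_continuous_onI)
  then have "cis \<in> measurable (uniform_measure lborel {0..<2 * pi}) circle_borel"
    unfolding circle_borel_def by (intro measurable_restrict_space2) auto
  from prob_space_distr[OF this] show ?thesis
    by (simp add: circle_probs_def arc_measure_def)
qed

lemma moments_arc: "moments arc_measure k = (if k = 0 then 1 else 0)"
proof -
  interpret arc: prob_space arc_measure by (rule circle_probsD(1)[OF arc_circle_probs])
  show ?thesis
  proof (cases "k = 0")
    case True
    then show ?thesis by (simp add: moments_def arc.prob_space)
  next
    case False
    \<comment> \<open>c = 1 / (2 \<pi> i k), so that c exp(i k t) is a primitive of the
      integrand.\<close>
    define c where "c = complex_of_real (1 / (2 * pi * real k)) * (- \<i>)"
    have cont: "continuous_on S cis" for S by (intro continuous_on_cis continuous_intros)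
    have cis_meas: "cis \<in> borel_measurable borel" by (intro borel_measurable_continuous_onI cont)
    have m: "cis \<in> measurable (uniform_measure lborel {0..<2 * pi}) circle_borel"
      unfolding circle_borel_def using cis_meas by (intro measurable_restrict_space2) auto
    have f: "(\<lambda>z. z ^ k) \<in> borel_measurable circle_borel"
      by (intro continuous_on_circle_measurable continuous_intros refl)
    have "moments arc_measure k = (\<integral>t. cis t ^ k \<partial>uniform_measure lborel {0..<2 * pi})"
      unfolding moments_def arc_measure_def by (rule integral_distr[OF m f])
    also have "\<dots> = (\<integral>t. cis (real k * t) \<partial>density lborel (\<lambda>t. ennreal (indicator {0..<2 * pi} t / (2 * pi))))"
      unfolding uniform_measure_def Complex.DeMoivre
      by (intro arg_cong2[where f="integral\<^sup>L"] density_cong refl)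
         (auto simp: indicator_def divide_ennreal[symmetric] ennreal_mult[symmetric] intro!: AE_I2)
    also have "\<dots> = (\<integral>t. (indicator {0..<2 * pi} t / (2 * pi)) *\<^sub>R cis (real k * t) \<partial>lborel)"
      by (intro integral_density measurable_compose[OF _ cis_meas]) (auto intro!: AE_I2)
    also have "\<dots> = (\<integral>t. indicator {0..2 * pi} t *\<^sub>R ((1 / (2 * pi)) *\<^sub>R cis (real k * t)) \<partial>lborel)"
    proof (intro integral_cong_AE)
      have "AE t in lborel. t \<noteq> 2 * pi" by (rule AE_lborel_singleton)
      then show "AE t in lborel. (indicator {0..<2 * pi} t / (2 * pi)) *\<^sub>R cis (real k * t) =
          indicator {0..2 * pi} t *\<^sub>R ((1 / (2 * pi)) *\<^sub>R cis (real k * t))"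
        by eventually_elim (auto simp: indicator_def)
    qed (intro borel_measurable_scaleR measurable_compose[OF _ cis_meas] borel_measurable_divide borel_measurable_indicator; simp)+
    also have "\<dots> = (\<lambda>t. c * cis (real k * t)) (2 * pi) -
        (\<lambda>t. c * cis (real k * t)) 0"
    proof (rule integral_FTC_Icc)
      fix t :: real
      have d: "((\<lambda>t. cis (real k * t)) has_vector_derivative (real k *\<^sub>R (\<i> * cis (real k * t)))) (at t within {0..2 * pi})"
        unfolding cis_conv_exp
        by (auto intro!: derivative_eq_intros has_vector_derivative_real_field simp: scaleR_conv_of_real)
      have "((\<lambda>t. c * cis (real k * t)) has_vector_derivative c * (real k *\<^sub>R (\<i> * cis (real k * t)))) (at t within {0..2 * pi})"
        by (intro has_vector_derivative_mult_right d)
      also have "c * (real k *\<^sub>R (\<i> * cis (real k * t))) = (1 / (2 * pi)) *\<^sub>R cis (real k * t)"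
        using False by (simp add: c_def scaleR_conv_of_real field_simps)
      finally show "((\<lambda>t. c * cis (real k * t)) has_vector_derivative
          (1 / (2 * pi)) *\<^sub>R cis (real k * t)) (at t within {0..2 * pi})" .
    next
      show "continuous_on {0..2 * pi} (\<lambda>t. (1 / (2 * pi)) *\<^sub>R cis (real k * t))"
        by (intro continuous_intros continuous_on_compose2[OF cont]) auto
    qed auto
    also have "\<dots> = 0"
      using cis_multiple_2pi[of "real k"] by (simp add: mult.commute)
    finally show ?thesis using False by simp
  qed
qed

section \<open>Mean values of analytic functions and outer functions\<close>

lemma integral_arc_poly: "(\<integral>z. poly p z \<partial>arc_measure) = poly p 0"
proof -
  have "(\<integral>z. poly p z \<partial>arc_measure) = (\<Sum>i\<le>degree p. coeff p i * (if i = 0 then 1 else 0))"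
    unfolding integral_poly[OF arc_circle_probs] moments_arc ..
  also have "\<dots> = (\<Sum>i\<le>degree p. if i = 0 then coeff p 0 else 0)" by (intro sum.cong) auto
  also have "\<dots> = poly p 0" by (simp add: poly_0_coeff_0)
  finally show ?thesis .
qed

lemma integral_arc_Re_poly: "(\<integral>z. Re (poly p z) \<partial>arc_measure) = Re (poly p 0)"
proof -
  have "continuous_on circle (poly p)" by (intro continuous_intros)
  then have "integrable arc_measure (poly p)" by (rule continuous_on_circle_integrable[OF _ arc_circle_probs])
  then show ?thesis using integral_arc_poly[of p] by (subst integral_Re) auto
qed

text \<open>Taylor sections of exp p. Being polynomials that converge uniformly on the circle and at
  0, they pass the mean value property on to exp p and also furnish polynomial approximations of the
  outer function exp (-p / 2).\<close>

definition exp_poly :: "complex poly \<Rightarrow> nat \<Rightarrow> complex poly" where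
  "exp_poly p n = (\<Sum>j<n. [:1 / fact j:] * p ^ j)"

lemma poly_exp_poly: "poly (exp_poly p n) z = (\<Sum>j<n. poly p z ^ j /\<^sub>R fact j)"
  unfolding exp_poly_def by (simp add: poly_sum scaleR_conv_of_real divide_inverse)

lemma exp_poly_uniform: "uniform_limit circle (\<lambda>n z. poly (exp_poly p n) z) (\<lambda>z. exp (poly p z)) sequentially"
proof -
  have "continuous_on circle (poly p)" by (intro continuous_intros)
  then obtain B where B: "B \<ge> 0" "\<And>z. z \<in> circle \<Longrightarrow> norm (poly p z) \<le> B"
    using continuous_on_circle_bounded by metis
  have "uniform_limit circle (\<lambda>n z. \<Sum>j<n. poly p z ^ j /\<^sub>R fact j) (\<lambda>z. suminf (\<lambda>j. poly p z ^ j /\<^sub>R fact j)) sequentially"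
  proof (rule Weierstrass_m_test)
    show "norm (poly p z ^ j /\<^sub>R fact j) \<le> B ^ j /\<^sub>R fact j" if "z \<in> circle" for j z
      using B(2)[OF that] by (simp add: norm_power power_mono divide_right_mono)
    show "summable (\<lambda>j. B ^ j /\<^sub>R fact j)" by (rule summable_exp_generic)
  qed
  then show ?thesis by (simp add: poly_exp_poly exp_def)
qed

lemma exp_poly_pointwise: "(\<lambda>n. poly (exp_poly p n) z) \<longlonglongrightarrow> exp (poly p z)"
  unfolding poly_exp_poly exp_def using summable_LIMSEQ[OF summable_exp_generic[of "poly p z"]] .

lemma integral_uniform_limit:
  fixes F :: "nat \<Rightarrow> complex \<Rightarrow> 'b::{banach,second_countable_topology}"
  assumes \<mu>: "\<mu> \<in> circle_probs" and F: "\<And>n. continuous_on circle (F n)"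
    and lim: "uniform_limit circle F G sequentially"
  shows "(\<lambda>n. \<integral>z. F n z \<partial>\<mu>) \<longlonglongrightarrow> (\<integral>z. G z \<partial>\<mu>)"
proof -
  interpret prob_space \<mu> by (rule circle_probsD(1)[OF \<mu>])
  have G: "continuous_on circle G" by (rule uniform_limit_theorem[OF _ lim]) (auto simp: F)
  show ?thesis
  proof (rule LIMSEQ_I)
    fix r :: real assume r: "0 < r"
    from uniform_limitD[OF lim half_gt_zero[OF r]] obtain N where N: "\<forall>n\<ge>N. \<forall>z\<in>circle. dist (F n z) (G z) < r / 2"
      unfolding eventually_sequentially by blast
    show "\<exists>no. \<forall>n\<ge>no. norm ((\<integral>z. F n z \<partial>\<mu>) - (\<integral>z. G z \<partial>\<mu>)) < r"
    proof (intro exI[of _ N] allI impI)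
      fix n assume n: "N \<le> n"
      have i: "integrable \<mu> (F n)" "integrable \<mu> G"
        by (auto intro: continuous_on_circle_integrable F G \<mu>)
      have "norm ((\<integral>z. F n z \<partial>\<mu>) - (\<integral>z. G z \<partial>\<mu>)) = norm (\<integral>z. F n z - G z \<partial>\<mu>)" using i by simp
      also have "\<dots> \<le> (\<integral>z. norm (F n z - G z) \<partial>\<mu>)" by (rule integral_norm_bound)
      also have "\<dots> \<le> (\<integral>z. r / 2 \<partial>\<mu>)"
        using i bspec[OF spec[OF N, THEN mp, OF n]] circle_probsD(3)[OF \<mu>]
        by (intro integral_mono) (auto simp: dist_norm intro: less_imp_le)
      also have "\<dots> < r" using r by (simp add: prob_space)
      finally show "norm ((\<integral>z. F n z \<partial>\<mu>) - (\<integral>z. G z \<partial>\<mu>)) < r" .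
    qed
  qed
qed

lemma uniform_limit_mult_poly:
  "uniform_limit circle (\<lambda>n z. poly P z * poly (exp_poly p n) z) (\<lambda>z. poly P z * exp (poly p z)) sequentially"
proof -
  have 1: "bounded (poly P ` circle)" "bounded ((\<lambda>z. exp (poly p z)) ` circle)"
    by (intro compact_imp_bounded compact_continuous_image compact_sphere continuous_intros)+
  show ?thesis
    by (rule uniform_lim_mult[OF uniform_limit_const exp_poly_uniform 1])
qed

lemma integral_arc_poly_exp: "(\<integral>z. poly P z * exp (poly p z) \<partial>arc_measure) = poly P 0 * exp (poly p 0)"
proof -
  have "(\<lambda>n. \<integral>z. poly P z * poly (exp_poly p n) z \<partial>arc_measure) \<longlonglongrightarrow> (\<integral>z. poly P z * exp (poly p z) \<partial>arc_measure)"
    by (rule integral_uniform_limit[OF arc_circle_probs _ uniform_limit_mult_poly]) (intro continuous_intros)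
  moreover have "(\<integral>z. poly P z * poly (exp_poly p n) z \<partial>arc_measure) = poly P 0 * poly (exp_poly p n) 0" for n
    using integral_arc_poly[of "P * exp_poly p n"] by simp
  moreover have "(\<lambda>n. poly P 0 * poly (exp_poly p n) 0) \<longlonglongrightarrow> poly P 0 * exp (poly p 0)"
    by (intro tendsto_intros exp_poly_pointwise)
  ultimately show ?thesis using LIMSEQ_unique by auto
qed

lemma square_norm_integral_le:
  assumes \<mu>: "\<mu> \<in> circle_probs" and F: "continuous_on circle F"
  shows "(cmod (\<integral>z. F z \<partial>\<mu>))\<^sup>2 \<le> (\<integral>z. (cmod (F z))\<^sup>2 \<partial>\<mu>)"
proof -
  interpret prob_space \<mu> by (rule circle_probsD(1)[OF \<mu>])
  define m where "m = (\<integral>z. cmod (F z) \<partial>\<mu>)"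
  have i: "integrable \<mu> (\<lambda>z. cmod (F z))" "integrable \<mu> (\<lambda>z. (cmod (F z))\<^sup>2)"
    by (intro continuous_on_circle_integrable[OF _ \<mu>] continuous_intros F)+
  have "0 \<le> (\<integral>z. (cmod (F z) - m)\<^sup>2 \<partial>\<mu>)" by simp
  also have "\<dots> = (\<integral>z. (cmod (F z))\<^sup>2 - 2 * m * cmod (F z) + m\<^sup>2 \<partial>\<mu>)"
    by (intro Bochner_Integration.integral_cong refl) (simp add: power2_diff algebra_simps)
  also have "\<dots> = (\<integral>z. (cmod (F z))\<^sup>2 \<partial>\<mu>) - m\<^sup>2"
    using i by (simp add: prob_space m_def[symmetric] power2_eq_square)
  finally have "m\<^sup>2 \<le> (\<integral>z. (cmod (F z))\<^sup>2 \<partial>\<mu>)" by simp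
  moreover have "cmod (\<integral>z. F z \<partial>\<mu>) \<le> m" unfolding m_def by (rule integral_norm_bound)
  then have "(cmod (\<integral>z. F z \<partial>\<mu>))\<^sup>2 \<le> m\<^sup>2" by (intro power_mono) auto
  ultimately show ?thesis by linarith
qed

lemma norm_exp_half: "(cmod (exp (w / 2)))\<^sup>2 = exp (Re w)"
  by (simp add: power2_eq_square flip: exp_add)

text \<open>The mean of P exp (p / 2) is its value at 0, the squared modulus of a mean is at most
  the mean of the squared modulus, and |exp (p / 2)|^2 = exp (Re p).\<close>

lemma integral_arc_poly_exp_ge:
  assumes P: "poly P 0 = 1"
  shows "exp (Re (poly p 0)) \<le> (\<integral>z. (cmod (poly P z))\<^sup>2 * exp (Re (poly p z)) \<partial>arc_measure)"
proof -
  let ?q = "[:1/2:] * p"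
  have h: "poly ?q z = poly p z / 2" for z by simp
  have "exp (Re (poly p 0)) = (cmod (poly P 0 * exp (poly ?q 0)))\<^sup>2"
    unfolding h P by (simp add: norm_exp_half del: norm_exp_eq_Re)
  also have "\<dots> = (cmod (\<integral>z. poly P z * exp (poly ?q z) \<partial>arc_measure))\<^sup>2"
    unfolding integral_arc_poly_exp ..
  also have "\<dots> \<le> (\<integral>z. (cmod (poly P z * exp (poly ?q z)))\<^sup>2 \<partial>arc_measure)"
    by (intro square_norm_integral_le arc_circle_probs continuous_intros)
  also have "\<dots> = (\<integral>z. (cmod (poly P z))\<^sup>2 * exp (Re (poly p z)) \<partial>arc_measure)"
    unfolding h norm_mult power_mult_distrib norm_exp_half ..
  finally show ?thesis .
qed

text \<open>Jensen's inequality for the Mahler measure, without reference to the zeros of \<open>P\<close>: approximate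
  \<open>- ln v\<close> by the real part of a polynomial.\<close>

lemma integral_arc_ln_ge:
  assumes P: "poly P 0 = 1" and e: "e > 0"
  shows "0 \<le> (\<integral>z. ln ((cmod (poly P z))\<^sup>2 + e) \<partial>arc_measure)"
proof -
  interpret arc: prob_space arc_measure by (rule circle_probsD(1)[OF arc_circle_probs])
  define v where "v z = (cmod (poly P z))\<^sup>2 + e" for z
  have v: "v z > 0" for z using e by (simp add: v_def add_nonneg_pos)
  have "continuous_on circle v" unfolding v_def by (intro continuous_intros)
  then have cv: "continuous_on circle (\<lambda>z. ln (v z))"
    by (rule continuous_on_ln) (use v in \<open>auto simp: less_imp_neq[symmetric]\<close>)
  have "0 \<le> (\<integral>z. ln (v z) \<partial>arc_measure) + d" if d: "d > 0" for d
  proof -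
    have "continuous_on circle (\<lambda>z. - ln (v z))" by (intro continuous_intros cv)
    from trig_poly_dense[OF this half_gt_zero[OF d]]
    obtain p where p: "\<And>z. z \<in> circle \<Longrightarrow> \<bar>- ln (v z) - Re (poly p z)\<bar> < d / 2" by blast
    \<comment> \<open>As exp (Re p) is about 1/v and |P|^2 \<le> v, the right-hand side is at most
      exp (d/2). This bounds Re (p 0), the mean of Re p, which differs from the mean of -ln v by at
      most d/2. The summand e keeps v positive where P vanishes.\<close>
    have "exp (Re (poly p 0)) \<le> (\<integral>z. (cmod (poly P z))\<^sup>2 * exp (Re (poly p z)) \<partial>arc_measure)"
      by (rule integral_arc_poly_exp_ge[OF P])
    also have "\<dots> \<le> (\<integral>z. exp (d / 2) \<partial>arc_measure)"
    proof (rule integral_mono)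
      fix z assume "z \<in> space arc_measure"
      then have z: "z \<in> circle" using circle_probsD(3)[OF arc_circle_probs] by simp
      have "Re (poly p z) \<le> d / 2 - ln (v z)" using p[OF z] by linarith
      then have "exp (Re (poly p z)) \<le> exp (d / 2 - ln (v z))" by simp
      also have "\<dots> = exp (d / 2) / v z" using v[of z] by (simp add: exp_diff)
      finally have "(cmod (poly P z))\<^sup>2 * exp (Re (poly p z)) \<le> v z * (exp (d / 2) / v z)"
        using e by (intro mult_mono) (auto simp: v_def)
      then show "(cmod (poly P z))\<^sup>2 * exp (Re (poly p z)) \<le> exp (d / 2)" using v[of z] by simp
    qed (auto intro!: continuous_on_circle_integrable arc_circle_probs continuous_intros)
    also have "\<dots> = exp (d / 2)" by (simp add: arc.prob_space)
    finally have "Re (poly p 0) \<le> d / 2" by simp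
    moreover have "\<bar>(\<integral>z. - ln (v z) \<partial>arc_measure) - (\<integral>z. Re (poly p z) \<partial>arc_measure)\<bar> \<le> d / 2"
      using p by (intro integral_circle_dist_le arc_circle_probs continuous_intros cv) (auto intro: less_imp_le)
    moreover have "(\<integral>z. - ln (v z) \<partial>arc_measure) = - (\<integral>z. ln (v z) \<partial>arc_measure)" by simp
    ultimately show ?thesis unfolding integral_arc_Re_poly by linarith
  qed
  then show ?thesis unfolding v_def by (rule field_le_epsilon)
qed

text \<open>The outer function \<open>exp (- p / 2)\<close> replaces the Fejer-Riesz factorization.\<close>

lemma poly_outer_approx:
  assumes \<mu>: "\<mu> \<in> circle_probs" and lt: "(\<integral>z. exp (- Re (poly p z)) \<partial>\<mu>) * exp (Re (poly p 0)) < b"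
  obtains P where "poly P 0 = 1" "(\<integral>z. (cmod (poly P z))\<^sup>2 \<partial>\<mu>) < b"
proof -
  let ?q = "[:-1/2:] * p"
  have h: "poly ?q z = (- poly p z) / 2" for z by simp
  define F where "F n z = (cmod (poly (exp_poly ?q n) z))\<^sup>2" for n z
  have u: "uniform_limit circle F (\<lambda>z. exp (- Re (poly p z))) sequentially"
  proof -
    have "bounded ((\<lambda>z. cmod (exp (poly ?q z))) ` circle)"
      by (intro compact_imp_bounded compact_continuous_image compact_sphere continuous_intros)
    then have "uniform_limit circle (\<lambda>n z. cmod (poly (exp_poly ?q n) z) * cmod (poly (exp_poly ?q n) z))
        (\<lambda>z. cmod (exp (poly ?q z)) * cmod (exp (poly ?q z))) sequentially"
      by (intro uniform_lim_mult uniform_limit_norm exp_poly_uniform)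
    moreover have "(\<lambda>z. cmod (exp (poly ?q z)) * cmod (exp (poly ?q z))) = (\<lambda>z. exp (- Re (poly p z)))"
      using norm_exp_half[of "- poly p z" for z] by (simp only: h power2_eq_square uminus_complex.simps)
    ultimately show ?thesis by (simp only: F_def[abs_def] power2_eq_square)
  qed
  have 1: "(\<lambda>n. \<integral>z. F n z \<partial>\<mu>) \<longlonglongrightarrow> (\<integral>z. exp (- Re (poly p z)) \<partial>\<mu>)"
    by (rule integral_uniform_limit[OF \<mu> _ u]) (auto simp: F_def intro!: continuous_intros)
  have 2: "(\<lambda>n. (cmod (poly (exp_poly ?q n) 0))\<^sup>2) \<longlonglongrightarrow> (cmod (exp (poly ?q 0)))\<^sup>2"
    by (intro tendsto_intros exp_poly_pointwise)
  have e0: "(cmod (exp (poly ?q 0)))\<^sup>2 = exp (- Re (poly p 0))"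
    using norm_exp_half[of "- poly p 0"] by (simp only: h uminus_complex.simps)
  have "(\<lambda>n. (\<integral>z. F n z \<partial>\<mu>) / (cmod (poly (exp_poly ?q n) 0))\<^sup>2) \<longlonglongrightarrow>
      (\<integral>z. exp (- Re (poly p z)) \<partial>\<mu>) / exp (- Re (poly p 0))"
    using tendsto_divide[OF 1 2[unfolded e0]] by simp
  moreover have "(\<integral>z. exp (- Re (poly p z)) \<partial>\<mu>) / exp (- Re (poly p 0)) < b"
    using lt by (simp add: exp_minus field_simps)
  ultimately have "\<forall>\<^sub>F n in sequentially. (\<integral>z. F n z \<partial>\<mu>) / (cmod (poly (exp_poly ?q n) 0))\<^sup>2 < b"
    by (rule order_tendstoD(2))
  moreover have "\<forall>\<^sub>F n in sequentially. (cmod (poly (exp_poly ?q n) 0))\<^sup>2 > 0"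
    using order_tendstoD(1)[OF 2[unfolded e0], of 0] by simp
  ultimately have "\<forall>\<^sub>F n in sequentially. (\<integral>z. F n z \<partial>\<mu>) / (cmod (poly (exp_poly ?q n) 0))\<^sup>2 < b \<and>
      (cmod (poly (exp_poly ?q n) 0))\<^sup>2 > 0"
    by (rule eventually_conj)
  then obtain n where n: "(\<integral>z. F n z \<partial>\<mu>) / (cmod (poly (exp_poly ?q n) 0))\<^sup>2 < b" "poly (exp_poly ?q n) 0 \<noteq> 0"
    by (auto simp: eventually_sequentially)
  \<comment> \<open>Dividing by the value at 0 enforces P(0) = 1. That value tends to exp (-p(0) /
    2), and its modulus accounts for the factor exp (Re p(0)) in the assumption.\<close>
  define P where "P = [:1 / poly (exp_poly ?q n) 0:] * exp_poly ?q n"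
  have "poly P 0 = 1" using n(2) unfolding P_def by simp
  moreover have "(cmod (poly P z))\<^sup>2 = F n z / (cmod (poly (exp_poly ?q n) 0))\<^sup>2" for z
    unfolding P_def F_def by (simp add: norm_mult norm_divide power_mult_distrib power_divide)
  then have "(\<integral>z. (cmod (poly P z))\<^sup>2 \<partial>\<mu>) < b" using n(1) by simp
  ultimately show ?thesis using that by blast
qed

subsection \<open>Approximation of bounded functions by continuous ones\<close>

text \<open>Inner and outer regularity, applied to the image of the measure in the plane and pulled
  back to the circle.\<close>

lemma circle_closed_open_approx:
  assumes \<mu>: "\<mu> \<in> circle_probs" and A: "A \<in> sets circle_borel" and e: "e > 0"
  shows "\<exists>K G. closed K \<and> open G \<and> K \<subseteq> A \<and> A \<subseteq> G \<and> measure \<mu> (G \<inter> circle - K) < e"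
proof -
  interpret prob_space \<mu> by (rule circle_probsD(1)[OF \<mu>])
  note sp = circle_probsD[OF \<mu>]
  let ?M = "distr \<mu> borel (\<lambda>z. z)"
  have meas: "(\<lambda>z. z) \<in> measurable \<mu> borel"
    using sp by (intro continuous_on_circle_measurable continuous_intros) auto
  interpret M: prob_space ?M by (rule prob_space_distr[OF meas])
  have AM: "A \<in> sets borel" "A \<subseteq> circle"
    using A by (auto simp: circle_borel_def sets_restrict_space)
  have fin: "emeasure ?M (space ?M) \<noteq> \<infinity>" by (simp add: M.emeasure_space_1)
  have em: "measure ?M B = measure \<mu> (B \<inter> circle)" if "B \<in> sets borel" for B
    using that sp by (simp add: measure_distr[OF meas])
  have "emeasure ?M A = (SUP K \<in> {K. K \<subseteq> A \<and> compact K}. emeasure ?M K)"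
    by (rule inner_regular) (use AM fin in auto)
  \<comment> \<open>A set of measure 0 is treated apart, because nothing in \<open>ennreal\<close>
    is strictly below 0; there the empty compact set serves.\<close>
  moreover have "emeasure ?M A - ennreal (e / 2) < emeasure ?M A \<or> emeasure ?M A = 0"
    using e by (auto simp: M.emeasure_eq_measure ennreal_minus intro!: ennreal_lessI) (simp add: zero_less_measure_iff)
  ultimately have "\<exists>K. K \<subseteq> A \<and> compact K \<and> measure ?M A - e / 2 < measure ?M K"
  proof (elim disjE)
    assume 1: "emeasure ?M A = (SUP K \<in> {K. K \<subseteq> A \<and> compact K}. emeasure ?M K)"
      and 2: "emeasure ?M A - ennreal (e / 2) < emeasure ?M A"
    then obtain K where "K \<subseteq> A" "compact K" "emeasure ?M A - ennreal (e / 2) < emeasure ?M K"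
      by (auto simp: less_SUP_iff)
    moreover from this(3) have "measure ?M A - e / 2 < measure ?M K"
      using e by (cases "measure ?M A - e / 2 \<ge> 0")
        (auto simp: M.emeasure_eq_measure ennreal_minus ennreal_less_iff intro: less_le_trans[OF _ measure_nonneg])
    ultimately show ?thesis by blast
  next
    assume "emeasure ?M A = 0"
    then show ?thesis using e by (intro exI[of _ "{}"]) (auto simp: M.emeasure_eq_measure)
  qed
  then obtain K where K: "K \<subseteq> A" "compact K" "measure ?M A - e / 2 < measure ?M K" by blast
  have "emeasure ?M A = (INF U \<in> {U. A \<subseteq> U \<and> open U}. emeasure ?M U)"
    by (rule outer_regular) (use AM fin in auto)
  moreover have "emeasure ?M A < emeasure ?M A + ennreal (e / 2)"
  proof -
    have "ennreal (measure ?M A) < ennreal (measure ?M A + e / 2)"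
      using e by (intro ennreal_lessI add_nonneg_pos) auto
    then show ?thesis using e by (simp add: M.emeasure_eq_measure)
  qed
  ultimately obtain G where G: "A \<subseteq> G" "open G" "emeasure ?M G < emeasure ?M A + ennreal (e / 2)"
    by (auto simp: INF_less_iff)
  then have G': "measure ?M G < measure ?M A + e / 2"
    using e by (simp add: M.emeasure_eq_measure ennreal_less_iff flip: ennreal_plus)
  have KG: "K \<in> sets ?M" "G \<in> sets ?M" "K \<subseteq> G" using K G by (auto intro: borel_compact)
  have "measure \<mu> (G \<inter> circle - K) = measure ?M (G - K)"
    using KG by (subst em) (auto simp: Int_Diff Diff_Int_distrib2 intro!: arg_cong[of _ _ "measure \<mu>"])
  also have "\<dots> = measure ?M G - measure ?M K"
    using KG by (intro M.finite_measure_Diff) auto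
  also have "\<dots> < e" using G' K(3) by simp
  finally show ?thesis using K G by (intro exI[of _ K] exI[of _ G]) (auto intro: compact_imp_closed)
qed

text \<open>Two measures at once: \<mu> may have a part singular to \<open>arc_measure\<close>, and
  the variational argument needs one function that is good for both. Join the inner closed sets,
  intersect the outer open sets, and apply Urysohn.\<close>

lemma circle_indicator_approx:
  assumes \<mu>: "\<mu> \<in> circle_probs" and \<nu>: "\<nu> \<in> circle_probs" and A: "A \<in> sets circle_borel" and e: "e > 0"
  shows "\<exists>k. continuous_on UNIV k \<and> (\<integral>z. \<bar>indicator A z - k z\<bar> \<partial>\<mu>) < e \<and> (\<integral>z. \<bar>indicator A z - k z\<bar> \<partial>\<nu>) < (e::real)"
proof -
  obtain K1 G1 where 1: "closed K1" "open G1" "K1 \<subseteq> A" "A \<subseteq> G1" "measure \<mu> (G1 \<inter> circle - K1) < e"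
    using circle_closed_open_approx[OF \<mu> A e] by blast
  obtain K2 G2 where 2: "closed K2" "open G2" "K2 \<subseteq> A" "A \<subseteq> G2" "measure \<nu> (G2 \<inter> circle - K2) < e"
    using circle_closed_open_approx[OF \<nu> A e] by blast
  define K where "K = K1 \<union> K2"
  define G where "G = G1 \<inter> G2"
  have KG: "closed K" "closed (- G)" "K \<inter> - G = {}" "K \<subseteq> A" "A \<subseteq> G"
    using 1 2 by (auto simp: K_def G_def)
  obtain k :: "complex \<Rightarrow> real" where k: "continuous_on UNIV k" "\<And>x. k x \<in> closed_segment 1 0"
      "\<And>x. x \<in> K \<Longrightarrow> k x = 1" "\<And>x. x \<in> - G \<Longrightarrow> k x = 0"
    using Urysohn[OF KG(1-3), of 1 0] by metis
  have k01: "0 \<le> k x \<and> k x \<le> 1" for x using k(2)[of x] by (auto simp: closed_segment_eq_real_ivl)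
  have "(\<integral>z. \<bar>indicator A z - k z\<bar> \<partial>M) < e"
    if M: "M \<in> circle_probs" and sub: "G \<inter> circle - K \<subseteq> B" and B: "B \<in> sets circle_borel" "measure M B < e" for M B
  proof -
    interpret prob_space M by (rule circle_probsD(1)[OF M])
    have km: "k \<in> borel_measurable M" 
      using circle_probsD(2)[OF M] continuous_on_subset[OF k(1)] by (intro continuous_on_circle_measurable) auto
    have sM: "A \<in> sets M" "B \<in> sets M" using A B circle_probsD(2)[OF M] by auto
    have "(\<integral>z. \<bar>indicator A z - k z\<bar> \<partial>M) \<le> (\<integral>z. indicator B z \<partial>M)"
    proof (rule integral_mono)
      show "integrable M (\<lambda>z. \<bar>indicator A z - k z\<bar>)"
      proof (rule integrable_const_bound[of _ 1])
        have "\<bar>indicator A z - k z\<bar> \<le> 1" for z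
          using k01[of z] by (auto simp: indicator_def abs_if)
        then show "AE z in M. norm \<bar>indicator A z - k z\<bar> \<le> 1" by simp
      qed (use km sM in simp)
      show "integrable M (indicat_real B)"
        by (rule integrable_real_indicator[OF sM(2)]) (simp add: emeasure_eq_measure)
      fix z assume "z \<in> space M"
      then have z: "z \<in> circle" using circle_probsD(3)[OF M] by simp
      show "\<bar>indicator A z - k z\<bar> \<le> indicator B z"
      proof (cases "z \<in> B")
        case True
        then show ?thesis using k01[of z] by (auto simp: indicator_def abs_if)
      next
        case False
        then have "z \<in> K \<or> z \<notin> G" using sub z by blast
        then show ?thesis using k(3,4)[of z] KG by (auto simp: indicator_def)
      qed
    qed
    also have "\<dots> = measure M B" using sM by simp
    finally show ?thesis using B(2) by simp
  qed
  note * = this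
  have "G1 \<inter> circle - K1 \<in> sets circle_borel" "G2 \<inter> circle - K2 \<in> sets circle_borel"
  proof -
    have *: "circle \<inter> B \<in> sets circle_borel" if "B \<in> sets borel" for B
      unfolding circle_borel_def sets_restrict_space using that by (rule imageI)
    have "G1 - K1 \<in> sets borel" "G2 - K2 \<in> sets borel"
      using 1(1,2) 2(1,2) by auto
    note this[THEN *]
    moreover have "circle \<inter> (G1 - K1) = G1 \<inter> circle - K1" "circle \<inter> (G2 - K2) = G2 \<inter> circle - K2"
      by blast+
    ultimately show "G1 \<inter> circle - K1 \<in> sets circle_borel" "G2 \<inter> circle - K2 \<in> sets circle_borel"
      by (simp_all only:)
  qed
  then have "(\<integral>z. \<bar>indicator A z - k z\<bar> \<partial>\<mu>) < e" "(\<integral>z. \<bar>indicator A z - k z\<bar> \<partial>\<nu>) < e"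
    using *[OF \<mu>, of "G1 \<inter> circle - K1"] *[OF \<nu>, of "G2 \<inter> circle - K2"] 1 2 by (auto simp: G_def K_def)
  then show ?thesis using k(1) by blast
qed

lemma integrable_bounded_circle:
  fixes f :: "complex \<Rightarrow> real"
  assumes \<mu>: "\<mu> \<in> circle_probs" and f: "f \<in> borel_measurable circle_borel" and "\<And>z. z \<in> circle \<Longrightarrow> \<bar>f z\<bar> \<le> B"
  shows "integrable \<mu> f"
proof -
  interpret prob_space \<mu> by (rule circle_probsD(1)[OF \<mu>])
  show ?thesis
    using assms circle_probsD[OF \<mu>]
    by (intro integrable_const_bound[of _ B]) (auto cong: measurable_cong_sets)
qed

lemma integral_abs_triangle:
  fixes f g h :: "'a \<Rightarrow> real"
  assumes "integrable M f" "integrable M g" "integrable M h"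
  shows "(\<integral>z. \<bar>f z - h z\<bar> \<partial>M) \<le> (\<integral>z. \<bar>f z - g z\<bar> \<partial>M) + (\<integral>z. \<bar>g z - h z\<bar> \<partial>M)"
proof -
  have "(\<integral>z. \<bar>f z - h z\<bar> \<partial>M) \<le> (\<integral>z. \<bar>f z - g z\<bar> + \<bar>g z - h z\<bar> \<partial>M)"
    using assms by (intro integral_mono) auto
  then show ?thesis using assms by simp
qed

lemma circle_L1_dense:
  fixes f :: "complex \<Rightarrow> real"
  assumes \<mu>: "\<mu> \<in> circle_probs" and \<nu>: "\<nu> \<in> circle_probs" and f: "f \<in> borel_measurable circle_borel"
    and bd: "\<And>z. 0 \<le> f z \<and> f z \<le> B" and e: "e > 0"
  shows "\<exists>k. continuous_on UNIV k \<and> (\<integral>z. \<bar>f z - k z\<bar> \<partial>\<mu>) < e \<and> (\<integral>z. \<bar>f z - k z\<bar> \<partial>\<nu>) < e"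
proof -
  define appr where "appr f \<longleftrightarrow> (\<forall>e>0. \<exists>k. continuous_on UNIV k \<and>
    (\<integral>z. \<bar>f z - k z\<bar> \<partial>\<mu>) < e \<and> (\<integral>z. \<bar>f z - k z\<bar> \<partial>\<nu>) < e)" for f :: "complex \<Rightarrow> real"
  have ki: "integrable M k" if "M \<in> circle_probs" "continuous_on UNIV k" for M and k :: "complex \<Rightarrow> real"
    using that continuous_on_subset by (intro continuous_on_circle_integrable) auto
  \<comment> \<open>Boundedness is a premise inside the induction: it passes from a function to the
    smaller pieces it is built from, and it guarantees that all of them are integrable.\<close>
  have "(\<exists>B. \<forall>z\<in>circle. f z \<le> B) \<longrightarrow> appr f"
    using f conjunct1[OF bd]
  proof (induction rule: borel_measurable_induct_real)
    fix A assume "A \<in> sets circle_borel"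
    then show "(\<exists>B. \<forall>z\<in>circle. indicat_real A z \<le> B) \<longrightarrow> appr (indicat_real A)"
      unfolding appr_def using circle_indicator_approx[OF \<mu> \<nu>] by blast
  next
    fix u :: "complex \<Rightarrow> real" and c :: real
    assume c: "0 \<le> c" and u: "u \<in> borel_measurable circle_borel" "\<And>x. 0 \<le> u x" and IH: "(\<exists>B. \<forall>z\<in>circle. u z \<le> B) \<longrightarrow> appr u"
    show "(\<exists>B. \<forall>z\<in>circle. c * u z \<le> B) \<longrightarrow> appr (\<lambda>x. c * u x)"
    proof
      assume "\<exists>B. \<forall>z\<in>circle. c * u z \<le> B"
      then obtain B where B: "\<forall>z\<in>circle. c * u z \<le> B" ..
      show "appr (\<lambda>x. c * u x)"
      proof (cases "c = 0")
        case True
        then show ?thesis unfolding appr_def by (auto intro!: exI[of _ "\<lambda>_. 0"])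
      next
        case False
        then have "c > 0" using c by simp
        then have "\<forall>z\<in>circle. u z \<le> B / c" using B by (simp add: field_simps)
        then have au: "appr u" using IH by blast
        show ?thesis
          unfolding appr_def
        proof (intro allI impI)
          fix e :: real assume "e > 0"
          then have "e / c > 0" using \<open>c > 0\<close> by simp
          then obtain k where k: "continuous_on UNIV k" "(\<integral>z. \<bar>u z - k z\<bar> \<partial>\<mu>) < e / c" "(\<integral>z. \<bar>u z - k z\<bar> \<partial>\<nu>) < e / c"
            using au unfolding appr_def by blast
          have "\<bar>c * u z - c * k z\<bar> = c * \<bar>u z - k z\<bar>" for z
            using \<open>c > 0\<close> by (simp add: abs_mult flip: right_diff_distrib)
          then show "\<exists>k. continuous_on UNIV k \<and> (\<integral>z. \<bar>c * u z - k z\<bar> \<partial>\<mu>) < e \<and> (\<integral>z. \<bar>c * u z - k z\<bar> \<partial>\<nu>) < e"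
            using k \<open>c > 0\<close> by (intro exI[of _ "\<lambda>z. c * k z"]) (auto intro!: continuous_intros simp: field_simps)
        qed
      qed
    qed
  next
    fix u v :: "complex \<Rightarrow> real"
    assume u: "u \<in> borel_measurable circle_borel" "\<And>x. 0 \<le> u x" and IHu: "(\<exists>B. \<forall>z\<in>circle. u z \<le> B) \<longrightarrow> appr u"
      and v: "v \<in> borel_measurable circle_borel" "\<And>x. 0 \<le> v x" and IHv: "(\<exists>B. \<forall>z\<in>circle. v z \<le> B) \<longrightarrow> appr v"
    show "(\<exists>B. \<forall>z\<in>circle. v z + u z \<le> B) \<longrightarrow> appr (\<lambda>x. v x + u x)"
    proof
      assume "\<exists>B. \<forall>z\<in>circle. v z + u z \<le> B"
      then obtain B where B: "\<forall>z\<in>circle. v z + u z \<le> B" ..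
      have Bu: "u z \<le> B" "v z \<le> B" if "z \<in> circle" for z
        using B that u(2)[of z] v(2)[of z] by force+
      have ui: "integrable M u" "integrable M v" if "M \<in> circle_probs" for M
        using Bu u v by (auto intro!: integrable_bounded_circle[OF that, of _ B])
      have au: "appr u" "appr v" using IHu IHv Bu by blast+
      show "appr (\<lambda>x. v x + u x)"
        unfolding appr_def
      proof (intro allI impI)
        fix e :: real assume "e > 0"
        then have e2: "e / 2 > 0" by simp
        obtain k where k: "continuous_on UNIV k" "(\<integral>z. \<bar>u z - k z\<bar> \<partial>\<mu>) < e / 2" "(\<integral>z. \<bar>u z - k z\<bar> \<partial>\<nu>) < e / 2"
          using au(1) e2 unfolding appr_def by blast
        obtain l where l: "continuous_on UNIV l" "(\<integral>z. \<bar>v z - l z\<bar> \<partial>\<mu>) < e / 2" "(\<integral>z. \<bar>v z - l z\<bar> \<partial>\<nu>) < e / 2"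
          using au(2) e2 unfolding appr_def by blast
        have "(\<integral>z. \<bar>v z + u z - (l z + k z)\<bar> \<partial>M) \<le> (\<integral>z. \<bar>v z - l z\<bar> \<partial>M) + (\<integral>z. \<bar>u z - k z\<bar> \<partial>M)" if M: "M \<in> circle_probs" for M
        proof -
          have "(\<integral>z. \<bar>v z + u z - (l z + k z)\<bar> \<partial>M) \<le> (\<integral>z. \<bar>v z - l z\<bar> + \<bar>u z - k z\<bar> \<partial>M)"
            using ui[OF M] ki[OF M k(1)] ki[OF M l(1)] by (intro integral_mono) auto
          then show ?thesis using ui[OF M] ki[OF M k(1)] ki[OF M l(1)] by simp
        qed
        from this[OF \<mu>] this[OF \<nu>] k l
        show "\<exists>k. continuous_on UNIV k \<and> (\<integral>z. \<bar>v z + u z - k z\<bar> \<partial>\<mu>) < e \<and> (\<integral>z. \<bar>v z + u z - k z\<bar> \<partial>\<nu>) < e"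
          by (intro exI[of _ "\<lambda>z. l z + k z"]) (auto intro!: continuous_intros)
      qed
    qed
  next
    fix U :: "nat \<Rightarrow> complex \<Rightarrow> real"
    assume U: "\<And>i. U i \<in> borel_measurable circle_borel" "\<And>i x. 0 \<le> U i x" "incseq U"
      and IH: "\<And>i. (\<exists>B. \<forall>z\<in>circle. U i z \<le> B) \<longrightarrow> appr (U i)"
      and lim: "\<And>x. x \<in> space circle_borel \<Longrightarrow> (\<lambda>i. U i x) \<longlonglongrightarrow> f x" 
    show "(\<exists>B. \<forall>z\<in>circle. f z \<le> B) \<longrightarrow> appr f"
    proof
      assume "\<exists>B. \<forall>z\<in>circle. f z \<le> B"
      then obtain B where B: "\<forall>z\<in>circle. f z \<le> B" ..
      have lim': "(\<lambda>i. U i x) \<longlonglongrightarrow> f x" if "x \<in> circle" for x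
        using lim that by (simp add: space_circle_borel)
      have Uu: "U i x \<le> f x" if "x \<in> circle" for i x
        using U(3) lim'[OF that] by (intro incseq_le) (auto simp: incseq_def le_fun_def)
      have UB: "U i x \<le> B" if "x \<in> circle" for i x using Uu[OF that, of i] B that by force
      have u0: "0 \<le> f x" if "x \<in> circle" for x using U(2)[of 0 x] Uu[OF that, of 0] by linarith
      have um: "f \<in> borel_measurable circle_borel"
        by (rule borel_measurable_LIMSEQ_real[OF lim U(1)])
      have Ui: "integrable M (U i)" if "M \<in> circle_probs" for M i
        using UB U by (intro integrable_bounded_circle[OF that, of _ B]) auto
      have ui: "integrable M f" if "M \<in> circle_probs" for M
        using um u0 B by (intro integrable_bounded_circle[OF that, of _ B]) auto
      have conv: "(\<lambda>i. \<integral>z. \<bar>f z - U i z\<bar> \<partial>M) \<longlonglongrightarrow> 0" if M: "M \<in> circle_probs" for M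
      proof -
        interpret prob_space M by (rule circle_probsD(1)[OF M])
        have "(\<lambda>i. \<integral>z. \<bar>f z - U i z\<bar> \<partial>M) \<longlonglongrightarrow> (\<integral>z. 0 \<partial>M)"
        proof (rule integral_dominated_convergence[where w="\<lambda>_. B"])
          show "AE z in M. (\<lambda>i. \<bar>f z - U i z\<bar>) \<longlonglongrightarrow> 0"
          proof (rule AE_I2)
            fix z assume "z \<in> space M"
            then have "(\<lambda>i. \<bar>f z - U i z\<bar>) \<longlonglongrightarrow> \<bar>f z - f z\<bar>"
              using lim' circle_probsD(3)[OF M] by (intro tendsto_intros) auto
            then show "(\<lambda>i. \<bar>f z - U i z\<bar>) \<longlonglongrightarrow> 0" by simp
          qed
          show "AE z in M. norm \<bar>f z - U i z\<bar> \<le> B" for i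
          proof (rule AE_I2)
            fix z assume "z \<in> space M"
            then have z: "z \<in> circle" using circle_probsD(3)[OF M] by simp
            have "0 \<le> U i z" "U i z \<le> f z" "f z \<le> B" using U(2) Uu[OF z] B z by auto
            then show "norm \<bar>f z - U i z\<bar> \<le> B" by simp
          qed
        qed (use Ui[OF M] ui[OF M] in auto)
        then show ?thesis by simp
      qed
      show "appr f"
        unfolding appr_def
      proof (intro allI impI)
        fix e :: real assume "e > 0"
        then have e2: "e / 2 > 0" by simp
        have "\<forall>\<^sub>F i in sequentially. (\<integral>z. \<bar>f z - U i z\<bar> \<partial>\<mu>) < e / 2 \<and> (\<integral>z. \<bar>f z - U i z\<bar> \<partial>\<nu>) < e / 2"
          using order_tendstoD(2)[OF conv[OF \<mu>] e2] order_tendstoD(2)[OF conv[OF \<nu>] e2] by (rule eventually_conj)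
        then obtain i where i: "(\<integral>z. \<bar>f z - U i z\<bar> \<partial>\<mu>) < e / 2" "(\<integral>z. \<bar>f z - U i z\<bar> \<partial>\<nu>) < e / 2"
          unfolding eventually_sequentially by blast
        have "appr (U i)" using IH UB by blast
        then obtain k where k: "continuous_on UNIV k" "(\<integral>z. \<bar>U i z - k z\<bar> \<partial>\<mu>) < e / 2" "(\<integral>z. \<bar>U i z - k z\<bar> \<partial>\<nu>) < e / 2"
          using e2 unfolding appr_def by blast
        have "(\<integral>z. \<bar>f z - k z\<bar> \<partial>\<mu>) < e" "(\<integral>z. \<bar>f z - k z\<bar> \<partial>\<nu>) < e"
          using integral_abs_triangle[OF ui[OF \<mu>] Ui[OF \<mu>] ki[OF \<mu> k(1)], of i]
            integral_abs_triangle[OF ui[OF \<nu>] Ui[OF \<nu>] ki[OF \<nu> k(1)], of i] i k by linarith+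
        then show "\<exists>k. continuous_on UNIV k \<and> (\<integral>z. \<bar>f z - k z\<bar> \<partial>\<mu>) < e \<and> (\<integral>z. \<bar>f z - k z\<bar> \<partial>\<nu>) < e"
          using k(1) by blast
      qed
    qed
  qed
  moreover have "\<exists>B. \<forall>z\<in>circle. f z \<le> B" using bd by blast
  ultimately show ?thesis using e unfolding appr_def by blast
qed

text \<open>Clipping an approximant to [a, b] never increases its distance to a function with values
  there. The bounds are kept because exp (-x) is Lipschitz only on half-lines bounded below.\<close>

lemma circle_L1_dense_between:
  fixes f :: "complex \<Rightarrow> real"
  assumes \<mu>: "\<mu> \<in> circle_probs" and \<nu>: "\<nu> \<in> circle_probs" and f: "f \<in> borel_measurable circle_borel"
    and bd: "\<And>z. a \<le> f z \<and> f z \<le> b" and e: "e > 0"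
  shows "\<exists>k. continuous_on UNIV k \<and> (\<forall>z. a \<le> k z \<and> k z \<le> b) \<and> (\<integral>z. \<bar>f z - k z\<bar> \<partial>\<mu>) < e \<and> (\<integral>z. \<bar>f z - k z\<bar> \<partial>\<nu>) < e"
proof -
  obtain k where k: "continuous_on UNIV k" "(\<integral>z. \<bar>f z - a - k z\<bar> \<partial>\<mu>) < e" "(\<integral>z. \<bar>f z - a - k z\<bar> \<partial>\<nu>) < e"
    using circle_L1_dense[OF \<mu> \<nu>, of "\<lambda>z. f z - a" "b - a" e] f bd e by (force simp: diff_right_mono)
  define l where "l z = max a (min b (k z + a))" for z
  have ab: "a \<le> b" using bd[of 0] by linarith
  have cl: "continuous_on UNIV l" unfolding l_def by (intro continuous_intros k)
  have fi: "integrable M f" if "M \<in> circle_probs" for M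
    using bd by (intro integrable_bounded_circle[OF that f, of "max \<bar>a\<bar> \<bar>b\<bar>"]) (smt (verit))
  have ki: "integrable M k" if "M \<in> circle_probs" "continuous_on UNIV k" for M and k :: "complex \<Rightarrow> real"
    using that continuous_on_subset by (intro continuous_on_circle_integrable) auto
  have "(\<integral>z. \<bar>f z - l z\<bar> \<partial>M) \<le> (\<integral>z. \<bar>f z - a - k z\<bar> \<partial>M)" if M: "M \<in> circle_probs" for M
  proof (rule integral_mono)
    interpret prob_space M by (rule circle_probsD(1)[OF M])
    show "integrable M (\<lambda>z. \<bar>f z - l z\<bar>)" "integrable M (\<lambda>z. \<bar>f z - a - k z\<bar>)"
      using fi[OF M] ki[OF M cl] ki[OF M k(1)] by auto
    show "\<bar>f z - l z\<bar> \<le> \<bar>f z - a - k z\<bar>" for z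
      using bd[of z] by (auto simp: l_def)
  qed
  from this[OF \<mu>] this[OF \<nu>] k cl ab show ?thesis
    by (intro exI[of _ l]) (auto simp: l_def)
qed

section \<open>The rate function\<close>

lemma sets_arc: "sets arc_measure = sets circle_borel"
  by (rule circle_probsD(2)[OF arc_circle_probs])

lemma space_arc: "space arc_measure = circle"
  by (rule circle_probsD(3)[OF arc_circle_probs])

lemma emeasure_density_indicator:
  assumes "A \<in> sets M" "B \<in> sets M"
  shows "emeasure (density M (indicator B)) A = emeasure M (A \<inter> B)"
  using assms by (simp add: emeasure_density indicator_inter_arith[symmetric] Int_commute mult.commute)

lemma emeasure_split:
  assumes "A \<in> sets M" "N \<in> sets M"
  shows "emeasure M A = emeasure M (A - N) + emeasure M (A \<inter> N)"
  using assms by (subst plus_emeasure) (auto simp: Int_Diff Un_Diff_Int Diff_Int2 intro!: arg_cong[of _ _ "emeasure M"])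

text \<open>The singular part lives on an arc-null set of maximal \<open>\<mu>\<close>-measure.\<close>

lemma lebesgue_decomposition_exists:
  assumes \<mu>: "\<mu> \<in> circle_probs"
  shows "\<exists>w \<mu>s. lebesgue_decomposition \<mu> w \<mu>s"
proof -
  interpret \<mu>: prob_space \<mu> by (rule circle_probsD(1)[OF \<mu>])
  interpret arc: prob_space arc_measure by (rule circle_probsD(1)[OF arc_circle_probs])
  have se: "sets \<mu> = sets arc_measure" "space \<mu> = space arc_measure"
    using circle_probsD[OF \<mu>] by (auto simp: sets_arc space_arc)
  let ?Z = "null_sets arc_measure"
  define s where "s = (SUP N\<in>?Z. measure \<mu> N)"
  have bdd: "bdd_above (measure \<mu> ` ?Z)" by (rule bdd_aboveI[of _ 1]) auto
  have le_s: "measure \<mu> N \<le> s" if "N \<in> ?Z" for N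
    unfolding s_def by (rule cSUP_upper[OF that bdd])
  have "\<exists>N\<in>?Z. s - 1 / Suc i < measure \<mu> N" for i :: nat
  proof -
    have "s - 1 / Suc i < s" by simp
    then show ?thesis unfolding s_def by (subst (asm) less_cSUP_iff[OF _ bdd]) auto
  qed
  then obtain F where F: "\<And>i. F i \<in> ?Z" "\<And>i::nat. s - 1 / Suc i < measure \<mu> (F i)" by metis
  define N where "N = (\<Union>i. F i)"
  have N: "N \<in> ?Z" unfolding N_def using F(1) by (rule null_sets_UN)
  then have Ns: "N \<in> sets \<mu>" "N \<in> sets arc_measure" by (auto simp: se)
  have "measure \<mu> N = s"
  proof (rule antisym[OF le_s[OF N]])
    have "s \<le> measure \<mu> N + e" if "e > 0" for e
    proof -
      obtain i where i: "inverse (real (Suc i)) < e" using reals_Archimedean[OF \<open>e > 0\<close>] by blast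
      have "measure \<mu> (F i) \<le> measure \<mu> N" using Ns by (intro \<mu>.finite_measure_mono) (auto simp: N_def)
      then show ?thesis using F(2)[of i] i by (simp add: inverse_eq_divide)
    qed
    then show "s \<le> measure \<mu> N" by (rule field_le_epsilon)
  qed
  \<comment> \<open>If \<mu> charged an arc-null set outside N, its union with N would exceed the
    supremum s. Hence \<mu> restricted to the complement of N is absolutely continuous.\<close>
  have zero: "emeasure \<mu> (A - N) = 0" if "A \<in> ?Z" for A
  proof -
    have A: "A \<in> sets \<mu>" using that by (auto simp: se)
    have "measure \<mu> (A \<union> N) \<le> s" using that N by (intro le_s) auto
    moreover have "measure \<mu> (A \<union> N) = measure \<mu> (A - N) + measure \<mu> N"
      using A Ns by (subst \<mu>.finite_measure_Union[symmetric]) (auto intro!: arg_cong[of _ _ "measure \<mu>"])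
    ultimately have "measure \<mu> (A - N) \<le> 0" using \<open>measure \<mu> N = s\<close> by simp
    then show ?thesis by (simp add: \<mu>.emeasure_eq_measure measure_le_0_iff)
  qed
  let ?C = "space \<mu> - N"
  have C: "?C \<in> sets \<mu>" using Ns by auto
  have ac: "absolutely_continuous arc_measure (density \<mu> (indicator ?C))"
    unfolding absolutely_continuous_def
  proof
    fix A assume A: "A \<in> ?Z"
    then have As: "A \<in> sets \<mu>" by (auto simp: se)
    have "A \<inter> ?C = A - N" using sets.sets_into_space[OF As] by auto
    then show "A \<in> null_sets (density \<mu> (indicator ?C))"
      using As C zero[OF A] by (intro null_setsI) (auto simp: emeasure_density_indicator)
  qed
  from arc.Radon_Nikodym[OF ac] obtain f where f: "f \<in> borel_measurable arc_measure"
    and df: "density arc_measure f = density \<mu> (indicator ?C)" by (auto simp: se)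
  have "(\<integral>\<^sup>+z. f z \<partial>arc_measure) = emeasure (density arc_measure f) (space arc_measure)"
    using f by (simp add: emeasure_density cong: nn_integral_cong)
  also have "\<dots> \<le> 1"
    unfolding df using C \<mu>.measure_le_1 by (subst emeasure_density_indicator) (auto simp: se)
  finally have "(\<integral>\<^sup>+z. f z \<partial>arc_measure) \<noteq> \<infinity>" by (auto simp: top_unique)
  then have fin: "AE z in arc_measure. f z \<noteq> \<infinity>" using f by (intro nn_integral_noteq_infinite)
  define w where "w z = enn2real (f z)" for z
  have "lebesgue_decomposition \<mu> w (density \<mu> (indicator N))"
    unfolding lebesgue_decomposition_def mutually_singular_def
  proof (intro conjI allI ballI)
    show "w \<in> borel_measurable arc_measure" unfolding w_def using f by measurable
    show "0 \<le> w z" for z by (simp add: w_def)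
    show "sets arc_measure = sets (density \<mu> (indicator N))" by (simp add: se)
    have "emeasure (density \<mu> (indicator N)) (space (density \<mu> (indicator N)) - N) = emeasure \<mu> ((space \<mu> - N) \<inter> N)"
      using Ns by (subst emeasure_density_indicator[symmetric]) auto
    moreover have "(space \<mu> - N) \<inter> N = {}" by blast
    ultimately have "emeasure (density \<mu> (indicator N)) (space (density \<mu> (indicator N)) - N) = 0"
      by (simp only: emeasure_empty)
    then show "\<exists>N'\<in>sets arc_measure. emeasure arc_measure N' = 0 \<and>
      emeasure (density \<mu> (indicator N)) (space (density \<mu> (indicator N)) - N') = 0"
      using N by (intro bexI[of _ N]) auto
    fix A assume A: "A \<in> sets arc_measure"
    then have As: "A \<in> sets \<mu>" by (simp add: se)
    have "(\<integral>\<^sup>+z\<in>A. ennreal (w z) \<partial>arc_measure) = (\<integral>\<^sup>+z\<in>A. f z \<partial>arc_measure)"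
      using fin by (intro nn_integral_cong_AE) (auto elim!: eventually_mono simp: w_def less_top)
    also have "\<dots> = emeasure (density arc_measure f) A" using A f by (simp add: emeasure_density)
    also have "\<dots> = emeasure \<mu> (A \<inter> ?C)" unfolding df using As C by (rule emeasure_density_indicator)
    also have "A \<inter> ?C = A - N" using sets.sets_into_space[OF As] by auto
    finally show "emeasure \<mu> A = (\<integral>\<^sup>+z\<in>A. ennreal (w z) \<partial>arc_measure) + emeasure (density \<mu> (indicator N)) A"
      using emeasure_split[OF As Ns(1)] As Ns by (simp add: emeasure_density_indicator)
  qed
  then show ?thesis by blast
qed

text \<open>These facts hold for whichever decomposition \<open>SOME\<close> picks. The last one is
  the working form: off a null set N that carries the singular part, w d\<open>arc_measure\<close>
  is just \<mu>.\<close>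

lemma ac_density:
  assumes \<mu>: "\<mu> \<in> circle_probs"
  shows ac_density_measurable: "ac_density \<mu> \<in> borel_measurable circle_borel"
    and ac_density_nonneg: "0 \<le> ac_density \<mu> z"
    and ac_density_integral: "\<exists>N\<in>sets circle_borel. emeasure arc_measure N = 0 \<and>
      (\<forall>g\<in>borel_measurable circle_borel. (\<integral>\<^sup>+z. ennreal (ac_density \<mu> z) * g z \<partial>arc_measure) =
         (\<integral>\<^sup>+z. indicator (circle - N) z * g z \<partial>\<mu>))"
proof -
  let ?w = "ac_density \<mu>"
  have "\<exists>\<mu>s. lebesgue_decomposition \<mu> ?w \<mu>s"
    unfolding ac_density_def using lebesgue_decomposition_exists[OF \<mu>] by (rule someI_ex)
  then obtain \<mu>s where ld: "lebesgue_decomposition \<mu> ?w \<mu>s" ..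
  have se: "sets \<mu> = sets arc_measure" "space \<mu> = space arc_measure" "space arc_measure = circle" "sets arc_measure = sets circle_borel"
    using circle_probsD[OF \<mu>] by (auto simp: sets_arc space_arc)
  have w: "?w \<in> borel_measurable arc_measure" "\<And>z. 0 \<le> ?w z"
    using ld by (auto simp: lebesgue_decomposition_def)
  then show w': "?w \<in> borel_measurable circle_borel" "0 \<le> ?w z"
    using se(4) by (auto cong: measurable_cong_sets)
  obtain N where N: "N \<in> sets arc_measure" "emeasure arc_measure N = 0" "emeasure \<mu>s (space \<mu>s - N) = 0"
    and ss: "sets \<mu>s = sets arc_measure"
    using ld unfolding lebesgue_decomposition_def mutually_singular_def by metis
  have sps: "space \<mu>s = circle" using sets_eq_imp_space_eq[OF ss] se by simp
  have dens: "density arc_measure (\<lambda>z. ennreal (?w z)) = density \<mu> (indicator (circle - N))"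
  proof (rule measure_eqI)
    fix A assume "A \<in> sets (density arc_measure (\<lambda>z. ennreal (?w z)))"
    then have A: "A \<in> sets arc_measure" by simp
    have AN: "A - N \<in> sets arc_measure" using A N by auto
    have "AE z in arc_measure. z \<notin> N" using N by (intro AE_not_in) auto
    then have "(\<integral>\<^sup>+z\<in>A. ennreal (?w z) \<partial>arc_measure) = (\<integral>\<^sup>+z\<in>A - N. ennreal (?w z) \<partial>arc_measure)"
      by (intro nn_integral_cong_AE) (auto elim!: eventually_mono simp: indicator_def)
    also have "\<dots> = emeasure \<mu> (A - N)"
    proof -
      have "emeasure \<mu>s (A - N) \<le> emeasure \<mu>s (space \<mu>s - N)"
        using A N sets.sets_into_space[OF A] sets.compl_sets[of N \<mu>s]
        by (intro emeasure_mono) (auto simp: ss sps se)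
      then have "emeasure \<mu>s (A - N) = 0" using N(3) by simp
      moreover have "emeasure \<mu> (A - N) = (\<integral>\<^sup>+z\<in>A - N. ennreal (?w z) \<partial>arc_measure) + emeasure \<mu>s (A - N)"
        using ld AN by (simp add: lebesgue_decomposition_def)
      ultimately show ?thesis by simp
    qed
    also have "A - N = A \<inter> (circle - N)" using sets.sets_into_space[OF A] by (auto simp: se)
    also have "emeasure \<mu> (A \<inter> (circle - N)) = emeasure (density \<mu> (indicator (circle - N))) A"
      using A N sets.compl_sets[of N arc_measure] by (intro emeasure_density_indicator[symmetric]) (auto simp: se)
    finally show "emeasure (density arc_measure (\<lambda>z. ennreal (?w z))) A = emeasure (density \<mu> (indicator (circle - N))) A"
      using A w by (simp add: emeasure_density)
  qed (simp add: se)
  have cN: "circle - N \<in> sets \<mu>" using N sets.compl_sets[of N arc_measure] by (auto simp: se)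
  show "\<exists>N\<in>sets circle_borel. emeasure arc_measure N = 0 \<and>
      (\<forall>g\<in>borel_measurable circle_borel. (\<integral>\<^sup>+z. ennreal (?w z) * g z \<partial>arc_measure) =
         (\<integral>\<^sup>+z. indicator (circle - N) z * g z \<partial>\<mu>))"
  proof (intro bexI[of _ N] conjI ballI)
    fix g :: "complex \<Rightarrow> ennreal" assume "g \<in> borel_measurable circle_borel"
    then have g: "g \<in> borel_measurable arc_measure" "g \<in> borel_measurable \<mu>"
      using se by (auto cong: measurable_cong_sets)
    have "(\<integral>\<^sup>+z. ennreal (?w z) * g z \<partial>arc_measure) = (\<integral>\<^sup>+z. g z \<partial>density arc_measure (\<lambda>z. ennreal (?w z)))"
      using w g by (intro nn_integral_density[symmetric]) auto
    also have "\<dots> = (\<integral>\<^sup>+z. indicator (circle - N) z * g z \<partial>\<mu>)"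
      unfolding dens using g cN by (intro nn_integral_density) auto
    finally show "(\<integral>\<^sup>+z. ennreal (?w z) * g z \<partial>arc_measure) = (\<integral>\<^sup>+z. indicator (circle - N) z * g z \<partial>\<mu>)" .
  qed (use N se in auto)
qed

section \<open>Variational description of the rate function\<close>

context
  fixes \<mu> :: "complex measure"
  assumes \<mu>: "\<mu> \<in> circle_probs"
begin

interpretation \<mu>: prob_space \<mu> by (rule circle_probsD(1)[OF \<mu>])
interpretation arc: prob_space arc_measure by (rule circle_probsD(1)[OF arc_circle_probs])

abbreviation (input) w where "w \<equiv> ac_density \<mu>"

lemma w_measurable [measurable]: "w \<in> borel_measurable arc_measure"
  using ac_density_measurable[OF \<mu>] sets_arc by (simp cong: measurable_cong_sets)

lemma w_nonneg: "0 \<le> w z"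
  by (rule ac_density_nonneg[OF \<mu>])

lemma nn_integral_w_le:
  assumes "g \<in> borel_measurable circle_borel"
  shows "(\<integral>\<^sup>+z. ennreal (w z) * g z \<partial>arc_measure) \<le> (\<integral>\<^sup>+z. g z \<partial>\<mu>)"
proof -
  obtain N where N: "N \<in> sets circle_borel" "emeasure arc_measure N = 0"
    and eq: "(\<integral>\<^sup>+z. ennreal (w z) * g z \<partial>arc_measure) = (\<integral>\<^sup>+z. indicator (circle - N) z * g z \<partial>\<mu>)"
    using ac_density_integral[OF \<mu>] assms by metis
  show ?thesis unfolding eq by (intro nn_integral_mono) (auto simp: indicator_def)
qed

lemma nn_integral_w_le_1: "(\<integral>\<^sup>+z. ennreal (w z) \<partial>arc_measure) \<le> 1"
  using nn_integral_w_le[of "\<lambda>_. 1"] by (simp add: \<mu>.emeasure_space_1)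

text \<open>The positive part of log w is integrable because ln w \<le> w and the integral of w is
  at most 1, so it may be a real number, while \<open>log_neg\<close> may be infinite. Where w = 0
  the value \<open>ln 0 = 0\<close> contributes nothing to the positive part, as it should; in
  \<open>log_neg\<close> the value \<infinity> is put in by hand.\<close>

definition log_pos :: real where
  "log_pos = enn2real (\<integral>\<^sup>+z. ennreal (ln (w z)) \<partial>arc_measure)"

definition log_neg :: ennreal where
  "log_neg = (\<integral>\<^sup>+z. (if w z = 0 then \<infinity> else ennreal (- ln (w z))) \<partial>arc_measure)"

lemma log_pos: "(\<integral>\<^sup>+z. ennreal (ln (w z)) \<partial>arc_measure) = ennreal log_pos" "log_pos \<ge> 0"
proof -
  have "(\<integral>\<^sup>+z. ennreal (ln (w z)) \<partial>arc_measure) \<le> (\<integral>\<^sup>+z. ennreal (w z) \<partial>arc_measure)"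
  proof (intro nn_integral_mono ennreal_leI)
    fix z show "ln (w z) \<le> w z"
      using w_nonneg[of z] ln_le_minus_one[of "w z"] by (cases "w z = 0") auto
  qed
  also note nn_integral_w_le_1
  finally show "(\<integral>\<^sup>+z. ennreal (ln (w z)) \<partial>arc_measure) = ennreal log_pos" "log_pos \<ge> 0"
    unfolding log_pos_def by (auto simp: ennreal_enn2real_if top_unique)
qed

lemma szego_rate_eq: "szego_rate \<mu> = enn2ereal log_neg - ereal log_pos"
proof -
  have 1: "e2ennreal (elog (w z)) = ennreal (ln (w z))" for z
    by (auto simp: elog_def e2ennreal_neg ennreal.rep_eq e2ennreal_ereal)
  have 2: "e2ennreal (- elog (w z)) = (if w z = 0 then \<infinity> else ennreal (- ln (w z)))" for z
    by (auto simp: elog_def e2ennreal_ereal e2ennreal_infty)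
  have "szego_rate \<mu> = - (ereal log_pos - enn2ereal log_neg)"
    unfolding szego_rate_def extended_integral_def 1 2 log_pos(1) log_neg_def[symmetric]
    using log_pos(2) by (simp add: enn2ereal_ennreal)
  also have "\<dots> = enn2ereal log_neg - ereal log_pos"
    by (cases "enn2ereal log_neg") auto
  finally show ?thesis .
qed

text \<open>A finite rate forces w > 0 almost everywhere. Then \<integral>exp (-h) d\<mu> is at
  least the integral of exp (-h + ln w) over the arc measure, and Jensen's inequality bounds that
  from below. Together with \<open>szego_rate_witness_continuous\<close> this says that exp
  (-I(\<mu>)) is the infimum of \<integral>exp (-h) d\<mu> times exp of the mean of h, over
  continuous h.\<close>

lemma szego_rate_jensen:
  assumes c: "szego_rate \<mu> \<le> ereal c" and h: "continuous_on circle h"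
  shows "exp (- c - (\<integral>z. h z \<partial>arc_measure)) \<le> (\<integral>z. exp (- h z) \<partial>\<mu>)"
proof -
  have "log_neg \<noteq> \<infinity>" using c unfolding szego_rate_eq by auto
  then obtain b where b: "log_neg = ennreal b" "b \<ge> 0" by (cases log_neg) auto
  have bc: "b - log_pos \<le> c" using c b unfolding szego_rate_eq by (simp add: enn2ereal_ennreal)
  have "AE z in arc_measure. (if w z = 0 then \<infinity> else ennreal (- ln (w z))) \<noteq> \<infinity>"
    using \<open>log_neg \<noteq> \<infinity>\<close> unfolding log_neg_def by (intro nn_integral_noteq_infinite) auto
  then have pos: "AE z in arc_measure. w z > 0"
    by eventually_elim (use w_nonneg in \<open>auto simp: less_le split: if_splits\<close>)
  have neg: "(\<integral>\<^sup>+z. ennreal (- ln (w z)) \<partial>arc_measure) = ennreal b"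
    unfolding b(1)[symmetric] log_neg_def using pos by (intro nn_integral_cong_AE) (auto elim!: eventually_mono)
  have int: "integrable arc_measure (\<lambda>z. ln (w z))"
    unfolding real_integrable_def using log_pos neg by auto
  have lw: "(\<integral>z. ln (w z) \<partial>arc_measure) = log_pos - b"
    unfolding real_lebesgue_integral_def[OF int] log_pos(1) neg using b log_pos by simp
  have hi: "integrable arc_measure h" using h by (rule continuous_on_circle_integrable[OF _ arc_circle_probs])
  define g where "g z = - h z + ln (w z)" for z
  define m where "m = (\<integral>z. g z \<partial>arc_measure)"
  have gi: "integrable arc_measure g" unfolding g_def using hi int by auto
  have m: "m = log_pos - b - (\<integral>z. h z \<partial>arc_measure)" unfolding m_def g_def using hi int lw by simp
  have eh: "(\<lambda>z. exp (- h z)) \<in> borel_measurable circle_borel" "integrable \<mu> (\<lambda>z. exp (- h z))"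
    by (auto intro!: continuous_on_circle_measurable continuous_on_circle_integrable \<mu> continuous_intros h)
  have mh: "h \<in> borel_measurable arc_measure" using hi by auto
  have le: "(\<integral>\<^sup>+z. ennreal (exp (- h z) * w z) \<partial>arc_measure) \<le> ennreal (\<integral>z. exp (- h z) \<partial>\<mu>)"
  proof -
    have "(\<integral>\<^sup>+z. ennreal (exp (- h z) * w z) \<partial>arc_measure) = (\<integral>\<^sup>+z. ennreal (w z) * ennreal (exp (- h z)) \<partial>arc_measure)"
      using w_nonneg by (intro nn_integral_cong) (simp add: ennreal_mult mult.commute)
    also have "\<dots> \<le> (\<integral>\<^sup>+z. ennreal (exp (- h z)) \<partial>\<mu>)" using eh by (intro nn_integral_w_le) auto
    also have "\<dots> = ennreal (\<integral>z. exp (- h z) \<partial>\<mu>)" using eh by (intro nn_integral_eq_integral) auto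
    finally show ?thesis .
  qed
  have ei: "integrable arc_measure (\<lambda>z. exp (- h z) * w z)"
    using le mh w_nonneg by (intro integrableI_bounded) (auto simp: less_top[symmetric] top_unique)
  \<comment> \<open>Jensen's inequality through the tangent of exp at the mean m of g.\<close>
  have "exp m = (\<integral>z. exp m * (1 + (g z - m)) \<partial>arc_measure)"
    using gi by (simp add: arc.prob_space m_def[symmetric])
  also have "\<dots> \<le> (\<integral>z. exp (- h z) * w z \<partial>arc_measure)"
  proof (rule integral_mono_AE)
    show "integrable arc_measure (\<lambda>z. exp m * (1 + (g z - m)))" using gi by auto
    show "AE z in arc_measure. exp m * (1 + (g z - m)) \<le> exp (- h z) * w z"
      using pos
    proof eventually_elim
      fix z assume "0 < w z"
      then have "exp (- h z) * w z = exp (m + (g z - m))" by (simp add: g_def exp_diff exp_minus field_simps)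
      also have "\<dots> = exp m * exp (g z - m)" by (rule exp_add)
      also have "\<dots> \<ge> exp m * (1 + (g z - m))" by (intro mult_left_mono exp_ge_add_one_self) auto
      finally show "exp m * (1 + (g z - m)) \<le> exp (- h z) * w z" .
    qed
  qed (rule ei)
  also have "\<dots> \<le> (\<integral>z. exp (- h z) \<partial>\<mu>)"
  proof -
    have "ennreal (\<integral>z. exp (- h z) * w z \<partial>arc_measure) \<le> ennreal (\<integral>z. exp (- h z) \<partial>\<mu>)"
      using le ei w_nonneg by (subst nn_integral_eq_integral[symmetric]) auto
    then show ?thesis by (simp add: ennreal_le_iff)
  qed
  finally have "exp m \<le> (\<integral>z. exp (- h z) \<partial>\<mu>)" .
  moreover have "exp (- c - (\<integral>z. h z \<partial>arc_measure)) \<le> exp m" using bc by (simp add: m)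
  ultimately show ?thesis by linarith
qed

lemma szego_rate_nonneg: "0 \<le> szego_rate \<mu>"
proof (rule ccontr)
  assume "\<not> 0 \<le> szego_rate \<mu>"
  then have "szego_rate \<mu> < 0" by simp
  then obtain c where c: "szego_rate \<mu> < ereal c" "ereal c < 0" using ereal_dense2 by blast
  then have "exp (- c - (\<integral>z. 0 \<partial>arc_measure)) \<le> (\<integral>z. exp (- 0) \<partial>\<mu>)"
    by (intro szego_rate_jensen) auto
  then show False using c by (simp add: \<mu>.prob_space)
qed

text \<open>The lower bound in Szego's theorem: take h = -ln (|P|^2 + e) in
  \<open>szego_rate_jensen\<close>; by \<open>integral_arc_ln_ge\<close> its mean is at most
  0.\<close>

lemma szego_rate_le_poly:
  assumes c: "szego_rate \<mu> \<le> ereal c" and P: "poly P 0 = 1"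
  shows "exp (- c) \<le> (\<integral>z. (cmod (poly P z))\<^sup>2 \<partial>\<mu>)"
proof (rule field_le_epsilon)
  fix e :: real assume e: "e > 0"
  define v where "v z = (cmod (poly P z))\<^sup>2 + e" for z
  have v: "v z > 0" for z using e by (simp add: v_def add_nonneg_pos)
  have "continuous_on circle v" unfolding v_def by (intro continuous_intros)
  then have cv: "continuous_on circle (\<lambda>z. - ln (v z))"
    by (intro continuous_on_minus continuous_on_ln) (use v in \<open>auto simp: less_imp_neq[symmetric]\<close>)
  have "0 \<le> (\<integral>z. ln (v z) \<partial>arc_measure)" unfolding v_def by (rule integral_arc_ln_ge[OF P e])
  then have "exp (- c) \<le> exp (- c - (\<integral>z. - ln (v z) \<partial>arc_measure))" by simp
  also have "\<dots> \<le> (\<integral>z. exp (- (- ln (v z))) \<partial>\<mu>)" by (rule szego_rate_jensen[OF c cv])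
  also have "\<dots> = (\<integral>z. v z \<partial>\<mu>)" using v by simp
  also have "\<dots> = (\<integral>z. (cmod (poly P z))\<^sup>2 \<partial>\<mu>) + e"
  proof -
    have "integrable \<mu> (\<lambda>z. (cmod (poly P z))\<^sup>2)"
      by (intro continuous_on_circle_integrable[OF _ \<mu>] continuous_intros)
    then show ?thesis unfolding v_def
      by (subst Bochner_Integration.integral_add) (auto simp: \<mu>.prob_space)
  qed
  finally show "exp (- c) \<le> (\<integral>z. (cmod (poly P z))\<^sup>2 \<partial>\<mu>) + e" .
qed

text \<open>Cutting w off at \<delta> \<le> 1 leaves the positive part of log w alone, and the
  negative part increases to \<open>log_neg\<close> as \<delta> decreases, by monotone convergence.
  This covers an infinite rate too.\<close>

lemma log_max_integral_less:
  assumes a: "ereal a < szego_rate \<mu>"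
  obtains \<delta> where "0 < \<delta>" "\<delta> \<le> 1" "(\<integral>z. ln (max (w z) \<delta>) \<partial>arc_measure) < - a"
    "integrable arc_measure (\<lambda>z. ln (max (w z) \<delta>))"
proof -
  define d where "d n = 1 / real (Suc n)" for n
  have d: "0 < d n" "d n \<le> 1" "m \<le> n \<Longrightarrow> d n \<le> d m" for n m by (auto simp: d_def frac_le)
  define f where "f n z = ennreal (- ln (max (w z) (d n)))" for n z
  have inc: "incseq f"
    unfolding incseq_def le_fun_def f_def
  proof (intro allI impI ennreal_leI)
    fix m n z assume "m \<le> (n::nat)"
    then have "max (w z) (d n) \<le> max (w z) (d m)" using d(3) by (intro max.mono) auto
    moreover have "0 < max (w z) (d n)" using d(1)[of n] by (simp add: less_max_iff_disj)
    ultimately have "ln (max (w z) (d n)) \<le> ln (max (w z) (d m))"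
      by (subst ln_le_cancel_iff) (auto intro: less_le_trans)
    then show "- ln (max (w z) (d m)) \<le> - ln (max (w z) (d n))" by simp
  qed
  have "(SUP n. f n z) = (if w z = 0 then \<infinity> else ennreal (- ln (w z)))" for z
  proof -
    have "(\<lambda>n. f n z) \<longlonglongrightarrow> (SUP n. f n z)"
      using inc by (intro LIMSEQ_SUP) (auto simp: incseq_def le_fun_def)
    moreover have "(\<lambda>n. f n z) \<longlonglongrightarrow> (if w z = 0 then \<infinity> else ennreal (- ln (w z)))"
    proof (cases "w z = 0")
      case True
      have "filterlim (\<lambda>n. ln (real (Suc n))) at_top sequentially"
        by (rule filterlim_compose[OF ln_at_top filterlim_compose[OF filterlim_real_sequentially filterlim_Suc]])
      moreover have "- ln (max (w z) (d n)) = ln (real (Suc n))" for n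
        using True d(1)[of n] by (simp add: max_def d_def ln_div)
      ultimately show ?thesis using True unfolding f_def by (simp add: ennreal_tendsto_top_eq_at_top)
    next
      case False
      then have "w z > 0" using w_nonneg[of z] by simp
      then obtain n0 where n0: "inverse (real (Suc n0)) < w z" using reals_Archimedean by blast
      have "\<forall>\<^sub>F n in sequentially. f n z = ennreal (- ln (w z))"
      proof (rule eventually_sequentiallyI[of n0])
        fix n assume "n0 \<le> n"
        then have "d n \<le> w z" using d(3)[of n0 n] n0 by (simp add: d_def inverse_eq_divide)
        then show "f n z = ennreal (- ln (w z))" by (simp add: f_def max_def)
      qed
      then show ?thesis using False by (simp add: tendsto_eventually)
    qed
    ultimately show ?thesis by (rule LIMSEQ_unique)
  qed
  then have "log_neg = (\<integral>\<^sup>+z. (SUP n. f n z) \<partial>arc_measure)" unfolding log_neg_def by simp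
  also have "\<dots> = (SUP n. \<integral>\<^sup>+z. f n z \<partial>arc_measure)"
    by (rule nn_integral_monotone_convergence_SUP[OF inc]) (unfold f_def[abs_def], measurable)
  finally have ln_eq: "log_neg = (SUP n. \<integral>\<^sup>+z. f n z \<partial>arc_measure)" .
  \<comment> \<open>\<open>ennreal\<close> truncates negative numbers, so the case a +
    \<open>log_pos\<close> < 0 is split off; there every cut-off works.\<close>
  have "ennreal (max 0 (a + log_pos)) < log_neg \<or> a + log_pos < 0"
  proof (cases "a + log_pos < 0")
    case False
    have "ereal (a + log_pos) < enn2ereal log_neg"
      using a unfolding szego_rate_eq by (cases "enn2ereal log_neg") auto
    then have "enn2ereal (ennreal (a + log_pos)) < enn2ereal log_neg" using False by (simp add: enn2ereal_ennreal)
    then show ?thesis using False by (simp add: less_ennreal.rep_eq max_def)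
  qed simp
  then have "\<exists>n. ennreal (a + log_pos) < (\<integral>\<^sup>+z. f n z \<partial>arc_measure) \<or> a + log_pos < 0"
    unfolding ln_eq by (auto simp: less_SUP_iff max_def split: if_splits)
  then obtain n where n: "ennreal (a + log_pos) < (\<integral>\<^sup>+z. f n z \<partial>arc_measure) \<or> a + log_pos < 0" by blast
  have fb: "(\<integral>\<^sup>+z. f n z \<partial>arc_measure) \<le> (\<integral>\<^sup>+z. ennreal (- ln (d n)) \<partial>arc_measure)"
    unfolding f_def using d(1)[of n] by (intro nn_integral_mono ennreal_leI) (simp add: less_max_iff_disj)
  then have "(\<integral>\<^sup>+z. f n z \<partial>arc_measure) \<noteq> \<infinity>" by (auto simp: arc.emeasure_space_1 top_unique)
  then obtain b where b: "(\<integral>\<^sup>+z. f n z \<partial>arc_measure) = ennreal b" "b \<ge> 0" by (cases "\<integral>\<^sup>+z. f n z \<partial>arc_measure") auto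
  have pp: "(\<integral>\<^sup>+z. ennreal (ln (max (w z) (d n))) \<partial>arc_measure) = ennreal log_pos"
    unfolding log_pos(1)[symmetric]
  proof (intro nn_integral_cong)
    fix z
    show "ennreal (ln (max (w z) (d n))) = ennreal (ln (w z))"
    proof (cases "d n \<le> w z")
      case False
      then have "ln (w z) \<le> 0" "ln (d n) \<le> 0" using d[of n] w_nonneg[of z] by (cases "w z = 0"; simp)+
      then show ?thesis using False by (simp add: max_def ennreal_neg)
    qed (simp add: max_def)
  qed
  have int: "integrable arc_measure (\<lambda>z. ln (max (w z) (d n)))"
    unfolding real_integrable_def using pp b by (auto simp: f_def)
  have "(\<integral>z. ln (max (w z) (d n)) \<partial>arc_measure) = log_pos - b"
    unfolding real_lebesgue_integral_def[OF int] pp using b log_pos by (simp add: f_def)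
  also have "\<dots> < - a"
    using n b by (auto simp: ennreal_less_iff) (smt (verit) ennreal_less_iff ennreal_neg b(1) b(2))
  finally show ?thesis using that[of "d n"] d int by blast
qed

text \<open>The ideal choice is h = ln w, for which exp (-h) w = 1. It is cut off below at ln
  \<delta> and above at L to be bounded, and set to L on the null set N, where the singular part
  sits: the mean of h does not notice N, while the singular part adds at most exp (-L).\<close>

lemma szego_rate_witness_measurable:
  assumes a: "ereal a < szego_rate \<mu>"
  obtains h lo hi where "h \<in> borel_measurable circle_borel" "\<And>z. lo \<le> h z \<and> h z \<le> (hi::real)"
    "(\<integral>z. exp (- h z) \<partial>\<mu>) * exp (\<integral>z. h z \<partial>arc_measure) < exp (- a)"
proof -
  obtain \<delta> where \<delta>: "0 < \<delta>" "\<delta> \<le> 1" "(\<integral>z. ln (max (w z) \<delta>) \<partial>arc_measure) < - a"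
    "integrable arc_measure (\<lambda>z. ln (max (w z) \<delta>))"
    using log_max_integral_less[OF a] by blast
  define E where "E = (\<integral>z. ln (max (w z) \<delta>) \<partial>arc_measure)"
  \<comment> \<open>One of the two terms exp (-L) comes from the cut-off at L, the other from the
    singular part.\<close>
  have "((\<lambda>L. (1 + 2 * exp (- L)) * exp E) \<longlongrightarrow> (1 + 2 * 0) * exp E) at_top"
    by (intro tendsto_intros filterlim_compose[OF exp_at_bot filterlim_uminus_at_bot_at_top])
  moreover have "(1 + 2 * 0) * exp E < exp (- a)" using \<delta>(3) by (simp add: E_def)
  ultimately have "\<forall>\<^sub>F L in at_top. (1 + 2 * exp (- L)) * exp E < exp (- a)" by (rule order_tendstoD(2))
  then have "\<forall>\<^sub>F L in at_top. (1 + 2 * exp (- L)) * exp E < exp (- a) \<and> L \<ge> 0"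
    using eventually_ge_at_top[of 0] by (rule eventually_conj)
  then obtain L where L: "(1 + 2 * exp (- L)) * exp E < exp (- a)" "L \<ge> 0"
    by (metis (no_types, lifting) eventually_at_top_linorder order_refl)
  obtain N where N: "N \<in> sets circle_borel" "emeasure arc_measure N = 0"
    and Neq: "\<And>g. g\<in>borel_measurable circle_borel \<Longrightarrow> (\<integral>\<^sup>+z. ennreal (w z) * g z \<partial>arc_measure) = (\<integral>\<^sup>+z. indicator (circle - N) z * g z \<partial>\<mu>)"
    using ac_density_integral[OF \<mu>] by metis
  define h where "h z = (if z \<in> N then L else min (ln (max (w z) \<delta>)) L)" for z
  have wc: "w \<in> borel_measurable circle_borel" by (rule ac_density_measurable[OF \<mu>])
  have hm: "h \<in> borel_measurable circle_borel"
    unfolding h_def using N(1) wc by measurable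
  have "ln \<delta> \<le> 0" using \<delta> by simp
  have hb: "ln \<delta> \<le> h z \<and> h z \<le> L" for z
  proof -
    have "ln \<delta> \<le> L" using L(2) \<open>ln \<delta> \<le> 0\<close> by linarith
    moreover have "ln \<delta> \<le> ln (max (w z) \<delta>)" using \<delta>(1) by (simp add: less_max_iff_disj)
    ultimately show ?thesis by (simp add: h_def)
  qed
  have hi: "integrable M h" if "M \<in> circle_probs" for M
    using hb hm by (intro integrable_bounded_circle[OF that, of _ "max \<bar>ln \<delta>\<bar> \<bar>L\<bar>"]) (smt (verit))+
  have ehm: "(\<lambda>z. exp (- h z)) \<in> borel_measurable circle_borel" using hm by measurable
  have ehi: "integrable \<mu> (\<lambda>z. exp (- h z))"
    using hb ehm by (intro integrable_bounded_circle[OF \<mu>, of _ "exp (- ln \<delta>)"]) auto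
  have "(\<integral>\<^sup>+z. ennreal (exp (- h z)) \<partial>\<mu>) =
      (\<integral>\<^sup>+z. indicator (circle - N) z * ennreal (exp (- h z)) + ennreal (exp (- L)) * indicator N z \<partial>\<mu>)"
    using circle_probsD(3)[OF \<mu>] by (intro nn_integral_cong) (auto simp: indicator_def h_def)
  also have "\<dots> = (\<integral>\<^sup>+z. indicator (circle - N) z * ennreal (exp (- h z)) \<partial>\<mu>) + (\<integral>\<^sup>+z. ennreal (exp (- L)) * indicator N z \<partial>\<mu>)"
  proof (rule nn_integral_add)
    have Ns: "N \<in> sets \<mu>" "circle - N \<in> sets \<mu>"
      using N(1) circle_probsD[OF \<mu>] sets.compl_sets[of N \<mu>] by auto
    show "(\<lambda>z. indicator (circle - N) z * ennreal (exp (- h z))) \<in> borel_measurable \<mu>"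
      using Ns ehm circle_probsD(2)[OF \<mu>] by (auto cong: measurable_cong_sets)
    show "(\<lambda>z. ennreal (exp (- L)) * indicator N z) \<in> borel_measurable \<mu>" using Ns by simp
  qed
  also have "(\<integral>\<^sup>+z. ennreal (exp (- L)) * indicator N z \<partial>\<mu>) \<le> ennreal (exp (- L))"
  proof -
    have "(\<integral>\<^sup>+z. ennreal (exp (- L)) * indicator N z \<partial>\<mu>) \<le> (\<integral>\<^sup>+z. ennreal (exp (- L)) \<partial>\<mu>)"
      by (intro nn_integral_mono) (auto simp: indicator_def)
    then show ?thesis by (simp add: \<mu>.emeasure_space_1)
  qed
  also have "(\<integral>\<^sup>+z. indicator (circle - N) z * ennreal (exp (- h z)) \<partial>\<mu>) = (\<integral>\<^sup>+z. ennreal (w z) * ennreal (exp (- h z)) \<partial>arc_measure)"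
    using ehm by (intro Neq[symmetric]) auto
  also have "\<dots> \<le> (\<integral>\<^sup>+z. 1 + ennreal (exp (- L)) * ennreal (w z) \<partial>arc_measure)"
  proof (rule nn_integral_mono_AE)
    have "AE z in arc_measure. z \<notin> N" using N by (intro AE_not_in) (auto simp: sets_arc)
    then show "AE z in arc_measure. ennreal (w z) * ennreal (exp (- h z)) \<le> 1 + ennreal (exp (- L)) * ennreal (w z)"
    proof eventually_elim
      fix z assume z: "z \<notin> N"
      have "w z * exp (- h z) \<le> 1 + exp (- L) * w z"
      proof (cases "ln (max (w z) \<delta>) \<le> L")
        case True
        then have "exp (- h z) = 1 / max (w z) \<delta>" using z \<delta> by (simp add: h_def exp_minus inverse_eq_divide less_max_iff_disj)
        then have "w z * exp (- h z) = w z / max (w z) \<delta>" by simp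
        also have "\<dots> \<le> 1" using \<delta> by (simp add: divide_le_eq_1 less_max_iff_disj)
        also have "1 \<le> 1 + exp (- L) * w z" using w_nonneg[of z] by simp
        finally show ?thesis .
      next
        case False
        then have "exp (- h z) = exp (- L)" using z by (simp add: h_def)
        then show ?thesis by simp
      qed
      then have "ennreal (w z * exp (- h z)) \<le> ennreal (1 + exp (- L) * w z)" by (rule ennreal_leI)
      then show "ennreal (w z) * ennreal (exp (- h z)) \<le> 1 + ennreal (exp (- L)) * ennreal (w z)"
        using w_nonneg[of z] by (simp add: ennreal_mult flip: ennreal_1)
    qed
  qed
  also have "\<dots> = 1 + ennreal (exp (- L)) * (\<integral>\<^sup>+z. ennreal (w z) \<partial>arc_measure)"
    by (simp add: nn_integral_add nn_integral_cmult arc.emeasure_space_1)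
  also have "\<dots> \<le> 1 + ennreal (exp (- L)) * 1"
    by (intro add_left_mono mult_left_mono nn_integral_w_le_1) auto
  finally have "(\<integral>\<^sup>+z. ennreal (exp (- h z)) \<partial>\<mu>) \<le> 1 + ennreal (exp (- L)) * 1 + ennreal (exp (- L))"
    by (simp add: add_right_mono)
  also have "\<dots> = ennreal (1 + (exp (- L) + exp (- L)))"
  proof -
    have "ennreal (exp (- L)) + ennreal (exp (- L)) = ennreal (2 * exp (- L))"
      by (simp flip: ennreal_plus)
    then show ?thesis by (simp add: add.assoc)
  qed
  also have "1 + (exp (- L) + exp (- L)) = 1 + 2 * exp (- L)" by simp
  finally have "(\<integral>z. exp (- h z) \<partial>\<mu>) \<le> 1 + 2 * exp (- L)"
  proof (subst (asm) nn_integral_eq_integral)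
    assume "ennreal (\<integral>z. exp (- h z) \<partial>\<mu>) \<le> ennreal (1 + 2 * exp (- L))"
    then show ?thesis by (subst (asm) ennreal_le_iff) auto
  qed (use ehi in auto)
  moreover have "(\<integral>z. h z \<partial>arc_measure) \<le> E"
    unfolding E_def
  proof (rule integral_mono_AE[OF hi[OF arc_circle_probs] \<delta>(4)])
    have "AE z in arc_measure. z \<notin> N" using N by (intro AE_not_in) (auto simp: sets_arc)
    then show "AE z in arc_measure. h z \<le> ln (max (w z) \<delta>)" by eventually_elim (simp add: h_def)
  qed
  ultimately have "(\<integral>z. exp (- h z) \<partial>\<mu>) * exp (\<integral>z. h z \<partial>arc_measure) \<le> (1 + 2 * exp (- L)) * exp E"
    by (intro mult_mono) (auto intro: add_nonneg_nonneg)
  then have "(\<integral>z. exp (- h z) \<partial>\<mu>) * exp (\<integral>z. h z \<partial>arc_measure) < exp (- a)" using L(1) by linarith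
  then show ?thesis using that[OF hm hb] by blast
qed

lemma exp_minus_lipschitz:
  assumes "lo \<le> x" "lo \<le> (y::real)"
  shows "\<bar>exp (- x) - exp (- y)\<bar> \<le> exp (- lo) * \<bar>x - y\<bar>"
proof -
  have *: "exp (- x) - exp (- y) \<le> exp (- lo) * (y - x)" if "lo \<le> x" "x \<le> y" for x y :: real
  proof -
    have "exp (- x) - exp (- y) = exp (- x) * (1 - exp (- (y - x)))" by (simp add: algebra_simps flip: exp_add)
    also have "\<dots> \<le> exp (- x) * (y - x)"
    proof (rule mult_left_mono)
      show "1 - exp (- (y - x)) \<le> y - x" using exp_ge_add_one_self[of "- (y - x)"] by linarith
    qed simp
    also have "\<dots> \<le> exp (- lo) * (y - x)" using that by (intro mult_right_mono) auto
    finally show ?thesis .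
  qed
  show ?thesis
  proof (cases "x \<le> y")
    case True
    then show ?thesis using *[of x y] assms by (simp add: abs_if)
  next
    case False
    then show ?thesis using *[of y x] assms by (simp add: abs_if)
  qed
qed

text \<open>A continuous k close to h in the mean for both measures, with the same bounds, changes
  the two factors little: exp (-x) is Lipschitz for x \<ge> lo.\<close>

lemma szego_rate_witness_continuous:
  assumes a: "ereal a < szego_rate \<mu>"
  obtains h where "continuous_on circle h" "(\<integral>z. exp (- h z) \<partial>\<mu>) * exp (\<integral>z. h z \<partial>arc_measure) < exp (- a)"
proof -
  obtain h lo hi where h: "h \<in> borel_measurable circle_borel" "\<And>z. lo \<le> h z \<and> h z \<le> (hi::real)"
    and lt: "(\<integral>z. exp (- h z) \<partial>\<mu>) * exp (\<integral>z. h z \<partial>arc_measure) < exp (- a)"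
    using szego_rate_witness_measurable[OF a] by blast
  define A where "A = (\<integral>z. exp (- h z) \<partial>\<mu>)"
  define E where "E = (\<integral>z. h z \<partial>arc_measure)"
  have "((\<lambda>e. (A + exp (- lo) * e) * exp (E + e)) \<longlongrightarrow> (A + exp (- lo) * 0) * exp (E + 0)) (at_right 0)"
    by (intro tendsto_intros)
  moreover have "(A + exp (- lo) * 0) * exp (E + 0) < exp (- a)" using lt by (simp add: A_def E_def)
  ultimately have "\<forall>\<^sub>F e in at_right 0. (A + exp (- lo) * e) * exp (E + e) < exp (- a)" by (rule order_tendstoD(2))
  then have "\<forall>\<^sub>F e in at_right 0. (A + exp (- lo) * e) * exp (E + e) < exp (- a) \<and> e > 0"
    using eventually_at_right_less[of 0] by (rule eventually_conj)
  then obtain e where e: "(A + exp (- lo) * e) * exp (E + e) < exp (- a)" "e > 0"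
    using eventually_happens'[OF trivial_limit_at_right_real] by blast
  obtain k where k: "continuous_on UNIV k" "\<And>z. lo \<le> k z \<and> k z \<le> hi"
    "(\<integral>z. \<bar>h z - k z\<bar> \<partial>\<mu>) < e" "(\<integral>z. \<bar>h z - k z\<bar> \<partial>arc_measure) < e"
    using circle_L1_dense_between[OF \<mu> arc_circle_probs h e(2)] by blast
  have ck: "continuous_on circle k" using continuous_on_subset[OF k(1)] by simp
  have hi: "integrable M h" if "M \<in> circle_probs" for M
    using h by (intro integrable_bounded_circle[OF that, of _ "max \<bar>lo\<bar> \<bar>hi\<bar>"]) (smt (verit))+
  have ki: "integrable M k" if "M \<in> circle_probs" for M
    by (rule continuous_on_circle_integrable[OF ck that])
  have ehi: "integrable \<mu> (\<lambda>z. exp (- h z))"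
    using h by (intro integrable_bounded_circle[OF \<mu>, of _ "exp (- lo)"]) auto
  have eki: "integrable \<mu> (\<lambda>z. exp (- k z))"
    by (intro continuous_on_circle_integrable[OF _ \<mu>] continuous_intros ck)
  have "(\<integral>z. exp (- k z) \<partial>\<mu>) \<le> (\<integral>z. exp (- h z) + exp (- lo) * \<bar>h z - k z\<bar> \<partial>\<mu>)"
  proof (rule integral_mono)
    show "integrable \<mu> (\<lambda>z. exp (- h z) + exp (- lo) * \<bar>h z - k z\<bar>)" using ehi hi[OF \<mu>] ki[OF \<mu>] by auto
    show "exp (- k z) \<le> exp (- h z) + exp (- lo) * \<bar>h z - k z\<bar>" for z
      using exp_minus_lipschitz[of lo "h z" "k z"] h(2)[of z] k(2)[of z] by linarith
  qed (rule eki)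
  also have "\<dots> = A + exp (- lo) * (\<integral>z. \<bar>h z - k z\<bar> \<partial>\<mu>)" using ehi hi[OF \<mu>] ki[OF \<mu>] by (simp add: A_def)
  also have "\<dots> \<le> A + exp (- lo) * e" using k(3) by simp
  finally have 1: "(\<integral>z. exp (- k z) \<partial>\<mu>) \<le> A + exp (- lo) * e" .
  have "(\<integral>z. k z \<partial>arc_measure) \<le> (\<integral>z. h z + \<bar>h z - k z\<bar> \<partial>arc_measure)"
    using hi[OF arc_circle_probs] ki[OF arc_circle_probs] by (intro integral_mono) auto
  also have "\<dots> = E + (\<integral>z. \<bar>h z - k z\<bar> \<partial>arc_measure)"
    using hi[OF arc_circle_probs] ki[OF arc_circle_probs] by (simp add: E_def)
  finally have 2: "(\<integral>z. k z \<partial>arc_measure) \<le> E + e" using k(4) by simp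
  have "0 \<le> A" by (simp add: A_def)
  have "(\<integral>z. exp (- k z) \<partial>\<mu>) * exp (\<integral>z. k z \<partial>arc_measure) \<le> (A + exp (- lo) * e) * exp (E + e)"
    using 1 2 \<open>0 \<le> A\<close> e(2) by (intro mult_mono) auto
  then show ?thesis using that[OF ck] e(1) by linarith
qed

text \<open>Uniform approximation of h by Re p moves each factor by at most exp e;
  \<open>poly_outer_approx\<close> then converts p into a polynomial P. This is the upper bound in
  Szego's theorem, with no absolute continuity assumed.\<close>

lemma szego_rate_witness_poly:
  assumes a: "ereal a < szego_rate \<mu>"
  obtains P where "poly P 0 = 1" "(\<integral>z. (cmod (poly P z))\<^sup>2 \<partial>\<mu>) < exp (- a)"
proof -
  obtain h where h: "continuous_on circle h" "(\<integral>z. exp (- h z) \<partial>\<mu>) * exp (\<integral>z. h z \<partial>arc_measure) < exp (- a)"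
    using szego_rate_witness_continuous[OF a] by blast
  define A where "A = (\<integral>z. exp (- h z) \<partial>\<mu>)"
  define E where "E = (\<integral>z. h z \<partial>arc_measure)"
  have "((\<lambda>e. (A * exp e) * exp (E + e)) \<longlongrightarrow> (A * exp 0) * exp (E + 0)) (at_right 0)"
    by (intro tendsto_intros)
  moreover have "(A * exp 0) * exp (E + 0) < exp (- a)" using h(2) by (simp add: A_def E_def)
  ultimately have "\<forall>\<^sub>F e in at_right 0. (A * exp e) * exp (E + e) < exp (- a)" by (rule order_tendstoD(2))
  then have "\<forall>\<^sub>F e in at_right 0. (A * exp e) * exp (E + e) < exp (- a) \<and> e > 0"
    using eventually_at_right_less[of 0] by (rule eventually_conj)
  then obtain e where e: "(A * exp e) * exp (E + e) < exp (- a)" "e > 0"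
    using eventually_happens'[OF trivial_limit_at_right_real] by blast
  obtain p where p: "\<And>z. z \<in> circle \<Longrightarrow> \<bar>h z - Re (poly p z)\<bar> < e" using trig_poly_dense[OF h(1) e(2)] by blast
  have cp: "continuous_on circle (\<lambda>z. Re (poly p z))" by (intro continuous_intros)
  have "(\<integral>z. exp (- Re (poly p z)) \<partial>\<mu>) \<le> (\<integral>z. exp (- h z) * exp e \<partial>\<mu>)"
  proof (rule integral_mono)
    show "integrable \<mu> (\<lambda>z. exp (- Re (poly p z)))" "integrable \<mu> (\<lambda>z. exp (- h z) * exp e)"
      by (intro continuous_on_circle_integrable[OF _ \<mu>] continuous_intros cp h)+
    fix z assume "z \<in> space \<mu>"
    then have "\<bar>h z - Re (poly p z)\<bar> < e" using p circle_probsD(3)[OF \<mu>] by simp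
    then have "- Re (poly p z) \<le> - h z + e" by linarith
    then show "exp (- Re (poly p z)) \<le> exp (- h z) * exp e" by (simp flip: exp_add)
  qed
  then have 1: "(\<integral>z. exp (- Re (poly p z)) \<partial>\<mu>) \<le> A * exp e" by (simp add: A_def)
  have "\<bar>(\<integral>z. h z \<partial>arc_measure) - (\<integral>z. Re (poly p z) \<partial>arc_measure)\<bar> \<le> e"
    using p by (intro integral_circle_dist_le[OF arc_circle_probs h(1) cp]) (auto intro: less_imp_le)
  then have 2: "Re (poly p 0) \<le> E + e" unfolding integral_arc_Re_poly E_def by linarith
  have "0 \<le> A" by (simp add: A_def)
  then have "(\<integral>z. exp (- Re (poly p z)) \<partial>\<mu>) * exp (Re (poly p 0)) \<le> (A * exp e) * exp (E + e)"
    using 1 2 by (intro mult_mono) auto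
  then have "(\<integral>z. exp (- Re (poly p z)) \<partial>\<mu>) * exp (Re (poly p 0)) < exp (- a)" using e(1) by linarith
  from poly_outer_approx[OF \<mu> this] that show ?thesis by blast
qed

end

section \<open>Exponential bounds for the moments\<close>

text \<open>The increase caused by the shift is largest when all factors are 1. For fixed length it
  tends to 0 with \<eta>, so the regularisation in \<open>entry_upper\<close> is free in the
  limit.\<close>

lemma prod_list_add_le:
  fixes xs :: "real list"
  assumes "\<forall>x\<in>set xs. 0 \<le> x \<and> x \<le> 1" "\<eta> \<ge> 0"
  shows "(\<Prod>x\<leftarrow>xs. x + \<eta>) \<le> prod_list xs + (1 + \<eta>) ^ length xs - 1"
  using assms(1)
proof (induction xs)
  case (Cons x xs)
  have x: "0 \<le> x" "x \<le> 1" using Cons.prems by auto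
  have "prod_list xs \<le> 1"
    using Cons.prems by (induction xs) (auto intro!: mult_le_one prod_list_nonneg)
  have "(\<Prod>y\<leftarrow>x # xs. y + \<eta>) \<le> (x + \<eta>) * (prod_list xs + (1 + \<eta>) ^ length xs - 1)"
    using Cons x assms(2) by (auto intro!: mult_left_mono)
  also have "\<dots> = x * prod_list xs + \<eta> * prod_list xs + (x + \<eta>) * ((1 + \<eta>) ^ length xs - 1)"
    by (simp add: algebra_simps)
  also have "\<dots> \<le> x * prod_list xs + \<eta> * 1 + (1 + \<eta>) * ((1 + \<eta>) ^ length xs - 1)"
    using x assms(2) \<open>prod_list xs \<le> 1\<close>
    by (intro add_mono mult_left_mono mult_right_mono order_refl) auto
  also have "\<dots> = prod_list (x # xs) + (1 + \<eta>) ^ length (x # xs) - 1"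
    by (simp add: algebra_simps)
  finally show ?case .
qed simp

text \<open>A bound by a product over the coefficients factorises along
  \<open>haar_umom_recursion\<close>, and each factor is handled by \<open>entry_upper\<close>. The
  exponent m stays fixed while the size drops, which is why m + k \<le> n is required, and M
  dominates all sizes on the way. Each step replaces f by its composition with
  \<open>schur_a\<close> and moves a factor into A, so both are generalised in the
  induction.\<close>

lemma haar_prod_upper:
  fixes H :: "nat \<Rightarrow> complex mat measure"
  assumes haar: "\<And>n. n \<ge> 1 \<Longrightarrow> haar_prob n (H n)" and \<eta>: "\<eta> > 0" and m: "m \<ge> 1"
    and n: "m + k \<le> n" "n \<le> M" and f: "f \<in> borel_measurable borel"
    and bound: "\<And>as V. length as = k \<Longrightarrow> \<forall>\<alpha>\<in>set as. cmod \<alpha> \<le> 1 \<Longrightarrow> V \<in> unitary_group (n - k) \<Longrightarrow>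
      f (foldr schur_a as (umom V)) \<le> A * (\<Prod>\<alpha>\<leftarrow>as. ennreal (1 / (1 - (cmod \<alpha>)\<^sup>2 + \<eta>) ^ m))"
  shows "(\<integral>\<^sup>+U. f (umom U) \<partial>H n) \<le> A * ennreal (real M / \<eta>) ^ k"
  using n f bound
proof (induction k arbitrary: n f A)
  case 0
  interpret prob_space "H n" by (rule haar_prob_space[OF haar]) (use 0 m in auto)
  have "(\<integral>\<^sup>+U. f (umom U) \<partial>H n) \<le> (\<integral>\<^sup>+U. A \<partial>H n)"
    using 0(4)[of "[]"] haar_space[OF haar, of n] 0(1) m by (intro nn_integral_mono) auto
  then show ?case by (simp add: emeasure_space_1)
next
  case (Suc k)
  define p where "p = n - 2"
  have np: "n = Suc (Suc p)" "m \<le> Suc p" using Suc.prems m by (auto simp: p_def)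
  have Hn: "haar_prob (Suc (Suc p)) (H n)" "haar_prob (Suc p) (H (Suc p))"
    using haar[of n] haar[of "Suc p"] np by auto
  interpret prob_space "H n" by (rule haar_prob_space[OF Hn(1)])
  define g where "g u = ennreal (1 / (1 - (cmod u)\<^sup>2 + \<eta>) ^ m)" for u
  have gm: "(\<lambda>U. g (U $$ (0, 0))) \<in> borel_measurable (H n)"
    unfolding g_def by (intro measurable_compose[OF entry_measurable[OF Hn(1)], of 0 "\<lambda>u. ennreal (1 / (1 - (cmod u)\<^sup>2 + \<eta>) ^ m)"]) (simp, measurable)
  have "(\<integral>\<^sup>+U. f (umom U) \<partial>H n) = (\<integral>\<^sup>+U. \<integral>\<^sup>+V. f (schur_a (U $$ (0, 0)) (umom V)) \<partial>H (Suc p) \<partial>H n)"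
    by (rule haar_umom_recursion[OF Hn Suc.prems(3)])
  also have "\<dots> \<le> (\<integral>\<^sup>+U. (A * g (U $$ (0, 0))) * ennreal (real M / \<eta>) ^ k \<partial>H n)"
  proof (rule nn_integral_mono)
    fix U assume U: "U \<in> space (H n)"
    let ?u = "U $$ (0, 0)"
    have u: "cmod ?u \<le> 1" using entry_le_1[OF Hn(1) U, of 0] by simp
    show "(\<integral>\<^sup>+V. f (schur_a ?u (umom V)) \<partial>H (Suc p)) \<le> (A * g ?u) * ennreal (real M / \<eta>) ^ k"
    proof (rule Suc.IH)
      show "m + k \<le> Suc p" "Suc p \<le> M" using Suc.prems np by auto
      show "(\<lambda>c. f (schur_a ?u c)) \<in> borel_measurable borel"
        by (intro measurable_compose[OF _ Suc.prems(3)] measurable_schur2) auto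
      fix as V assume as: "length as = k" "\<forall>\<alpha>\<in>set as. cmod \<alpha> \<le> 1" and V: "V \<in> unitary_group (Suc p - k)"
      have "f (foldr schur_a (?u # as) (umom V)) \<le> A * (\<Prod>\<alpha>\<leftarrow>?u # as. ennreal (1 / (1 - (cmod \<alpha>)\<^sup>2 + \<eta>) ^ m))"
        using as V u np by (intro Suc.prems(4)) auto
      then show "f (schur_a ?u (foldr schur_a as (umom V))) \<le> A * g ?u * (\<Prod>\<alpha>\<leftarrow>as. ennreal (1 / (1 - (cmod \<alpha>)\<^sup>2 + \<eta>) ^ m))"
        by (simp add: g_def mult.assoc)
    qed
  qed
  also have "\<dots> = (\<integral>\<^sup>+U. (A * ennreal (real M / \<eta>) ^ k) * g (U $$ (0, 0)) \<partial>H n)"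
    by (simp add: mult_ac)
  also have "\<dots> = A * ennreal (real M / \<eta>) ^ k * (\<integral>\<^sup>+U. g (U $$ (0, 0)) \<partial>H n)"
    by (rule nn_integral_cmult[OF gm])
  also have "\<dots> \<le> A * ennreal (real M / \<eta>) ^ k * ennreal (real M / \<eta>)"
  proof (rule mult_left_mono)
    have "(\<integral>\<^sup>+U. g (U $$ (0, 0)) \<partial>H n) \<le> ennreal (real (Suc p) / \<eta>)"
      unfolding g_def using entry_upper[OF Hn(1) \<eta> m] np by simp
    also have "\<dots> \<le> ennreal (real M / \<eta>)" using Suc.prems(2) np \<eta> by (intro ennreal_leI divide_right_mono) auto
    finally show "(\<integral>\<^sup>+U. g (U $$ (0, 0)) \<partial>H n) \<le> ennreal (real M / \<eta>)" .
  qed simp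
  finally show ?case by (simp add: mult_ac)
qed

lemma qform_measurable: "qform k q \<in> borel_measurable borel"
proof -
  have c: "continuous_on UNIV (\<lambda>c :: nat \<Rightarrow> complex. c i)" for i
    by (rule continuous_on_product_coordinates)
  have "continuous_on UNIV (\<lambda>m. Re (\<Sum>i<k. \<Sum>j<k. q i * cnj (q j) * (if j \<le> i then m (i - j) else cnj (m (j - i)))))"
  proof (intro continuous_on_Re continuous_on_sum continuous_on_mult continuous_on_const)
    fix i j
    show "continuous_on UNIV (\<lambda>m. if j \<le> i then m (i - j) else cnj (m (j - i)))"
      by (cases "j \<le> i") (auto intro!: continuous_intros c)
  qed
  then have "continuous_on UNIV (qform k q)" by (simp add: qform_def[abs_def])
  then show ?thesis by (rule borel_measurable_continuous_onI)
qed

text \<open>Markov's inequality: on the event the product of the 1 - |\<alpha>|^2 + \<eta> is at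
  most t + (1 + \<eta>)^k - 1, so its indicator is at most the m-th power of this number times the
  product of the inverse m-th powers. The largest exponent allowed by \<open>haar_prod_upper\<close>
  is m = n - k.\<close>

lemma haar_qform_upper:
  fixes H :: "nat \<Rightarrow> complex mat measure"
  assumes haar: "\<And>n. n \<ge> 1 \<Longrightarrow> haar_prob n (H n)" and \<eta>: "\<eta> > 0" and n: "k < n" and q: "q 0 = 1" and t: "t > 0"
  shows "measure (H n) {U \<in> space (H n). qform (Suc k) q (umom U) < t} \<le>
    (t + (1 + \<eta>) ^ k - 1) ^ (n - k) * (real n / \<eta>) ^ k"
proof -
  have Hn: "haar_prob n (H n)" using haar n by simp
  interpret prob_space "H n" by (rule haar_prob_space[OF Hn])
  define S where "S = {c. qform (Suc k) q c < t}"
  have S: "S \<in> sets borel" unfolding S_def using qform_measurable[of "Suc k" q] by measurable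
  define \<tau> where "\<tau> = t + (1 + \<eta>) ^ k - 1"
  have "(1 + \<eta>) ^ k \<ge> 1" using \<eta> by (intro one_le_power) auto
  then have \<tau>: "\<tau> > 0" using t by (simp add: \<tau>_def)
  define m where "m = n - k"
  have m: "m \<ge> 1" "m + k = n" using n by (auto simp: m_def)
  have "(\<integral>\<^sup>+U. indicator S (umom U) \<partial>H n) \<le> ennreal (\<tau> ^ m) * ennreal (real n / \<eta>) ^ k"
  proof (rule haar_prod_upper[OF haar \<eta> m(1)])
    fix as V assume as: "length as = k" "\<forall>\<alpha>\<in>set as. cmod \<alpha> \<le> 1" and V: "V \<in> unitary_group (n - k)"
    show "indicator S (foldr schur_a as (umom V)) \<le> ennreal (\<tau> ^ m) * (\<Prod>\<alpha>\<leftarrow>as. ennreal (1 / (1 - (cmod \<alpha>)\<^sup>2 + \<eta>) ^ m))"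
    proof (cases "foldr schur_a as (umom V) \<in> S")
      case True
      have "Suc (m - 1) = n - k" using n by (simp add: m_def)
      then have V': "V \<in> unitary_group (Suc (m - 1))" using V by (simp only:)
      have "(\<Prod>\<alpha>\<leftarrow>as. 1 - (cmod \<alpha>)\<^sup>2) < t"
        using qform_foldr_schur_ge[OF V' as(2), of q] q True as(1) by (simp add: S_def)
      have pos: "\<alpha> \<in> set as \<Longrightarrow> 1 - (cmod \<alpha>)\<^sup>2 + \<eta> > 0" for \<alpha>
        using as(2) \<eta> by (auto simp: add_nonneg_pos power_le_one)
      have "(\<Prod>x\<leftarrow>map (\<lambda>\<alpha>. 1 - (cmod \<alpha>)\<^sup>2) as. x + \<eta>) \<le> prod_list (map (\<lambda>\<alpha>. 1 - (cmod \<alpha>)\<^sup>2) as) + (1 + \<eta>) ^ length (map (\<lambda>\<alpha>. 1 - (cmod \<alpha>)\<^sup>2) as) - 1"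
        using as(2) \<eta> by (intro prod_list_add_le) (auto simp: power_le_one)
      then have le: "(\<Prod>\<alpha>\<leftarrow>as. 1 - (cmod \<alpha>)\<^sup>2 + \<eta>) \<le> \<tau>"
        using \<open>(\<Prod>\<alpha>\<leftarrow>as. 1 - (cmod \<alpha>)\<^sup>2) < t\<close> as(1) by (simp add: \<tau>_def o_def)
      have eq: "ennreal ((\<Prod>\<alpha>\<leftarrow>as. 1 - (cmod \<alpha>)\<^sup>2 + \<eta>) ^ m) * (\<Prod>\<alpha>\<leftarrow>as. ennreal (1 / (1 - (cmod \<alpha>)\<^sup>2 + \<eta>) ^ m)) = 1"
        using pos
      proof (induction as)
        case (Cons \<alpha> as)
        let ?x = "1 - (cmod \<alpha>)\<^sup>2 + \<eta>" and ?P = "\<Prod>\<alpha>\<leftarrow>as. 1 - (cmod \<alpha>)\<^sup>2 + \<eta>"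
        have x: "?x > 0" using Cons.prems by simp
        have P: "?P \<ge> 0" using Cons.prems by (intro prod_list_nonneg) (auto intro: less_imp_le)
        have "ennreal ((\<Prod>\<alpha>\<leftarrow>\<alpha> # as. 1 - (cmod \<alpha>)\<^sup>2 + \<eta>) ^ m) = ennreal (?x ^ m) * ennreal (?P ^ m)"
          using x P by (simp add: power_mult_distrib ennreal_mult)
        moreover have 1: "ennreal (?x ^ m) * ennreal (1 / ?x ^ m) = 1"
          using x by (simp flip: ennreal_mult)
        moreover have 2: "ennreal (?P ^ m) * (\<Prod>\<alpha>\<leftarrow>as. ennreal (1 / (1 - (cmod \<alpha>)\<^sup>2 + \<eta>) ^ m)) = 1"
          using Cons by simp
        moreover have "(a * b) * (c * d) = (a * c) * (b * d)" for a b c d :: ennreal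
          by (simp only: mult_ac)
        ultimately show ?case by (simp only: list.map prod_list.Cons 1 2 mult_1)
      qed simp
      have "(1::ennreal) = ennreal ((\<Prod>\<alpha>\<leftarrow>as. 1 - (cmod \<alpha>)\<^sup>2 + \<eta>) ^ m) * (\<Prod>\<alpha>\<leftarrow>as. ennreal (1 / (1 - (cmod \<alpha>)\<^sup>2 + \<eta>) ^ m))"
        by (rule eq[symmetric])
      also have "\<dots> \<le> ennreal (\<tau> ^ m) * (\<Prod>\<alpha>\<leftarrow>as. ennreal (1 / (1 - (cmod \<alpha>)\<^sup>2 + \<eta>) ^ m))"
        using le pos by (intro mult_right_mono ennreal_leI power_mono prod_list_nonneg) (auto intro: less_imp_le)
      finally show ?thesis using True by simp
    qed simp
  qed (use m S in auto)
  moreover have "(\<integral>\<^sup>+U. indicator S (umom U) \<partial>H n) = emeasure (H n) {U \<in> space (H n). qform (Suc k) q (umom U) < t}"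
  proof -
    have um: "umom \<in> borel_measurable (H n)"
      using n by (intro haar_measurable[OF Hn] measurable_umom) auto
    have "{U \<in> space (H n). qform (Suc k) q (umom U) < t} \<in> sets (H n)"
      using measurable_sets[OF um S] by (simp add: S_def vimage_def Int_def conj_commute)
    then have "(\<integral>\<^sup>+U. indicator {U \<in> space (H n). qform (Suc k) q (umom U) < t} U \<partial>H n) =
        emeasure (H n) {U \<in> space (H n). qform (Suc k) q (umom U) < t}"
      by (rule nn_integral_indicator)
    moreover have "(\<integral>\<^sup>+U. indicator S (umom U) \<partial>H n) =
        (\<integral>\<^sup>+U. indicator {U \<in> space (H n). qform (Suc k) q (umom U) < t} U \<partial>H n)"
      by (intro nn_integral_cong) (auto simp: S_def indicator_def)
    ultimately show ?thesis by simp
  qed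
  ultimately have "ennreal (measure (H n) {U \<in> space (H n). qform (Suc k) q (umom U) < t}) \<le> ennreal (\<tau> ^ m * (real n / \<eta>) ^ k)"
    using \<tau> \<eta> by (simp add: emeasure_eq_measure ennreal_mult ennreal_power)
  then show ?thesis using \<tau> \<eta> by (subst (asm) ennreal_le_iff) (auto simp: \<tau>_def m_def)
qed

text \<open>Otherwise there are \<beta> and y within 1/(n+1) for every n that violate the
  conclusion. The first K moments converge, those beyond k are overwritten by c (by
  \<open>schur_cong\<close> this changes nothing up to stage k + 1), and
  \<open>tendsto_schur\<close> gives a contradiction.\<close>

lemma schur_continuity:
  assumes e: "e > 0"
  obtains \<delta> where "\<delta> > 0" "\<And>\<beta> y i. cmod (\<beta> - \<alpha>) < \<delta> \<Longrightarrow> (\<And>i. i \<le> k \<Longrightarrow> cmod (y i - c i) < \<delta>) \<Longrightarrow>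
    i \<le> Suc k \<Longrightarrow> cmod (schur_a \<beta> y i - schur_a \<alpha> c i) < e"
proof (rule ccontr)
  assume no: "\<not> thesis"
  have "\<exists>\<beta> y. cmod (\<beta> - \<alpha>) < inverse (Suc n) \<and> (\<forall>i\<le>k. cmod (y i - c i) < inverse (Suc n)) \<and>
    (\<exists>i\<le>Suc k. \<not> cmod (schur_a \<beta> y i - schur_a \<alpha> c i) < e)" for n
  proof (rule ccontr)
    assume "\<not> ?thesis"
    then have "thesis" by (intro that[of "inverse (Suc n)"]) auto
    then show False using no by simp
  qed
  then obtain \<beta> y where yb: "\<And>n. cmod (\<beta> n - \<alpha>) < inverse (Suc n)" "\<And>n i. i \<le> k \<Longrightarrow> cmod (y n i - c i) < inverse (Suc n)"
    "\<And>n. \<exists>i\<le>Suc k. \<not> cmod (schur_a (\<beta> n) (y n) i - schur_a \<alpha> c i) < e" by metis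
  define y' where "y' n i = (if i \<le> k then y n i else c i)" for n i
  have 1: "\<beta> \<longlonglongrightarrow> \<alpha>"
    by (rule LIMSEQ_norm_0[THEN LIM_zero_cancel]) (use yb(1) in \<open>simp add: inverse_eq_divide\<close>)
  have 2: "(\<lambda>n. y' n i) \<longlonglongrightarrow> c i" for i
  proof (cases "i \<le> k")
    case True
    show ?thesis
      by (rule LIMSEQ_norm_0[THEN LIM_zero_cancel]) (use yb(2)[OF True] True in \<open>simp add: y'_def inverse_eq_divide\<close>)
  qed (simp add: y'_def)
  have "\<forall>\<^sub>F n in sequentially. cmod (schur_a (\<beta> n) (y' n) i - schur_a \<alpha> c i) < e" for i
    using tendstoD[OF tendsto_schur[of \<beta> \<alpha> sequentially y' c i, OF 1 2] e] by (simp add: dist_norm)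
  then have "\<forall>\<^sub>F n in sequentially. \<forall>i\<in>{..Suc k}. cmod (schur_a (\<beta> n) (y' n) i - schur_a \<alpha> c i) < e"
    by (intro eventually_ball_finite) auto
  then obtain n where n: "\<forall>i\<in>{..Suc k}. cmod (schur_a (\<beta> n) (y' n) i - schur_a \<alpha> c i) < e"
    unfolding eventually_sequentially by blast
  moreover have "schur_a (\<beta> n) (y' n) i = schur_a (\<beta> n) (y n) i" if "i \<le> Suc k" for i
    using that by (intro schur_cong) (auto simp: y'_def)
  ultimately show False using yb(3)[of n] by auto
qed

text \<open>Induction on the coefficients: by \<open>schur_continuity\<close> it suffices that the
  corner entry is near \<alpha> and the moments of the smaller matrix are near theirs. These are
  independent events, bounded below by \<open>entry_lower\<close> and by the induction
  hypothesis.\<close>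

lemma haar_lower:
  fixes H :: "nat \<Rightarrow> complex mat measure"
  assumes haar: "\<And>n. n \<ge> 1 \<Longrightarrow> haar_prob n (H n)"
    and as: "\<forall>\<alpha>\<in>set as. cmod \<alpha> < 1" and c0: "c 0 = 1" and e: "e > 0"
    and r: "0 < r" "r < (\<Prod>\<alpha>\<leftarrow>as. 1 - (cmod \<alpha>)\<^sup>2)"
  shows "\<forall>\<^sub>F n in sequentially. r ^ n \<le> measure (H n) {U \<in> space (H n). \<forall>i\<le>length as. cmod (umom U i - foldr schur_a as c i) < e}"
  using as e r
proof (induction as arbitrary: e r)
  case Nil
  show ?case
  proof (rule eventually_sequentiallyI[of 1])
    fix n :: nat assume n: "1 \<le> n"
    then have Hn: "haar_prob n (H n)" using haar by simp
    interpret prob_space "H n" by (rule haar_prob_space[OF Hn])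
    have "umom U 0 = 1" if "U \<in> space (H n)" for U
      using that n unitary_group_dim[of U n] by (simp add: haar_space[OF Hn] umom_def)
    then have "{U \<in> space (H n). \<forall>i\<le>length []. cmod (umom U i - foldr schur_a [] c i) < e} = space (H n)"
      using c0 Nil by auto
    then show "r ^ n \<le> measure (H n) {U \<in> space (H n). \<forall>i\<le>length []. cmod (umom U i - foldr schur_a [] c i) < e}"
      using Nil by (simp add: prob_space power_le_one)
  qed
next
  case (Cons \<alpha> as)
  define k where "k = length as"
  define c' where "c' = foldr schur_a as c"
  define D where "D = (\<Prod>\<alpha>\<leftarrow>as. 1 - (cmod \<alpha>)\<^sup>2)"
  have \<alpha>: "cmod \<alpha> < 1" using Cons.prems by simp
  then have x: "1 - (cmod \<alpha>)\<^sup>2 > 0" by (simp add: abs_square_less_1)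
  have rD: "r < (1 - (cmod \<alpha>)\<^sup>2) * D" using Cons.prems by (simp add: D_def)
  then have D: "D > 0" using x Cons.prems(3) by (metis less_trans zero_less_mult_pos)
  \<comment> \<open>The slack between r and the full product is shared by the two factors: both lose
    t, and their product q still exceeds r.\<close>
  have "((\<lambda>t. (1 - (cmod \<alpha>)\<^sup>2 - t) * (D - t)) \<longlongrightarrow> (1 - (cmod \<alpha>)\<^sup>2 - 0) * (D - 0)) (at_right 0)"
    by (intro tendsto_intros)
  then have "\<forall>\<^sub>F t in at_right 0. r < (1 - (cmod \<alpha>)\<^sup>2 - t) * (D - t)" using rD by (intro order_tendstoD(1)) auto
  moreover have "\<forall>\<^sub>F t in at_right 0. t < min (1 - (cmod \<alpha>)\<^sup>2) D"
    using x D by (intro order_tendstoD(2)[OF tendsto_ident_at]) auto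
  moreover have "\<forall>\<^sub>F t::real in at_right 0. 0 < t" by (rule eventually_at_right_less)
  ultimately have "\<forall>\<^sub>F t in at_right 0. r < (1 - (cmod \<alpha>)\<^sup>2 - t) * (D - t) \<and> t < min (1 - (cmod \<alpha>)\<^sup>2) D \<and> 0 < t"
    by eventually_elim auto
  then obtain t where t: "r < (1 - (cmod \<alpha>)\<^sup>2 - t) * (D - t)" "t < 1 - (cmod \<alpha>)\<^sup>2" "t < D" "0 < t"
    using eventually_happens'[OF trivial_limit_at_right_real] by (metis (no_types, lifting) min_less_iff_conj)
  define q where "q = (1 - (cmod \<alpha>)\<^sup>2 - t) * (D - t)"
  obtain \<delta> where \<delta>: "\<delta> > 0" "\<And>\<beta> y i. cmod (\<beta> - \<alpha>) < \<delta> \<Longrightarrow> (\<And>i. i \<le> k \<Longrightarrow> cmod (y i - c' i) < \<delta>) \<Longrightarrow>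
    i \<le> Suc k \<Longrightarrow> cmod (schur_a \<beta> y i - schur_a \<alpha> c' i) < e"
    using schur_continuity[OF Cons.prems(2), of \<alpha> k c'] by blast
  have "\<exists>\<kappa>>0. \<forall>p H. haar_prob (Suc (Suc p)) H \<longrightarrow>
    measure H {U \<in> space H. cmod (U $$ (0, 0) - \<alpha>) < \<delta>} \<ge> \<kappa> * (1 - (cmod \<alpha>)\<^sup>2 - t) ^ p"
    using t(2) by (intro entry_lower[OF \<alpha> \<delta>(1) t(4)]) simp
  then obtain \<kappa> where \<kappa>: "\<kappa> > 0" "\<And>p H. haar_prob (Suc (Suc p)) H \<Longrightarrow>
    measure H {U \<in> space H. cmod (U $$ (0, 0) - \<alpha>) < \<delta>} \<ge> \<kappa> * (1 - (cmod \<alpha>)\<^sup>2 - t) ^ p"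
    by blast
  have IH: "\<forall>\<^sub>F n in sequentially. (D - t) ^ n \<le> measure (H n) {U \<in> space (H n). \<forall>i\<le>k. cmod (umom U i - c' i) < \<delta>}"
    unfolding k_def c'_def using Cons.prems t \<delta>(1) by (intro Cons.IH) (auto simp: D_def)
  then obtain N0 where N0: "\<And>n. n \<ge> N0 \<Longrightarrow> (D - t) ^ n \<le> measure (H n) {U \<in> space (H n). \<forall>i\<le>k. cmod (umom U i - c' i) < \<delta>}"
    unfolding eventually_sequentially by blast
  have step: "\<kappa> * (D - t) * q ^ p \<le> measure (H (Suc (Suc p))) {U \<in> space (H (Suc (Suc p))). \<forall>i\<le>Suc k. cmod (umom U i - schur_a \<alpha> c' i) < e}"
    if p: "p \<ge> N0" for p
  proof -
    let ?H = "H (Suc (Suc p))" and ?K = "H (Suc p)"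
    have Hn: "haar_prob (Suc (Suc p)) ?H" "haar_prob (Suc p) ?K" using haar by auto
    interpret H: prob_space ?H by (rule haar_prob_space[OF Hn(1)])
    interpret K: prob_space ?K by (rule haar_prob_space[OF Hn(2)])
    have umH: "umom \<in> borel_measurable ?H" by (intro haar_measurable[OF Hn(1)] measurable_umom) simp
    have umK: "umom \<in> borel_measurable ?K" by (intro haar_measurable[OF Hn(2)] measurable_umom) simp
    have nb: "{y :: nat \<Rightarrow> complex. \<forall>i\<le>l. cmod (y i - b i) < a} \<in> sets borel" for l b a
    proof -
      have "open (\<Inter>i\<in>{..l}. {y :: nat \<Rightarrow> complex. cmod (y i - b i) < a})"
        by (intro open_INT finite_atMost ballI open_Collect_less continuous_on_norm continuous_on_diff continuous_on_product_coordinates continuous_on_const)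
      moreover have "(\<Inter>i\<in>{..l}. {y :: nat \<Rightarrow> complex. cmod (y i - b i) < a}) = {y. \<forall>i\<le>l. cmod (y i - b i) < a}" by auto
      ultimately show ?thesis by simp
    qed
    define S where "S = {y. \<forall>i\<le>Suc k. cmod (y i - schur_a \<alpha> c' i) < e}"
    define A where "A = {U \<in> space ?H. cmod (U $$ (0, 0) - \<alpha>) < \<delta>}"
    define B where "B = {V \<in> space ?K. \<forall>i\<le>k. cmod (umom V i - c' i) < \<delta>}"
    have S: "S \<in> sets borel" unfolding S_def by (rule nb)
    have Am: "A \<in> sets ?H" unfolding A_def
      using entry_measurable[OF Hn(1), of 0] by measurable
    have Bm: "B \<in> sets ?K"
    proof -
      have "B = umom -` {y. \<forall>i\<le>k. cmod (y i - c' i) < \<delta>} \<inter> space ?K" by (auto simp: B_def)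
      then show ?thesis using measurable_sets[OF umK nb[of k c' \<delta>]] by (simp only:)
    qed
    have eqH: "{U \<in> space ?H. \<forall>i\<le>Suc k. cmod (umom U i - schur_a \<alpha> c' i) < e} = umom -` S \<inter> space ?H"
      by (auto simp: S_def)
    have "emeasure ?H (umom -` S \<inter> space ?H) = (\<integral>\<^sup>+U. indicator S (umom U) \<partial>?H)"
    proof -
      have "(\<integral>\<^sup>+U. indicator S (umom U) \<partial>?H) = (\<integral>\<^sup>+U. indicator (umom -` S \<inter> space ?H) U \<partial>?H)"
        by (intro nn_integral_cong) (auto simp: indicator_def)
      also have "\<dots> = emeasure ?H (umom -` S \<inter> space ?H)"
        by (rule nn_integral_indicator[OF measurable_sets[OF umH S]])
      finally show ?thesis ..
    qed
    also have "\<dots> = (\<integral>\<^sup>+U. \<integral>\<^sup>+V. indicator S (schur_a (U $$ (0, 0)) (umom V)) \<partial>?K \<partial>?H)"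
      using S by (intro haar_umom_recursion[OF Hn]) simp
    also have "\<dots> \<ge> (\<integral>\<^sup>+U. \<integral>\<^sup>+V. indicator A U * indicator B V \<partial>?K \<partial>?H)"
      using \<delta>(2) by (intro nn_integral_mono) (auto simp: indicator_def A_def B_def S_def)
    also have "(\<integral>\<^sup>+U. \<integral>\<^sup>+V. indicator A U * indicator B V \<partial>?K \<partial>?H) = emeasure ?H A * emeasure ?K B"
      using Am Bm by (simp add: nn_integral_cmult nn_integral_multc)
    finally have "ennreal (measure ?H A * measure ?K B) \<le> ennreal (measure ?H (umom -` S \<inter> space ?H))"
      by (simp only: H.emeasure_eq_measure K.emeasure_eq_measure ennreal_mult measure_nonneg)
    then have AB: "measure ?H A * measure ?K B \<le> measure ?H (umom -` S \<inter> space ?H)"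
      by (rule ennreal_le_iff[THEN iffD1, rotated]) simp
    have "measure ?H A \<ge> \<kappa> * (1 - (cmod \<alpha>)\<^sup>2 - t) ^ p" unfolding A_def by (rule \<kappa>(2)[OF Hn(1)])
    moreover have "measure ?K B \<ge> (D - t) ^ Suc p" unfolding B_def using p by (intro N0) auto
    ultimately have "\<kappa> * (1 - (cmod \<alpha>)\<^sup>2 - t) ^ p * (D - t) ^ Suc p \<le> measure ?H (umom -` S \<inter> space ?H)"
      using t by (intro order_trans[OF mult_mono AB] zero_le_power measure_nonneg) auto
    moreover have "\<kappa> * (1 - (cmod \<alpha>)\<^sup>2 - t) ^ p * (D - t) ^ Suc p = \<kappa> * (D - t) * q ^ p"
      by (simp add: q_def power_mult_distrib)
    ultimately show ?thesis unfolding eqH by (simp only:)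
  qed
  \<comment> \<open>The growth of (q / r)^p absorbs \<kappa>, D - t and the shift by 2 between n and
    p.\<close>
  have "1 < q / r" using t(1) Cons.prems(3) by (simp add: q_def)
  then obtain N1 where N1': "r\<^sup>2 / (\<kappa> * (D - t)) < (q / r) ^ N1" using real_arch_pow by blast
  have N1: "r\<^sup>2 / (\<kappa> * (D - t)) \<le> (q / r) ^ p" if "p \<ge> N1" for p
    using power_increasing[OF that, of "q / r"] \<open>1 < q / r\<close> N1' by linarith
  show ?case
  proof (rule eventually_sequentiallyI[of "N0 + N1 + 2"])
    fix n assume n: "N0 + N1 + 2 \<le> n"
    define p where "p = n - 2"
    have np: "n = Suc (Suc p)" "p \<ge> N0" "p \<ge> N1" using n by (auto simp: p_def)
    have "\<kappa> * (D - t) > 0" using \<kappa>(1) t by simp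
    then have "r\<^sup>2 * r ^ p \<le> \<kappa> * (D - t) * q ^ p"
      using N1[OF np(3)] Cons.prems(3) by (simp add: power_divide field_simps)
    moreover have "r ^ n = r\<^sup>2 * r ^ p" by (simp add: np(1) power2_eq_square)
    ultimately have "r ^ n \<le> \<kappa> * (D - t) * q ^ p" by simp
    also note step[OF np(2)]
    finally show "r ^ n \<le> measure (H n) {U \<in> space (H n). \<forall>i\<le>length (\<alpha> # as). cmod (umom U i - foldr schur_a (\<alpha> # as) c i) < e}"
      by (simp add: np(1) k_def c'_def)
  qed
qed

section \<open>Spectral measures\<close>

lemma power_cnj_integrable: "\<mu> \<in> circle_probs \<Longrightarrow> integrable \<mu> (\<lambda>z. c * (z ^ i * cnj (z ^ j)))"
  by (intro continuous_on_circle_integrable continuous_intros)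

lemma integral_power_cnj:
  assumes \<mu>: "\<mu> \<in> circle_probs"
  shows "(\<integral>z. z ^ i * cnj (z ^ j) \<partial>\<mu>) = (if j \<le> i then moments \<mu> (i - j) else cnj (moments \<mu> (j - i)))"
proof -
  have sp: "space \<mu> = circle" by (rule circle_probsD(3)[OF \<mu>])
  have "(\<integral>z. z ^ i * cnj (z ^ j) \<partial>\<mu>) = (\<integral>z. (if j \<le> i then z ^ (i - j) else cnj (z ^ (j - i))) \<partial>\<mu>)"
    by (intro Bochner_Integration.integral_cong refl circle_cnj_power) (simp add: sp)
  also have "\<dots> = (if j \<le> i then moments \<mu> (i - j) else cnj (moments \<mu> (j - i)))"
    unfolding moments_def using Bochner_Integration.integral_cnj[of \<mu> "\<lambda>z. z ^ (j - i)"] by simp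
  finally show ?thesis .
qed

lemma integral_norm_square_eq_qform:
  assumes \<mu>: "\<mu> \<in> circle_probs"
  shows "(\<integral>z. (cmod (\<Sum>i<n. q i * z ^ i))\<^sup>2 \<partial>\<mu>) = qform n q (moments \<mu>)"
proof -
  have e: "complex_of_real ((cmod (\<Sum>i<n. q i * z ^ i))\<^sup>2) = (\<Sum>i<n. \<Sum>j<n. q i * cnj (q j) * (z ^ i * cnj (z ^ j)))" for z
    unfolding complex_norm_square cnj_sum sum_product by (intro sum.cong refl) (simp add: mult_ac)
  have "complex_of_real (\<integral>z. (cmod (\<Sum>i<n. q i * z ^ i))\<^sup>2 \<partial>\<mu>) = (\<integral>z. complex_of_real ((cmod (\<Sum>i<n. q i * z ^ i))\<^sup>2) \<partial>\<mu>)"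
    by (rule integral_complex_of_real[symmetric])
  also have "\<dots> = (\<Sum>i<n. \<Sum>j<n. q i * cnj (q j) * (\<integral>z. z ^ i * cnj (z ^ j) \<partial>\<mu>))"
    unfolding e using power_cnj_integrable[OF \<mu>]
    by (subst Bochner_Integration.integral_sum | intro Bochner_Integration.integrable_sum sum.cong refl integral_mult_right_zero | assumption | blast)+
  also have "\<dots> = (\<Sum>i<n. \<Sum>j<n. q i * cnj (q j) * (if j \<le> i then moments \<mu> (i - j) else cnj (moments \<mu> (j - i))))"
    unfolding integral_power_cnj[OF \<mu>] ..
  finally show ?thesis unfolding qform_def by (metis Re_complex_of_real)
qed

lemma integral_norm_square_poly:
  assumes \<mu>: "\<mu> \<in> circle_probs"
  shows "(\<integral>z. (cmod (poly P z))\<^sup>2 \<partial>\<mu>) = qform (Suc (degree P)) (coeff P) (moments \<mu>)"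
  unfolding integral_norm_square_eq_qform[OF \<mu>, symmetric] poly_altdef lessThan_Suc_atMost ..

text \<open>The Fejer sums of the moments of \<open>U\<close> are nonnegative because they are squared norms.\<close>

lemma fejer_measure:
  assumes U: "U \<in> unitary_group (Suc n)" and N: "N > 0"
  shows "\<exists>\<mu>\<in>circle_probs. \<forall>m\<le>N. moments \<mu> m = of_real (real (N - m) / real N) * umom U m"
proof -
  \<comment> \<open>The Fejer density: the squared norm of the sum of cnj z^i U^i e_1 over i < N,
    divided by N.\<close>
  define g where "g z = qform N (\<lambda>i. cnj z ^ i) (umom U) / real N" for z
  have g0: "g z \<ge> 0" for z
    unfolding g_def vnorm2_comb[OF U, symmetric] by (simp add: vnorm2_nonneg)
  define c where "c i j = (if j \<le> i then umom U (i - j) else cnj (umom U (j - i)))" for i j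
  have cg: "continuous_on circle g"
    unfolding g_def qform_def c_def[symmetric] using N by (intro continuous_intros) auto
  have u0: "umom U 0 = 1" using unitary_group_dim[OF U] by (simp add: umom_def)
  have qreal: "complex_of_real (qform N (\<lambda>i. cnj z ^ i) (umom U)) = (\<Sum>i<N. \<Sum>j<N. c i j * (z ^ j * cnj (z ^ i)))" for z
  proof -
    have "cnj (\<Sum>i<N. \<Sum>j<N. c i j * (z ^ j * cnj (z ^ i))) = (\<Sum>i<N. \<Sum>j<N. c j i * (z ^ i * cnj (z ^ j)))"
      unfolding cnj_sum by (intro sum.cong refl) (auto simp: c_def mult_ac u0)
    also have "\<dots> = (\<Sum>j<N. \<Sum>i<N. c j i * (z ^ i * cnj (z ^ j)))" by (rule sum.swap)
    finally have "(\<Sum>i<N. \<Sum>j<N. c i j * (z ^ j * cnj (z ^ i))) \<in> \<real>"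
      by (rule Reals_cnj_iff[THEN iffD2])
    then have "Im (\<Sum>i<N. \<Sum>j<N. c i j * (z ^ j * cnj (z ^ i))) = 0"
      by (rule complex_is_Real_iff[THEN iffD1])
    moreover have "qform N (\<lambda>i. cnj z ^ i) (umom U) = Re (\<Sum>i<N. \<Sum>j<N. c i j * (z ^ j * cnj (z ^ i)))"
      unfolding qform_def c_def by (intro arg_cong[of _ _ Re] sum.cong refl) (simp add: mult_ac)
    ultimately show ?thesis by (intro complex_eqI) (simp_all only: Re_complex_of_real Im_complex_of_real)
  qed
  have int: "(\<integral>z. z ^ m * complex_of_real (g z) \<partial>arc_measure) = of_real (real (N - m) / real N) * umom U m" if m: "m \<le> N" for m
  proof -
    have "(\<integral>z. z ^ m * complex_of_real (g z) \<partial>arc_measure) = (\<integral>z. (\<Sum>i<N. \<Sum>j<N. (c i j / of_nat N) * (z ^ (j + m) * cnj (z ^ i))) \<partial>arc_measure)"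
    proof (intro Bochner_Integration.integral_cong refl)
      fix z
      have "z ^ m * complex_of_real (g z) = z ^ m * (\<Sum>i<N. \<Sum>j<N. c i j * (z ^ j * cnj (z ^ i))) / of_nat N"
        unfolding g_def qreal[symmetric] by simp
      also have "\<dots> = (\<Sum>i<N. \<Sum>j<N. (c i j / of_nat N) * (z ^ (j + m) * cnj (z ^ i)))"
        unfolding sum_distrib_left sum_divide_distrib by (intro sum.cong refl) (simp add: power_add mult_ac)
      finally show "z ^ m * complex_of_real (g z) = (\<Sum>i<N. \<Sum>j<N. (c i j / of_nat N) * (z ^ (j + m) * cnj (z ^ i)))" .
    qed
    also have "\<dots> = (\<Sum>i<N. \<Sum>j<N. (c i j / of_nat N) * (\<integral>z. z ^ (j + m) * cnj (z ^ i) \<partial>arc_measure))"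
      using power_cnj_integrable[OF arc_circle_probs]
      by (subst Bochner_Integration.integral_sum | intro Bochner_Integration.integrable_sum sum.cong refl integral_mult_right_zero | assumption | blast)+
    \<comment> \<open>Only pairs with i = j + m have a nonzero mean, and there are N - m of them;
      this is the Fejer weight.\<close>
    also have "\<dots> = (\<Sum>i<N. \<Sum>j<N. if i = j + m then umom U m / of_nat N else 0)"
      unfolding integral_power_cnj[OF arc_circle_probs] moments_arc
      by (intro sum.cong refl) (auto simp: c_def)
    also have "\<dots> = (\<Sum>j<N. \<Sum>i<N. if i = j + m then umom U m / of_nat N else 0)" by (rule sum.swap)
    also have "\<dots> = (\<Sum>j<N. if j < N - m then umom U m / of_nat N else 0)"
      by (intro sum.cong refl) auto
    also have "\<dots> = (\<Sum>j<N - m. umom U m / of_nat N)"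
      by (intro sum.mono_neutral_cong_right) auto
    finally show ?thesis by simp
  qed
  define \<mu> where "\<mu> = density arc_measure (\<lambda>z. ennreal (g z))"
  have gm: "g \<in> borel_measurable arc_measure"
    by (intro continuous_on_circle_measurable cg circle_probsD(2)[OF arc_circle_probs])
  have gi: "integrable arc_measure g" by (rule continuous_on_circle_integrable[OF cg arc_circle_probs])
  have "complex_of_real (\<integral>z. g z \<partial>arc_measure) = 1"
    using int[of 0] N u0 by simp
  then have g1: "(\<integral>z. g z \<partial>arc_measure) = 1" by simp
  have \<mu>: "\<mu> \<in> circle_probs"
  proof -
    have "emeasure \<mu> (space \<mu>) = (\<integral>\<^sup>+z. ennreal (g z) \<partial>arc_measure)"
      unfolding \<mu>_def using gm by (subst emeasure_density) (auto intro!: nn_integral_cong)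
    also have "\<dots> = ennreal (\<integral>z. g z \<partial>arc_measure)"
      using gi g0 by (intro nn_integral_eq_integral) auto
    finally have "prob_space \<mu>" by (intro prob_spaceI) (simp add: g1)
    then show ?thesis by (simp add: circle_probs_def \<mu>_def sets_arc)
  qed
  have "moments \<mu> m = of_real (real (N - m) / real N) * umom U m" if m: "m \<le> N" for m
  proof -
    have "moments \<mu> m = (\<integral>z. g z *\<^sub>R z ^ m \<partial>arc_measure)"
      unfolding moments_def \<mu>_def using gm g0
      by (intro integral_density continuous_on_circle_measurable continuous_intros sets_arc cg) auto
    also have "\<dots> = (\<integral>z. z ^ m * complex_of_real (g z) \<partial>arc_measure)"
      by (simp add: scaleR_conv_of_real mult.commute)
    finally show ?thesis using int[OF m] by simp
  qed
  then show ?thesis using \<mu> by blast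
qed

text \<open>For fixed m the Fejer weight (N - m) / N tends to 1, so any weak limit of the Fejer
  measures has the moments of U; compactness provides one.\<close>

lemma umom_measure_exists:
  assumes U: "U \<in> unitary_group (Suc n)"
  shows "\<exists>\<mu>\<in>circle_probs. moments \<mu> = umom U"
proof -
  have "\<forall>N. \<exists>\<mu>. \<mu> \<in> circle_probs \<and> (\<forall>m\<le>Suc N. moments \<mu> m = of_real (real (Suc N - m) / real (Suc N)) * umom U m)"
    using fejer_measure[OF U] by blast
  from choice[OF this] obtain \<mu> where \<mu>: "\<And>N. \<mu> N \<in> circle_probs"
    "\<And>N m. m \<le> Suc N \<Longrightarrow> moments (\<mu> N) m = of_real (real (Suc N - m) / real (Suc N)) * umom U m" by blast
  obtain r \<nu> where r: "strict_mono (r :: nat \<Rightarrow> nat)" "\<nu> \<in> circle_probs"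
    "\<forall>k. (\<lambda>n. moments (\<mu> (r n)) k) \<longlonglongrightarrow> moments \<nu> k"
    using moments_convergent_subsequence[of \<mu>] \<mu>(1) by auto
  have lim: "(\<lambda>N. moments (\<mu> N) m) \<longlonglongrightarrow> umom U m" for m
  proof -
    have "(\<lambda>N. real m / real (Suc N)) \<longlonglongrightarrow> 0"
      by (rule LIMSEQ_Suc[OF lim_const_over_n[of "real m"]])
    then have "(\<lambda>N. 1 - real m / real (Suc N)) \<longlonglongrightarrow> 1 - 0"
      by (intro tendsto_diff[OF tendsto_const])
    then have "(\<lambda>N. of_real (1 - real m / real (Suc N)) * umom U m) \<longlonglongrightarrow> of_real (1 - 0) * umom U m"
      by (intro tendsto_mult[OF tendsto_of_real tendsto_const])
    moreover have "\<forall>\<^sub>F N in sequentially. of_real (1 - real m / real (Suc N)) * umom U m = moments (\<mu> N) m"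
    proof (rule eventually_sequentiallyI[of m])
      fix N assume "m \<le> N"
      then show "of_real (1 - real m / real (Suc N)) * umom U m = moments (\<mu> N) m"
        using \<mu>(2)[of m N] by (simp add: of_nat_diff diff_divide_distrib)
    qed
    ultimately show ?thesis using Lim_transform_eventually by force
  qed
  have "moments \<nu> m = umom U m" for m
    using LIMSEQ_unique[OF r(3)[rule_format, of m] LIMSEQ_subseq_LIMSEQ[OF lim[of m] r(1), unfolded o_def]] .
  then show ?thesis using r(2) by blast
qed

lemma funpow_adjoint_cscalar:
  assumes U: "U \<in> carrier_mat n n" and x: "x \<in> carrier_vec n" and y: "y \<in> carrier_vec n"
  shows "(((*\<^sub>v) (mat_adjoint U)) ^^ k) x \<bullet>c y = x \<bullet>c (((*\<^sub>v) U) ^^ k) (y :: complex Matrix.vec)"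
  using x y
proof (induction k arbitrary: y)
  case (Suc k)
  have "(((*\<^sub>v) (mat_adjoint U)) ^^ k) x \<in> carrier_vec n"
    using U Suc.prems(1) by (induction k) (auto intro!: mult_mat_vec_carrier[OF mat_adjoint_carrier[OF U]])
  then have "(((*\<^sub>v) (mat_adjoint U)) ^^ Suc k) x \<bullet>c y = (((*\<^sub>v) (mat_adjoint U)) ^^ k) x \<bullet>c (U *\<^sub>v y)"
    using U Suc.prems cscalar_adjoint[of "mat_adjoint U" n n] by simp
  also have "\<dots> = x \<bullet>c (((*\<^sub>v) U) ^^ k) (U *\<^sub>v y)" using U Suc.prems by (intro Suc.IH) auto
  finally show ?case by (simp add: funpow_swap1)
qed simp

lemma spectral_moment_nonneg:
  assumes U: "U \<in> unitary_group (Suc n)"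
  shows "(U ^\<^sub>m k *\<^sub>v unit_vec (Suc n) 0) \<bullet>c unit_vec (Suc n) 0 = umom U k"
proof -
  have c: "U \<in> carrier_mat (Suc n) (Suc n)" using U by (rule unitary_group_carrier)
  have "U ^\<^sub>m k *\<^sub>v unit_vec (Suc n) 0 = orb U k"
    using c by (simp add: pow_mat_orb orb_def)
  moreover have "conjugate (unit_vec (Suc n) 0) = (unit_vec (Suc n) 0 :: complex Matrix.vec)"
    by (intro eq_vecI) auto
  ultimately show ?thesis using orb_carrier[OF c, of k] by (simp add: umom_def)
qed

text \<open>This justifies the \<open>THE\<close> in the definition: existence is
  \<open>umom_measure_exists\<close>, uniqueness is \<open>circle_probs_eqI\<close>. The conditions
  for negative k are the conjugates of those for positive k, since z^(-1) = cnj z on the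
  circle.\<close>

lemma spectral_measure_props:
  assumes U: "U \<in> unitary_group (Suc n)"
  shows "spectral_measure U (unit_vec (Suc n) 0) \<in> circle_probs"
    and "moments (spectral_measure U (unit_vec (Suc n) 0)) = umom U"
proof -
  let ?v = "unit_vec (Suc n) 0 :: complex Matrix.vec"
  let ?P = "\<lambda>\<mu>. \<mu> \<in> circle_probs \<and> (\<forall>k::int. (\<integral>z. z powi k \<partial>\<mu>) = (unitary_powi U k *\<^sub>v ?v) \<bullet>c ?v)"
  have c: "U \<in> carrier_mat (Suc n) (Suc n)" using U by (rule unitary_group_carrier)
  have ca: "mat_adjoint U \<in> carrier_mat (Suc n) (Suc n)" using c by simp
  have spec: "(\<integral>z. z powi k \<partial>\<mu>) = (unitary_powi U k *\<^sub>v ?v) \<bullet>c ?v"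
    if "\<forall>k::int. (\<integral>z. z powi k \<partial>\<mu>) = (unitary_powi U k *\<^sub>v ?v) \<bullet>c ?v" for \<mu> k
    using that by blast
  have P_iff: "?P \<mu> \<longleftrightarrow> \<mu> \<in> circle_probs \<and> moments \<mu> = umom U" for \<mu>
  proof safe
    assume \<mu>: "\<mu> \<in> circle_probs" and eq: "\<forall>k::int. (\<integral>z. z powi k \<partial>\<mu>) = (unitary_powi U k *\<^sub>v ?v) \<bullet>c ?v"
    show "moments \<mu> = umom U"
    proof
      fix k
      have "moments \<mu> k = (\<integral>z. z powi int k \<partial>\<mu>)" by (simp add: moments_def)
      also have "\<dots> = umom U k"
        using spec[OF eq, of "int k"] spectral_moment_nonneg[OF U, of k] by (simp add: unitary_powi_def)
      finally show "moments \<mu> k = umom U k" .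
    qed
  next
    fix k :: int
    assume \<mu>: "\<mu> \<in> circle_probs" and eq: "moments \<mu> = umom U"
    show "(\<integral>z. z powi k \<partial>\<mu>) = (unitary_powi U k *\<^sub>v ?v) \<bullet>c ?v"
    proof (cases "k \<ge> 0")
      case True
      then obtain m where m: "k = int m" using zero_le_imp_eq_int by blast
      have "(\<integral>z. z powi k \<partial>\<mu>) = moments \<mu> m" by (simp add: m moments_def)
      then show ?thesis
        using spectral_moment_nonneg[OF U, of m] eq by (simp add: m unitary_powi_def)
    next
      case False
      define m where "m = nat (- k)"
      have k: "k = - int m" using False by (simp add: m_def)
      have "(\<integral>z. z powi k \<partial>\<mu>) = (\<integral>z. cnj (z ^ m) \<partial>\<mu>)"
      proof (intro Bochner_Integration.integral_cong refl)
        fix z assume "z \<in> space \<mu>"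
        then have z: "cmod z = 1" using circle_probsD(3)[OF \<mu>] by simp
        then have "z * cnj z = 1" using complex_norm_square[of z] by simp
        then have "inverse z = cnj z" by (rule inverse_unique)
        then show "z powi k = cnj (z ^ m)" by (simp add: k power_int_minus flip: power_inverse)
      qed
      also have "\<dots> = cnj (umom U m)" using Bochner_Integration.integral_cnj[of \<mu> "\<lambda>z. z ^ m"] by (simp add: moments_def flip: eq)
      also have "\<dots> = (unitary_powi U k *\<^sub>v ?v) \<bullet>c ?v"
      proof -
        have "(unitary_powi U k *\<^sub>v ?v) \<bullet>c ?v = (((*\<^sub>v) (mat_adjoint U)) ^^ m) ?v \<bullet>c ?v"
          using False ca by (simp add: unitary_powi_def m_def[symmetric] pow_mat_orb[OF ca])
        also have "\<dots> = ?v \<bullet>c (((*\<^sub>v) U) ^^ m) ?v"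
          using c by (intro funpow_adjoint_cscalar) auto
        also have "\<dots> = ?v \<bullet>c orb U m" using c by (simp add: orb_def)
        also have "\<dots> = cnj (umom U m)"
          using orb_carrier[OF c, of m] by (simp add: umom_def)
        finally show ?thesis ..
      qed
      finally show ?thesis .
    qed
  qed
  have "\<exists>!\<mu>. ?P \<mu>"
    unfolding P_iff using umom_measure_exists[OF U] circle_probs_eqI by (metis)
  then have "?P (spectral_measure U ?v)"
    unfolding spectral_measure_def by (rule theI')
  then show "spectral_measure U ?v \<in> circle_probs" "moments (spectral_measure U ?v) = umom U"
    unfolding P_iff by auto
qed

subsection \<open>Discretization\<close>

lemma power_diff_le:
  assumes "cmod z = 1" "cmod x = 1"
  shows "cmod (z ^ k - x ^ k) \<le> real k * cmod (z - x)"
proof (induction k)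
  case (Suc k)
  have "z ^ Suc k - x ^ Suc k = z * (z ^ k - x ^ k) + (z - x) * x ^ k" by (simp add: algebra_simps)
  then have "cmod (z ^ Suc k - x ^ Suc k) \<le> cmod (z * (z ^ k - x ^ k)) + cmod ((z - x) * x ^ k)"
    by (simp only: norm_triangle_ineq)
  also have "\<dots> \<le> real k * cmod (z - x) + cmod (z - x)" using Suc assms by (simp add: norm_mult norm_power)
  finally show ?case by (simp add: algebra_simps)
qed simp

text \<open>The angles are cut into N cells of length 8/N covering [-4, 4], and the mass of each
  cell is moved to its left end. A point moves by at most 8/N, and z^k has Lipschitz constant k on
  the circle.\<close>

lemma circle_discretization:
  assumes \<mu>: "\<mu> \<in> circle_probs" and N: "N > 0"
  obtains p x where "\<And>i. i < N \<Longrightarrow> 0 \<le> p i" "(\<Sum>i<N. p i) = (1::real)" "\<And>i. cmod (x i) = 1"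
    "\<And>k. cmod ((\<Sum>i<N. of_real (p i) * x i ^ k) - moments \<mu> k) \<le> real k * (8 / real N)"
proof -
  interpret prob_space \<mu> by (rule circle_probsD(1)[OF \<mu>])
  have sp: "space \<mu> = circle" by (rule circle_probsD(3)[OF \<mu>])
  \<comment> \<open>The minimum with N - 1 keeps the index in range if the angle reaches the bound
    4.\<close>
  define idx where "idx z = min (N - 1) (nat \<lfloor>(arg_acos z + 4) / 8 * real N\<rfloor>)" for z
  define x where "x i = cis (- 4 + 8 * real i / real N)" for i
  define A where "A i = {z \<in> circle. idx z = i}" for i
  define p where "p i = measure \<mu> (A i)" for i
  have idx: "idx z < N" for z using N by (auto simp: idx_def)
  have "idx \<in> measurable circle_borel (count_space UNIV)"
  proof -
    have "arg_acos \<in> borel_measurable circle_borel"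
      unfolding circle_borel_def by (intro measurable_restrict_space1) simp
    then show ?thesis unfolding idx_def[abs_def] by measurable
  qed
  then have im: "idx \<in> measurable \<mu> (count_space UNIV)"
    using circle_probsD(2)[OF \<mu>] by (simp cong: measurable_cong_sets)
  have A: "A i \<in> sets \<mu>" for i
    using measurable_sets[OF im, of "{i}"] by (simp add: A_def sp vimage_def Int_def conj_commute)
  have close: "cmod (x (idx z) - z) \<le> 8 / real N" if z: "z \<in> circle" for z
  proof -
    define t where "t = (arg_acos z + 4) / 8 * real N"
    have "0 \<le> arg_acos z + 4" "arg_acos z + 4 \<le> 8" using arg_acos_bounds[of z] by auto
    then have t: "0 \<le> t" "t \<le> real N"
      using mult_right_mono[of "(arg_acos z + 4) / 8" 1 "real N"] by (auto simp: t_def)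
    have idx_t: "idx z = min (N - 1) (nat \<lfloor>t\<rfloor>)" by (simp only: idx_def t_def)
    have "\<bar>real (idx z) - t\<bar> \<le> 1"
    proof (cases "nat \<lfloor>t\<rfloor> \<le> N - 1")
      case True
      then have "real (idx z) = real_of_int \<lfloor>t\<rfloor>" using t by (simp add: idx_t min_def)
      then show ?thesis by linarith
    next
      case False
      then have "idx z = N - 1" by (simp add: idx_t min_def)
      moreover have "t \<ge> real (N - 1)" using False t by linarith
      ultimately show ?thesis using t N by (simp add: of_nat_diff abs_if)
    qed
    then have d: "\<bar>real (idx z) - t\<bar> * (8 / real N) \<le> 1 * (8 / real N)" by (intro mult_right_mono) auto
    have "arg_acos z = - 4 + 8 * t / real N" using N by (simp add: t_def)
    then have "- 4 + 8 * real (idx z) / real N - arg_acos z = (real (idx z) - t) * (8 / real N)"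
      using N by (simp add: field_simps)
    then have "\<bar>- 4 + 8 * real (idx z) / real N - arg_acos z\<bar> = \<bar>real (idx z) - t\<bar> * (8 / real N)"
      by (simp only: abs_mult abs_divide abs_numeral abs_of_nat)
    then have "\<bar>- 4 + 8 * real (idx z) / real N - arg_acos z\<bar> \<le> 8 / real N"
      using d by linarith
    then show ?thesis using norm_cis_diff_le[of "- 4 + 8 * real (idx z) / real N" "arg_acos z"] cis_arg_acos[OF z]
      by (simp add: x_def)
  qed
  have si: "(\<integral>z. F (idx z) \<partial>\<mu>) = (\<Sum>i<N. of_real (p i) * F i)" "integrable \<mu> (\<lambda>z. F (idx z))" for F :: "nat \<Rightarrow> complex"
  proof -
    have ii: "integrable \<mu> (\<lambda>z. indicat_real (A i) z *\<^sub>R F i)" for i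
      by (intro integrable_scaleR_left integrable_real_indicator A) (simp add: emeasure_eq_measure)
    have eq: "F (idx z) = (\<Sum>i<N. indicat_real (A i) z *\<^sub>R F i)" if "z \<in> space \<mu>" for z
    proof -
      have "(\<Sum>i<N. indicat_real (A i) z *\<^sub>R F i) = (\<Sum>i<N. if i = idx z then F i else 0)"
        using that by (intro sum.cong refl) (auto simp: A_def sp indicator_def)
      then show ?thesis using idx by simp
    qed
    have "integrable \<mu> (\<lambda>z. \<Sum>i<N. indicat_real (A i) z *\<^sub>R F i)" using ii by (intro Bochner_Integration.integrable_sum)
    then show "integrable \<mu> (\<lambda>z. F (idx z))" using eq by (simp cong: Bochner_Integration.integrable_cong)
    have "(\<integral>z. F (idx z) \<partial>\<mu>) = (\<integral>z. (\<Sum>i<N. indicat_real (A i) z *\<^sub>R F i) \<partial>\<mu>)"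
      by (intro Bochner_Integration.integral_cong refl eq)
    also have "\<dots> = (\<Sum>i<N. \<integral>z. indicat_real (A i) z *\<^sub>R F i \<partial>\<mu>)" using ii by (intro Bochner_Integration.integral_sum)
    also have "\<dots> = (\<Sum>i<N. of_real (p i) * F i)"
      using A by (intro sum.cong refl) (simp add: p_def scaleR_conv_of_real emeasure_eq_measure)
    finally show "(\<integral>z. F (idx z) \<partial>\<mu>) = (\<Sum>i<N. of_real (p i) * F i)" .
  qed
  show ?thesis
  proof (rule that[of p x])
    show "0 \<le> p i" if "i < N" for i by (simp add: p_def)
    show "(\<Sum>i<N. p i) = 1"
    proof -
      have "complex_of_real (\<Sum>i<N. p i) = 1" using si(1)[of "\<lambda>_. 1"] by (simp add: prob_space)
      then show ?thesis by (simp only: of_real_eq_1_iff)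
    qed
    show "cmod (x i) = 1" for i by (simp add: x_def)
    fix k
    have zi: "integrable \<mu> (\<lambda>z. z ^ k)" by (intro continuous_on_circle_integrable[OF _ \<mu>] continuous_intros)
    have "(\<Sum>i<N. of_real (p i) * x i ^ k) - moments \<mu> k = (\<integral>z. x (idx z) ^ k - z ^ k \<partial>\<mu>)"
      using si[of "\<lambda>i. x i ^ k"] zi by (simp add: moments_def)
    also have "cmod \<dots> \<le> (\<integral>z. cmod (x (idx z) ^ k - z ^ k) \<partial>\<mu>)" by (rule integral_norm_bound)
    also have "\<dots> \<le> (\<integral>z. real k * (8 / real N) \<partial>\<mu>)"
    proof (rule integral_mono)
      show "integrable \<mu> (\<lambda>z. cmod (x (idx z) ^ k - z ^ k))" using si(2)[of "\<lambda>i. x i ^ k"] zi by auto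
      fix z assume "z \<in> space \<mu>"
      then have z: "z \<in> circle" by (simp add: sp)
      have "cmod (x (idx z) ^ k - z ^ k) \<le> real k * cmod (x (idx z) - z)"
        using z by (intro power_diff_le) (auto simp: x_def)
      also have "\<dots> \<le> real k * (8 / real N)" by (intro mult_left_mono close z) simp
      finally show "cmod (x (idx z) ^ k - z ^ k) \<le> real k * (8 / real N)" .
    qed simp
    finally show "cmod ((\<Sum>i<N. of_real (p i) * x i ^ k) - moments \<mu> k) \<le> real k * (8 / real N)"
      by (simp add: prob_space)
  qed
qed

text \<open>Let T carry e_1 to the vector of the square roots of the p_i. Conjugating the diagonal
  matrix of the x_i by T gives \<langle>e_1, U^k e_1\<rangle> as the mean of x_i^k with weights p_i;
  the x_i may repeat.\<close>

lemma unitary_of_atoms: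
  assumes p: "\<And>i. i < Suc n \<Longrightarrow> 0 \<le> p i" "(\<Sum>i<Suc n. p i) = (1::real)" and x: "\<And>i. cmod (x i) = 1"
  obtains U where "U \<in> unitary_group (Suc n)" "\<And>k. umom U k = (\<Sum>i<Suc n. of_real (p i) * x i ^ k)"
proof -
  let ?N = "Suc n"
  define g where "g = Matrix.vec ?N (\<lambda>i. complex_of_real (sqrt (p i)))"
  have "vnorm2 g = (\<Sum>i<?N. p i)"
    unfolding vnorm2_def by (rule sum.cong) (use p(1) in \<open>auto simp: g_def\<close>)
  then have g: "g \<in> carrier_vec ?N" "vnorm2 g = 1" using p(2) by (auto simp: g_def)
  obtain T where T: "T \<in> unitary_group ?N" "\<And>i. i < ?N \<Longrightarrow> T $$ (i, 0) = g $ i"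
    using unitary_completion[OF g] by blast
  have cT: "T \<in> carrier_mat ?N ?N" using T(1) by (rule unitary_group_carrier)
  define D where "D = Matrix.mat ?N ?N (\<lambda>(i, j). if i = j then x i else 0)"
  have cD: "D \<in> carrier_mat ?N ?N" by (simp add: D_def)
  have D: "D \<in> unitary_group ?N"
  proof (rule unitary_groupI[OF cD])
    fix i j assume ij: "i < ?N" "j < ?N"
    have "cnj (x i) * x i = 1" for i using x[of i] complex_norm_square[of "x i"] by (simp add: mult.commute)
    then have "(\<Sum>l<?N. cnj (D $$ (l, i)) * D $$ (l, j)) = (\<Sum>l<?N. if l = i then (if i = j then 1 else 0) else 0)"
      using ij by (intro sum.cong refl) (auto simp: D_def)
    then show "(\<Sum>l<?N. cnj (D $$ (l, i)) * D $$ (l, j)) = (if i = j then 1 else 0)" using ij by simp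
  qed
  define U where "U = mat_adjoint T * (D * T)"
  have U: "U \<in> unitary_group ?N"
    unfolding U_def by (intro unitary_group_mult unitary_group_adjoint T D)
  have ca: "mat_adjoint T \<in> carrier_mat ?N ?N" using cT by simp
  define y where "y k = Matrix.vec ?N (\<lambda>i. x i ^ k * g $ i)" for k
  have y: "y k \<in> carrier_vec ?N" for k by (simp add: y_def)
  have Dy: "D *\<^sub>v y k = y (Suc k)" for k
  proof (rule eq_vecI)
    fix i assume "i < dim_vec (y (Suc k))"
    then have i: "i < ?N" by (simp add: y_def)
    have "(D *\<^sub>v y k) $ i = (\<Sum>j<?N. D $$ (i, j) * y k $ j)" by (rule mult_mat_vec_index_sum[OF cD y i])
    also have "\<dots> = (\<Sum>j<?N. if j = i then x i * y k $ i else 0)" using i by (intro sum.cong refl) (auto simp: D_def)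
    also have "\<dots> = y (Suc k) $ i" using i by (simp add: y_def)
    finally show "(D *\<^sub>v y k) $ i = y (Suc k) $ i" .
  qed (simp add: y_def D_def)
  have TT: "T *\<^sub>v (mat_adjoint T *\<^sub>v v) = v" "mat_adjoint T *\<^sub>v (T *\<^sub>v v) = v" if "v \<in> carrier_vec ?N" for v
    using that cT ca unitary_group_right[OF T(1)] unitary_group_left[OF T(1)]
    by (simp_all add: assoc_mult_mat_vec[symmetric, of _ ?N ?N _ ?N])
  have Te: "T *\<^sub>v unit_vec ?N 0 = y 0"
  proof (rule eq_vecI)
    fix i assume "i < dim_vec (y 0)"
    then have i: "i < ?N" by (simp add: y_def)
    have "(T *\<^sub>v unit_vec ?N 0) $ i = (\<Sum>j<?N. T $$ (i, j) * unit_vec ?N 0 $ j)"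
      by (rule mult_mat_vec_index_sum[OF cT _ i]) simp
    also have "\<dots> = (\<Sum>j<?N. if j = 0 then T $$ (i, 0) else 0)" by (intro sum.cong refl) auto
    also have "\<dots> = y 0 $ i" using i T(2) by (simp add: y_def)
    finally show "(T *\<^sub>v unit_vec ?N 0) $ i = y 0 $ i" .
  qed (use cT in \<open>auto simp: y_def\<close>)
  have orb: "orb U k = mat_adjoint T *\<^sub>v y k" for k
  proof (induction k)
    case 0
    have "dim_row U = ?N" using unitary_group_dim[OF U] by simp
    then show ?case using TT(2)[of "unit_vec ?N 0"] by (simp add: Te)
  next
    case (Suc k)
    have ty: "mat_adjoint T *\<^sub>v y k \<in> carrier_vec ?N" using ca y by auto
    have "orb U (Suc k) = U *\<^sub>v (mat_adjoint T *\<^sub>v y k)" by (simp add: orb_Suc Suc)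
    also have "\<dots> = mat_adjoint T *\<^sub>v (D *\<^sub>v (T *\<^sub>v (mat_adjoint T *\<^sub>v y k)))"
    proof -
      have "U *\<^sub>v (mat_adjoint T *\<^sub>v y k) = mat_adjoint T *\<^sub>v ((D * T) *\<^sub>v (mat_adjoint T *\<^sub>v y k))"
        unfolding U_def by (rule assoc_mult_mat_vec[OF ca mult_carrier_mat[OF cD cT] ty])
      also have "(D * T) *\<^sub>v (mat_adjoint T *\<^sub>v y k) = D *\<^sub>v (T *\<^sub>v (mat_adjoint T *\<^sub>v y k))"
        by (rule assoc_mult_mat_vec[OF cD cT ty])
      finally show ?thesis .
    qed
    finally show ?case by (simp add: TT(1)[OF y] Dy)
  qed
  have "umom U k = (\<Sum>i<?N. of_real (p i) * x i ^ k)" for k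
  proof -
    have "umom U k = (\<Sum>i<?N. mat_adjoint T $$ (0, i) * y k $ i)"
      unfolding umom_def orb by (rule mult_mat_vec_index_sum[OF ca y]) simp
    also have "\<dots> = (\<Sum>i<?N. of_real (p i) * x i ^ k)"
    proof (intro sum.cong refl)
      fix i assume "i \<in> {..<?N}"
      then have i: "i < ?N" by simp
      have "complex_of_real (sqrt (p i)) * complex_of_real (sqrt (p i)) = of_real (p i)"
        using p(1)[OF i] by (simp flip: of_real_mult)
      then have "cnj (complex_of_real (sqrt (p i))) * (x i ^ k * complex_of_real (sqrt (p i))) = of_real (p i) * x i ^ k"
        by (simp add: mult_ac)
      then show "mat_adjoint T $$ (0, i) * y k $ i = of_real (p i) * x i ^ k"
        using i T(2)[OF i] by (simp add: mat_adjoint_index[OF cT] y_def g_def)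
    qed
    finally show ?thesis .
  qed
  then show ?thesis using that U by blast
qed

section \<open>Lower semicontinuity and approximation\<close>

lemma openin_weak_integral_less:
  fixes f :: "complex \<Rightarrow> real"
  assumes "continuous_on circle f"
  shows "openin weak_topology {\<nu> \<in> circle_probs. (\<integral>z. f z \<partial>\<nu>) < t}"
  using openin_continuous_map_preimage[OF continuous_map_weak_integral[OF assms], of "{..<t}"]
  by (simp add: topspace_weak_topology)

text \<open>A continuous witness h for a rate above r remains a witness near \<mu>, because
  \<integral>exp (-h) d\<nu> depends continuously on \<nu>; \<open>szego_rate_jensen\<close> then
  rules out a rate at most r for such \<nu>.\<close>

lemma closedin_szego_rate: "closedin weak_topology {\<mu> \<in> circle_probs. szego_rate \<mu> \<le> c}"
proof (cases c)
  case (real r)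
  have "openin weak_topology {\<mu> \<in> circle_probs. c < szego_rate \<mu>}"
  proof (subst openin_subopen, safe)
    fix \<mu> assume \<mu>: "\<mu> \<in> circle_probs" "c < szego_rate \<mu>"
    then have "ereal r < szego_rate \<mu>" by (simp add: real)
    then obtain h where h: "continuous_on circle h"
      "(\<integral>z. exp (- h z) \<partial>\<mu>) * exp (\<integral>z. h z \<partial>arc_measure) < exp (- r)"
      by (rule szego_rate_witness_continuous[OF \<mu>(1)])
    define T where "T = {\<nu> \<in> circle_probs. (\<integral>z. exp (- h z) \<partial>\<nu>) < exp (- r - (\<integral>z. h z \<partial>arc_measure))}"
    have "openin weak_topology T"
      unfolding T_def by (intro openin_weak_integral_less continuous_intros h(1))
    moreover have "\<mu> \<in> T"
      using \<mu>(1) h(2) by (simp add: T_def exp_diff pos_less_divide_eq)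
    moreover have "T \<subseteq> {\<mu> \<in> circle_probs. c < szego_rate \<mu>}"
    proof
      fix \<nu> assume \<nu>: "\<nu> \<in> T"
      have "\<not> szego_rate \<nu> \<le> ereal r"
        using szego_rate_jensen[of \<nu> r h] h(1) \<nu> by (auto simp: T_def)
      then show "\<nu> \<in> {\<mu> \<in> circle_probs. c < szego_rate \<mu>}" using \<nu> by (simp add: T_def real)
    qed
    ultimately show "\<exists>T. openin weak_topology T \<and> \<mu> \<in> T \<and> T \<subseteq> {\<mu> \<in> circle_probs. c < szego_rate \<mu>}" by blast
  qed
  moreover have "circle_probs - {\<mu> \<in> circle_probs. szego_rate \<mu> \<le> c} = {\<mu> \<in> circle_probs. c < szego_rate \<mu>}" by auto
  ultimately show ?thesis by (simp add: closedin_def topspace_weak_topology)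
next
  case PInf
  then show ?thesis using closedin_topspace[of weak_topology] by (simp add: topspace_weak_topology)
next
  case MInf
  then have "{\<mu> \<in> circle_probs. szego_rate \<mu> \<le> c} = {}" using szego_rate_nonneg by fastforce
  then show ?thesis by (simp only: closedin_empty)
qed

text \<open>Scaling the assumption bounds the constant coefficient. Removing it and dividing by z
  costs a factor 2 + 2/r, since |z| = 1, and exposes the next coefficient. The bound is needed for a
  polynomial that comes from an approximating matrix and is not known in advance.\<close>

lemma coeff_le_integral_norm_square:
  assumes \<mu>: "\<mu> \<in> circle_probs" and r: "r > 0"
    and P: "\<And>P. poly P 0 = 1 \<Longrightarrow> r \<le> (\<integral>z. (cmod (poly P z))\<^sup>2 \<partial>\<mu>)"
  shows "(cmod (coeff q i))\<^sup>2 \<le> (2 + 2 / r) ^ i / r * (\<integral>z. (cmod (poly q z))\<^sup>2 \<partial>\<mu>)"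
proof (induction i arbitrary: q)
  have base: "(cmod (coeff q 0))\<^sup>2 \<le> 1 / r * (\<integral>z. (cmod (poly q z))\<^sup>2 \<partial>\<mu>)" for q
  proof (cases "coeff q 0 = 0")
    case False
    have "r \<le> (\<integral>z. (cmod (poly (Polynomial.smult (1 / coeff q 0) q) z))\<^sup>2 \<partial>\<mu>)"
      using False by (intro P) (simp add: poly_0_coeff_0)
    also have "\<dots> = (\<integral>z. (cmod (poly q z))\<^sup>2 / (cmod (coeff q 0))\<^sup>2 \<partial>\<mu>)"
      by (intro Bochner_Integration.integral_cong refl) (simp add: norm_divide power_divide)
    also have "\<dots> = (\<integral>z. (cmod (poly q z))\<^sup>2 \<partial>\<mu>) / (cmod (coeff q 0))\<^sup>2"
      by (rule integral_divide_zero)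
    finally show ?thesis using False r by (simp add: field_simps)
  qed (use r in simp)
  {
    case 0
    show ?case using base by simp
  next
    case (Suc i)
    interpret prob_space \<mu> by (rule circle_probsD(1)[OF \<mu>])
    obtain a p where q: "q = pCons a p" by (cases q)
    have int: "integrable \<mu> (\<lambda>z. (cmod (poly p z))\<^sup>2)" for p
      by (intro continuous_on_circle_integrable[OF _ \<mu>] continuous_intros)
    have "(\<integral>z. (cmod (poly p z))\<^sup>2 \<partial>\<mu>) \<le> (\<integral>z. 2 * (cmod (poly q z))\<^sup>2 + 2 * (cmod a)\<^sup>2 \<partial>\<mu>)"
    proof (rule integral_mono)
      fix z assume "z \<in> space \<mu>"
      then have "cmod z = 1" using circle_probsD(3)[OF \<mu>] by simp
      then have "cmod (poly p z) = cmod (poly q z - a)" by (simp add: q norm_mult)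
      also have "\<dots> \<le> cmod (poly q z) + cmod a" by (rule norm_triangle_ineq4)
      finally have "(cmod (poly p z))\<^sup>2 \<le> (cmod (poly q z) + cmod a)\<^sup>2" by (intro power_mono) auto
      also have "\<dots> \<le> 2 * (cmod (poly q z))\<^sup>2 + 2 * (cmod a)\<^sup>2"
        using zero_le_power2[of "cmod (poly q z) - cmod a"] unfolding power2_sum power2_diff by linarith
      finally show "(cmod (poly p z))\<^sup>2 \<le> 2 * (cmod (poly q z))\<^sup>2 + 2 * (cmod a)\<^sup>2" .
    qed (use int in auto)
    also have "\<dots> = 2 * (\<integral>z. (cmod (poly q z))\<^sup>2 \<partial>\<mu>) + 2 * (cmod a)\<^sup>2"
      using int[of q] by (simp add: prob_space)
    also have "\<dots> \<le> (2 + 2 / r) * (\<integral>z. (cmod (poly q z))\<^sup>2 \<partial>\<mu>)"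
      using base[of q] by (simp add: q algebra_simps)
    finally have "(2 + 2 / r) ^ i / r * (\<integral>z. (cmod (poly p z))\<^sup>2 \<partial>\<mu>) \<le>
        (2 + 2 / r) ^ i / r * ((2 + 2 / r) * (\<integral>z. (cmod (poly q z))\<^sup>2 \<partial>\<mu>))"
      using r by (intro mult_left_mono) auto
    with Suc[of p] show ?case by (simp add: q mult_ac)
  }
qed

lemma qform_perturbation:
  assumes q: "\<And>i. i < k \<Longrightarrow> (cmod (q i))\<^sup>2 \<le> M" and m: "\<And>i. i < k \<Longrightarrow> cmod (m i - m' i) \<le> \<delta>"
  shows "\<bar>qform k q m - qform k q m'\<bar> \<le> (real k)\<^sup>2 * (M * \<delta>)"
proof -
  define x where "x m i j = (if j \<le> i then m (i - j) else cnj (m (j - i)))" for m :: "nat \<Rightarrow> complex" and i j :: nat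
  have x: "cmod (x m i j - x m' i j) \<le> \<delta>" if "i < k" "j < k" for i j
  proof (cases "j \<le> i")
    case True
    then show ?thesis using m[of "i - j"] that by (simp add: x_def)
  next
    case False
    then have "x m i j - x m' i j = cnj (m (j - i) - m' (j - i))" by (simp add: x_def)
    then show ?thesis using m[of "j - i"] that by (simp only: complex_mod_cnj)
  qed
  have "qform k q m - qform k q m' = Re (\<Sum>i<k. \<Sum>j<k. q i * cnj (q j) * (x m i j - x m' i j))"
    unfolding qform_def x_def[symmetric] minus_complex.sel(1)[symmetric] sum_subtractf[symmetric] right_diff_distrib ..
  also have "\<bar>\<dots>\<bar> \<le> cmod (\<Sum>i<k. \<Sum>j<k. q i * cnj (q j) * (x m i j - x m' i j))" by (rule abs_Re_le_cmod)
  also have "\<dots> \<le> (\<Sum>i<k. \<Sum>j<k. M * \<delta>)"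
  proof (intro sum_norm_le)
    fix i j assume ij: "i \<in> {..<k}" "j \<in> {..<k}"
    have "2 * (cmod (q i) * cmod (q j)) \<le> (cmod (q i))\<^sup>2 + (cmod (q j))\<^sup>2"
      using zero_le_power2[of "cmod (q i) - cmod (q j)"] unfolding power2_diff by linarith
    then have "cmod (q i) * cmod (q j) \<le> M" using q[of i] q[of j] ij by simp
    moreover have "0 \<le> M" using q[of i] ij zero_le_power2[of "cmod (q i)"] by (metis lessThan_iff order_trans)
    ultimately have "cmod (q i) * cmod (q j) * cmod (x m i j - x m' i j) \<le> M * \<delta>"
      using x[of i j] ij by (intro mult_mono) auto
    then show "cmod (q i * cnj (q j) * (x m i j - x m' i j)) \<le> M * \<delta>" by (simp add: norm_mult)
  qed
  also have "\<dots> = (real k)\<^sup>2 * (M * \<delta>)" by (simp add: power2_eq_square)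
  finally show ?thesis .
qed

text \<open>Replace \<mu> by atoms on the eigenvalues of a matrix U and take the minimiser of U from
  \<open>qform_attained\<close>. Its integral A against \<mu> is at least r and its squared
  coefficients are at most M A, so passing from the moments of \<mu> to those of U is a small
  relative error. The minimum for U therefore exceeds r'.\<close>

lemma schur_parameters_approximation:
  assumes \<mu>: "\<mu> \<in> circle_probs" and r: "0 < r'" "r' < r" and e: "e > 0"
    and P: "\<And>P. poly P 0 = 1 \<Longrightarrow> r \<le> (\<integral>z. (cmod (poly P z))\<^sup>2 \<partial>\<mu>)"
  shows "\<exists>as m. length as = K \<and> (\<forall>\<alpha>\<in>set as. cmod \<alpha> < 1) \<and> m 0 = 1 \<and> r' < (\<Prod>\<alpha>\<leftarrow>as. 1 - (cmod \<alpha>)\<^sup>2) \<and>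
    (\<forall>i\<le>K. cmod (foldr schur_a as m i - moments \<mu> i) < e)"
proof -
  define M where "M = (2 + 2 / r) ^ K / r"
  have r0: "r > 0" using r by simp
  have M: "M > 0" unfolding M_def using r0 by (intro divide_pos_pos zero_less_power) (auto intro: add_pos_pos)
  \<comment> \<open>Chosen so that the bound of \<open>qform_perturbation\<close>, which is (K +
    1)^2 M \<delta> times A, stays below (1 - r'/r) A.\<close>
  define \<delta> where "\<delta> = min (e / 2) ((1 - r' / r) / (2 * (real (Suc K))\<^sup>2 * M))"
  have pos: "1 - r' / r > 0" using r by simp
  have \<delta>: "\<delta> > 0" "\<delta> < e" "(real (Suc K))\<^sup>2 * M * \<delta> < 1 - r' / r"
  proof -
    have D: "0 < 2 * (real (Suc K))\<^sup>2 * M" using M by (intro mult_pos_pos) auto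
    show "\<delta> > 0" using e divide_pos_pos[OF pos D] by (simp only: \<delta>_def min_less_iff_conj half_gt_zero)
    show "\<delta> < e" using e by (simp add: \<delta>_def)
    have "\<delta> \<le> (1 - r' / r) / (2 * (real (Suc K))\<^sup>2 * M)" unfolding \<delta>_def by (rule min.cobounded2)
    then have "2 * (real (Suc K))\<^sup>2 * M * \<delta> \<le> 1 - r' / r" using D by (metis mult.commute pos_le_divide_eq)
    then show "(real (Suc K))\<^sup>2 * M * \<delta> < 1 - r' / r" using pos by (simp only: mult.assoc)
  qed
  obtain n :: nat where n: "real K * 8 / \<delta> < real n" using reals_Archimedean2 by blast
  define N where "N = Suc (K + n)"
  have N: "N > 0" "real K * (8 / real N) < \<delta>"
  proof -
    have "real K * 8 / \<delta> < real N" using n by (simp add: N_def)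
    then show "real K * (8 / real N) < \<delta>" using \<delta>(1) by (simp add: N_def field_simps)
  qed (simp add: N_def)
  obtain p x where p: "\<And>i. i < N \<Longrightarrow> 0 \<le> p i" "(\<Sum>i<N. p i) = (1::real)" "\<And>i. cmod (x i) = 1"
    "\<And>k. cmod ((\<Sum>i<N. of_real (p i) * x i ^ k) - moments \<mu> k) \<le> real k * (8 / real N)"
    using circle_discretization[OF \<mu> N(1)] by metis
  obtain U where U: "U \<in> unitary_group N" "\<And>k. umom U k = (\<Sum>i<N. of_real (p i) * x i ^ k)"
    using unitary_of_atoms[of "K + n" p x] p(1-3) unfolding N_def[symmetric] by metis
  have close: "cmod (umom U i - moments \<mu> i) < \<delta>" if "i \<le> K" for i
  proof -
    have "cmod (umom U i - moments \<mu> i) \<le> real i * (8 / real N)" using p(4)[of i] by (simp only: U(2))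
    also have "\<dots> \<le> real K * (8 / real N)" using that by (intro mult_right_mono) auto
    finally show ?thesis using N(2) by simp
  qed
  obtain c where c: "c 0 = 1" "qform (Suc K) c (umom U) = 0 \<or>
    (\<exists>as m. length as = K \<and> (\<forall>\<alpha>\<in>set as. cmod \<alpha> < 1) \<and> m 0 = 1 \<and> umom U = foldr schur_a as m \<and>
       qform (Suc K) c (umom U) = (\<Prod>\<alpha>\<leftarrow>as. 1 - (cmod \<alpha>)\<^sup>2))"
    using qform_attained[of U K n] U(1) unfolding N_def by blast
  define q where "q = (\<Sum>i\<le>K. monom (c i) i)"
  define A where "A = (\<integral>z. (cmod (poly q z))\<^sup>2 \<partial>\<mu>)"
  have cq: "coeff q i = c i" if "i \<le> K" for i using that by (simp add: q_def coeff_sum)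
  have pq: "poly q z = (\<Sum>i<Suc K. c i * z ^ i)" for z
    by (simp add: q_def poly_sum poly_monom lessThan_Suc_atMost)
  have Aq: "A = qform (Suc K) c (moments \<mu>)"
    unfolding A_def pq by (rule integral_norm_square_eq_qform[OF \<mu>])
  have "poly q 0 = 1" using cq[of 0] c(1) by (simp add: poly_0_coeff_0)
  then have A: "r \<le> A" unfolding A_def by (rule P)
  have "(cmod (c i))\<^sup>2 \<le> M * A" if "i < Suc K" for i
  proof -
    have "(cmod (c i))\<^sup>2 \<le> (2 + 2 / r) ^ i / r * A"
      using coeff_le_integral_norm_square[OF \<mu> r0 P, of q i] cq[of i] that by (simp add: A_def)
    also have "\<dots> \<le> M * A"
      unfolding M_def using that r0 A by (intro mult_right_mono divide_right_mono power_increasing) auto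
    finally show ?thesis .
  qed
  then have "\<bar>qform (Suc K) c (umom U) - A\<bar> \<le> (real (Suc K))\<^sup>2 * (M * A * \<delta>)"
    unfolding Aq using close by (intro qform_perturbation) (auto intro: less_imp_le)
  also have "\<dots> = (real (Suc K))\<^sup>2 * M * \<delta> * A" by (simp only: mult_ac)
  also have "\<dots> < (1 - r' / r) * A" using \<delta>(3) A r0 by (intro mult_strict_right_mono) auto
  \<comment> \<open>In particular the minimum is not 0, so the degenerate case of
    \<open>qform_attained\<close> is excluded and all K coefficients lie in the open disc.\<close>
  finally have "r' / r * A < qform (Suc K) c (umom U)" unfolding left_diff_distrib by linarith
  moreover have "r' / r * A \<ge> r' / r * r" using A r0 r by (intro mult_left_mono) auto
  ultimately have Q: "r' < qform (Suc K) c (umom U)" using r0 by simp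
  then obtain as m where as: "length as = K" "\<forall>\<alpha>\<in>set as. cmod \<alpha> < 1" "m 0 = 1" "umom U = foldr schur_a as m"
    "qform (Suc K) c (umom U) = (\<Prod>\<alpha>\<leftarrow>as. 1 - (cmod \<alpha>)\<^sup>2)"
    using c(2) r(1) by fastforce
  have "cmod (foldr schur_a as m i - moments \<mu> i) < e" if "i \<le> K" for i
    using close[OF that] \<delta>(2) as(4) by simp
  then show ?thesis using as Q by (intro exI[of _ as] exI[of _ m]) simp
qed

section \<open>The large deviation bounds\<close>

lemma spectral_measure_umom:
  assumes "n \<ge> 1" "U \<in> unitary_group n"
  shows "spectral_measure U (unit_vec n 0) \<in> circle_probs" "moments (spectral_measure U (unit_vec n 0)) = umom U"
  using spectral_measure_props[of U "n - 1"] assms by auto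

lemma spectral_measure_measurable:
  assumes H: "haar_prob n H" and n: "n \<ge> 1"
  shows "(\<lambda>U. spectral_measure U (unit_vec n 0)) \<in> measurable H (borel_of weak_topology)"
proof (rule measurable_borel_of_weak)
  show "(\<lambda>U. spectral_measure U (unit_vec n 0)) \<in> space H \<rightarrow> circle_probs"
    using spectral_measure_umom[OF n] by (auto simp: haar_space[OF H])
  fix k
  have um: "umom \<in> borel_measurable H" using n by (intro haar_measurable[OF H] measurable_umom) simp
  have "(\<lambda>m :: nat \<Rightarrow> complex. m k) \<in> borel_measurable borel"
    by (intro borel_measurable_continuous_onI continuous_on_product_coordinates)
  from measurable_compose[OF um this] have "(\<lambda>U. umom U k) \<in> borel_measurable H" .
  then show "(\<lambda>U. moments (spectral_measure U (unit_vec n 0)) k) \<in> borel_measurable H"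
    by (subst measurable_cong[of _ _ "\<lambda>U. umom U k"]) (simp_all add: spectral_measure_umom[OF n] haar_space[OF H])
qed

lemma space_borel_of: "space (borel_of X) = topspace X"
  by (simp add: borel_of_def space_measure_of_conv)

lemma openin_borel_of: "openin X G \<Longrightarrow> G \<in> sets (borel_of X)"
  unfolding borel_of_def by (subst sets_measure_of) (auto dest: openin_subset)

lemma closedin_borel_of:
  assumes "closedin X K" shows "K \<in> sets (borel_of X)"
proof -
  have "topspace X - (topspace X - K) \<in> sets (borel_of X)"
    using sets.compl_sets[OF openin_borel_of[of X "topspace X - K"]] assms by (simp add: space_borel_of closedin_def)
  then show ?thesis using closedin_subset[OF assms] by (simp add: double_diff)
qed

lemma measure_spectral_law:
  assumes H: "haar_prob n H" and n: "n \<ge> 1" and G: "G \<in> sets (borel_of weak_topology)"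
  shows "measure (spectral_law n H) G = measure H {U \<in> space H. spectral_measure U (unit_vec n 0) \<in> G}"
    and "{U \<in> space H. spectral_measure U (unit_vec n 0) \<in> G} \<in> sets H"
proof -
  have eq: "(\<lambda>U. spectral_measure U (unit_vec n 0)) -` G \<inter> space H = {U \<in> space H. spectral_measure U (unit_vec n 0) \<in> G}"
    by auto
  show "measure (spectral_law n H) G = measure H {U \<in> space H. spectral_measure U (unit_vec n 0) \<in> G}"
    unfolding spectral_law_def eq[symmetric] by (rule measure_distr[OF spectral_measure_measurable[OF H n] G])
  show "{U \<in> space H. spectral_measure U (unit_vec n 0) \<in> G} \<in> sets H"
    unfolding eq[symmetric] by (rule measurable_sets[OF spectral_measure_measurable[OF H n] G])
qed

lemma elog_divide_ge:
  assumes "n \<ge> 1" "exp b ^ n \<le> x"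
  shows "ereal b \<le> elog x / ereal (real n)"
proof -
  have x: "x > 0" using assms(2) by (rule less_le_trans[rotated]) simp
  have "real n * b \<le> ln x" using assms x by (subst ln_ge_iff) (simp_all add: exp_of_nat_mult)
  then have "b \<le> ln x / real n" using assms(1) by (simp add: pos_le_divide_eq mult.commute)
  moreover have "elog x / ereal (real n) = ereal (ln x / real n)" using x assms(1) by (simp add: elog_def)
  ultimately show ?thesis by (simp only: ereal_less_eq)
qed

lemma elog_divide_le:
  assumes "n \<ge> 1" "0 \<le> x" "x \<le> exp b ^ n"
  shows "elog x / ereal (real n) \<le> ereal b"
proof (cases "x = 0")
  case False
  then have x: "x > 0" using assms by simp
  have "ln x \<le> ln (exp (real n * b))" using assms x by (subst ln_le_cancel_iff) (simp_all add: exp_of_nat_mult)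
  then have "ln x / real n \<le> b" using assms(1) by (simp add: pos_divide_le_eq mult.commute)
  moreover have "elog x / ereal (real n) = ereal (ln x / real n)" using x assms(1) by (simp add: elog_def)
  ultimately show ?thesis by (simp only: ereal_less_eq)
qed (use assms(1) in \<open>simp add: elog_def\<close>)

text \<open>By \<open>szego_rate_le_poly\<close> every normalised polynomial has integral at least
  exp (-c) > exp b. Half of the radius e is spent on the passage from \<mu> to coefficients inside
  the disc, the other half on the random matrix.\<close>

lemma spectral_law_lower_bound:
  fixes H :: "nat \<Rightarrow> complex mat measure"
  assumes haar: "\<And>n. n \<ge> 1 \<Longrightarrow> haar_prob n (H n)" and G: "openin weak_topology G"
    and \<mu>: "\<mu> \<in> G" "szego_rate \<mu> = ereal c" and b: "b < - c"
  shows "\<forall>\<^sub>F n in sequentially. exp b ^ n \<le> measure (spectral_law n (H n)) G"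
proof -
  have \<mu>p: "\<mu> \<in> circle_probs" using openin_subset[OF G] \<mu>(1) by (auto simp: topspace_weak_topology)
  obtain S where S: "open S" "G = {\<mu> \<in> circle_probs. moments \<mu> \<in> S}"
    using G unfolding openin_weak_topology_iff by blast
  have "moments \<mu> \<in> S" using \<mu>(1) S(2) by simp
  with S(1) have "\<exists>K e. e > 0 \<and> (\<forall>y. (\<forall>i\<le>K. dist (y i) (moments \<mu> i) < e) \<longrightarrow> y \<in> S)"
    by (rule open_seq_contains_cylinder) blast
  then obtain K e where K: "e > 0" "\<And>y. (\<And>i. i \<le> K \<Longrightarrow> dist (y i) (moments \<mu> i) < e) \<Longrightarrow> y \<in> S"
    by blast
  have P: "exp (- c) \<le> (\<integral>z. (cmod (poly P z))\<^sup>2 \<partial>\<mu>)" if "poly P 0 = 1" for P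
    using \<mu>(2) that by (intro szego_rate_le_poly[OF \<mu>p]) auto
  have "\<exists>as m. length as = K \<and> (\<forall>\<alpha>\<in>set as. cmod \<alpha> < 1) \<and> m 0 = 1 \<and> exp b < (\<Prod>\<alpha>\<leftarrow>as. 1 - (cmod \<alpha>)\<^sup>2) \<and>
    (\<forall>i\<le>K. cmod (foldr schur_a as m i - moments \<mu> i) < e / 2)"
    using b K(1) P by (intro schur_parameters_approximation[OF \<mu>p, of _ "exp (- c)"]) auto
  then obtain as m where as: "length as = K" "\<forall>\<alpha>\<in>set as. cmod \<alpha> < 1" "m 0 = 1" "exp b < (\<Prod>\<alpha>\<leftarrow>as. 1 - (cmod \<alpha>)\<^sup>2)"
    "\<And>i. i \<le> K \<Longrightarrow> cmod (foldr schur_a as m i - moments \<mu> i) < e / 2" by blast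
  have "\<forall>\<^sub>F n in sequentially. exp b ^ n \<le>
      measure (H n) {U \<in> space (H n). \<forall>i\<le>length as. cmod (umom U i - foldr schur_a as m i) < e / 2}"
    using haar as(2-4) K(1) by (intro haar_lower) auto
  then show ?thesis using eventually_ge_at_top[of 1]
  proof eventually_elim
    case (elim n)
    interpret prob_space "H n" by (rule haar_prob_space[OF haar[OF elim(2)]])
    have "moments (spectral_measure U (unit_vec n 0)) \<in> S"
      if "\<forall>i\<le>length as. cmod (umom U i - foldr schur_a as m i) < e / 2" "U \<in> space (H n)" for U
    proof (rule K(2))
      fix i assume i: "i \<le> K"
      have "cmod (umom U i - foldr schur_a as m i) < e / 2" using that(1) i by (simp add: as(1))
      moreover note as(5)[OF i]
      moreover have "umom U i - moments \<mu> i = (umom U i - foldr schur_a as m i) + (foldr schur_a as m i - moments \<mu> i)" by simp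
      ultimately have "cmod (umom U i - moments \<mu> i) < e"
        using norm_triangle_ineq[of "umom U i - foldr schur_a as m i" "foldr schur_a as m i - moments \<mu> i"] by simp
      then show "dist (moments (spectral_measure U (unit_vec n 0)) i) (moments \<mu> i) < e"
        using that(2) spectral_measure_umom[OF elim(2)] by (simp add: dist_norm haar_space[OF haar[OF elim(2)]])
    qed
    then have "measure (H n) {U \<in> space (H n). \<forall>i\<le>length as. cmod (umom U i - foldr schur_a as m i) < e / 2}
      \<le> measure (H n) {U \<in> space (H n). spectral_measure U (unit_vec n 0) \<in> G}"
      using spectral_measure_umom[OF elim(2)] measure_spectral_law(2)[OF haar[OF elim(2)] elim(2) openin_borel_of[OF G]]
      by (intro finite_measure_mono) (auto simp: S(2) haar_space[OF haar[OF elim(2)]])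
    also have "\<dots> = measure (spectral_law n (H n)) G"
      by (rule measure_spectral_law(1)[OF haar[OF elim(2)] elim(2) openin_borel_of[OF G], symmetric])
    finally show ?case using elim(1) by simp
  qed
qed

text \<open>Choose \<eta> so small that the base is a \<tau> < s; then (s / \<tau>)^n outgrows every
  constant multiple of n^k. The constant C leaves room for a union bound.\<close>

lemma eventually_geometric_bound:
  fixes t s C :: real
  assumes ts: "0 < t" "t < s" and C: "C > 0"
  shows "\<exists>\<eta>>0. \<forall>\<^sub>F n in sequentially. (t + (1 + \<eta>) ^ k - 1) ^ (n - k) * (real n / \<eta>) ^ k \<le> s ^ n / C"
proof -
  have "((\<lambda>\<eta>. t + (1 + \<eta>) ^ k - 1) \<longlongrightarrow> t + (1 + 0) ^ k - 1) (at_right 0)"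
    by (intro tendsto_intros)
  then have "\<forall>\<^sub>F \<eta> in at_right 0. t + (1 + \<eta>) ^ k - 1 < s"
    using ts by (intro order_tendstoD(2)) auto
  moreover have "\<forall>\<^sub>F \<eta>::real in at_right 0. 0 < \<eta>" by (rule eventually_at_right_less)
  ultimately have "\<forall>\<^sub>F \<eta> in at_right 0. t + (1 + \<eta>) ^ k - 1 < s \<and> 0 < \<eta>" by eventually_elim auto
  then obtain \<eta> :: real where \<eta>: "t + (1 + \<eta>) ^ k - 1 < s" "0 < \<eta>"
    using eventually_happens'[OF trivial_limit_at_right_real] by blast
  define \<tau> where "\<tau> = t + (1 + \<eta>) ^ k - 1"
  have "1 \<le> (1 + \<eta>) ^ k" using \<eta>(2) by (intro one_le_power) simp
  then have \<tau>: "0 < \<tau>" "\<tau> < s" using \<eta>(1) ts by (auto simp: \<tau>_def)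
  define l where "l = ln (s / \<tau>)"
  have l: "l > 0" using \<tau> by (simp add: l_def)
  have lim: "filterlim (\<lambda>n. l * real n) at_top sequentially"
    using l by (intro filterlim_tendsto_pos_mult_at_top[OF tendsto_const] filterlim_real_sequentially)
  have "((\<lambda>n. (l * real n) ^ k / exp (l * real n)) \<longlongrightarrow> 0) sequentially"
    by (rule filterlim_compose[OF tendsto_power_div_exp_0 lim])
  moreover have "0 < l ^ k * \<tau> ^ k * \<eta> ^ k / C" using l \<tau> \<eta> C by simp
  ultimately have "\<forall>\<^sub>F n in sequentially. (l * real n) ^ k / exp (l * real n) < l ^ k * \<tau> ^ k * \<eta> ^ k / C"
    by (rule order_tendstoD(2))
  then have "\<forall>\<^sub>F n in sequentially. \<tau> ^ (n - k) * (real n / \<eta>) ^ k \<le> s ^ n / C"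
    using eventually_ge_at_top[of k]
  proof eventually_elim
    case (elim n)
    have s: "s ^ n = \<tau> ^ n * exp (l * real n)"
    proof -
      have "exp (l * real n) = (s / \<tau>) ^ n" using \<tau> ts by (simp add: l_def exp_of_nat2_mult)
      then show ?thesis using \<tau> by (simp add: power_divide)
    qed
    have n: "\<tau> ^ n = \<tau> ^ (n - k) * \<tau> ^ k" using elim(2) by (simp flip: power_add)
    have "l ^ k * real n ^ k * C \<le> l ^ k * \<tau> ^ k * \<eta> ^ k * exp (l * real n)"
      using elim(1) C by (simp add: power_mult_distrib field_simps)
    then have "l ^ k * (real n ^ k * C) \<le> l ^ k * (\<tau> ^ k * \<eta> ^ k * exp (l * real n))" by (simp only: mult.assoc)
    then have "real n ^ k * C \<le> \<tau> ^ k * \<eta> ^ k * exp (l * real n)" using l by simp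
    then have "\<tau> ^ (n - k) * (real n ^ k * C) \<le> \<tau> ^ (n - k) * (\<tau> ^ k * \<eta> ^ k * exp (l * real n))"
      using \<tau> by (intro mult_left_mono) auto
    then show ?case using \<eta> C unfolding s n by (simp add: power_divide field_simps)
  qed
  then show ?thesis using \<eta>(2) unfolding \<tau>_def by blast
qed

text \<open>Every \<mu> in K has its own polynomial with integral below exp (-a), and this remains
  true in a weak neighbourhood. Finitely many such neighbourhoods cover the compact set K, and
  \<open>haar_qform_upper\<close> bounds the probability of each.\<close>

lemma spectral_law_upper_bound:
  fixes H :: "nat \<Rightarrow> complex mat measure"
  assumes haar: "\<And>n. n \<ge> 1 \<Longrightarrow> haar_prob n (H n)" and K: "closedin weak_topology K"
    and a: "\<And>\<mu>. \<mu> \<in> K \<Longrightarrow> ereal a < szego_rate \<mu>" and b: "- a < b"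
  shows "\<forall>\<^sub>F n in sequentially. measure (spectral_law n (H n)) K \<le> exp b ^ n"
proof -
  have Kp: "K \<subseteq> circle_probs" using closedin_subset[OF K] by (simp add: topspace_weak_topology)
  have "\<forall>\<mu>\<in>K. \<exists>P. poly P 0 = 1 \<and> (\<integral>z. (cmod (poly P z))\<^sup>2 \<partial>\<mu>) < exp (- a)"
  proof
    fix \<mu> assume \<mu>: "\<mu> \<in> K"
    then have "\<mu> \<in> circle_probs" using Kp by blast
    from szego_rate_witness_poly[OF this a[OF \<mu>]]
    show "\<exists>P. poly P 0 = 1 \<and> (\<integral>z. (cmod (poly P z))\<^sup>2 \<partial>\<mu>) < exp (- a)" by blast
  qed
  from bchoice[OF this] obtain P where P: "\<And>\<mu>. \<mu> \<in> K \<Longrightarrow> poly (P \<mu>) 0 = 1"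
    "\<And>\<mu>. \<mu> \<in> K \<Longrightarrow> (\<integral>z. (cmod (poly (P \<mu>) z))\<^sup>2 \<partial>\<mu>) < exp (- a)" by blast
  define V where "V \<mu> = {\<nu> \<in> circle_probs. (\<integral>z. (cmod (poly (P \<mu>) z))\<^sup>2 \<partial>\<nu>) < exp (- a)}" for \<mu>
  have "\<forall>U\<in>V ` K. openin weak_topology U"
    unfolding V_def by (auto intro!: openin_weak_integral_less continuous_intros)
  moreover have "K \<subseteq> \<Union>(V ` K)" using Kp P(2) by (auto simp: V_def)
  moreover have "compactin weak_topology K" by (rule closedin_compact_space[OF compact_space_weak_topology K])
  ultimately have "\<exists>\<F>. finite \<F> \<and> \<F> \<subseteq> V ` K \<and> K \<subseteq> \<Union>\<F>" unfolding compactin_def by blast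
  then obtain F where F: "finite F" "F \<subseteq> K" "K \<subseteq> \<Union>(V ` F)" by (metis finite_subset_image)
  define B where "B n \<mu> = {U \<in> space (H n). qform (Suc (degree (P \<mu>))) (coeff (P \<mu>)) (umom U) < exp (- a)}" for n \<mu>
  \<comment> \<open>The share 1 / (card F + 1) of the bound goes to each of the card F events; the
    successor keeps the denominator positive when F is empty.\<close>
  have each: "\<forall>\<^sub>F n in sequentially. measure (H n) (B n \<mu>) \<le> exp b ^ n / real (Suc (card F))" if "\<mu> \<in> F" for \<mu>
  proof -
    define k where "k = degree (P \<mu>)"
    have "\<exists>\<eta>>0. \<forall>\<^sub>F n in sequentially. (exp (- a) + (1 + \<eta>) ^ k - 1) ^ (n - k) * (real n / \<eta>) ^ k \<le> exp b ^ n / real (Suc (card F))"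
      using b by (intro eventually_geometric_bound) auto
    then obtain \<eta> where \<eta>: "\<eta> > 0"
      "\<forall>\<^sub>F n in sequentially. (exp (- a) + (1 + \<eta>) ^ k - 1) ^ (n - k) * (real n / \<eta>) ^ k \<le> exp b ^ n / real (Suc (card F))" by blast
    from \<eta>(2) eventually_gt_at_top[of k] show ?thesis
    proof eventually_elim
      case (elim n)
      have "coeff (P \<mu>) 0 = 1" using P(1)[of \<mu>] that F(2) by (auto simp: poly_0_coeff_0)
      then have "measure (H n) (B n \<mu>) \<le> (exp (- a) + (1 + \<eta>) ^ k - 1) ^ (n - k) * (real n / \<eta>) ^ k"
        unfolding B_def k_def[symmetric] using haar \<eta>(1) elim(2) by (intro haar_qform_upper) auto
      then show ?case using elim(1) by linarith
    qed
  qed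
  then have "\<forall>\<^sub>F n in sequentially. \<forall>\<mu>\<in>F. measure (H n) (B n \<mu>) \<le> exp b ^ n / real (Suc (card F))"
    using F(1) by (intro eventually_ball_finite) auto
  then show ?thesis using eventually_ge_at_top[of 1]
  proof eventually_elim
    case (elim n)
    note Hn = haar[OF elim(2)]
    interpret prob_space "H n" by (rule haar_prob_space[OF Hn])
    have um: "umom \<in> borel_measurable (H n)" using elim(2) by (intro haar_measurable[OF Hn] measurable_umom) simp
    have Bm: "B n \<mu> \<in> sets (H n)" for \<mu>
    proof -
      have "(\<lambda>U. qform (Suc (degree (P \<mu>))) (coeff (P \<mu>)) (umom U)) \<in> borel_measurable (H n)"
        by (rule measurable_compose[OF um qform_measurable])
      then show ?thesis unfolding B_def by measurable
    qed
    have sub: "{U \<in> space (H n). spectral_measure U (unit_vec n 0) \<in> K} \<subseteq> (\<Union>\<mu>\<in>F. B n \<mu>)"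
    proof
      fix U assume "U \<in> {U \<in> space (H n). spectral_measure U (unit_vec n 0) \<in> K}"
      then have U: "U \<in> space (H n)" "U \<in> unitary_group n" and UK: "spectral_measure U (unit_vec n 0) \<in> K"
        by (auto simp: haar_space[OF Hn])
      note sm = spectral_measure_umom[OF elim(2) U(2)]
      from UK F(3) obtain \<mu> where \<mu>: "\<mu> \<in> F" "spectral_measure U (unit_vec n 0) \<in> V \<mu>" by blast
      have "qform (Suc (degree (P \<mu>))) (coeff (P \<mu>)) (umom U) < exp (- a)"
        using \<mu>(2) integral_norm_square_poly[OF sm(1), of "P \<mu>"] by (simp add: V_def sm(2))
      then show "U \<in> (\<Union>\<mu>\<in>F. B n \<mu>)" using \<mu>(1) U(1) by (auto simp: B_def)
    qed
    have "measure (spectral_law n (H n)) K = measure (H n) {U \<in> space (H n). spectral_measure U (unit_vec n 0) \<in> K}"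
      by (rule measure_spectral_law(1)[OF Hn elim(2) closedin_borel_of[OF K]])
    also have "\<dots> \<le> measure (H n) (\<Union>\<mu>\<in>F. B n \<mu>)"
      using sub Bm F(1) by (intro finite_measure_mono) auto
    also have "\<dots> \<le> (\<Sum>\<mu>\<in>F. measure (H n) (B n \<mu>))"
      using Bm F(1) by (intro finite_measure_subadditive_finite) auto
    also have "\<dots> \<le> (\<Sum>\<mu>\<in>F. exp b ^ n / real (Suc (card F)))" using elim(1) by (intro sum_mono) blast
    also have "\<dots> = real (card F) / real (Suc (card F)) * exp b ^ n" by simp
    also have "\<dots> \<le> 1 * exp b ^ n" by (intro mult_right_mono) auto
    finally show ?case by simp
  qed
qed

theorem theorem3p1:
  fixes H :: "nat \<Rightarrow> complex mat measure"
  assumes "\<And>n. n \<ge> 1 \<Longrightarrow> haar_prob n (H n)"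
  shows "LDP weak_topology (\<lambda>n. spectral_law n (H n)) (\<lambda>n. real n) szego_rate \<and>
         good_rate_function weak_topology szego_rate"
proof
  show "good_rate_function weak_topology szego_rate"
    unfolding good_rate_function_def topspace_weak_topology
    by (intro allI impI closedin_compact_space compact_space_weak_topology closedin_szego_rate)
  have prob: "prob_space (spectral_law n (H n))" "sets (spectral_law n (H n)) = sets (borel_of weak_topology)"
    if n: "n \<ge> 1" for n
    unfolding spectral_law_def
    using prob_space.prob_space_distr[OF haar_prob_space[OF assms[OF n]] spectral_measure_measurable[OF assms[OF n] n]]
    by simp_all
  have lower: "- (INF x\<in>G. szego_rate x) \<le> liminf (\<lambda>n. elog (measure (spectral_law n (H n)) G) / ereal (real n))"
    (is "_ \<le> ?L") if G: "openin weak_topology G" for G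
  proof -
    have "- ?L \<le> szego_rate \<mu>" if \<mu>: "\<mu> \<in> G" for \<mu>
    proof (cases "szego_rate \<mu>")
      case (real c)
      have "ereal (- c) \<le> ?L"
      proof (rule dense_le)
        fix y assume "y < ereal (- c)"
        then obtain b where b: "y < ereal b" "ereal b < ereal (- c)" using ereal_dense2 by blast
        have "\<forall>\<^sub>F n in sequentially. exp b ^ n \<le> measure (spectral_law n (H n)) G"
          using b(2) by (intro spectral_law_lower_bound[OF assms G \<mu> real]) auto
        then have "\<forall>\<^sub>F n in sequentially. ereal b \<le> elog (measure (spectral_law n (H n)) G) / ereal (real n)"
          using eventually_ge_at_top[of 1] by eventually_elim (rule elog_divide_ge)
        then have "ereal b \<le> ?L" by (rule Liminf_bounded)
        then show "y \<le> ?L" using b(1) by simp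
      qed
      then have "- ?L \<le> - ereal (- c)" by (simp only: ereal_minus_le_minus)
      then show ?thesis by (simp add: real)
    next
      case MInf
      have "\<mu> \<in> circle_probs" using openin_subset[OF G] \<mu> by (auto simp: topspace_weak_topology)
      then show ?thesis using szego_rate_nonneg[of \<mu>] MInf by simp
    qed simp
    then have "- ?L \<le> (INF x\<in>G. szego_rate x)" by (intro INF_greatest)
    then show ?thesis using ereal_uminus_le_reorder by blast
  qed
  have upper: "limsup (\<lambda>n. elog (measure (spectral_law n (H n)) K) / ereal (real n)) \<le> - (INF x\<in>K. szego_rate x)"
    (is "?L \<le> _") if K: "closedin weak_topology K" for K
  proof (rule dense_ge)
    fix y assume "- (INF x\<in>K. szego_rate x) < y"
    then obtain b where b: "- (INF x\<in>K. szego_rate x) < ereal b" "ereal b < y" using ereal_dense2 by blast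
    from b(1) obtain a where a: "- (INF x\<in>K. szego_rate x) < ereal a" "ereal a < ereal b" using ereal_dense2 by blast
    \<comment> \<open>Stepping strictly below the infimum gives one real level under the rate on all
      of K; this also serves when the infimum is \<infinity>, for instance for empty K.\<close>
    have "ereal (- a) < (INF x\<in>K. szego_rate x)"
      using a(1) ereal_uminus_less_reorder[of "INF x\<in>K. szego_rate x" "ereal a"] by simp
    then have *: "ereal (- a) < szego_rate \<mu>" if "\<mu> \<in> K" for \<mu>
      using that by (meson INF_lower less_le_trans)
    have "\<forall>\<^sub>F n in sequentially. measure (spectral_law n (H n)) K \<le> exp b ^ n"
      using * a(2) by (intro spectral_law_upper_bound[OF assms K, of "- a"]) auto
    then have "\<forall>\<^sub>F n in sequentially. elog (measure (spectral_law n (H n)) K) / ereal (real n) \<le> ereal b"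
      using eventually_ge_at_top[of 1] by eventually_elim (intro elog_divide_le, auto)
    then have "?L \<le> ereal b" by (rule Limsup_bounded)
    then show "?L \<le> y" using b(2) by simp
  qed
  show "LDP weak_topology (\<lambda>n. spectral_law n (H n)) (\<lambda>n. real n) szego_rate"
    unfolding LDP_def lower_semicontinuous_on_topology_def topspace_weak_topology
    using polish_weak_topology prob filterlim_real_sequentially szego_rate_nonneg closedin_szego_rate lower upper
    by auto
qed

end
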